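(* Let $\kappa$ be a regular cardinal and $\mathcal{D}$ a small decidable coherent category with a saturated set of $\kappa$-small models. Then the topos of sheaves on $\mathcal{D}$ for the coherent coverage is equivalent to the topos of equivariant sheaves on the topological groupoid $\mathbb{G}_{\mathcal{D}}=(G_{\mathcal{D}}\rightrightarrows X_{\mathcal{D}})$ equipped with the coherent topology: \[\mathrm{Sh}(\mathcal{D},J_{coh})\simeq\mathrm{Sh}(\mathbb{G}_{\mathcal{D}}).\]
   Context: A decidable coherent category is a category with: - finite limits and images; - pullback-stable covers; - pullback-stable finite unions of subobjects; - complemented diagonals $A\to A\times A$. $\mathrm{Sets}_\kappa$ is the category of hereditarily $\kappa$-small sets. $\mathcal{D}$ has a saturated set of $\kappa$-small models if the following holds: for any family $f_i:C_i\to C$ in $\mathcal{D}$ such that $\bigcup_i \mathrm{Im}(M(f_i))=M(C)$ for all coherent functors $M:\mathcal{D}\to\mathrm{Sets}_\kappa$, finitely many of the images of the $f_i$ have join $C$. $X_{\mathcal{D}}$ is the set of coherent functors $\mathcal{D}\to\mathrm{Sets}_\kappa$. $G_{\mathcal{D}}$ is the set of invertible natural transformations between them, with source $s$ and target $t$. The coherent topology on $X_{\mathcal{D}}$ has as subbasis the sets \[\{M\in X_{\mathcal{D}}:\exists x\in M(A)\ \ M(f_1)(x)=a_1\wedge\dots\wedge M(f_n)(x)=a_n\},\] for finite spans $f_i:A\to B_i$ in $\mathcal{D}$ and $a_1,\dots,a_n\in\mathrm{Sets}_\kappa$. The coherent topology on $G_{\mathcal{D}}$ is the coarsest topology making $s,t$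 continuous and containing all sets $\{f:M\to N: a\in M(A),\ f_A(a)=b\}$, for objects $A$ of $\mathcal{D}$ and $a,b\in\mathrm{Sets}_\kappa$. The coherent coverage consists of finite jointly epimorphic families. For a topological groupoid $H_1\rightrightarrows H_0$, an equivariant sheaf is a local homeomorphism $a:A\to H_0$ with a continuous action $\alpha:H_1\times_{H_0}A\to A$ (the pullback taken along $s$) satisfying $a(\alpha(g,x))=t(g)$, $\alpha(1,x)=x$ and $\alpha(g,\alpha(f,x))=\alpha(gf,x)$. Morphisms are continuous maps over $H_0$ commuting with the actions; these form the topos $\mathrm{Sh}(\mathbb{H})$. *)

theory Defs
  imports "HOL-Analysis.Analysis"
begin

unbundle cardinal_syntax

section \<open>Hereditarily small sets\<close>

text \<open>
  HOL has no type of all sets. The type \<open>'k hset\<close> consists of the well-founded sets all of whose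
  hereditary elements have at most \<open>|UNIV :: 'k set|\<close> elements: well-founded trees, where a node has
  no children or a \<open>'k\<close>-indexed family of them, up to extensional equality. For a cardinal \<open>\<kappa>\<close> on
  the type \<open>'k\<close> it contains every hereditarily \<open>\<kappa>\<close>-small set. The facts \<open>elts_inject\<close>, \<open>ex_elts\<close>,
  \<open>elts_bound\<close> and \<open>wf_elts\<close> below characterise the membership structure up to isomorphism.
\<close>

datatype 'k tree = Leaf | Node "'k \<Rightarrow> 'k tree"

fun children :: "'k tree \<Rightarrow> 'k tree set" where
  "children Leaf = {}"
| "children (Node f) = range f"

lemma tree_children_induct:
  assumes "\<And>t. (\<And>u. u \<in> children t \<Longrightarrow> P u) \<Longrightarrow> P t"
  shows "P t"
  by (induction t) (rule assms, force)+

inductive tree_eq :: "'k tree \<Rightarrow> 'k tree \<Rightarrow> bool" where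
  "\<forall>u\<in>children s. \<exists>v\<in>children t. tree_eq u v \<Longrightarrow> \<forall>v\<in>children t. \<exists>u\<in>children s. tree_eq u v
    \<Longrightarrow> tree_eq s t"

lemma tree_eq_iff:
  "tree_eq s t \<longleftrightarrow>
    (\<forall>u\<in>children s. \<exists>v\<in>children t. tree_eq u v) \<and> (\<forall>v\<in>children t. \<exists>u\<in>children s. tree_eq u v)"
  by (subst tree_eq.simps) auto

lemma tree_eq_refl: "tree_eq t t"
  by (induction t rule: tree_children_induct) (subst tree_eq_iff, blast)

lemma tree_eq_sym: "tree_eq s t \<Longrightarrow> tree_eq t s"
  by (induction rule: tree_eq.induct) (subst tree_eq_iff, blast)

lemma tree_eq_trans: "tree_eq s t \<Longrightarrow> tree_eq t u \<Longrightarrow> tree_eq s u"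
proof (induction arbitrary: u rule: tree_eq.induct)
  case (1 s t)
  have "(\<forall>b\<in>children t. \<exists>c\<in>children u. tree_eq b c) \<and> (\<forall>c\<in>children u. \<exists>b\<in>children t. tree_eq b c)"
    using 1(3) by (subst (asm) tree_eq_iff)
  with 1(1,2) show ?case by (subst tree_eq_iff) blast
qed

quotient_type 'k hset = "'k tree" / tree_eq
  by (intro equivpI reflpI sympI transpI) (blast intro: tree_eq_refl tree_eq_sym tree_eq_trans)+

definition elts :: "'k hset \<Rightarrow> 'k hset set" where
  "elts x = (\<Union>t\<in>{t. abs_hset t = x}. abs_hset ` children t)"

lemma abs_hset_eq_iff: "abs_hset s = abs_hset t \<longleftrightarrow> tree_eq s t"
  using Quotient3_rel[OF Quotient3_hset, of s t] tree_eq_refl by blast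

lemma ex_abs_hset: "\<exists>t. x = abs_hset t"
  by (rule exI[of _ "rep_hset x"]) (simp add: Quotient3_abs_rep[OF Quotient3_hset])

lemma elts_abs: "elts (abs_hset t) = abs_hset ` children t"
proof
  show "elts (abs_hset t) \<subseteq> abs_hset ` children t"
  proof
    fix y assume "y \<in> elts (abs_hset t)"
    then obtain s u where s: "tree_eq s t" "u \<in> children s" "y = abs_hset u"
      by (auto simp: elts_def abs_hset_eq_iff)
    then obtain v where "v \<in> children t" "tree_eq u v" by (subst (asm) tree_eq_iff) blast
    then show "y \<in> abs_hset ` children t" using s(3) by (metis abs_hset_eq_iff image_eqI)
  qed
  show "abs_hset ` children t \<subseteq> elts (abs_hset t)"
    by (auto simp: elts_def)
qed

lemma elts_inject: "elts x = elts y \<longleftrightarrow> x = y"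
proof
  assume e: "elts x = elts y"
  obtain s t where x: "x = abs_hset s" and y: "y = abs_hset t"
    using ex_abs_hset[of x] ex_abs_hset[of y] by blast
  have e': "abs_hset ` children s = abs_hset ` children t"
    using e by (simp add: x y elts_abs)
  have "\<exists>v\<in>children t. tree_eq u v" if "u \<in> children s" for u
  proof -
    have "abs_hset u \<in> abs_hset ` children t" using e' that by blast
    then show ?thesis by (auto simp: abs_hset_eq_iff)
  qed
  moreover have "\<exists>u\<in>children s. tree_eq u v" if "v \<in> children t" for v
  proof -
    have "abs_hset v \<in> abs_hset ` children s" using e' that by blast
    then obtain u where "u \<in> children s" "tree_eq v u" by (auto simp: abs_hset_eq_iff)
    then show ?thesis using tree_eq_sym by blast
  qed
  ultimately show "x = y" by (simp add: x y abs_hset_eq_iff tree_eq_iff[of s t])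
qed auto

lemma ex_elts:
  fixes S :: "'k hset set"
  assumes "|S| \<le>o |UNIV :: 'k set|"
  shows "\<exists>x. elts x = S"
proof (cases "S = {}")
  case True
  then have "elts (abs_hset Leaf) = S" by (simp add: elts_abs)
  then show ?thesis ..
next
  case False
  then obtain g :: "'k \<Rightarrow> 'k hset" where g: "range g = S"
    using card_of_ordLeq2[OF False, of "UNIV :: 'k set"] assms by (simp only:) blast
  have "elts (abs_hset (Node (\<lambda>a. rep_hset (g a)))) = range (\<lambda>a. abs_hset (rep_hset (g a)))"
    by (simp only: elts_abs children.simps image_image)
  also have "\<dots> = S" by (simp only: Quotient3_abs_rep[OF Quotient3_hset] g)
  finally show ?thesis ..
qed

lemma elts_bound: "|elts (x :: 'k hset)| \<le>o |UNIV :: 'k set|"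
proof -
  obtain t where x: "x = abs_hset t" using ex_abs_hset[of x] by blast
  have "|children t| \<le>o |UNIV :: 'k set|"
    by (cases t) (simp_all add: card_of_image card_of_empty)
  then show ?thesis unfolding x elts_abs by (rule ordLeq_transitive[OF card_of_image])
qed

lemma wf_elts: "wf {(x :: 'k hset, y). x \<in> elts y}"
proof (rule wfUNIVI)
  fix P :: "'k hset \<Rightarrow> bool" and x :: "'k hset"
  assume "\<forall>x. (\<forall>y. (y, x) \<in> {(x, y). x \<in> elts y} \<longrightarrow> P y) \<longrightarrow> P x"
  then have *: "(\<And>y. y \<in> elts x \<Longrightarrow> P y) \<Longrightarrow> P x" for x by blast
  have "P (abs_hset t)" for t
    by (induction t rule: tree_children_induct) (rule *, auto simp: elts_abs)
  moreover obtain t where "x = abs_hset t" using ex_abs_hset[of x] by blast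
  ultimately show "P x" by simp
qed

text \<open>The hereditarily \<open>\<kappa>\<close>-small sets.\<close>

inductive_set hered_small :: "'k rel \<Rightarrow> 'k hset set" for \<kappa> :: "'k rel" where
  "|elts x| <o \<kappa> \<Longrightarrow> (\<And>y. y \<in> elts x \<Longrightarrow> y \<in> hered_small \<kappa>) \<Longrightarrow> x \<in> hered_small \<kappa>"

lemma ex_hered_small:
  fixes S :: "'k hset set"
  assumes "Card_order \<kappa>" "S \<subseteq> hered_small \<kappa>" "|S| <o \<kappa>"
  shows "\<exists>x\<in>hered_small \<kappa>. elts x = S"
proof -
  have "\<kappa> \<le>o |UNIV :: 'k set|"
    by (rule ordIso_ordLeq_trans[OF ordIso_symmetric[OF card_of_Field_ordIso[OF assms(1)]]])
      (rule card_of_mono1[OF subset_UNIV])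
  then have "|S| \<le>o |UNIV :: 'k set|"
    by (rule ordLeq_transitive[OF ordLess_imp_ordLeq[OF assms(3)]])
  then obtain x where "elts x = S" using ex_elts by blast
  moreover have "x \<in> hered_small \<kappa>"
    by (rule hered_small.intros) (use calculation assms in auto)
  ultimately show ?thesis by blast
qed


section \<open>Categories\<close>

record ('o, 'a) cat =
  Obj :: "'o set"
  Arr :: "'a set"
  Dom :: "'a \<Rightarrow> 'o"
  Cod :: "'a \<Rightarrow> 'o"
  Idt :: "'o \<Rightarrow> 'a"
  Cmp :: "'a \<Rightarrow> 'a \<Rightarrow> 'a"  \<comment> \<open>\<open>Cmp C g f\<close> is \<open>g\<close> after \<open>f\<close>\<close>

definition hom :: "('o, 'a) cat \<Rightarrow> 'o \<Rightarrow> 'o \<Rightarrow> 'a set" where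
  "hom C A B = {f \<in> Arr C. Dom C f = A \<and> Cod C f = B}"

definition category :: "('o, 'a) cat \<Rightarrow> bool" where
  "category C \<longleftrightarrow>
    (\<forall>f\<in>Arr C. Dom C f \<in> Obj C \<and> Cod C f \<in> Obj C) \<and>
    (\<forall>A\<in>Obj C. Idt C A \<in> hom C A A) \<and>
    (\<forall>f\<in>Arr C. \<forall>g\<in>Arr C. Cod C f = Dom C g \<longrightarrow> Cmp C g f \<in> hom C (Dom C f) (Cod C g)) \<and>
    (\<forall>f\<in>Arr C. Cmp C f (Idt C (Dom C f)) = f \<and> Cmp C (Idt C (Cod C f)) f = f) \<and>
    (\<forall>f\<in>Arr C. \<forall>g\<in>Arr C. \<forall>h\<in>Arr C. Cod C f = Dom C g \<and> Cod C g = Dom C h \<longrightarrow>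
      Cmp C h (Cmp C g f) = Cmp C (Cmp C h g) f)"

definition op_cat :: "('o, 'a) cat \<Rightarrow> ('o, 'a) cat" where
  "op_cat C = \<lparr>Obj = Obj C, Arr = Arr C, Dom = Cod C, Cod = Dom C, Idt = Idt C,
    Cmp = (\<lambda>g f. Cmp C f g)\<rparr>"

definition full_subcat :: "('o, 'a) cat \<Rightarrow> 'o set \<Rightarrow> ('o, 'a) cat" where
  "full_subcat C P = C\<lparr>Obj := Obj C \<inter> P, Arr := {f \<in> Arr C. Dom C f \<in> P \<and> Cod C f \<in> P}\<rparr>"

definition isos :: "('o, 'a) cat \<Rightarrow> 'a set" where
  "isos C = {f \<in> Arr C. \<exists>g\<in>hom C (Cod C f) (Dom C f).
    Cmp C g f = Idt C (Dom C f) \<and> Cmp C f g = Idt C (Cod C f)}"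

text \<open>Functors are extensional, so that equality of functors is equality in HOL.\<close>

record ('o, 'a, 'p, 'b) functr =
  fobj :: "'o \<Rightarrow> 'p"
  farr :: "'a \<Rightarrow> 'b"

definition is_functor :: "('o, 'a) cat \<Rightarrow> ('p, 'b) cat \<Rightarrow> ('o, 'a, 'p, 'b) functr \<Rightarrow> bool" where
  "is_functor C D F \<longleftrightarrow>
    fobj F \<in> Obj C \<rightarrow>\<^sub>E Obj D \<and> farr F \<in> extensional (Arr C) \<and>
    (\<forall>f\<in>Arr C. farr F f \<in> hom D (fobj F (Dom C f)) (fobj F (Cod C f))) \<and>
    (\<forall>A\<in>Obj C. farr F (Idt C A) = Idt D (fobj F A)) \<and>
    (\<forall>f\<in>Arr C. \<forall>g\<in>Arr C. Cod C f = Dom C g \<longrightarrow>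
      farr F (Cmp C g f) = Cmp D (farr F g) (farr F f))"

definition id_functor :: "('o, 'a) cat \<Rightarrow> ('o, 'a, 'o, 'a) functr" where
  "id_functor C = \<lparr>fobj = restrict id (Obj C), farr = restrict id (Arr C)\<rparr>"

definition comp_functor :: "('o, 'a) cat \<Rightarrow> ('p, 'b, 'q, 'c) functr \<Rightarrow> ('o, 'a, 'p, 'b) functr
    \<Rightarrow> ('o, 'a, 'q, 'c) functr" where
  "comp_functor C G F =
    \<lparr>fobj = compose (Obj C) (fobj G) (fobj F), farr = compose (Arr C) (farr G) (farr F)\<rparr>"

text \<open>An underlying map together with its source and target.\<close>

datatype ('o, 'm) arrow = Arrow (src: 'o) (app: 'm) (trg: 'o)

definition nat_trans :: "('o, 'a) cat \<Rightarrow> ('p, 'b) cat \<Rightarrow> ('o, 'a, 'p, 'b) functr \<Rightarrow> ('o \<Rightarrow> 'b)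
    \<Rightarrow> ('o, 'a, 'p, 'b) functr \<Rightarrow> bool" where
  "nat_trans C D F \<tau> G \<longleftrightarrow>
    is_functor C D F \<and> is_functor C D G \<and> \<tau> \<in> extensional (Obj C) \<and>
    (\<forall>A\<in>Obj C. \<tau> A \<in> hom D (fobj F A) (fobj G A)) \<and>
    (\<forall>f\<in>Arr C. Cmp D (farr G f) (\<tau> (Dom C f)) = Cmp D (\<tau> (Cod C f)) (farr F f))"

definition functor_cat :: "('o, 'a) cat \<Rightarrow> ('p, 'b) cat
    \<Rightarrow> (('o, 'a, 'p, 'b) functr, (('o, 'a, 'p, 'b) functr, 'o \<Rightarrow> 'b) arrow) cat" where
  "functor_cat C D =
    \<lparr>Obj = {F. is_functor C D F},
     Arr = {\<alpha>. nat_trans C D (src \<alpha>) (app \<alpha>) (trg \<alpha>)},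
     Dom = src,
     Cod = trg,
     Idt = (\<lambda>F. Arrow F (\<lambda>A\<in>Obj C. Idt D (fobj F A)) F),
     Cmp = (\<lambda>\<beta> \<alpha>. Arrow (src \<alpha>) (\<lambda>A\<in>Obj C. Cmp D (app \<beta> A) (app \<alpha> A)) (trg \<beta>))\<rparr>"

definition naturally_isomorphic :: "('o, 'a) cat \<Rightarrow> ('p, 'b) cat \<Rightarrow> ('o, 'a, 'p, 'b) functr
    \<Rightarrow> ('o, 'a, 'p, 'b) functr \<Rightarrow> bool" where
  "naturally_isomorphic C D F G \<longleftrightarrow>
    (\<exists>\<alpha>\<in>isos (functor_cat C D). src \<alpha> = F \<and> trg \<alpha> = G)"

definition equivalent_cats :: "('o, 'a) cat \<Rightarrow> ('p, 'b) cat \<Rightarrow> bool" where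
  "equivalent_cats C D \<longleftrightarrow>
    category C \<and> category D \<and>
    (\<exists>F G. is_functor C D F \<and> is_functor D C G \<and>
      naturally_isomorphic C C (comp_functor C G F) (id_functor C) \<and>
      naturally_isomorphic D D (comp_functor D F G) (id_functor D))"

definition set_cat :: "'u set set \<Rightarrow> ('u set, ('u set, 'u \<Rightarrow> 'u) arrow) cat" where
  "set_cat \<U> =
    \<lparr>Obj = \<U>,
     Arr = {f. src f \<in> \<U> \<and> trg f \<in> \<U> \<and> app f \<in> src f \<rightarrow>\<^sub>E trg f},
     Dom = src,
     Cod = trg,
     Idt = (\<lambda>A. Arrow A (\<lambda>x\<in>A. x) A),
     Cmp = (\<lambda>g f. Arrow (src f) (compose (src f) (app g) (app f)) (trg g))\<rparr>"

text \<open>A set \<open>x \<in> hered_small \<kappa>\<close> is represented as an object by \<open>elts x\<close>; this is faithful by \<open>elts_inject\<close>.\<close>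

definition Sets :: "'k rel \<Rightarrow> ('k hset set, ('k hset set, 'k hset \<Rightarrow> 'k hset) arrow) cat" where
  "Sets \<kappa> = set_cat (elts ` hered_small \<kappa>)"


section \<open>Decidable coherent categories\<close>

definition cone :: "('o, 'a) cat \<Rightarrow> ('i, 'j) cat \<Rightarrow> ('i, 'j, 'o, 'a) functr \<Rightarrow> 'o \<Rightarrow> ('i \<Rightarrow> 'a)
    \<Rightarrow> bool" where
  "cone C J K L \<pi> \<longleftrightarrow>
    L \<in> Obj C \<and> (\<forall>i\<in>Obj J. \<pi> i \<in> hom C L (fobj K i)) \<and>
    (\<forall>u\<in>Arr J. Cmp C (farr K u) (\<pi> (Dom J u)) = \<pi> (Cod J u))"

definition limit_cone :: "('o, 'a) cat \<Rightarrow> ('i, 'j) cat \<Rightarrow> ('i, 'j, 'o, 'a) functr \<Rightarrow> 'o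
    \<Rightarrow> ('i \<Rightarrow> 'a) \<Rightarrow> bool" where
  "limit_cone C J K L \<pi> \<longleftrightarrow>
    cone C J K L \<pi> \<and>
    (\<forall>N \<rho>. cone C J K N \<rho> \<longrightarrow> (\<exists>!h. h \<in> hom C N L \<and> (\<forall>i\<in>Obj J. Cmp C (\<pi> i) h = \<rho> i)))"

text \<open>Every finite category is isomorphic to one whose objects and arrows are natural numbers.\<close>

definition finite_diagram :: "(nat, nat) cat \<Rightarrow> ('o, 'a) cat \<Rightarrow> (nat, nat, 'o, 'a) functr \<Rightarrow> bool"
  where
  "finite_diagram J C K \<longleftrightarrow>
    category J \<and> finite (Obj J) \<and> finite (Arr J) \<and> is_functor J C K"

definition has_finite_limits :: "('o, 'a) cat \<Rightarrow> bool" where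
  "has_finite_limits C \<longleftrightarrow> (\<forall>J K. finite_diagram J C K \<longrightarrow> (\<exists>L \<pi>. limit_cone C J K L \<pi>))"

definition is_product :: "('o, 'a) cat \<Rightarrow> 'o \<Rightarrow> 'o \<Rightarrow> 'o \<Rightarrow> 'a \<Rightarrow> 'a \<Rightarrow> bool" where
  "is_product C A B P p q \<longleftrightarrow>
    p \<in> hom C P A \<and> q \<in> hom C P B \<and>
    (\<forall>N\<in>Obj C. \<forall>u\<in>hom C N A. \<forall>v\<in>hom C N B. \<exists>!h. h \<in> hom C N P \<and> Cmp C p h = u \<and> Cmp C q h = v)"

text \<open>\<open>p\<close> is the pullback of \<open>f\<close> along \<open>g\<close>, and \<open>q\<close> the other projection.\<close>

definition is_pullback :: "('o, 'a) cat \<Rightarrow> 'a \<Rightarrow> 'a \<Rightarrow> 'a \<Rightarrow> 'a \<Rightarrow> bool" where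
  "is_pullback C f g p q \<longleftrightarrow>
    f \<in> Arr C \<and> g \<in> Arr C \<and> Cod C f = Cod C g \<and>
    p \<in> Arr C \<and> q \<in> Arr C \<and> Dom C p = Dom C q \<and> Cod C p = Dom C g \<and> Cod C q = Dom C f \<and>
    Cmp C g p = Cmp C f q \<and>
    (\<forall>N\<in>Obj C. \<forall>u\<in>hom C N (Dom C g). \<forall>v\<in>hom C N (Dom C f). Cmp C g u = Cmp C f v \<longrightarrow>
      (\<exists>!h. h \<in> hom C N (Dom C p) \<and> Cmp C p h = u \<and> Cmp C q h = v))"

definition mono_arr :: "('o, 'a) cat \<Rightarrow> 'a \<Rightarrow> bool" where
  "mono_arr C m \<longleftrightarrow> m \<in> Arr C \<and>
    (\<forall>u\<in>Arr C. \<forall>v\<in>Arr C. Dom C u = Dom C v \<and> Cod C u = Dom C m \<and> Cod C v = Dom C m \<and>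
      Cmp C m u = Cmp C m v \<longrightarrow> u = v)"

text \<open>Subobjects of \<open>A\<close> are represented by monomorphisms into \<open>A\<close>, preordered by \<open>factors\<close>.\<close>

definition subobj :: "('o, 'a) cat \<Rightarrow> 'o \<Rightarrow> 'a \<Rightarrow> bool" where
  "subobj C A m \<longleftrightarrow> mono_arr C m \<and> Cod C m = A"

definition factors :: "('o, 'a) cat \<Rightarrow> 'a \<Rightarrow> 'a \<Rightarrow> bool" where
  "factors C f m \<longleftrightarrow> (\<exists>h\<in>hom C (Dom C f) (Dom C m). Cmp C m h = f)"

definition is_image :: "('o, 'a) cat \<Rightarrow> 'a \<Rightarrow> 'a \<Rightarrow> bool" where
  "is_image C f m \<longleftrightarrow>
    f \<in> Arr C \<and> subobj C (Cod C f) m \<and> factors C f m \<and>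
    (\<forall>n. subobj C (Cod C f) n \<and> factors C f n \<longrightarrow> factors C m n)"

definition is_cover :: "('o, 'a) cat \<Rightarrow> 'a \<Rightarrow> bool" where
  "is_cover C f \<longleftrightarrow> is_image C f (Idt C (Cod C f))"

definition is_union :: "('o, 'a) cat \<Rightarrow> 'o \<Rightarrow> 'a set \<Rightarrow> 'a \<Rightarrow> bool" where
  "is_union C A S u \<longleftrightarrow>
    (\<forall>m\<in>S. subobj C A m) \<and> subobj C A u \<and> (\<forall>m\<in>S. factors C m u) \<and>
    (\<forall>n. subobj C A n \<and> (\<forall>m\<in>S. factors C m n) \<longrightarrow> factors C u n)"

definition complemented :: "('o, 'a) cat \<Rightarrow> 'o \<Rightarrow> 'a \<Rightarrow> bool" where
  "complemented C A m \<longleftrightarrow> subobj C A m \<and>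
    (\<exists>n. is_union C A {m, n} (Idt C A) \<and>
      (\<forall>w. subobj C A w \<and> factors C w m \<and> factors C w n \<longrightarrow> is_union C A {} w))"

definition coherent_category :: "('o, 'a) cat \<Rightarrow> bool" where
  "coherent_category C \<longleftrightarrow>
    category C \<and>
    has_finite_limits C \<and>
    (\<forall>f\<in>Arr C. \<exists>m. is_image C f m) \<and>
    (\<forall>f g p q. is_pullback C f g p q \<and> is_cover C f \<longrightarrow> is_cover C p) \<and>
    (\<forall>A\<in>Obj C. \<forall>S. finite S \<and> (\<forall>m\<in>S. subobj C A m) \<longrightarrow> (\<exists>u. is_union C A S u)) \<and>
    (\<forall>g\<in>Arr C. \<forall>S u P v. finite S \<and> is_union C (Cod C g) S u \<and>
      (\<forall>m\<in>S. \<exists>q. is_pullback C m g (P m) q) \<and> (\<exists>q. is_pullback C u g v q) \<longrightarrow>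
      is_union C (Dom C g) (P ` S) v)"

definition decidable_coherent_category :: "('o, 'a) cat \<Rightarrow> bool" where
  "decidable_coherent_category C \<longleftrightarrow>
    coherent_category C \<and>
    (\<forall>A P p q \<delta>. is_product C A A P p q \<and> \<delta> \<in> hom C A P \<and>
      Cmp C p \<delta> = Idt C A \<and> Cmp C q \<delta> = Idt C A \<longrightarrow> complemented C P \<delta>)"

definition coherent_functor :: "('o, 'a) cat \<Rightarrow> ('p, 'b) cat \<Rightarrow> ('o, 'a, 'p, 'b) functr \<Rightarrow> bool"
  where
  "coherent_functor C D F \<longleftrightarrow>
    is_functor C D F \<and>
    (\<forall>J K L \<pi>. finite_diagram J C K \<and> limit_cone C J K L \<pi> \<longrightarrow>
      limit_cone D J (comp_functor J F K) (fobj F L) (\<lambda>i. farr F (\<pi> i))) \<and>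
    (\<forall>f m. is_image C f m \<longrightarrow> is_image D (farr F f) (farr F m)) \<and>
    (\<forall>A\<in>Obj C. \<forall>S u. finite S \<and> is_union C A S u \<longrightarrow>
      is_union D (fobj F A) (farr F ` S) (farr F u))"

definition images_join_to_top :: "('o, 'a) cat \<Rightarrow> 'o \<Rightarrow> 'a set \<Rightarrow> bool" where
  "images_join_to_top C A T \<longleftrightarrow>
    (\<exists>im. (\<forall>f\<in>T. is_image C f (im f)) \<and> is_union C A (im ` T) (Idt C A))"

definition models :: "'k rel \<Rightarrow> ('o, 'a) cat
    \<Rightarrow> ('o, 'a, 'k hset set, ('k hset set, 'k hset \<Rightarrow> 'k hset) arrow) functr set" where
  "models \<kappa> D = {M. coherent_functor D (Sets \<kappa>) M}"

definition saturated_set_of_small_models :: "'k rel \<Rightarrow> ('o, 'a) cat \<Rightarrow> bool" where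
  "saturated_set_of_small_models \<kappa> D \<longleftrightarrow>
    (\<forall>C\<in>Obj D. \<forall>S\<subseteq>{f \<in> Arr D. Cod D f = C}.
      (\<forall>M\<in>models \<kappa> D. (\<Union>f\<in>S. app (farr M f) ` fobj M (Dom D f)) = fobj M C) \<longrightarrow>
      (\<exists>T\<subseteq>S. finite T \<and> images_join_to_top D C T))"


section \<open>Sheaves on a site\<close>

text \<open>
  A coverage assigns to each object a collection of families of arrows into it. A finite family is
  ``jointly epimorphic'' in the sense of coherent categories: its images have join the codomain.
  (Being jointly right-cancellable is weaker: in a distributive lattice every family is.)
\<close>

definition coherent_coverage :: "('o, 'a) cat \<Rightarrow> 'o \<Rightarrow> 'a set set" where
  "coherent_coverage C A =
    {T. finite T \<and> T \<subseteq> {f \<in> Arr C. Cod C f = A} \<and> images_join_to_top C A T}"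

definition matching_family :: "('o, 'a) cat
    \<Rightarrow> ('o, 'a, 'u set, ('u set, 'u \<Rightarrow> 'u) arrow) functr \<Rightarrow> 'a set \<Rightarrow> ('a \<Rightarrow> 'u) \<Rightarrow> bool" where
  "matching_family C P T x \<longleftrightarrow>
    (\<forall>f\<in>T. x f \<in> fobj P (Dom C f)) \<and>
    (\<forall>f\<in>T. \<forall>g\<in>T. \<forall>u\<in>Arr C. \<forall>v\<in>Arr C.
      Dom C u = Dom C v \<and> Cod C u = Dom C f \<and> Cod C v = Dom C g \<and> Cmp C f u = Cmp C g v \<longrightarrow>
      app (farr P u) (x f) = app (farr P v) (x g))"

definition is_sheaf :: "('o, 'a) cat \<Rightarrow> ('o \<Rightarrow> 'a set set)
    \<Rightarrow> ('o, 'a, 'u set, ('u set, 'u \<Rightarrow> 'u) arrow) functr \<Rightarrow> bool" where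
  "is_sheaf C J P \<longleftrightarrow>
    (\<forall>A\<in>Obj C. \<forall>T\<in>J A. \<forall>x. matching_family C P T x \<longrightarrow>
      (\<exists>!y. y \<in> fobj P A \<and> (\<forall>f\<in>T. app (farr P f) y = x f)))"

text \<open>Sheaves with values in the collection \<open>\<U>\<close> of sets, as a full subcategory of presheaves.\<close>

definition sheaf_cat :: "'u set set \<Rightarrow> ('o, 'a) cat \<Rightarrow> ('o \<Rightarrow> 'a set set) \<Rightarrow>
    (('o, 'a, 'u set, ('u set, 'u \<Rightarrow> 'u) arrow) functr,
     (('o, 'a, 'u set, ('u set, 'u \<Rightarrow> 'u) arrow) functr, 'o \<Rightarrow> ('u set, 'u \<Rightarrow> 'u) arrow) arrow) cat"
  where
  "sheaf_cat \<U> C J = full_subcat (functor_cat (op_cat C) (set_cat \<U>)) {P. is_sheaf C J P}"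


section \<open>Equivariant sheaves on a topological groupoid\<close>

record ('x, 'g) groupoid =
  ob_top :: "'x topology"
  ar_top :: "'g topology"
  source :: "'g \<Rightarrow> 'x"
  target :: "'g \<Rightarrow> 'x"
  unit_at :: "'x \<Rightarrow> 'g"
  mult :: "'g \<Rightarrow> 'g \<Rightarrow> 'g"  \<comment> \<open>\<open>mult H g f\<close> is \<open>g\<close> after \<open>f\<close>\<close>
  inverse_of :: "'g \<Rightarrow> 'g"

definition groupoid_cat :: "('x, 'g) groupoid \<Rightarrow> ('x, 'g) cat" where
  "groupoid_cat H = \<lparr>Obj = topspace (ob_top H), Arr = topspace (ar_top H), Dom = source H,
    Cod = target H, Idt = unit_at H, Cmp = mult H\<rparr>"

definition topological_groupoid :: "('x, 'g) groupoid \<Rightarrow> bool" where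
  "topological_groupoid H \<longleftrightarrow>
    category (groupoid_cat H) \<and>
    (\<forall>f\<in>topspace (ar_top H). inverse_of H f \<in> hom (groupoid_cat H) (target H f) (source H f) \<and>
      mult H (inverse_of H f) f = unit_at H (source H f) \<and>
      mult H f (inverse_of H f) = unit_at H (target H f)) \<and>
    continuous_map (ar_top H) (ob_top H) (source H) \<and>
    continuous_map (ar_top H) (ob_top H) (target H) \<and>
    continuous_map (ob_top H) (ar_top H) (unit_at H) \<and>
    continuous_map (ar_top H) (ar_top H) (inverse_of H) \<and>
    continuous_map
      (subtopology (prod_topology (ar_top H) (ar_top H)) {(g, f). target H f = source H g})
      (ar_top H) (\<lambda>(g, f). mult H g f)"

definition local_homeo :: "'a topology \<Rightarrow> 'b topology \<Rightarrow> ('a \<Rightarrow> 'b) \<Rightarrow> bool" where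
  "local_homeo X Y f \<longleftrightarrow>
    continuous_map X Y f \<and>
    (\<forall>x\<in>topspace X. \<exists>U. openin X U \<and> x \<in> U \<and> openin Y (f ` U) \<and>
      homeomorphic_map (subtopology X U) (subtopology Y (f ` U)) f)"

record ('x, 'g, 'u) action =
  total :: "'u topology"
  proj :: "'u \<Rightarrow> 'x"
  act :: "'g \<times> 'u \<Rightarrow> 'u"

definition act_dom :: "('x, 'g) groupoid \<Rightarrow> ('x, 'g, 'u) action \<Rightarrow> ('g \<times> 'u) set" where
  "act_dom H E = {(g, x) \<in> topspace (ar_top H) \<times> topspace (total E). source H g = proj E x}"

definition equivariant_sheaf :: "('x, 'g) groupoid \<Rightarrow> ('x, 'g, 'u) action \<Rightarrow> bool" where
  "equivariant_sheaf H E \<longleftrightarrow>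
    proj E \<in> extensional (topspace (total E)) \<and> act E \<in> extensional (act_dom H E) \<and>
    local_homeo (total E) (ob_top H) (proj E) \<and>
    continuous_map (subtopology (prod_topology (ar_top H) (total E)) (act_dom H E))
      (total E) (act E) \<and>
    (\<forall>(g, x)\<in>act_dom H E. proj E (act E (g, x)) = target H g) \<and>
    (\<forall>x\<in>topspace (total E). act E (unit_at H (proj E x), x) = x) \<and>
    (\<forall>(f, x)\<in>act_dom H E. \<forall>g\<in>topspace (ar_top H). source H g = target H f \<longrightarrow>
      act E (g, act E (f, x)) = act E (mult H g f, x))"

definition equivariant_map :: "('x, 'g) groupoid \<Rightarrow> ('x, 'g, 'u) action \<Rightarrow> ('u \<Rightarrow> 'u)
    \<Rightarrow> ('x, 'g, 'u) action \<Rightarrow> bool" where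
  "equivariant_map H E h E' \<longleftrightarrow>
    h \<in> extensional (topspace (total E)) \<and>
    continuous_map (total E) (total E') h \<and>
    (\<forall>x\<in>topspace (total E). proj E' (h x) = proj E x) \<and>
    (\<forall>(g, x)\<in>act_dom H E. h (act E (g, x)) = act E' (g, h x))"

text \<open>The equivariant sheaves whose total space has its underlying set in \<open>\<U>\<close>.\<close>

definition equivariant_sheaf_cat :: "'u set set \<Rightarrow> ('x, 'g) groupoid
    \<Rightarrow> (('x, 'g, 'u) action, (('x, 'g, 'u) action, 'u \<Rightarrow> 'u) arrow) cat" where
  "equivariant_sheaf_cat \<U> H =
    \<lparr>Obj = {E. equivariant_sheaf H E \<and> topspace (total E) \<in> \<U>},
     Arr = {f. equivariant_sheaf H (src f) \<and> topspace (total (src f)) \<in> \<U> \<and>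
       equivariant_sheaf H (trg f) \<and> topspace (total (trg f)) \<in> \<U> \<and>
       equivariant_map H (src f) (app f) (trg f)},
     Dom = src,
     Cod = trg,
     Idt = (\<lambda>E. Arrow E (\<lambda>x\<in>topspace (total E). x) E),
     Cmp = (\<lambda>g f. Arrow (src f) (compose (topspace (total (src f))) (app g) (app f)) (trg g))\<rparr>"


section \<open>The groupoid of models\<close>

type_synonym ('k, 'o, 'a) model =
  "('o, 'a, 'k hset set, ('k hset set, 'k hset \<Rightarrow> 'k hset) arrow) functr"

type_synonym ('k, 'o, 'a) model_map =
  "(('k, 'o, 'a) model, 'o \<Rightarrow> ('k hset set, 'k hset \<Rightarrow> 'k hset) arrow) arrow"

definition model_isos :: "'k rel \<Rightarrow> ('o, 'a) cat \<Rightarrow> ('k, 'o, 'a) model_map set" where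
  "model_isos \<kappa> D =
    {\<phi> \<in> isos (functor_cat D (Sets \<kappa>)). src \<phi> \<in> models \<kappa> D \<and> trg \<phi> \<in> models \<kappa> D}"

definition model_topology :: "'k rel \<Rightarrow> ('o, 'a) cat \<Rightarrow> ('k, 'o, 'a) model topology" where
  "model_topology \<kappa> D = topology_generated_by
    {{M \<in> models \<kappa> D. \<exists>x\<in>fobj M A. \<forall>i<length fs. app (farr M (fs ! i)) x = as ! i} | A fs as.
      A \<in> Obj D \<and> set fs \<subseteq> {f \<in> Arr D. Dom D f = A} \<and>
      set as \<subseteq> hered_small \<kappa> \<and> length as = length fs}"

definition model_iso_topology :: "'k rel \<Rightarrow> ('o, 'a) cat \<Rightarrow> ('k, 'o, 'a) model_map topology" where
  "model_iso_topology \<kappa> D = topology_generated_by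
    ({{\<phi> \<in> model_isos \<kappa> D. src \<phi> \<in> U} | U. openin (model_topology \<kappa> D) U} \<union>
     {{\<phi> \<in> model_isos \<kappa> D. trg \<phi> \<in> U} | U. openin (model_topology \<kappa> D) U} \<union>
     {{\<phi> \<in> model_isos \<kappa> D. a \<in> fobj (src \<phi>) A \<and> app (app \<phi> A) a = b} | A a b.
       A \<in> Obj D \<and> a \<in> hered_small \<kappa> \<and> b \<in> hered_small \<kappa>})"

definition model_groupoid :: "'k rel \<Rightarrow> ('o, 'a) cat
    \<Rightarrow> (('k, 'o, 'a) model, ('k, 'o, 'a) model_map) groupoid" where
  "model_groupoid \<kappa> D =
    \<lparr>ob_top = model_topology \<kappa> D,
     ar_top = model_iso_topology \<kappa> D,
     source = src,
     target = trg,
     unit_at = Idt (functor_cat D (Sets \<kappa>)),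
     mult = Cmp (functor_cat D (Sets \<kappa>)),
     inverse_of = (\<lambda>\<phi>. THE \<psi>. \<psi> \<in> hom (functor_cat D (Sets \<kappa>)) (trg \<phi>) (src \<phi>) \<and>
       Cmp (functor_cat D (Sets \<kappa>)) \<psi> \<phi> = Idt (functor_cat D (Sets \<kappa>)) (src \<phi>) \<and>
       Cmp (functor_cat D (Sets \<kappa>)) \<phi> \<psi> = Idt (functor_cat D (Sets \<kappa>)) (trg \<phi>))\<rparr>"

text \<open>\<open>model_groupoid \<kappa> D\<close> is a topological groupoid on the set of all models.\<close>

lemma category_set_cat: "category (set_cat \<U>)"
  unfolding category_def set_cat_def hom_def
  by (auto simp: compose_def PiE_def extensional_def restrict_def fun_eq_iff Pi_def
      intro!: arrow.expand)

lemma category_functor_cat: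
  assumes C: "category C" and D: "category D"
  shows "category (functor_cat C D)"
proof -
  have id: "nat_trans C D F (\<lambda>A\<in>Obj C. Idt D (fobj F A)) F" if F: "is_functor C D F" for F
    unfolding nat_trans_def
  proof (intro conjI ballI F)
    fix A assume "A \<in> Obj C"
    then show "(\<lambda>A\<in>Obj C. Idt D (fobj F A)) A \<in> hom D (fobj F A) (fobj F A)"
      using F D by (auto simp: is_functor_def category_def PiE_iff)
  next
    fix f assume f: "f \<in> Arr C"
    then have "Dom C f \<in> Obj C" "Cod C f \<in> Obj C" using C by (auto simp: category_def)
    moreover have "farr F f \<in> hom D (fobj F (Dom C f)) (fobj F (Cod C f))"
      using F f by (auto simp: is_functor_def)
    then have "Cmp D (farr F f) (Idt D (fobj F (Dom C f))) = farr F f"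
      "Cmp D (Idt D (fobj F (Cod C f))) (farr F f) = farr F f"
      using D unfolding category_def hom_def by fastforce+
    ultimately show "Cmp D (farr F f) ((\<lambda>A\<in>Obj C. Idt D (fobj F A)) (Dom C f)) =
        Cmp D ((\<lambda>A\<in>Obj C. Idt D (fobj F A)) (Cod C f)) (farr F f)" by simp
  qed simp
  have cmp: "nat_trans C D F (\<lambda>A\<in>Obj C. Cmp D (\<beta> A) (\<alpha> A)) K"
    if \<alpha>: "nat_trans C D F \<alpha> G" and \<beta>: "nat_trans C D G \<beta> K" for F G K \<alpha> \<beta>
    unfolding nat_trans_def
  proof (intro conjI ballI)
    show "is_functor C D F" "is_functor C D K" using \<alpha> \<beta> by (auto simp: nat_trans_def)
    have ty: "\<alpha> A \<in> Arr D" "Dom D (\<alpha> A) = fobj F A" "Cod D (\<alpha> A) = fobj G A"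
      "\<beta> A \<in> Arr D" "Dom D (\<beta> A) = fobj G A" "Cod D (\<beta> A) = fobj K A" if "A \<in> Obj C" for A
      using \<alpha> \<beta> that by (auto simp: nat_trans_def hom_def)
    show "(\<lambda>A\<in>Obj C. Cmp D (\<beta> A) (\<alpha> A)) A \<in> hom D (fobj F A) (fobj K A)" if "A \<in> Obj C" for A
      using D ty[OF that] that unfolding category_def hom_def by auto
    fix f assume f: "f \<in> Arr C"
    then have d: "Dom C f \<in> Obj C" "Cod C f \<in> Obj C" using C by (auto simp: category_def)
    have fn: "farr F f \<in> Arr D" "Dom D (farr F f) = fobj F (Dom C f)" "Cod D (farr F f) = fobj F (Cod C f)"
      "farr G f \<in> Arr D" "Dom D (farr G f) = fobj G (Dom C f)" "Cod D (farr G f) = fobj G (Cod C f)"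
      "farr K f \<in> Arr D" "Dom D (farr K f) = fobj K (Dom C f)" "Cod D (farr K f) = fobj K (Cod C f)"
      using \<alpha> \<beta> f by (auto simp: nat_trans_def is_functor_def hom_def)
    have nat: "Cmp D (farr G f) (\<alpha> (Dom C f)) = Cmp D (\<alpha> (Cod C f)) (farr F f)"
      "Cmp D (farr K f) (\<beta> (Dom C f)) = Cmp D (\<beta> (Cod C f)) (farr G f)"
      using \<alpha> \<beta> f by (auto simp: nat_trans_def)
    have assoc: "Cmp D h (Cmp D g e) = Cmp D (Cmp D h g) e"
      if "e \<in> Arr D" "g \<in> Arr D" "h \<in> Arr D" "Cod D e = Dom D g" "Cod D g = Dom D h" for e g h
      using D that unfolding category_def by blast
    have "Cmp D (farr K f) (Cmp D (\<beta> (Dom C f)) (\<alpha> (Dom C f))) =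
        Cmp D (Cmp D (farr K f) (\<beta> (Dom C f))) (\<alpha> (Dom C f))"
      by (rule assoc) (use ty d fn in auto)
    also have "\<dots> = Cmp D (\<beta> (Cod C f)) (Cmp D (farr G f) (\<alpha> (Dom C f)))"
      unfolding nat(2) by (rule assoc[symmetric]) (use ty d fn in auto)
    also have "\<dots> = Cmp D (Cmp D (\<beta> (Cod C f)) (\<alpha> (Cod C f))) (farr F f)"
      unfolding nat(1) by (rule assoc) (use ty d fn in auto)
    finally show "Cmp D (farr K f) ((\<lambda>A\<in>Obj C. Cmp D (\<beta> A) (\<alpha> A)) (Dom C f)) =
        Cmp D ((\<lambda>A\<in>Obj C. Cmp D (\<beta> A) (\<alpha> A)) (Cod C f)) (farr F f)"
      using d by simp
  qed simp
  have unit: "(\<lambda>A\<in>Obj C. Cmp D (\<alpha> A) ((\<lambda>A\<in>Obj C. Idt D (fobj F A)) A)) = \<alpha>"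
    "(\<lambda>A\<in>Obj C. Cmp D ((\<lambda>A\<in>Obj C. Idt D (fobj G A)) A) (\<alpha> A)) = \<alpha>"
    if \<alpha>: "nat_trans C D F \<alpha> G" for F G \<alpha>
  proof -
    have ext: "\<alpha> \<in> extensional (Obj C)" using \<alpha> by (simp add: nat_trans_def)
    have u: "Cmp D (\<alpha> A) (Idt D (fobj F A)) = \<alpha> A" "Cmp D (Idt D (fobj G A)) (\<alpha> A) = \<alpha> A"
      if "A \<in> Obj C" for A
    proof -
      have "\<alpha> A \<in> Arr D" "Dom D (\<alpha> A) = fobj F A" "Cod D (\<alpha> A) = fobj G A"
        using \<alpha> that by (auto simp: nat_trans_def hom_def)
      then show "Cmp D (\<alpha> A) (Idt D (fobj F A)) = \<alpha> A" "Cmp D (Idt D (fobj G A)) (\<alpha> A) = \<alpha> A"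
        using D unfolding category_def by fastforce+
    qed
    show "(\<lambda>A\<in>Obj C. Cmp D (\<alpha> A) ((\<lambda>A\<in>Obj C. Idt D (fobj F A)) A)) = \<alpha>"
      "(\<lambda>A\<in>Obj C. Cmp D ((\<lambda>A\<in>Obj C. Idt D (fobj G A)) A) (\<alpha> A)) = \<alpha>"
      by (rule extensionalityI[OF _ ext]; simp add: u)+
  qed
  have assoc: "(\<lambda>A\<in>Obj C. Cmp D (\<gamma> A) ((\<lambda>A\<in>Obj C. Cmp D (\<beta> A) (\<alpha> A)) A)) =
      (\<lambda>A\<in>Obj C. Cmp D ((\<lambda>A\<in>Obj C. Cmp D (\<gamma> A) (\<beta> A)) A) (\<alpha> A))"
    if "nat_trans C D F \<alpha> G" "nat_trans C D G \<beta> K" "nat_trans C D K \<gamma> L" for F G K L \<alpha> \<beta> \<gamma>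
  proof (rule restrict_ext)
    fix A assume A: "A \<in> Obj C"
    have "\<alpha> A \<in> Arr D" "\<beta> A \<in> Arr D" "\<gamma> A \<in> Arr D"
      "Cod D (\<alpha> A) = Dom D (\<beta> A)" "Cod D (\<beta> A) = Dom D (\<gamma> A)"
      using that A by (auto simp: nat_trans_def hom_def)
    then have "Cmp D (\<gamma> A) (Cmp D (\<beta> A) (\<alpha> A)) = Cmp D (Cmp D (\<gamma> A) (\<beta> A)) (\<alpha> A)"
      using D unfolding category_def by blast
    then show "Cmp D (\<gamma> A) ((\<lambda>A\<in>Obj C. Cmp D (\<beta> A) (\<alpha> A)) A) =
        Cmp D ((\<lambda>A\<in>Obj C. Cmp D (\<gamma> A) (\<beta> A)) A) (\<alpha> A)"
      using A by simp
  qed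
  show ?thesis
    unfolding category_def
  proof (intro conjI ballI impI)
    fix f assume "f \<in> Arr (functor_cat C D)"
    then have f: "nat_trans C D (src f) (app f) (trg f)" by (simp add: functor_cat_def)
    show "Dom (functor_cat C D) f \<in> Obj (functor_cat C D)" "Cod (functor_cat C D) f \<in> Obj (functor_cat C D)"
      using f by (simp_all add: functor_cat_def nat_trans_def)
    show "Cmp (functor_cat C D) f (Idt (functor_cat C D) (Dom (functor_cat C D) f)) = f"
      "Cmp (functor_cat C D) (Idt (functor_cat C D) (Cod (functor_cat C D) f)) f = f"
      using unit[OF f] by (simp_all add: functor_cat_def)
  next
    fix F assume "F \<in> Obj (functor_cat C D)"
    then show "Idt (functor_cat C D) F \<in> hom (functor_cat C D) F F"
      using id[of F] by (simp add: functor_cat_def hom_def)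
  next
    fix f g assume "f \<in> Arr (functor_cat C D)" "g \<in> Arr (functor_cat C D)"
      "Cod (functor_cat C D) f = Dom (functor_cat C D) g"
    then show "Cmp (functor_cat C D) g f
        \<in> hom (functor_cat C D) (Dom (functor_cat C D) f) (Cod (functor_cat C D) g)"
      using cmp[of "src f" "app f" "trg f" "app g" "trg g"] by (simp add: functor_cat_def hom_def)
  next
    fix f g h assume "f \<in> Arr (functor_cat C D)" "g \<in> Arr (functor_cat C D)"
      "h \<in> Arr (functor_cat C D)"
      "Cod (functor_cat C D) f = Dom (functor_cat C D) g \<and>
       Cod (functor_cat C D) g = Dom (functor_cat C D) h"
    then show "Cmp (functor_cat C D) h (Cmp (functor_cat C D) g f) =
        Cmp (functor_cat C D) (Cmp (functor_cat C D) h g) f"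
      using assoc[of "src f" "app f" "trg f" "app g" "trg g" "app h" "trg h"]
      by (simp add: functor_cat_def)
  qed
qed

lemma is_functor_into_Sets:
  assumes "is_functor D (Sets \<kappa>) M" "A \<in> Obj D"
  shows "fobj M A \<in> elts ` hered_small \<kappa>" "fobj M A \<subseteq> hered_small \<kappa>"
proof -
  show 1: "fobj M A \<in> elts ` hered_small \<kappa>"
    using assms by (auto simp: is_functor_def Sets_def set_cat_def PiE_iff)
  then show "fobj M A \<subseteq> hered_small \<kappa>" by (auto elim: hered_small.cases)
qed

lemma singleton_in_Sets:
  assumes "Cinfinite \<kappa>"
  shows "\<exists>x. {x} \<in> elts ` hered_small \<kappa>"
proof -
  have co: "Card_order \<kappa>" and fin: "\<And>S. finite S \<Longrightarrow> |S| <o \<kappa>"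
    using assms Cfinite_ordLess_Cinfinite[of "|_|" \<kappa>]
    by (auto simp: cfinite_def Field_card_of card_of_card_order_on)
  obtain x where x: "x \<in> hered_small \<kappa>" "elts x = {}"
    using ex_hered_small[OF co, of "{}"] fin by auto
  obtain y where "y \<in> hered_small \<kappa>" "elts y = {x}"
    using ex_hered_small[OF co, of "{x}"] fin[of "{x}"] x(1) by blast
  then show ?thesis by (metis image_eqI)
qed

lemma ex_nonempty_fobj:
  fixes D :: "('o, 'a) cat"
  assumes \<kappa>: "Cinfinite \<kappa>" and D: "coherent_category D"
  shows "\<exists>A\<in>Obj D. \<forall>M\<in>models \<kappa> D. fobj M A \<noteq> {}"
proof -
  define J :: "(nat, nat) cat"
    where "J = \<lparr>Obj = {}, Arr = {}, Dom = id, Cod = id, Idt = id, Cmp = (\<lambda>_. id)\<rparr>"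
  define K :: "(nat, nat, 'o, 'a) functr" where "K = \<lparr>fobj = (\<lambda>_. undefined), farr = (\<lambda>_. undefined)\<rparr>"
  have fd: "finite_diagram J D K"
    by (auto simp: finite_diagram_def J_def K_def category_def is_functor_def)
  moreover have "has_finite_limits D" using D by (simp add: coherent_category_def)
  ultimately obtain L \<pi> where lim: "limit_cone D J K L \<pi>"
    unfolding has_finite_limits_def by blast
  have "L \<in> Obj D" using lim by (auto simp: limit_cone_def cone_def)
  moreover have "fobj M L \<noteq> {}" if "M \<in> models \<kappa> D" for M
  proof -
    have "limit_cone (Sets \<kappa>) J (comp_functor J M K) (fobj M L) (\<lambda>i. farr M (\<pi> i))"
      using that fd lim by (auto simp: models_def coherent_functor_def)
    moreover obtain x where "{x} \<in> elts ` hered_small \<kappa>" using singleton_in_Sets[OF \<kappa>] by blast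
    then have "cone (Sets \<kappa>) J (comp_functor J M K) {x} undefined"
      by (auto simp: cone_def J_def Sets_def set_cat_def)
    ultimately obtain h where "h \<in> hom (Sets \<kappa>) {x} (fobj M L)"
      unfolding limit_cone_def by blast
    then show ?thesis by (auto simp: hom_def Sets_def set_cat_def)
  qed
  ultimately show ?thesis by blast
qed

lemma topspace_model_topology:
  assumes "Cinfinite \<kappa>" "coherent_category D"
  shows "topspace (model_topology \<kappa> D) = models \<kappa> D"
proof
  show "topspace (model_topology \<kappa> D) \<subseteq> models \<kappa> D"
    unfolding model_topology_def topology_generated_by_topspace by blast
  obtain A where A: "A \<in> Obj D" "\<forall>M\<in>models \<kappa> D. fobj M A \<noteq> {}"
    using ex_nonempty_fobj[OF assms] by blast
  have "openin (model_topology \<kappa> D)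
      {M \<in> models \<kappa> D. \<exists>x\<in>fobj M A. \<forall>i<length []. app (farr M ([] ! i)) x = [] ! i}"
    unfolding model_topology_def using A(1)
    by (intro topology_generated_by_Basis CollectI exI[of _ A] exI[of _ "[]"]) auto
  also have "{M \<in> models \<kappa> D. \<exists>x\<in>fobj M A. \<forall>i<length []. app (farr M ([] ! i)) x = [] ! i} = models \<kappa> D"
    using A(2) by auto
  finally show "models \<kappa> D \<subseteq> topspace (model_topology \<kappa> D)" by (rule openin_subset)
qed

lemma topspace_model_iso_topology:
  assumes "Cinfinite \<kappa>" "coherent_category D"
  shows "topspace (model_iso_topology \<kappa> D) = model_isos \<kappa> D"
proof
  show "topspace (model_iso_topology \<kappa> D) \<subseteq> model_isos \<kappa> D"
    unfolding model_iso_topology_def topology_generated_by_topspace by blast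
  have "openin (model_iso_topology \<kappa> D) {\<phi> \<in> model_isos \<kappa> D. src \<phi> \<in> topspace (model_topology \<kappa> D)}"
    unfolding model_iso_topology_def
    by (intro topology_generated_by_Basis UnI1 CollectI exI[of _ "topspace (model_topology \<kappa> D)"]) auto
  also have "{\<phi> \<in> model_isos \<kappa> D. src \<phi> \<in> topspace (model_topology \<kappa> D)} = model_isos \<kappa> D"
    using topspace_model_topology[OF assms] by (auto simp: model_isos_def)
  finally show "model_isos \<kappa> D \<subseteq> topspace (model_iso_topology \<kappa> D)" by (rule openin_subset)
qed

lemma topological_groupoid_model_groupoid:
  assumes \<kappa>: "Cinfinite \<kappa>" and D: "coherent_category D"
  shows "topological_groupoid (model_groupoid \<kappa> D)"
proof -
  let ?F = "functor_cat D (Sets \<kappa>)" and ?H = "model_groupoid \<kappa> D"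
    and ?X = "model_topology \<kappa> D" and ?G = "model_iso_topology \<kappa> D"
  have F: "category ?F"
    using D by (auto simp: Sets_def coherent_category_def intro!: category_functor_cat category_set_cat)
  note topX = topspace_model_topology[OF assms] and topG = topspace_model_iso_topology[OF assms]
  have DC[simp]: "Dom ?F = src" "Cod ?F = trg" by (simp_all add: functor_cat_def)
  have Fid: "Idt ?F M \<in> hom ?F M M" if "M \<in> Obj ?F" for M
    using F that unfolding category_def by blast
  have Fcmp: "Cmp ?F g f \<in> hom ?F (src f) (trg g)" if "f \<in> Arr ?F" "g \<in> Arr ?F" "trg f = src g" for f g
    using F that unfolding category_def DC by blast
  have Funit: "Cmp ?F f (Idt ?F (src f)) = f" "Cmp ?F (Idt ?F (trg f)) f = f" if "f \<in> Arr ?F" for f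
    using F that unfolding category_def DC by blast+
  have Fassoc: "Cmp ?F h (Cmp ?F g f) = Cmp ?F (Cmp ?F h g) f"
    if "f \<in> Arr ?F" "g \<in> Arr ?F" "h \<in> Arr ?F" "trg f = src g" "trg g = src h" for f g h
    using F that unfolding category_def DC by blast
  define Inv where "Inv \<phi> \<psi> \<longleftrightarrow> \<psi> \<in> hom ?F (trg \<phi>) (src \<phi>) \<and>
       Cmp ?F \<psi> \<phi> = Idt ?F (src \<phi>) \<and> Cmp ?F \<phi> \<psi> = Idt ?F (trg \<phi>)" for \<phi> \<psi>
  have Inv_unique: "\<psi> = \<psi>'" if "\<phi> \<in> Arr ?F" "Inv \<phi> \<psi>" "Inv \<phi> \<psi>'" for \<phi> \<psi> \<psi>'
  proof -
    have a: "\<psi> \<in> Arr ?F" "\<psi>' \<in> Arr ?F" "src \<psi> = trg \<phi>" "trg \<psi> = src \<phi>" "src \<psi>' = trg \<phi>" "trg \<psi>' = src \<phi>"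
      using that by (auto simp: Inv_def hom_def)
    have "\<psi> = Cmp ?F \<psi> (Cmp ?F \<phi> \<psi>')" using that a Funit(1)[OF a(1)] by (simp add: Inv_def)
    also have "\<dots> = Cmp ?F (Cmp ?F \<psi> \<phi>) \<psi>'" by (rule Fassoc) (use that a in auto)
    also have "\<dots> = \<psi>'" using that a Funit(2)[OF a(2)] by (simp add: Inv_def)
    finally show ?thesis .
  qed
  have isosD: "\<phi> \<in> Arr ?F" "src \<phi> \<in> models \<kappa> D" "trg \<phi> \<in> models \<kappa> D" "\<exists>\<psi>. Inv \<phi> \<psi>"
    if "\<phi> \<in> model_isos \<kappa> D" for \<phi>
    using that by (auto simp: model_isos_def isos_def Inv_def)
  have isosI: "\<phi> \<in> model_isos \<kappa> D"
    if "\<phi> \<in> Arr ?F" "src \<phi> \<in> models \<kappa> D" "trg \<phi> \<in> models \<kappa> D" "Inv \<phi> \<psi>" for \<phi> \<psi>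
    using that by (auto simp: model_isos_def isos_def Inv_def)
  have obj: "M \<in> Obj ?F" if "M \<in> models \<kappa> D" for M
    using that by (simp add: models_def coherent_functor_def functor_cat_def)
  define inv where "inv = inverse_of ?H"
  have inv: "Inv \<phi> (inv \<phi>)" if "\<phi> \<in> model_isos \<kappa> D" for \<phi>
  proof -
    have "\<exists>!\<psi>. Inv \<phi> \<psi>" using isosD[OF that] Inv_unique by blast
    then show ?thesis
      unfolding inv_def model_groupoid_def groupoid.simps Inv_def by (rule theI')
  qed
  have inv_iso: "inv \<phi> \<in> model_isos \<kappa> D" "src (inv \<phi>) = trg \<phi>" "trg (inv \<phi>) = src \<phi>"
    if "\<phi> \<in> model_isos \<kappa> D" for \<phi>
  proof -
    note i = inv[OF that]
    show "src (inv \<phi>) = trg \<phi>" "trg (inv \<phi>) = src \<phi>" using i by (auto simp: Inv_def hom_def)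
    then show "inv \<phi> \<in> model_isos \<kappa> D"
      using isosD[OF that] i by (intro isosI[of _ \<phi>]) (auto simp: Inv_def hom_def)
  qed
  have id_iso: "Idt ?F M \<in> model_isos \<kappa> D" "src (Idt ?F M) = M" "trg (Idt ?F M) = M"
    if "M \<in> models \<kappa> D" for M
  proof -
    note i = Fid[OF obj[OF that]]
    show "src (Idt ?F M) = M" "trg (Idt ?F M) = M" using i by (auto simp: hom_def)
    then show "Idt ?F M \<in> model_isos \<kappa> D"
      using i that Funit(1)[of "Idt ?F M"] by (intro isosI[of _ "Idt ?F M"]) (auto simp: Inv_def hom_def)
  qed
  have cmp_iso: "Cmp ?F g f \<in> model_isos \<kappa> D" "src (Cmp ?F g f) = src f" "trg (Cmp ?F g f) = trg g"
    if f: "f \<in> model_isos \<kappa> D" and g: "g \<in> model_isos \<kappa> D" and fg: "trg f = src g" for f g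
  proof -
    note af = isosD(1)[OF f] and ag = isosD(1)[OF g]
    note i = Fcmp[OF af ag fg]
    show s: "src (Cmp ?F g f) = src f" and t: "trg (Cmp ?F g f) = trg g" using i by (auto simp: hom_def)
    note ai = isosD(1)[OF inv_iso(1)[OF f]] and aj = isosD(1)[OF inv_iso(1)[OF g]]
    have gf: "Cmp ?F g f \<in> Arr ?F" using i by (simp add: hom_def)
    have k: "Cmp ?F (inv f) (inv g) \<in> hom ?F (trg g) (src f)"
      using Fcmp[OF aj ai] inv_iso[OF f] inv_iso[OF g] fg by simp
    have "Cmp ?F (Cmp ?F (inv f) (inv g)) (Cmp ?F g f) = Cmp ?F (inv f) (Cmp ?F (inv g) (Cmp ?F g f))"
      by (rule Fassoc[symmetric]) (use gf ai aj s t inv_iso[OF f] inv_iso[OF g] fg in auto)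
    also have "Cmp ?F (inv g) (Cmp ?F g f) = Cmp ?F (Cmp ?F (inv g) g) f"
      by (rule Fassoc) (use af ag aj inv_iso[OF g] fg in auto)
    also have "\<dots> = f" using inv[OF g] fg Funit(2)[OF af] by (simp add: Inv_def)
    also have "Cmp ?F (inv f) f = Idt ?F (src f)" using inv[OF f] by (simp add: Inv_def)
    finally have 1: "Cmp ?F (Cmp ?F (inv f) (inv g)) (Cmp ?F g f) = Idt ?F (src f)" .
    have "Cmp ?F (Cmp ?F g f) (Cmp ?F (inv f) (inv g)) = Cmp ?F g (Cmp ?F f (Cmp ?F (inv f) (inv g)))"
      by (rule Fassoc[symmetric]) (use af ag k inv_iso[OF f] inv_iso[OF g] fg in \<open>auto simp: hom_def\<close>)
    also have "Cmp ?F f (Cmp ?F (inv f) (inv g)) = Cmp ?F (Cmp ?F f (inv f)) (inv g)"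
      by (rule Fassoc) (use af ai aj inv_iso[OF f] inv_iso[OF g] fg in auto)
    also have "\<dots> = inv g" using inv[OF f] fg Funit(2)[OF aj] inv_iso[OF g] by (simp add: Inv_def)
    also have "Cmp ?F g (inv g) = Idt ?F (trg g)" using inv[OF g] by (simp add: Inv_def)
    finally have 2: "Cmp ?F (Cmp ?F g f) (Cmp ?F (inv f) (inv g)) = Idt ?F (trg g)" .
    show "Cmp ?F g f \<in> model_isos \<kappa> D"
      by (rule isosI[of _ "Cmp ?F (inv f) (inv g)"])
        (use gf s t isosD[OF f] isosD[OF g] k 1 2 in \<open>auto simp: Inv_def\<close>)
  qed
  have app_cmp: "app (app (Cmp ?F g f) A) a = app (app g A) (app (app f A) a)"
    if "f \<in> model_isos \<kappa> D" "g \<in> model_isos \<kappa> D" "A \<in> Obj D" "a \<in> fobj (src f) A" for f g A a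
  proof -
    have "app f A \<in> hom (Sets \<kappa>) (fobj (src f) A) (fobj (trg f) A)"
      using isosD(1)[OF that(1)] that(3) by (simp add: functor_cat_def nat_trans_def)
    then have "src (app f A) = fobj (src f) A" by (simp add: hom_def Sets_def set_cat_def)
    then show ?thesis
      using that(3,4) by (simp add: functor_cat_def Sets_def set_cat_def compose_def)
  qed
  have app_id: "app (app (Idt ?F M) A) a = a" if "A \<in> Obj D" "a \<in> fobj M A" for M A a
    using that by (simp add: functor_cat_def Sets_def set_cat_def)
  have app_ty: "app (app f A) a \<in> fobj (trg f) A"
    if "f \<in> model_isos \<kappa> D" "A \<in> Obj D" "a \<in> fobj (src f) A" for f A a
  proof -
    have "app f A \<in> hom (Sets \<kappa>) (fobj (src f) A) (fobj (trg f) A)"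
      using isosD(1)[OF that(1)] that(2) by (simp add: functor_cat_def nat_trans_def)
    then show ?thesis using that(3) by (auto simp: hom_def Sets_def set_cat_def PiE_iff)
  qed
  have fobj_sub: "fobj M A \<subseteq> hered_small \<kappa>" if "M \<in> models \<kappa> D" "A \<in> Obj D" for M A
    using that by (auto simp: models_def coherent_functor_def dest: is_functor_into_Sets(2))
  let ?W = "\<lambda>A a b. {\<phi> \<in> model_isos \<kappa> D. a \<in> fobj (src \<phi>) A \<and> app (app \<phi> A) a = b}"
  have open_src: "openin ?G {\<phi> \<in> model_isos \<kappa> D. src \<phi> \<in> U}" if "openin ?X U" for U
    unfolding model_iso_topology_def using that by (intro topology_generated_by_Basis) blast
  have open_trg: "openin ?G {\<phi> \<in> model_isos \<kappa> D. trg \<phi> \<in> U}" if "openin ?X U" for U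
    unfolding model_iso_topology_def using that by (intro topology_generated_by_Basis) blast
  have open_W: "openin ?G (?W A a b)" if "A \<in> Obj D" "a \<in> hered_small \<kappa>" "b \<in> hered_small \<kappa>" for A a b
    unfolding model_iso_topology_def using that by (intro topology_generated_by_Basis) blast
  have cont_into_G: "continuous_map T ?G h"
    if h: "\<And>x. x \<in> topspace T \<Longrightarrow> h x \<in> model_isos \<kappa> D"
      and 1: "\<And>U. openin ?X U \<Longrightarrow> openin T {x \<in> topspace T. src (h x) \<in> U}"
      and 2: "\<And>U. openin ?X U \<Longrightarrow> openin T {x \<in> topspace T. trg (h x) \<in> U}"
      and 3: "\<And>A a b. A \<in> Obj D \<Longrightarrow> a \<in> hered_small \<kappa> \<Longrightarrow> b \<in> hered_small \<kappa> \<Longrightarrow>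
        openin T {x \<in> topspace T. a \<in> fobj (src (h x)) A \<and> app (app (h x) A) a = b}"
    for h :: "'x \<Rightarrow> ('a, 'b, 'c) model_map" and T
    unfolding model_iso_topology_def
  proof (rule continuous_on_generated_topo)
    show "h ` topspace T \<subseteq> \<Union> ({{\<phi> \<in> model_isos \<kappa> D. src \<phi> \<in> U} | U. openin ?X U} \<union>
     {{\<phi> \<in> model_isos \<kappa> D. trg \<phi> \<in> U} | U. openin ?X U} \<union>
     {?W A a b | A a b. A \<in> Obj D \<and> a \<in> hered_small \<kappa> \<and> b \<in> hered_small \<kappa>})"
      unfolding topology_generated_by_topspace[symmetric] model_iso_topology_def[symmetric] topG
      using h by blast
    fix V assume "V \<in> {{\<phi> \<in> model_isos \<kappa> D. src \<phi> \<in> U} | U. openin ?X U} \<union>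
     {{\<phi> \<in> model_isos \<kappa> D. trg \<phi> \<in> U} | U. openin ?X U} \<union>
     {?W A a b | A a b. A \<in> Obj D \<and> a \<in> hered_small \<kappa> \<and> b \<in> hered_small \<kappa>}"
    then consider U where "openin ?X U" "V = {\<phi> \<in> model_isos \<kappa> D. src \<phi> \<in> U}"
      | U where "openin ?X U" "V = {\<phi> \<in> model_isos \<kappa> D. trg \<phi> \<in> U}"
      | A a b where "A \<in> Obj D" "a \<in> hered_small \<kappa>" "b \<in> hered_small \<kappa>" "V = ?W A a b"
      by blast
    then show "openin T (h -` V \<inter> topspace T)"
    proof cases
      case (1 U)
      then have "h -` V \<inter> topspace T = {x \<in> topspace T. src (h x) \<in> U}" using h by blast
      then show ?thesis using that(2) 1 by simp
    next
      case (2 U)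
      then have "h -` V \<inter> topspace T = {x \<in> topspace T. trg (h x) \<in> U}" using h by blast
      then show ?thesis using that(3) 2 by simp
    next
      case (3 A a b)
      then have "h -` V \<inter> topspace T = {x \<in> topspace T. a \<in> fobj (src (h x)) A \<and> app (app (h x) A) a = b}"
        using h by blast
      then show ?thesis using that(4) 3 by simp
    qed
  qed
  have c_src: "continuous_map ?G ?X src" and c_trg: "continuous_map ?G ?X trg"
    using open_src open_trg isosD(2,3) by (auto simp: continuous_map_def topX topG)
  have c_unit: "continuous_map ?X ?G (Idt ?F)"
  proof (rule cont_into_G, unfold topX)
    fix U assume U: "openin ?X U"
    then have "U \<subseteq> models \<kappa> D" using openin_subset topX by metis
    then have "{M \<in> models \<kappa> D. src (Idt ?F M) \<in> U} = U" "{M \<in> models \<kappa> D. trg (Idt ?F M) \<in> U} = U"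
      using id_iso by auto
    then show "openin ?X {M \<in> models \<kappa> D. src (Idt ?F M) \<in> U}"
      "openin ?X {M \<in> models \<kappa> D. trg (Idt ?F M) \<in> U}" using U by simp_all
  next
    fix A a b assume A: "A \<in> Obj D" and a: "a \<in> hered_small \<kappa>"
    show "openin ?X {M \<in> models \<kappa> D. a \<in> fobj (src (Idt ?F M)) A \<and> app (app (Idt ?F M) A) a = b}"
    proof (cases "a = b")
      case True
      have Aid: "Idt D A \<in> Arr D" "Dom D (Idt D A) = A"
        using D A by (auto simp: coherent_category_def category_def hom_def)
      have Mid: "app (farr M (Idt D A)) x = x" if "M \<in> models \<kappa> D" "x \<in> fobj M A" for M x
        using that A by (simp add: models_def coherent_functor_def is_functor_def Sets_def set_cat_def)
      have "openin ?X {M \<in> models \<kappa> D.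
          \<exists>x\<in>fobj M A. \<forall>i<length [Idt D A]. app (farr M ([Idt D A] ! i)) x = [a] ! i}"
        unfolding model_topology_def
        by (intro topology_generated_by_Basis CollectI exI[of _ A] exI[of _ "[Idt D A]"] exI[of _ "[a]"])
          (use A a Aid in auto)
      also have "{M \<in> models \<kappa> D.
          \<exists>x\<in>fobj M A. \<forall>i<length [Idt D A]. app (farr M ([Idt D A] ! i)) x = [a] ! i} =
          {M \<in> models \<kappa> D. a \<in> fobj M A}"
        using Mid by auto
      also have "\<dots> = {M \<in> models \<kappa> D. a \<in> fobj (src (Idt ?F M)) A \<and> app (app (Idt ?F M) A) a = b}"
        using id_iso(2) app_id[OF A] True by auto
      finally show ?thesis .
    next
      case False
      then have "{M \<in> models \<kappa> D. a \<in> fobj (src (Idt ?F M)) A \<and> app (app (Idt ?F M) A) a = b} = {}"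
        using id_iso(2) app_id[OF A] by auto
      then show ?thesis by (simp only: openin_empty)
    qed
  qed (use id_iso in auto)
  have app_inv: "a \<in> fobj (src (inv \<phi>)) A \<and> app (app (inv \<phi>) A) a = b \<longleftrightarrow>
      b \<in> fobj (src \<phi>) A \<and> app (app \<phi> A) b = a" if \<phi>: "\<phi> \<in> model_isos \<kappa> D" and A: "A \<in> Obj D" for \<phi> A a b
  proof -
    note i = inv[OF \<phi>] inv_iso[OF \<phi>]
    have 1: "app (app (inv \<phi>) A) (app (app \<phi> A) b) = b" if "b \<in> fobj (src \<phi>) A" for b
      using app_cmp[OF \<phi> i(2) A that] app_id[OF A that] i(1) by (simp add: Inv_def)
    have 2: "app (app \<phi> A) (app (app (inv \<phi>) A) a) = a" if "a \<in> fobj (trg \<phi>) A" for a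
      using app_cmp[OF i(2) \<phi> A, of a] app_id[OF A that] i that by (simp add: Inv_def)
    show ?thesis
      using 1 2 app_ty[OF \<phi> A] app_ty[OF i(2) A] i by auto
  qed
  have c_inv: "continuous_map ?G ?G inv"
  proof (rule cont_into_G, unfold topG)
    fix U assume "openin ?X U"
    moreover have "{\<phi> \<in> model_isos \<kappa> D. src (inv \<phi>) \<in> U} = {\<phi> \<in> model_isos \<kappa> D. trg \<phi> \<in> U}"
      "{\<phi> \<in> model_isos \<kappa> D. trg (inv \<phi>) \<in> U} = {\<phi> \<in> model_isos \<kappa> D. src \<phi> \<in> U}"
      using inv_iso by auto
    ultimately show "openin ?G {\<phi> \<in> model_isos \<kappa> D. src (inv \<phi>) \<in> U}"
      "openin ?G {\<phi> \<in> model_isos \<kappa> D. trg (inv \<phi>) \<in> U}" using open_src open_trg by simp_all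
  next
    fix A a b assume A: "A \<in> Obj D" "a \<in> hered_small \<kappa>" "b \<in> hered_small \<kappa>"
    have "{\<phi> \<in> model_isos \<kappa> D. a \<in> fobj (src (inv \<phi>)) A \<and> app (app (inv \<phi>) A) a = b} = ?W A b a"
      using app_inv[OF _ A(1)] by blast
    then show "openin ?G {\<phi> \<in> model_isos \<kappa> D. a \<in> fobj (src (inv \<phi>)) A \<and> app (app (inv \<phi>) A) a = b}"
      using open_W A by simp
  qed (use inv_iso in auto)
  let ?P = "{(g, f). trg f = src g}"
  let ?T = "subtopology (prod_topology ?G ?G) ?P"
  have topT: "topspace ?T = (model_isos \<kappa> D \<times> model_isos \<kappa> D) \<inter> ?P" by (simp add: topG)
  have c_mult: "continuous_map ?T ?G (\<lambda>(g, f). Cmp ?F g f)"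
  proof (rule cont_into_G)
    fix x assume "x \<in> topspace ?T"
    then show "(case x of (g, f) \<Rightarrow> Cmp ?F g f) \<in> model_isos \<kappa> D"
      unfolding topT using cmp_iso(1) by auto
  next
    fix U assume U: "openin ?X U"
    have "openin ?T ((model_isos \<kappa> D \<times> {f \<in> model_isos \<kappa> D. src f \<in> U}) \<inter> ?P)"
      using open_src[OF U] openin_topspace[of ?G] topG
      by (intro openin_subtopology_Int) (simp add: openin_prod_Times_iff)
    also have "(model_isos \<kappa> D \<times> {f \<in> model_isos \<kappa> D. src f \<in> U}) \<inter> ?P =
        {x \<in> topspace ?T. src (case x of (g, f) \<Rightarrow> Cmp ?F g f) \<in> U}"
      unfolding topT using cmp_iso(2) by auto
    finally show "openin ?T {x \<in> topspace ?T. src (case x of (g, f) \<Rightarrow> Cmp ?F g f) \<in> U}" .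
    have "openin ?T (({g \<in> model_isos \<kappa> D. trg g \<in> U} \<times> model_isos \<kappa> D) \<inter> ?P)"
      using open_trg[OF U] openin_topspace[of ?G] topG
      by (intro openin_subtopology_Int) (simp add: openin_prod_Times_iff)
    also have "({g \<in> model_isos \<kappa> D. trg g \<in> U} \<times> model_isos \<kappa> D) \<inter> ?P =
        {x \<in> topspace ?T. trg (case x of (g, f) \<Rightarrow> Cmp ?F g f) \<in> U}"
      unfolding topT using cmp_iso(3) by auto
    finally show "openin ?T {x \<in> topspace ?T. trg (case x of (g, f) \<Rightarrow> Cmp ?F g f) \<in> U}" .
  next
    fix A a b assume A: "A \<in> Obj D" "a \<in> hered_small \<kappa>" "b \<in> hered_small \<kappa>"
    have "openin ?T ((\<Union>c\<in>hered_small \<kappa>. ?W A c b \<times> ?W A a c) \<inter> ?P)"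
      using open_W A by (intro openin_subtopology_Int openin_Union) (auto simp: openin_prod_Times_iff)
    also have "(\<Union>c\<in>hered_small \<kappa>. ?W A c b \<times> ?W A a c) \<inter> ?P = {x \<in> topspace ?T.
        a \<in> fobj (src (case x of (g, f) \<Rightarrow> Cmp ?F g f)) A \<and>
        app (app (case x of (g, f) \<Rightarrow> Cmp ?F g f) A) a = b}" (is "?L = ?R")
    proof
      show "?L \<subseteq> ?R" unfolding topT using cmp_iso(2) app_cmp A(1) by auto
      show "?R \<subseteq> ?L"
      proof
        fix x assume x: "x \<in> ?R"
        obtain g f where gf: "x = (g, f)" by (cases x)
        then have f: "f \<in> model_isos \<kappa> D" and g: "g \<in> model_isos \<kappa> D" and e: "trg f = src g"
          using x unfolding topT by auto
        have a: "a \<in> fobj (src f) A" "app (app g A) (app (app f A) a) = b"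
          using x cmp_iso(2)[OF f g e] app_cmp[OF f g A(1)] by (auto simp: gf)
        let ?c = "app (app f A) a"
        have "?c \<in> fobj (src g) A" using app_ty[OF f A(1) a(1)] e by simp
        moreover from this have "?c \<in> hered_small \<kappa>" using fobj_sub[OF isosD(2)[OF g] A(1)] by blast
        ultimately show "x \<in> ?L" using a f g e by (auto simp: gf)
      qed
    qed
    finally show "openin ?T {x \<in> topspace ?T.
        a \<in> fobj (src (case x of (g, f) \<Rightarrow> Cmp ?F g f)) A \<and>
        app (app (case x of (g, f) \<Rightarrow> Cmp ?F g f) A) a = b}" .
  qed
  have cat: "category (groupoid_cat ?H)"
    unfolding category_def groupoid_cat_def cat.simps model_groupoid_def groupoid.simps topX topG hom_def
    using isosD(1,2,3) id_iso cmp_iso Funit Fassoc by simp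
  have invs: "\<forall>f\<in>topspace (ar_top ?H).
      inverse_of ?H f \<in> hom (groupoid_cat ?H) (target ?H f) (source ?H f) \<and>
      mult ?H (inverse_of ?H f) f = unit_at ?H (source ?H f) \<and>
      mult ?H f (inverse_of ?H f) = unit_at ?H (target ?H f)"
    using inv inv_iso unfolding inv_def[symmetric]
    by (simp add: Inv_def groupoid_cat_def model_groupoid_def topG hom_def)
  show ?thesis
    unfolding topological_groupoid_def
    using cat invs c_src c_trg c_unit c_inv c_mult unfolding inv_def by (simp add: model_groupoid_def)
qed


section \<open>Size\<close>

text \<open>
  HOL has no category of all sets, so sheaves take values in the sets of cardinality less than
  some \<open>\<mu>\<close>, and equivariant sheaves have total spaces of cardinality less than \<open>\<mu>\<close>. As \<open>\<mu>\<close> is a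
  relation on \<open>'u\<close>, every set of cardinality less than \<open>\<mu>\<close> is in bijection with a member of
  \<open>small_sets \<mu>\<close>. The cardinal \<open>\<mu>\<close> has to be large compared with the index set \<open>I\<close> (later the
  arrows of the site and the points and labels of the groupoid), so that both constructions stay
  within size \<open>\<mu>\<close>. By the two lemmas below this holds for inaccessible \<open>\<mu>\<close>, that is for
  Grothendieck universes, whenever \<open>|I| <o \<mu>\<close>; and a suitable \<open>\<mu>\<close> exists for every infinite \<open>I\<close>.
\<close>

definition small_sets :: "'u rel \<Rightarrow> 'u set set" where
  "small_sets \<mu> = {S. |S| <o \<mu>}"

text \<open>\<open>Func I S\<close> is the set of functions from \<open>I\<close> to \<open>S\<close>.\<close>

definition closed_under_powers :: "'u rel \<Rightarrow> 'i set \<Rightarrow> bool" where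
  "closed_under_powers \<mu> I \<longleftrightarrow>
    Cinfinite \<mu> \<and> regularCard \<mu> \<and> |I| <o \<mu> \<and>
    (\<forall>S::'u set. |S| <o \<mu> \<longrightarrow> |Func I S| <o \<mu>)"

lemma closed_under_powers_strong_limit:
  fixes \<mu> :: "'u rel" and I :: "'i set"
  assumes \<mu>: "Cinfinite \<mu>" "regularCard \<mu>" and I: "|I| <o \<mu>"
    and Pow: "\<And>S::'u set. |S| <o \<mu> \<Longrightarrow> |Pow S| <o \<mu>"
  shows "closed_under_powers \<mu> I"
  unfolding closed_under_powers_def
proof (intro conjI allI impI \<mu> I)
  fix S :: "'u set" assume S: "|S| <o \<mu>"
  have "|Pair i ` S| <o \<mu>" for i :: 'i
    by (rule ordLeq_ordLess_trans[OF card_of_image S])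
  then have "|\<Union>i\<in>I. Pair i ` S| <o \<mu>"
    by (intro card_of_UNION_ordLess_infinite_Field_regularCard[OF \<mu>(2,1) I]) blast
  moreover have "(\<Union>i\<in>I. Pair i ` S) = I \<times> S" by auto
  ultimately have "|I \<times> S| <o \<mu>" by simp
  then obtain T :: "'u set" where T: "( |I \<times> S|, |T| ) \<in> ordIso" "|T| <o \<mu>"
    using iffD1[OF internalize_card_of_ordLess] by blast
  have "|Func I S| \<le>o |Pow (I \<times> S)|"
  proof (rule card_of_ordLeqI[where f = "\<lambda>f. (\<lambda>i. (i, f i)) ` I"])
    show "inj_on (\<lambda>f. (\<lambda>i. (i, f i)) ` I) (Func I S)"
    proof (rule inj_onI, rule ext)
      fix f g i
      assume fg: "f \<in> Func I S" "g \<in> Func I S" "(\<lambda>i. (i, f i)) ` I = (\<lambda>i. (i, g i)) ` I"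
      show "f i = g i"
      proof (cases "i \<in> I")
        case True
        then have "(i, f i) \<in> (\<lambda>i. (i, g i)) ` I" using fg(3) by blast
        then show ?thesis by auto
      qed (use fg in \<open>simp add: Func_def\<close>)
    qed
  qed (auto simp: Func_def)
  also have "|Pow (I \<times> S)| \<le>o |Pow T|"
  proof -
    obtain h where h: "inj_on h (I \<times> S)" "h ` (I \<times> S) \<subseteq> T"
      using iffD2[OF card_of_ordLeq ordIso_imp_ordLeq[OF T(1)]] by blast
    show ?thesis
      by (rule card_of_ordLeqI[of "image h", OF inj_on_image_Pow[OF h(1)]]) (use h(2) in blast)
  qed
  finally show "|Func I S| <o \<mu>"
    using Pow[OF T(2)] by (rule ordLeq_ordLess_trans)
qed (use \<mu>(1) in auto)

lemma closed_under_powers_cardSuc: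
  assumes "infinite I"
  shows "closed_under_powers (cardSuc (ctwo ^c |I| )) I"
proof -
  let ?\<nu> = "ctwo ^c |I|"
  have I: "Cinfinite |I|"
    using assms by (simp add: cinfinite_def Field_card_of card_of_card_order_on)
  have \<nu>: "Cinfinite ?\<nu>"
    by (rule Cinfinite_cexp[OF ordLeq_refl[OF Card_order_ctwo] I])
  note co = conjunct2[OF \<nu>]
  have "|I| <o cardSuc ?\<nu>"
    by (rule ordLess_transitive[OF ordLess_ctwo_cexp[OF conjunct2[OF I]] cardSuc_greater[OF co]])
  moreover have "|Func I S| <o cardSuc ?\<nu>" if S: "|S| <o cardSuc ?\<nu>" for S :: "('a \<Rightarrow> bool) set set"
  proof -
    have "|S| \<le>o ?\<nu>"
      using S by (simp only: cardSuc_ordLeq_ordLess[OF co card_of_Card_order])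
    then have "|S| ^c |I| \<le>o ?\<nu> ^c |I|" by (rule cexp_mono1) (rule card_of_Card_order)
    also have "?\<nu> ^c |I| \<le>o ?\<nu>"
      by (rule ordIso_imp_ordLeq[OF cexp_cprod_ordLeq[OF Card_order_ctwo I]])
        (rule Cinfinite_Cnotzero[OF I], rule ordLeq_refl[OF card_of_Card_order])
    finally (ordLeq_transitive) have "|Func I S| \<le>o ?\<nu>"
      by (simp only: cexp_def[of "|S|"] Field_card_of)
    then show ?thesis
      by (simp only: cardSuc_ordLeq_ordLess[OF co card_of_Card_order])
  qed
  ultimately show ?thesis
    unfolding closed_under_powers_def
    using Cinfinite_cardSuc[OF \<nu>] regularCard_cardSuc[OF \<nu>] by blast
qed

end

(*
  For an object A of D, the pairs (M, x) with x in M(A) form an equivariant sheaf EL A over the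
  groupoid of models. A section of EL A near M is given by a label, and a neighbourhood of a model
  is given by finitely many labels. As diagonals are complemented, the equality pattern of finitely
  many elements is definable, and any elements with the right pattern can be renamed to prescribed
  labels by an isomorphism of models. Hence a stable open subset of EL A is a union of definable
  ones, and the EL A generate all equivariant sheaves.

  The equivalence sends an equivariant sheaf E to the sheaf A |-> Hom(EL A, E). It is faithful since
  the EL A generate, full since two maps EL A -> E that agree at a point agree on a definable part,
  and essentially surjective: a sheaf P gives an equivariant sheaf whose stalk at M is the colimit
  of P over the elements of M, and saturation shows that P(A) -> Hom(EL A, E) is
  bijective.
*)

theory Submission
  imports Defs
begin

text \<open>Types and sizes force a detour. A point of \<open>EL A\<close> is a pair of a model and
  a label, while equivariant sheaves live on the type \<open>'u\<close>; so \<open>EL A\<close> is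
  never made an object. \<open>HomE A\<close> collects the maps out of it as plain functions, and
  these are coded injectively into \<open>'u\<close>. The bound behind the code is
  \<open>closed_under_powers\<close>: such a map is a function from models and labels to the total
  space.

  The topologies know elements by label only, and a label means nothing across models. What makes up
  for this is that any permutation of the labels, taken separately at each object, turns a model
  into an isomorphic one. A finite assignment of labels extends to a permutation exactly when it
  respects equality and inequality; this is why equality patterns have to be definable, and why
  finitely many labels at a time suffice.

  The functor starts from equivariant sheaves because maps out of \<open>EL A\<close> glue along
  covers pointwise. The way back is then needed on objects alone, and no functoriality of the stalks
  has to be proved.\<close>

abbreviation ev where "ev M f \<equiv> app (farr M f)"

abbreviation cmpt where "cmpt \<phi> A \<equiv> app (app \<phi> A)"

section \<open>Limits, images and unions of small sets\<close>

lemma mem_elts_hered_small_iff: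
  fixes S :: "'k hset set"
  assumes "Card_order \<kappa>"
  shows "S \<in> elts ` hered_small \<kappa> \<longleftrightarrow> S \<subseteq> hered_small \<kappa> \<and> |S| <o \<kappa>"
proof
  assume "S \<in> elts ` hered_small \<kappa>"
  then show "S \<subseteq> hered_small \<kappa> \<and> |S| <o \<kappa>" by (auto elim: hered_small.cases)
next
  assume "S \<subseteq> hered_small \<kappa> \<and> |S| <o \<kappa>"
  then show "S \<in> elts ` hered_small \<kappa>" using ex_hered_small[OF assms] by blast
qed

lemma set_cat_simps [simp]:
  "Obj (set_cat \<U>) = \<U>" "Dom (set_cat \<U>) = src" "Cod (set_cat \<U>) = trg"
  by (simp_all add: set_cat_def)

lemma Idt_set_cat: "Idt (set_cat \<U>) S = Arrow S (\<lambda>x\<in>S. x) S"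
  by (simp add: set_cat_def)

lemma Cmp_set_cat: "Cmp (set_cat \<U>) g f = Arrow (src f) (compose (src f) (app g) (app f)) (trg g)"
  by (simp add: set_cat_def)

lemma Arr_set_cat_iff:
  "f \<in> Arr (set_cat \<U>) \<longleftrightarrow> src f \<in> \<U> \<and> trg f \<in> \<U> \<and> app f \<in> src f \<rightarrow>\<^sub>E trg f"
  by (simp add: set_cat_def)

lemma hom_set_cat_iff:
  "f \<in> hom (set_cat \<U>) S T \<longleftrightarrow>
    src f = S \<and> trg f = T \<and> S \<in> \<U> \<and> T \<in> \<U> \<and> app f \<in> S \<rightarrow>\<^sub>E T"
  by (auto simp: hom_def Arr_set_cat_iff)

lemma arrow_eqI:
  assumes "f \<in> hom (set_cat \<U>) S T" "g \<in> hom (set_cat \<U>) S T" "\<And>x. x \<in> S \<Longrightarrow> app f x = app g x"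
  shows "f = g"
proof (rule arrow.expand, intro conjI)
  show "app f = app g"
    by (rule PiE_ext[of _ S "\<lambda>_. T"]) (use assms in \<open>auto simp: hom_set_cat_iff\<close>)
qed (use assms in \<open>auto simp: hom_set_cat_iff\<close>)

lemma hom_set_catD:
  "f \<in> hom (set_cat \<U>) S T \<Longrightarrow> x \<in> S \<Longrightarrow> app f x \<in> T"
  by (auto simp: hom_set_cat_iff)

lemma Arrow_in_hom_set_cat:
  assumes "S \<in> \<U>" "T \<in> \<U>" "\<And>x. x \<in> S \<Longrightarrow> h x \<in> T"
  shows "Arrow S (restrict h S) T \<in> hom (set_cat \<U>) S T"
  using assms by (auto simp: hom_set_cat_iff)

lemma app_Cmp_set_cat:
  "f \<in> hom (set_cat \<U>) S T \<Longrightarrow> x \<in> S \<Longrightarrow> app (Cmp (set_cat \<U>) g f) x = app g (app f x)"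
  by (auto simp: Cmp_set_cat compose_def hom_set_cat_iff)

lemma Cmp_in_hom_set_cat:
  "f \<in> hom (set_cat \<U>) S T \<Longrightarrow> g \<in> hom (set_cat \<U>) T U \<Longrightarrow> Cmp (set_cat \<U>) g f \<in> hom (set_cat \<U>) S U"
  by (auto simp: Cmp_set_cat hom_set_cat_iff compose_def)

lemma homD:
  assumes "category C" "f \<in> hom C A B"
  shows "f \<in> Arr C" "Dom C f = A" "Cod C f = B" "A \<in> Obj C" "B \<in> Obj C"
  using assms by (auto simp: category_def hom_def)

lemma Arr_hom: "f \<in> Arr C \<Longrightarrow> f \<in> hom C (Dom C f) (Cod C f)"
  by (simp add: hom_def)

lemma Cmp_in_hom:
  "category C \<Longrightarrow> f \<in> hom C A B \<Longrightarrow> g \<in> hom C B E \<Longrightarrow> Cmp C g f \<in> hom C A E"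
  by (auto simp: category_def hom_def)

lemma Idt_in_hom: "category C \<Longrightarrow> A \<in> Obj C \<Longrightarrow> Idt C A \<in> hom C A A"
  by (simp add: category_def)

lemma Cmp_assoc:
  "category C \<Longrightarrow> f \<in> hom C A B \<Longrightarrow> g \<in> hom C B E \<Longrightarrow> h \<in> hom C E F \<Longrightarrow>
    Cmp C h (Cmp C g f) = Cmp C (Cmp C h g) f"
  by (auto simp: category_def hom_def)

lemma Cmp_Idt:
  "category C \<Longrightarrow> f \<in> hom C A B \<Longrightarrow> Cmp C f (Idt C A) = f"
  "category C \<Longrightarrow> f \<in> hom C A B \<Longrightarrow> Cmp C (Idt C B) f = f"
  by (auto simp: category_def hom_def)

text \<open>A choice of preimages under \<open>m\<close> is the factorizing map.\<close>

lemma factors_set_cat_iff: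
  assumes f: "f \<in> hom (set_cat \<U>) S B" and m: "m \<in> hom (set_cat \<U>) T B"
  shows "factors (set_cat \<U>) f m \<longleftrightarrow> app f ` S \<subseteq> app m ` T"
proof
  assume "factors (set_cat \<U>) f m"
  then obtain h where h: "h \<in> hom (set_cat \<U>) S T" "Cmp (set_cat \<U>) m h = f"
    using f m by (auto simp: factors_def hom_set_cat_iff)
  show "app f ` S \<subseteq> app m ` T"
  proof
    fix y assume "y \<in> app f ` S"
    then obtain x where x: "x \<in> S" "y = app f x" by blast
    then have "y = app m (app h x)" using app_Cmp_set_cat[OF h(1) x(1), of m] h(2) by simp
    then show "y \<in> app m ` T" using hom_set_catD[OF h(1) x(1)] by blast
  qed
next
  assume sub: "app f ` S \<subseteq> app m ` T"
  define h where "h = Arrow S (restrict (\<lambda>x. inv_into T (app m) (app f x)) S) T"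
  have h: "h \<in> hom (set_cat \<U>) S T"
    unfolding h_def using f m sub
    by (intro Arrow_in_hom_set_cat inv_into_into) (auto simp: hom_set_cat_iff)
  have "Cmp (set_cat \<U>) m h = f"
  proof (rule arrow_eqI[OF Cmp_in_hom_set_cat[OF h m] f])
    fix x assume x: "x \<in> S"
    then have "app f x \<in> app m ` T" using sub by blast
    then show "app (Cmp (set_cat \<U>) m h) x = app f x"
      unfolding app_Cmp_set_cat[OF h x] using x by (simp add: h_def f_inv_into_f)
  qed
  then show "factors (set_cat \<U>) f m"
    using h f m by (auto simp: factors_def hom_set_cat_iff)
qed

context
  fixes \<kappa> :: "'k rel"
  assumes \<kappa>: "Cinfinite \<kappa>"
begin

abbreviation "Sk \<equiv> Sets \<kappa>"

lemma Obj_Sets_iff: "S \<in> Obj Sk \<longleftrightarrow> S \<subseteq> hered_small \<kappa> \<and> |S| <o \<kappa>"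
  using mem_elts_hered_small_iff[of \<kappa> S] \<kappa> by (simp add: Sets_def)

lemma Obj_Sets_subset: "S \<in> Obj Sk \<Longrightarrow> T \<subseteq> S \<Longrightarrow> T \<in> Obj Sk"
  unfolding Obj_Sets_iff using ordLeq_ordLess_trans[OF card_of_mono1] by blast

lemma incl_in_hom_Sets:
  assumes "S \<in> Obj Sk" "T \<subseteq> S"
  shows "Arrow T (\<lambda>x\<in>T. x) S \<in> hom Sk T S"
proof -
  have "T \<in> Obj Sk" using Obj_Sets_subset[OF assms] .
  then show ?thesis
    unfolding Sets_def using assms by (intro Arrow_in_hom_set_cat) (auto simp: Sets_def)
qed

text \<open>Elements of a set are the arrows out of a singleton, which exists among the hereditarily
  small sets as \<open>\<kappa>\<close> is infinite. Hence cancelling arrows separates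
  elements.\<close>

lemma mono_Sets_iff:
  assumes m: "m \<in> hom Sk S T"
  shows "mono_arr Sk m \<longleftrightarrow> inj_on (app m) S"
proof
  note m' = m[unfolded Sets_def]
  assume mono: "mono_arr Sk m"
  show "inj_on (app m) S"
  proof (rule inj_onI)
    fix x y assume xy: "x \<in> S" "y \<in> S" "app m x = app m y"
    obtain p where p: "{p} \<in> Obj Sk" using singleton_in_Sets[OF \<kappa>] by (auto simp: Sets_def)
    have S: "S \<in> Obj Sk" using m' by (auto simp: hom_set_cat_iff Sets_def)
    let ?u = "\<lambda>x. Arrow {p} (\<lambda>_\<in>{p}. x) S"
    have u: "?u x \<in> hom Sk {p} S" if "x \<in> S" for x
      unfolding Sets_def using p S that by (intro Arrow_in_hom_set_cat) (auto simp: Sets_def)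
    have "Cmp Sk m (?u x) = Cmp Sk m (?u y)"
      using xy by (simp add: Sets_def Cmp_set_cat compose_def restrict_def fun_eq_iff)
    moreover have "u = v"
      if "u \<in> hom Sk {p} S" "v \<in> hom Sk {p} S" "Cmp Sk m u = Cmp Sk m v" for u v
      using mono that m by (auto simp: mono_arr_def hom_def)
    ultimately have "?u x = ?u y" using u xy by blast
    then have "app (?u x) p = app (?u y) p" by (rule arg_cong)
    then show "x = y" by simp
  qed
next
  note m' = m[unfolded Sets_def]
  assume inj: "inj_on (app m) S"
  show "mono_arr Sk m"
    unfolding mono_arr_def
  proof (intro conjI ballI impI)
    show "m \<in> Arr Sk" using m by (simp add: hom_def)
    fix u v assume uv: "u \<in> Arr Sk" "v \<in> Arr Sk"
      "Dom Sk u = Dom Sk v \<and> Cod Sk u = Dom Sk m \<and> Cod Sk v = Dom Sk m \<and> Cmp Sk m u = Cmp Sk m v"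
    have u: "u \<in> hom (set_cat (elts ` hered_small \<kappa>)) (src u) S"
      and v: "v \<in> hom (set_cat (elts ` hered_small \<kappa>)) (src u) S"
      using uv m by (auto simp: Sets_def hom_def)
    show "u = v"
    proof (rule arrow_eqI[OF u v])
      fix x assume x: "x \<in> src u"
      have "app m (app u x) = app m (app v x)"
        using app_Cmp_set_cat[OF u x, of m] app_Cmp_set_cat[OF v x, of m] uv(3)
        by (simp add: Sets_def)
      then show "app u x = app v x"
        using inj hom_set_catD[OF u x] hom_set_catD[OF v x] by (auto dest: inj_onD)
    qed
  qed
qed

lemma subobj_Sets_iff:
  assumes m: "m \<in> hom Sk S T"
  shows "subobj Sk T m \<longleftrightarrow> inj_on (app m) S"
  using mono_Sets_iff[OF m] m by (auto simp: subobj_def hom_def)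

lemma factors_Sets_iff:
  "f \<in> hom Sk S B \<Longrightarrow> m \<in> hom Sk T B \<Longrightarrow> factors Sk f m \<longleftrightarrow> app f ` S \<subseteq> app m ` T"
  unfolding Sets_def by (rule factors_set_cat_iff)

lemma subobj_Sets_incl:
  assumes "S \<in> Obj Sk" "T \<subseteq> S"
  shows "subobj Sk S (Arrow T (\<lambda>x\<in>T. x) S)"
  unfolding subobj_Sets_iff[OF incl_in_hom_Sets[OF assms]] by (simp add: inj_on_def)

text \<open>The set-theoretic image is itself a subobject, since subsets of small sets are small;
  minimality is tested against its inclusion.\<close>

lemma is_image_Sets_iff:
  assumes f: "f \<in> hom Sk S B" and m: "m \<in> hom Sk T B"
  shows "is_image Sk f m \<longleftrightarrow> inj_on (app m) T \<and> app m ` T = app f ` S"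
proof -
  have BO: "B \<in> Obj Sk" using f by (auto simp: Sets_def hom_set_cat_iff)
  have fa: "f \<in> Arr Sk" "Cod Sk f = B" using f by (auto simp: hom_def)
  have sub: "app f ` S \<subseteq> B" using hom_set_catD f unfolding Sets_def by fast
  show ?thesis
  proof
    assume im: "is_image Sk f m"
    then have "subobj Sk B m" and 1: "factors Sk f m"
      and 2: "\<And>n. subobj Sk B n \<Longrightarrow> factors Sk f n \<Longrightarrow> factors Sk m n"
      using fa by (auto simp: is_image_def)
    let ?n = "Arrow (app f ` S) (\<lambda>x\<in>app f ` S. x) B"
    note n = incl_in_hom_Sets[OF BO sub]
    have "factors Sk m ?n"
      by (rule 2[OF subobj_Sets_incl[OF BO sub]]) (simp add: factors_Sets_iff[OF f n])
    then show "inj_on (app m) T \<and> app m ` T = app f ` S"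
      using 1 \<open>subobj Sk B m\<close> subobj_Sets_iff[OF m]
      by (auto simp: factors_Sets_iff[OF m n] factors_Sets_iff[OF f m])
  next
    assume r: "inj_on (app m) T \<and> app m ` T = app f ` S"
    show "is_image Sk f m"
      unfolding is_image_def fa(2)
    proof (intro conjI allI impI fa(1))
      show "subobj Sk B m" using r subobj_Sets_iff[OF m] by simp
      show "factors Sk f m" using r factors_Sets_iff[OF f m] by simp
      fix n assume n: "subobj Sk B n \<and> factors Sk f n"
      then have nh: "n \<in> hom Sk (Dom Sk n) B" by (auto simp: subobj_def mono_arr_def hom_def)
      show "factors Sk m n" using n r factors_Sets_iff[OF f nh] factors_Sets_iff[OF m nh] by simp
    qed
  qed
qed

text \<open>As for images: the set-theoretic union with its inclusion is the competitor that keeps a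
  least upper bound from being any larger.\<close>

lemma is_union_Sets_iff:
  assumes u: "u \<in> hom Sk T B" and S: "\<And>m. m \<in> S \<Longrightarrow> m \<in> hom Sk (src m) B"
  shows "is_union Sk B S u \<longleftrightarrow> (\<forall>m\<in>S. inj_on (app m) (src m)) \<and> inj_on (app u) T \<and>
    app u ` T = (\<Union>m\<in>S. app m ` src m)"
proof -
  have BO: "B \<in> Obj Sk" using u by (auto simp: Sets_def hom_set_cat_iff)
  let ?N = "\<Union>m\<in>S. app m ` src m"
  have "app m ` src m \<subseteq> B" if "m \<in> S" for m
    using S[OF that] hom_set_catD unfolding Sets_def by fast
  then have sub: "?N \<subseteq> B" by blast
  show ?thesis
  proof
    assume un: "is_union Sk B S u"
    let ?n = "Arrow ?N (\<lambda>x\<in>?N. x) B"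
    note n = incl_in_hom_Sets[OF BO sub]
    have sm: "app m ` src m \<subseteq> app u ` T" if "m \<in> S" for m
      using un that factors_Sets_iff[OF S[OF that] u] by (auto simp: is_union_def)
    have "factors Sk m ?n" if "m \<in> S" for m
      unfolding factors_Sets_iff[OF S[OF that] n] using that by auto
    then have "factors Sk u ?n"
      using un subobj_Sets_incl[OF BO sub] by (simp add: is_union_def)
    then have "app u ` T \<subseteq> ?N" unfolding factors_Sets_iff[OF u n] by auto
    moreover have "inj_on (app m) (src m)" if "m \<in> S" for m
      using un that subobj_Sets_iff[OF S[OF that]] by (auto simp: is_union_def)
    moreover have "inj_on (app u) T" using un subobj_Sets_iff[OF u] by (auto simp: is_union_def)
    ultimately show "(\<forall>m\<in>S. inj_on (app m) (src m)) \<and> inj_on (app u) T \<and> app u ` T = ?N"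
      using sm by blast
  next
    assume r: "(\<forall>m\<in>S. inj_on (app m) (src m)) \<and> inj_on (app u) T \<and> app u ` T = ?N"
    show "is_union Sk B S u"
      unfolding is_union_def
    proof (intro conjI allI impI ballI)
      show "subobj Sk B m" if "m \<in> S" for m using r that subobj_Sets_iff[OF S[OF that]] by simp
      show "subobj Sk B u" using r subobj_Sets_iff[OF u] by simp
      show "factors Sk m u" if "m \<in> S" for m using r that factors_Sets_iff[OF S[OF that] u] by auto
      fix n assume n: "subobj Sk B n \<and> (\<forall>m\<in>S. factors Sk m n)"
      then have nh: "n \<in> hom Sk (Dom Sk n) B" by (auto simp: subobj_def mono_arr_def hom_def)
      have "app m ` src m \<subseteq> app n ` Dom Sk n" if "m \<in> S" for m
        using n that factors_Sets_iff[OF S[OF that] nh] by blast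
      then show "factors Sk u n" unfolding factors_Sets_iff[OF u nh] using r by auto
    qed
  qed
qed

text \<open>Elements of a limit are the compatible families. Such a family is a cone from a
  singleton, and a cone from \<open>N\<close> is one compatible family for each element of
  \<open>N\<close>; so it is enough to know the universal property for singletons.\<close>

lemma limit_cone_Sets_iff:
  assumes J: "category J" and K: "is_functor J Sk K"
    and L: "L \<in> Obj Sk" and \<pi>: "\<And>i. i \<in> Obj J \<Longrightarrow> \<pi> i \<in> hom Sk L (fobj K i)"
  shows "limit_cone Sk J K L \<pi> \<longleftrightarrow>
    (\<forall>u\<in>Arr J. \<forall>z\<in>L. ev K u (app (\<pi> (Dom J u)) z) = app (\<pi> (Cod J u)) z) \<and>
    (\<forall>x. (\<forall>i\<in>Obj J. x i \<in> fobj K i) \<and> (\<forall>u\<in>Arr J. ev K u (x (Dom J u)) = x (Cod J u)) \<longrightarrow>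
      (\<exists>!z. z \<in> L \<and> (\<forall>i\<in>Obj J. app (\<pi> i) z = x i)))"
proof -
  let ?V = "elts ` hered_small \<kappa>"
  have Jo: "Dom J u \<in> Obj J" "Cod J u \<in> Obj J" if "u \<in> Arr J" for u
    using J that by (auto simp: category_def)
  have Kh: "farr K u \<in> hom Sk (fobj K (Dom J u)) (fobj K (Cod J u))" if "u \<in> Arr J" for u
    using K that by (simp add: is_functor_def)
  have KO: "fobj K i \<in> Obj Sk" if "i \<in> Obj J" for i
    using K that by (auto simp: is_functor_def)
  have cone_iff: "cone Sk J K N \<rho> \<longleftrightarrow>
      (\<forall>u\<in>Arr J. \<forall>z\<in>N. ev K u (app (\<rho> (Dom J u)) z) = app (\<rho> (Cod J u)) z)"
    if N: "N \<in> Obj Sk" and \<rho>: "\<And>i. i \<in> Obj J \<Longrightarrow> \<rho> i \<in> hom Sk N (fobj K i)" for N \<rho>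
  proof -
    have "Cmp Sk (farr K u) (\<rho> (Dom J u)) = \<rho> (Cod J u) \<longleftrightarrow>
        (\<forall>z\<in>N. ev K u (app (\<rho> (Dom J u)) z) = app (\<rho> (Cod J u)) z)" if "u \<in> Arr J" for u
    proof -
      note r = \<rho>[OF Jo(1)[OF that], unfolded Sets_def] \<rho>[OF Jo(2)[OF that], unfolded Sets_def]
      note k = Kh[OF that, unfolded Sets_def]
      have "Cmp (set_cat ?V) (farr K u) (\<rho> (Dom J u)) = \<rho> (Cod J u)"
        if "\<forall>z\<in>N. ev K u (app (\<rho> (Dom J u)) z) = app (\<rho> (Cod J u)) z"
        by (rule arrow_eqI[OF Cmp_in_hom_set_cat[OF r(1) k] r(2)])
          (use that in \<open>simp add: app_Cmp_set_cat[OF r(1)]\<close>)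
      moreover have "ev K u (app (\<rho> (Dom J u)) z) = app (\<rho> (Cod J u)) z"
        if "Cmp (set_cat ?V) (farr K u) (\<rho> (Dom J u)) = \<rho> (Cod J u)" "z \<in> N" for z
        using app_Cmp_set_cat[OF r(1) that(2), of "farr K u"] that(1) by simp
      ultimately show ?thesis unfolding Sets_def by blast
    qed
    then show ?thesis using N \<rho> by (auto simp: cone_def)
  qed
  show ?thesis
  proof (intro iffI conjI)
    assume lim: "limit_cone Sk J K L \<pi>"
    then show "\<forall>u\<in>Arr J. \<forall>z\<in>L. ev K u (app (\<pi> (Dom J u)) z) = app (\<pi> (Cod J u)) z"
      using cone_iff[OF L \<pi>] by (simp add: limit_cone_def)
    show "\<forall>x. (\<forall>i\<in>Obj J. x i \<in> fobj K i) \<and> (\<forall>u\<in>Arr J. ev K u (x (Dom J u)) = x (Cod J u)) \<longrightarrow>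
      (\<exists>!z. z \<in> L \<and> (\<forall>i\<in>Obj J. app (\<pi> i) z = x i))"
    proof (intro allI impI)
      fix x assume x: "(\<forall>i\<in>Obj J. x i \<in> fobj K i) \<and> (\<forall>u\<in>Arr J. ev K u (x (Dom J u)) = x (Cod J u))"
      obtain p where p: "{p} \<in> Obj Sk" using singleton_in_Sets[OF \<kappa>] by (auto simp: Sets_def)
      let ?c = "\<lambda>S z. Arrow {p} (\<lambda>_\<in>{p}. z) S"
      have ch: "?c S z \<in> hom Sk {p} S" if "S \<in> Obj Sk" "z \<in> S" for S z
        unfolding Sets_def using p that by (intro Arrow_in_hom_set_cat) (auto simp: Sets_def)
      let ?\<rho> = "\<lambda>i. ?c (fobj K i) (x i)"
      have \<rho>: "?\<rho> i \<in> hom Sk {p} (fobj K i)" if "i \<in> Obj J" for i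
        using ch[OF KO[OF that]] x that by simp
      have "cone Sk J K {p} ?\<rho>"
        by (subst cone_iff[OF p \<rho>]) (use x Jo in auto)
      then have ex1: "\<exists>!h. h \<in> hom Sk {p} L \<and> (\<forall>i\<in>Obj J. Cmp Sk (\<pi> i) h = ?\<rho> i)"
        using lim by (simp add: limit_cone_def)
      have key: "Cmp Sk (\<pi> i) (?c L z) = ?\<rho> i \<longleftrightarrow> app (\<pi> i) z = x i" if "i \<in> Obj J" "z \<in> L" for i z
      proof -
        note r = ch[OF L that(2), unfolded Sets_def] \<pi>[OF that(1), unfolded Sets_def]
        have a: "app (Cmp (set_cat ?V) (\<pi> i) (?c L z)) p = app (\<pi> i) z"
          using app_Cmp_set_cat[OF r(1), of p "\<pi> i"] by simp
        have "Cmp (set_cat ?V) (\<pi> i) (?c L z) = ?\<rho> i" if "app (\<pi> i) z = x i"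
          by (rule arrow_eqI[OF Cmp_in_hom_set_cat[OF r] \<rho>[OF \<open>i \<in> Obj J\<close>, unfolded Sets_def]])
            (use that a in simp)
        then show ?thesis unfolding Sets_def using a by auto
      qed
      obtain h where h: "h \<in> hom Sk {p} L" "\<And>i. i \<in> Obj J \<Longrightarrow> Cmp Sk (\<pi> i) h = ?\<rho> i"
        using ex1 by blast
      have hp: "app h p \<in> L" using hom_set_catD[OF h(1)[unfolded Sets_def]] by simp
      have "h = ?c L (app h p)"
        by (rule arrow_eqI[OF h(1)[unfolded Sets_def] ch[OF L hp, unfolded Sets_def]]) simp
      then have "app (\<pi> i) (app h p) = x i" if "i \<in> Obj J" for i
        using h(2)[OF that] key[OF that hp] by simp
      moreover have "z = z'" if "z \<in> L" "\<forall>i\<in>Obj J. app (\<pi> i) z = x i"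
        "z' \<in> L" "\<forall>i\<in>Obj J. app (\<pi> i) z' = x i" for z z'
      proof -
        have "\<forall>i\<in>Obj J. Cmp Sk (\<pi> i) (?c L z) = ?\<rho> i" "\<forall>i\<in>Obj J. Cmp Sk (\<pi> i) (?c L z') = ?\<rho> i"
          using key that by blast+
        then have "?c L z = ?c L z'"
          using ex1 ch[OF L that(1)] ch[OF L that(3)] by blast
        then have "app (?c L z) p = app (?c L z') p" by (rule arg_cong)
        then show ?thesis by simp
      qed
      ultimately show "\<exists>!z. z \<in> L \<and> (\<forall>i\<in>Obj J. app (\<pi> i) z = x i)" using hp by blast
    qed
  next
    assume r: "(\<forall>u\<in>Arr J. \<forall>z\<in>L. ev K u (app (\<pi> (Dom J u)) z) = app (\<pi> (Cod J u)) z) \<and>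
      (\<forall>x. (\<forall>i\<in>Obj J. x i \<in> fobj K i) \<and> (\<forall>u\<in>Arr J. ev K u (x (Dom J u)) = x (Cod J u)) \<longrightarrow>
      (\<exists>!z. z \<in> L \<and> (\<forall>i\<in>Obj J. app (\<pi> i) z = x i)))"
    show "limit_cone Sk J K L \<pi>"
      unfolding limit_cone_def
    proof (intro conjI allI impI)
      show "cone Sk J K L \<pi>" using r cone_iff[OF L \<pi>] by simp
      fix N \<rho> assume c: "cone Sk J K N \<rho>"
      then have N: "N \<in> Obj Sk" and \<rho>: "\<And>i. i \<in> Obj J \<Longrightarrow> \<rho> i \<in> hom Sk N (fobj K i)"
        by (auto simp: cone_def)
      have ex1: "\<exists>!z. z \<in> L \<and> (\<forall>i\<in>Obj J. app (\<pi> i) z = app (\<rho> i) n)" if n: "n \<in> N" for n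
      proof -
        have "\<forall>i\<in>Obj J. app (\<rho> i) n \<in> fobj K i"
          using \<rho> n hom_set_catD unfolding Sets_def by fast
        moreover have "\<forall>u\<in>Arr J. ev K u (app (\<rho> (Dom J u)) n) = app (\<rho> (Cod J u)) n"
          using c cone_iff[OF N \<rho>] n by simp
        ultimately show ?thesis using conjunct2[OF r, rule_format, of "\<lambda>i. app (\<rho> i) n"] by blast
      qed
      define h where "h n = (THE z. z \<in> L \<and> (\<forall>i\<in>Obj J. app (\<pi> i) z = app (\<rho> i) n))" for n
      have h: "h n \<in> L" "\<And>i. i \<in> Obj J \<Longrightarrow> app (\<pi> i) (h n) = app (\<rho> i) n" if "n \<in> N" for n
        using theI'[OF ex1[OF that]] unfolding h_def by auto
      let ?h = "Arrow N (restrict h N) L"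
      have hh: "?h \<in> hom Sk N L"
        unfolding Sets_def using N L h(1) by (intro Arrow_in_hom_set_cat) (auto simp: Sets_def)
      show "\<exists>!h. h \<in> hom Sk N L \<and> (\<forall>i\<in>Obj J. Cmp Sk (\<pi> i) h = \<rho> i)"
      proof (rule ex1I[of _ ?h], intro conjI hh ballI)
        fix i assume i: "i \<in> Obj J"
        show "Cmp Sk (\<pi> i) ?h = \<rho> i"
          unfolding Sets_def
        proof (rule arrow_eqI[OF Cmp_in_hom_set_cat \<rho>[OF i, unfolded Sets_def]])
          show "?h \<in> hom (set_cat ?V) N L" using hh by (simp add: Sets_def)
          show "\<pi> i \<in> hom (set_cat ?V) L (fobj K i)" using \<pi>[OF i] by (simp add: Sets_def)
        qed (use h(2) i in \<open>simp add: Cmp_set_cat compose_def\<close>)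
      next
        fix k assume k: "k \<in> hom Sk N L \<and> (\<forall>i\<in>Obj J. Cmp Sk (\<pi> i) k = \<rho> i)"
        then have kh: "k \<in> hom (set_cat ?V) N L" by (simp add: Sets_def)
        show "k = ?h"
        proof (rule arrow_eqI[OF kh hh[unfolded Sets_def]])
          fix n assume n: "n \<in> N"
          have "app (\<pi> i) (app k n) = app (\<rho> i) n" if "i \<in> Obj J" for i
            using app_Cmp_set_cat[OF kh n, of "\<pi> i"] k that by (simp add: Sets_def)
          then have "app k n = h n"
            using ex1[OF n] hom_set_catD[OF kh n] h[OF n] by blast
          then show "app k n = app ?h n" using n by simp
        qed
      qed
    qed
  qed
qed

end

section \<open>Models\<close>

lemma is_functorD:
  assumes "is_functor C D F"
  shows "A \<in> Obj C \<Longrightarrow> fobj F A \<in> Obj D"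
    "f \<in> hom C A B \<Longrightarrow> farr F f \<in> hom D (fobj F A) (fobj F B)"
    "A \<in> Obj C \<Longrightarrow> farr F (Idt C A) = Idt D (fobj F A)"
    "f \<in> hom C A B \<Longrightarrow> g \<in> hom C B E \<Longrightarrow> farr F (Cmp C g f) = Cmp D (farr F g) (farr F f)"
    "fobj F \<in> extensional (Obj C)" "farr F \<in> extensional (Arr C)"
  using assms by (auto simp: is_functor_def hom_def PiE_iff)

lemma is_functorI:
  assumes "category C"
    and "\<And>A. A \<in> Obj C \<Longrightarrow> fobj F A \<in> Obj D"
    and "\<And>f A B. f \<in> hom C A B \<Longrightarrow> farr F f \<in> hom D (fobj F A) (fobj F B)"
    and "\<And>A. A \<in> Obj C \<Longrightarrow> farr F (Idt C A) = Idt D (fobj F A)"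
    and "\<And>f g A B E. f \<in> hom C A B \<Longrightarrow> g \<in> hom C B E \<Longrightarrow> farr F (Cmp C g f) = Cmp D (farr F g) (farr F f)"
    and "fobj F \<in> extensional (Obj C)" "farr F \<in> extensional (Arr C)"
  shows "is_functor C D F"
  unfolding is_functor_def
proof (intro conjI ballI impI)
  fix f assume f: "f \<in> Arr C"
  show "farr F f \<in> hom D (fobj F (Dom C f)) (fobj F (Cod C f))"
    by (rule assms(3)[OF Arr_hom[OF f]])
  fix g assume g: "g \<in> Arr C" "Cod C f = Dom C g"
  show "farr F (Cmp C g f) = Cmp D (farr F g) (farr F f)"
    using assms(5)[OF Arr_hom[OF f], of g "Cod C g"] Arr_hom[OF g(1)] g(2) by simp
qed (use assms in \<open>auto simp: PiE_iff\<close>)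

lemma comp_functor_simps [simp]:
  "A \<in> Obj C \<Longrightarrow> fobj (comp_functor C G F) A = fobj G (fobj F A)"
  "f \<in> Arr C \<Longrightarrow> farr (comp_functor C G F) f = farr G (farr F f)"
  by (simp_all add: comp_functor_def compose_def)

lemma is_functor_comp:
  assumes C: "category C" and F: "is_functor C D F" and G: "is_functor D E G"
  shows "is_functor C E (comp_functor C G F)"
proof (rule is_functorI[OF C])
  note F' = is_functorD[OF F] and G' = is_functorD[OF G]
  fix A assume A: "A \<in> Obj C"
  show "fobj (comp_functor C G F) A \<in> Obj E" using A F' G' by simp
  show "farr (comp_functor C G F) (Idt C A) = Idt E (fobj (comp_functor C G F) A)"
    using A F' G' homD(1)[OF C Idt_in_hom[OF C A]] by simp
next
  note F' = is_functorD[OF F] and G' = is_functorD[OF G]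
  fix f A B assume f: "f \<in> hom C A B"
  note h = homD[OF C f]
  show "farr (comp_functor C G F) f \<in> hom E (fobj (comp_functor C G F) A) (fobj (comp_functor C G F) B)"
    using h F' G' f by simp
  fix g X assume g: "g \<in> hom C B X"
  show "farr (comp_functor C G F) (Cmp C g f) =
      Cmp E (farr (comp_functor C G F) g) (farr (comp_functor C G F) f)"
    using h homD[OF C g] homD(1)[OF C Cmp_in_hom[OF C f g]] F'(4)[OF f g] G'(4)[OF F'(2)[OF f] F'(2)[OF g]]
    by simp
qed (simp_all add: comp_functor_def)

section \<open>Coherent functors described by elements\<close>

locale coherent_models =
  fixes \<kappa> :: "'k rel" and D :: "('o, 'a) cat"
  assumes \<kappa>: "Cinfinite \<kappa>" and coh: "coherent_category D"
begin

abbreviation "H \<equiv> hered_small \<kappa>"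
abbreviation "Mod \<equiv> models \<kappa> D"
abbreviation "Iso \<equiv> model_isos \<kappa> D"
abbreviation "X \<equiv> model_topology \<kappa> D"
abbreviation "GG \<equiv> model_iso_topology \<kappa> D"
abbreviation "Grpd \<equiv> model_groupoid \<kappa> D"
abbreviation "FC \<equiv> functor_cat D (Sets \<kappa>)"
abbreviation DCmp (infixl "\<cdot>" 70) where "g \<cdot> f \<equiv> Cmp D g f"

lemma cat: "category D" using coh by (simp add: coherent_category_def)

lemma Mod_functor: "M \<in> Mod \<Longrightarrow> is_functor D (Sets \<kappa>) M"
  by (simp add: models_def coherent_functor_def)

lemma fobj_H: "M \<in> Mod \<Longrightarrow> A \<in> Obj D \<Longrightarrow> x \<in> fobj M A \<Longrightarrow> x \<in> H"
  using is_functor_into_Sets(2)[OF Mod_functor] by blast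

lemma ev_in:
  assumes "is_functor D (Sets \<kappa>) M" "f \<in> hom D A B" "x \<in> fobj M A"
  shows "ev M f x \<in> fobj M B"
  using is_functorD(2)[OF assms(1,2)] assms(3) unfolding Sets_def by (rule hom_set_catD)

lemma ev_Cmp:
  assumes "is_functor D (Sets \<kappa>) M" "f \<in> hom D A B" "g \<in> hom D B C" "x \<in> fobj M A"
  shows "ev M (g \<cdot> f) x = ev M g (ev M f x)"
  unfolding is_functorD(4)[OF assms(1-3)] Sets_def
  by (rule app_Cmp_set_cat[OF is_functorD(2)[OF assms(1,2), unfolded Sets_def] assms(4)])

lemma ev_Idt:
  assumes "is_functor D (Sets \<kappa>) M" "A \<in> Obj D" "x \<in> fobj M A"
  shows "ev M (Idt D A) x = x"
  unfolding is_functorD(3)[OF assms(1,2)] using assms(3) by (simp add: Sets_def Idt_set_cat)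

lemmas Mev_in = ev_in[OF Mod_functor]
lemmas Mev_Cmp = ev_Cmp[OF Mod_functor]
lemmas Mev_Idt = ev_Idt[OF Mod_functor]

text \<open>Compatible families of elements have unique amalgamations. Here and in the next two
  definitions preservation is phrased with elements, so that it passes along bijections.\<close>

definition preserves_limits where
  "preserves_limits M \<longleftrightarrow> (\<forall>J K L \<pi> x. finite_diagram J D K \<and> limit_cone D J K L \<pi> \<and>
    (\<forall>i\<in>Obj J. x i \<in> fobj M (fobj K i)) \<and>
    (\<forall>u\<in>Arr J. ev M (farr K u) (x (Dom J u)) = x (Cod J u)) \<longrightarrow>
    (\<exists>!z. z \<in> fobj M L \<and> (\<forall>i\<in>Obj J. ev M (\<pi> i) z = x i)))"

definition preserves_images where
  "preserves_images M \<longleftrightarrow> (\<forall>f m. is_image D f m \<longrightarrow>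
    inj_on (ev M m) (fobj M (Dom D m)) \<and> ev M m ` fobj M (Dom D m) = ev M f ` fobj M (Dom D f))"

definition preserves_unions where
  "preserves_unions M \<longleftrightarrow> (\<forall>A S u. finite S \<and> is_union D A S u \<longrightarrow>
    (\<forall>m\<in>S. inj_on (ev M m) (fobj M (Dom D m))) \<and> inj_on (ev M u) (fobj M (Dom D u)) \<and>
    ev M u ` fobj M (Dom D u) = (\<Union>m\<in>S. ev M m ` fobj M (Dom D m)))"

lemma subobj_hom: "subobj D A m \<Longrightarrow> m \<in> hom D (Dom D m) A"
  by (simp add: subobj_def mono_arr_def hom_def)

text \<open>The descriptions of limits, images and unions of sets turn the conditions on a coherent
  functor into conditions on elements. Both the use of a model and the proof that a renamed model is
  one go through this form.\<close>

lemma models_iff: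
  "M \<in> Mod \<longleftrightarrow> is_functor D (Sets \<kappa>) M \<and> preserves_limits M \<and> preserves_images M \<and> preserves_unions M"
proof (cases "is_functor D (Sets \<kappa>) M")
  case True
  note F = is_functorD[OF True]
  have lim: "limit_cone (Sets \<kappa>) J (comp_functor J M K) (fobj M L) (\<lambda>i. farr M (\<pi> i)) \<longleftrightarrow>
      (\<forall>x. (\<forall>i\<in>Obj J. x i \<in> fobj M (fobj K i)) \<and>
        (\<forall>u\<in>Arr J. ev M (farr K u) (x (Dom J u)) = x (Cod J u)) \<longrightarrow>
        (\<exists>!z. z \<in> fobj M L \<and> (\<forall>i\<in>Obj J. ev M (\<pi> i) z = x i)))"
    if fd: "finite_diagram J D K" and lc: "limit_cone D J K L \<pi>"
    for J :: "(nat, nat) cat" and K L \<pi>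
  proof -
    have J: "category J" and K: "is_functor J D K" using fd by (auto simp: finite_diagram_def)
    have c: "cone D J K L \<pi>" using lc by (simp add: limit_cone_def)
    then have L: "L \<in> Obj D" and \<pi>: "\<And>i. i \<in> Obj J \<Longrightarrow> \<pi> i \<in> hom D L (fobj K i)"
      by (auto simp: cone_def)
    have Jo: "Dom J u \<in> Obj J" "Cod J u \<in> Obj J" if "u \<in> Arr J" for u
      using J that by (auto simp: category_def)
    have cone: "ev M (farr K u) (ev M (\<pi> (Dom J u)) z) = ev M (\<pi> (Cod J u)) z"
      if "u \<in> Arr J" "z \<in> fobj M L" for u z
      using c ev_Cmp[OF True \<pi>[OF Jo(1)[OF that(1)]] is_functorD(2)[OF K Arr_hom[OF that(1)]] that(2)]
        that(1) by (simp add: cone_def)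
    show ?thesis
      by (subst limit_cone_Sets_iff[OF \<kappa> J is_functor_comp[OF J K True]])
        (use F L \<pi> cone Jo in auto)
  qed
  have im: "is_image (Sets \<kappa>) (farr M f) (farr M m) \<longleftrightarrow>
      inj_on (ev M m) (fobj M (Dom D m)) \<and> ev M m ` fobj M (Dom D m) = ev M f ` fobj M (Dom D f)"
    if "is_image D f m" for f m
  proof (rule is_image_Sets_iff[OF \<kappa> F(2) F(2)])
    show "f \<in> hom D (Dom D f) (Cod D f)" "m \<in> hom D (Dom D m) (Cod D f)"
      using that by (auto simp: is_image_def hom_def subobj_def mono_arr_def)
  qed
  have un: "is_union (Sets \<kappa>) (fobj M A) (farr M ` S) (farr M u) \<longleftrightarrow>
      (\<forall>m\<in>S. inj_on (ev M m) (fobj M (Dom D m))) \<and> inj_on (ev M u) (fobj M (Dom D u)) \<and>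
      ev M u ` fobj M (Dom D u) = (\<Union>m\<in>S. ev M m ` fobj M (Dom D m))"
    if "is_union D A S u" for A S u
  proof -
    have u: "u \<in> hom D (Dom D u) A" and S: "\<And>m. m \<in> S \<Longrightarrow> m \<in> hom D (Dom D m) A"
      using that subobj_hom by (auto simp: is_union_def)
    have s: "src (farr M m) = fobj M (Dom D m)" if "m \<in> S" for m
      using F(2)[OF S[OF that]] by (simp add: Sets_def hom_set_cat_iff)
    show ?thesis
      by (subst is_union_Sets_iff[OF \<kappa> F(2)[OF u]]) (use F(2)[OF S] s in auto)
  qed
  have A: "A \<in> Obj D" if "is_union D A S u" for A S u
    using that homD(5)[OF cat subobj_hom] by (auto simp: is_union_def)
  have "preserves_limits M \<longleftrightarrow> (\<forall>(J :: (nat, nat) cat) K L \<pi>. finite_diagram J D K \<and> limit_cone D J K L \<pi> \<longrightarrow>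
      limit_cone (Sets \<kappa>) J (comp_functor J M K) (fobj M L) (\<lambda>i. farr M (\<pi> i)))"
    (is "_ \<longleftrightarrow> ?lim")
  proof
    assume p: "preserves_limits M"
    show ?lim
    proof (intro allI impI, elim conjE)
      fix J :: "(nat, nat) cat" and K L \<pi> assume d: "finite_diagram J D K" "limit_cone D J K L \<pi>"
      show "limit_cone (Sets \<kappa>) J (comp_functor J M K) (fobj M L) (\<lambda>i. farr M (\<pi> i))"
        unfolding lim[OF d] using p d unfolding preserves_limits_def by blast
    qed
  next
    assume ?lim
    then show "preserves_limits M"
      unfolding preserves_limits_def using lim by blast
  qed
  moreover have "preserves_images M \<longleftrightarrow> (\<forall>f m. is_image D f m \<longrightarrow> is_image (Sets \<kappa>) (farr M f) (farr M m))"
    unfolding preserves_images_def by (simp add: im cong: imp_cong)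
  moreover have "preserves_unions M \<longleftrightarrow> (\<forall>A\<in>Obj D. \<forall>S u. finite S \<and> is_union D A S u \<longrightarrow>
      is_union (Sets \<kappa>) (fobj M A) (farr M ` S) (farr M u))"
    (is "_ \<longleftrightarrow> ?un")
  proof
    assume p: "preserves_unions M"
    show ?un
    proof (intro allI ballI impI, elim conjE)
      fix A S u assume d: "finite S" "is_union D A S u"
      show "is_union (Sets \<kappa>) (fobj M A) (farr M ` S) (farr M u)"
        unfolding un[OF d(2)] using p[unfolded preserves_unions_def, rule_format, OF conjI[OF d]] .
    qed
  next
    assume q: ?un
    show "preserves_unions M"
      unfolding preserves_unions_def
    proof (intro allI impI)
      fix A S u assume d: "finite S \<and> is_union D A S u"
      show "(\<forall>m\<in>S. inj_on (ev M m) (fobj M (Dom D m))) \<and> inj_on (ev M u) (fobj M (Dom D u)) \<and>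
          ev M u ` fobj M (Dom D u) = (\<Union>m\<in>S. ev M m ` fobj M (Dom D m))"
        using q[rule_format, OF A[OF conjunct2[OF d]] d] unfolding un[OF conjunct2[OF d]] .
    qed
  qed
  ultimately show ?thesis
    unfolding models_def coherent_functor_def using True by simp
qed (simp add: models_def coherent_functor_def)

lemma model_image:
  "M \<in> Mod \<Longrightarrow> is_image D f m \<Longrightarrow> ev M m ` fobj M (Dom D m) = ev M f ` fobj M (Dom D f)"
  by (simp add: models_iff preserves_images_def)

lemma model_union:
  "M \<in> Mod \<Longrightarrow> finite S \<Longrightarrow> is_union D A S u \<Longrightarrow>
    ev M u ` fobj M (Dom D u) = (\<Union>m\<in>S. ev M m ` fobj M (Dom D m))"
  unfolding models_iff preserves_unions_def by blast

lemma model_limit: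
  "M \<in> Mod \<Longrightarrow> finite_diagram J D K \<Longrightarrow> limit_cone D J K L \<pi> \<Longrightarrow>
    (\<And>i. i \<in> Obj J \<Longrightarrow> x i \<in> fobj M (fobj K i)) \<Longrightarrow>
    (\<And>u. u \<in> Arr J \<Longrightarrow> ev M (farr K u) (x (Dom J u)) = x (Cod J u)) \<Longrightarrow>
    \<exists>!z. z \<in> fobj M L \<and> (\<forall>i\<in>Obj J. ev M (\<pi> i) z = x i)"
  unfolding models_iff preserves_limits_def by blast

section \<open>Finite limits in D and their points\<close>

lemma ex_terminal:
  "\<exists>T\<in>Obj D. (\<forall>N\<in>Obj D. \<exists>!h. h \<in> hom D N T) \<and> (\<forall>M\<in>Mod. \<exists>!z. z \<in> fobj M T)"
proof -
  define J :: "(nat, nat) cat"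
    where "J = \<lparr>Obj = {}, Arr = {}, Dom = id, Cod = id, Idt = id, Cmp = (\<lambda>_. id)\<rparr>"
  define K :: "(nat, nat, 'o, 'a) functr" where "K = \<lparr>fobj = (\<lambda>_. undefined), farr = (\<lambda>_. undefined)\<rparr>"
  have fd: "finite_diagram J D K"
    by (auto simp: finite_diagram_def J_def K_def category_def is_functor_def)
  moreover have "has_finite_limits D" using coh by (simp add: coherent_category_def)
  ultimately obtain L \<pi> where lim: "limit_cone D J K L \<pi>"
    unfolding has_finite_limits_def by blast
  have c: "cone D J K N undefined" if "N \<in> Obj D" for N
    using that by (simp add: cone_def J_def)
  have "\<exists>!h. h \<in> hom D N L" if "N \<in> Obj D" for N
    using lim c[OF that] by (auto simp: limit_cone_def J_def)
  moreover have "\<exists>!z. z \<in> fobj M L" if "M \<in> Mod" for M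
    using model_limit[OF that fd lim, of undefined] by (auto simp: J_def)
  moreover have "L \<in> Obj D" using lim by (simp add: limit_cone_def cone_def)
  ultimately show ?thesis by blast
qed

text \<open>The universal property in D and its form in models are asserted of the same cone, so
  they are proved together. A cone over a cospan also has a leg at the corner; it is the common
  composite of the other two, which is why two legs remain in the conclusion.\<close>

lemma ex_pullback:
  assumes f: "f \<in> hom D A C" and g: "g \<in> hom D B C"
  obtains P p q where "p \<in> hom D P A" "q \<in> hom D P B" "f \<cdot> p = g \<cdot> q"
    "\<And>N u v. u \<in> hom D N A \<Longrightarrow> v \<in> hom D N B \<Longrightarrow> f \<cdot> u = g \<cdot> v \<Longrightarrow>
      \<exists>!h. h \<in> hom D N P \<and> p \<cdot> h = u \<and> q \<cdot> h = v"
    "\<And>M x y. M \<in> Mod \<Longrightarrow> x \<in> fobj M A \<Longrightarrow> y \<in> fobj M B \<Longrightarrow> ev M f x = ev M g y \<Longrightarrow>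
      \<exists>!z. z \<in> fobj M P \<and> ev M p z = x \<and> ev M q z = y"
proof -
  note fh = homD[OF cat f] and gh = homD[OF cat g]
  \<comment> \<open>The cospan as a category: objects 0, 1, 2, an arrow 3 from 0 to 2 and an arrow 4
    from 1 to 2, while 0, 1, 2 also name the identities. One factor of any composite is an identity,
    so \<open>Cmp\<close> returns the other one.\<close>
  define J :: "(nat, nat) cat"
    where "J = \<lparr>Obj = {0,1,2}, Arr = {0,1,2,3,4}, Dom = (\<lambda>a. if a = 3 then 0 else if a = 4 then 1 else a),
      Cod = (\<lambda>a. if 3 \<le> a then 2 else a), Idt = id, Cmp = (\<lambda>b a. if b < 3 then a else b)\<rparr>"
  define Ko where "Ko = (\<lambda>i\<in>{0,1,2::nat}. if i = 0 then A else if i = 1 then B else C)"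
  define Ka where "Ka = (\<lambda>a\<in>{0,1,2,3,4::nat}. if a = 3 then f else if a = 4 then g else Idt D (Ko a))"
  define K where "K = \<lparr>fobj = Ko, farr = Ka\<rparr>"
  have Ko: "Ko 0 = A" "Ko (Suc 0) = B" "Ko 2 = C" by (simp_all add: Ko_def)
  have Ka: "Ka 0 = Idt D A" "Ka (Suc 0) = Idt D B" "Ka 2 = Idt D C" "Ka 3 = f" "Ka 4 = g"
    by (simp_all add: Ka_def Ko)
  have id: "Idt D A \<in> hom D A A" "Idt D B \<in> hom D B B" "Idt D C \<in> hom D C C"
    using fh gh Idt_in_hom[OF cat] by auto
  have fd: "finite_diagram J D K"
    unfolding finite_diagram_def
  proof (intro conjI)
    show J: "category J"
      by (auto simp: category_def J_def hom_def)
    have "Ko \<in> {0,1,2} \<rightarrow>\<^sub>E Obj D" "Ka \<in> extensional {0,1,2,3,4}"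
      using fh gh by (auto simp: Ko_def Ka_def)
    then show "is_functor J D K"
      unfolding is_functor_def J_def K_def
      using id f g fh gh Cmp_Idt[OF cat f] Cmp_Idt[OF cat g] Cmp_Idt(1)[OF cat id(1)]
        Cmp_Idt(1)[OF cat id(2)] Cmp_Idt(1)[OF cat id(3)]
      by (auto simp: Ka Ko)
  qed (auto simp: J_def)
  moreover have "has_finite_limits D" using coh by (simp add: coherent_category_def)
  ultimately obtain L \<pi> where lim: "limit_cone D J K L \<pi>"
    unfolding has_finite_limits_def by blast
  have c: "cone D J K N \<rho> \<longleftrightarrow> \<rho> 0 \<in> hom D N A \<and> \<rho> 1 \<in> hom D N B \<and> \<rho> 2 = f \<cdot> \<rho> 0 \<and> f \<cdot> \<rho> 0 = g \<cdot> \<rho> 1" for N \<rho>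
  proof
    assume "cone D J K N \<rho>"
    then show "\<rho> 0 \<in> hom D N A \<and> \<rho> 1 \<in> hom D N B \<and> \<rho> 2 = f \<cdot> \<rho> 0 \<and> f \<cdot> \<rho> 0 = g \<cdot> \<rho> 1"
      by (auto simp: cone_def J_def K_def Ko Ka)
  next
    assume r: "\<rho> 0 \<in> hom D N A \<and> \<rho> 1 \<in> hom D N B \<and> \<rho> 2 = f \<cdot> \<rho> 0 \<and> f \<cdot> \<rho> 0 = g \<cdot> \<rho> 1"
    have "N \<in> Obj D" using homD[OF cat conjunct1[OF r]] by simp
    moreover have "f \<cdot> \<rho> 0 \<in> hom D N C" "g \<cdot> \<rho> 1 \<in> hom D N C"
      using Cmp_in_hom[OF cat _ f] Cmp_in_hom[OF cat _ g] r by simp_all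
    ultimately show "cone D J K N \<rho>"
      using r Cmp_Idt(2)[OF cat] by (auto simp: cone_def J_def K_def Ko Ka)
  qed
  have cL: "\<pi> 0 \<in> hom D L A" "\<pi> 1 \<in> hom D L B" "\<pi> 2 = f \<cdot> \<pi> 0" "f \<cdot> \<pi> 0 = g \<cdot> \<pi> 1"
    using lim by (auto simp: limit_cone_def c)
  show ?thesis
  proof (rule that[OF cL(1,2,4)])
    fix N u v assume u: "u \<in> hom D N A" and v: "v \<in> hom D N B" and e: "f \<cdot> u = g \<cdot> v"
    let ?\<rho> = "\<lambda>i::nat. if i = 0 then u else if i = 1 then v else f \<cdot> u"
    have "cone D J K N ?\<rho>" unfolding c using u v e by simp
    then have "\<exists>!h. h \<in> hom D N L \<and> (\<forall>i\<in>Obj J. \<pi> i \<cdot> h = ?\<rho> i)"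
      using lim unfolding limit_cone_def by blast
    moreover have "(\<forall>i\<in>Obj J. \<pi> i \<cdot> h = ?\<rho> i) \<longleftrightarrow> \<pi> 0 \<cdot> h = u \<and> \<pi> 1 \<cdot> h = v" if "h \<in> hom D N L" for h
      using Cmp_assoc[OF cat that cL(1) f] cL(3) by (auto simp: J_def)
    ultimately show "\<exists>!h. h \<in> hom D N L \<and> \<pi> 0 \<cdot> h = u \<and> \<pi> 1 \<cdot> h = v"
      by (simp cong: conj_cong)
  next
    fix M x y assume M: "M \<in> Mod" and x: "x \<in> fobj M A" and y: "y \<in> fobj M B" and e: "ev M f x = ev M g y"
    let ?x = "\<lambda>i::nat. if i = 0 then x else if i = 1 then y else ev M f x"
    have "\<exists>!z. z \<in> fobj M L \<and> (\<forall>i\<in>Obj J. ev M (\<pi> i) z = ?x i)"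
    proof (rule model_limit[OF M fd lim])
      fix i assume "i \<in> Obj J"
      then show "?x i \<in> fobj M (fobj K i)"
        using x y Mev_in[OF M f x] by (auto simp: J_def K_def Ko)
    next
      fix u assume "u \<in> Arr J"
      then show "ev M (farr K u) (?x (Dom J u)) = ?x (Cod J u)"
        using x y e Mev_in[OF M f x] fh gh Mev_Idt[OF M] by (auto simp: J_def K_def Ka)
    qed
    moreover have "(\<forall>i\<in>Obj J. ev M (\<pi> i) z = ?x i) \<longleftrightarrow> ev M (\<pi> 0) z = x \<and> ev M (\<pi> 1) z = y"
      if "z \<in> fobj M L" for z
      using Mev_Cmp[OF M cL(1) f that] cL(3) by (auto simp: J_def)
    ultimately show "\<exists>!z. z \<in> fobj M L \<and> ev M (\<pi> 0) z = x \<and> ev M (\<pi> 1) z = y"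
      by (simp cong: conj_cong)
  qed
qed

text \<open>The category of elements of a model is cofiltered; this and the point lemmas for
  products and equalizers are the form in which that is used.\<close>

lemma ex_pullback_point:
  assumes "f \<in> hom D A C" "g \<in> hom D B C" "M \<in> Mod" "x \<in> fobj M A" "y \<in> fobj M B" "ev M f x = ev M g y"
  obtains P p q z where "p \<in> hom D P A" "q \<in> hom D P B" "f \<cdot> p = g \<cdot> q" "z \<in> fobj M P"
    "ev M p z = x" "ev M q z = y"
proof -
  obtain P p q where P: "p \<in> hom D P A" "q \<in> hom D P B" "f \<cdot> p = g \<cdot> q"
    "\<And>M x y. M \<in> Mod \<Longrightarrow> x \<in> fobj M A \<Longrightarrow> y \<in> fobj M B \<Longrightarrow> ev M f x = ev M g y \<Longrightarrow>
      \<exists>!z. z \<in> fobj M P \<and> ev M p z = x \<and> ev M q z = y"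
    by (rule ex_pullback[OF assms(1,2)]) (rule that, assumption+)
  show ?thesis using that[OF P(1-3)] P(4)[OF assms(3-6)] by blast
qed

text \<open>A product is a pullback over the terminal object, in D and in each model, where the
  terminal object has exactly one element.\<close>

lemma ex_product:
  assumes A: "A \<in> Obj D" and B: "B \<in> Obj D"
  obtains P p q where "is_product D A B P p q" "p \<in> hom D P A" "q \<in> hom D P B"
    "\<And>M x y. M \<in> Mod \<Longrightarrow> x \<in> fobj M A \<Longrightarrow> y \<in> fobj M B \<Longrightarrow>
      \<exists>!z. z \<in> fobj M P \<and> ev M p z = x \<and> ev M q z = y"
proof -
  obtain T where "T \<in> Obj D" and T': "\<forall>N\<in>Obj D. \<exists>!h. h \<in> hom D N T" "\<forall>M\<in>Mod. \<exists>!z. z \<in> fobj M T"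
    using ex_terminal by (elim bexE conjE) (rule that)
  note T = T'[rule_format]
  obtain a b where a: "a \<in> hom D A T" and b: "b \<in> hom D B T"
    using T(1)[OF A] T(1)[OF B] by blast
  obtain P p q where P: "p \<in> hom D P A" "q \<in> hom D P B"
    "\<And>N u v. u \<in> hom D N A \<Longrightarrow> v \<in> hom D N B \<Longrightarrow> a \<cdot> u = b \<cdot> v \<Longrightarrow>
      \<exists>!h. h \<in> hom D N P \<and> p \<cdot> h = u \<and> q \<cdot> h = v"
    "\<And>M x y. M \<in> Mod \<Longrightarrow> x \<in> fobj M A \<Longrightarrow> y \<in> fobj M B \<Longrightarrow> ev M a x = ev M b y \<Longrightarrow>
      \<exists>!z. z \<in> fobj M P \<and> ev M p z = x \<and> ev M q z = y"
    by (rule ex_pullback[OF a b]) (rule that, assumption+)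
  have "a \<cdot> u = b \<cdot> v" if "N \<in> Obj D" "u \<in> hom D N A" "v \<in> hom D N B" for N u v
    using T(1)[OF that(1)] Cmp_in_hom[OF cat that(2) a] Cmp_in_hom[OF cat that(3) b] by blast
  then have "is_product D A B P p q"
    unfolding is_product_def using P(1-3) by simp
  moreover have "ev M a x = ev M b y" if "M \<in> Mod" "x \<in> fobj M A" "y \<in> fobj M B" for M x y
    using T(2)[OF that(1)] Mev_in[OF that(1) a that(2)] Mev_in[OF that(1) b that(3)] by blast
  ultimately show ?thesis using that P by simp
qed

lemma ex_product_point:
  assumes "A \<in> Obj D" "B \<in> Obj D" "M \<in> Mod" "x \<in> fobj M A" "y \<in> fobj M B"
  obtains P p q z where "p \<in> hom D P A" "q \<in> hom D P B" "z \<in> fobj M P" "ev M p z = x" "ev M q z = y"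
proof -
  obtain P p q where P: "p \<in> hom D P A" "q \<in> hom D P B"
    "\<And>M x y. M \<in> Mod \<Longrightarrow> x \<in> fobj M A \<Longrightarrow> y \<in> fobj M B \<Longrightarrow>
      \<exists>!z. z \<in> fobj M P \<and> ev M p z = x \<and> ev M q z = y"
    by (rule ex_product[OF assms(1,2)]) (rule that, assumption+)
  show ?thesis using that[OF P(1,2)] P(3)[OF assms(3-5)] by blast
qed

text \<open>The equalizer is the pullback of the two graphs \<open>f'\<close> and \<open>g'\<close>
  into the product \<open>P\<close>. The first projection makes the two legs of this pullback equal,
  and the second one then gives the equation.\<close>

lemma ex_equalizer_point:
  assumes f: "f \<in> hom D A B" and g: "g \<in> hom D A B" and M: "M \<in> Mod" and x: "x \<in> fobj M A"
    and e: "ev M f x = ev M g x"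
  obtains E k z where "k \<in> hom D E A" "f \<cdot> k = g \<cdot> k" "z \<in> fobj M E" "ev M k z = x"
proof -
  note fh = homD[OF cat f]
  obtain P p q where pr: "is_product D A B P p q" and p: "p \<in> hom D P A" and q: "q \<in> hom D P B"
    and prM: "\<And>M x y. M \<in> Mod \<Longrightarrow> x \<in> fobj M A \<Longrightarrow> y \<in> fobj M B \<Longrightarrow>
      \<exists>!z. z \<in> fobj M P \<and> ev M p z = x \<and> ev M q z = y"
    by (rule ex_product[OF fh(4,5)]) (rule that, assumption+)
  have pair: "\<exists>h\<in>hom D A P. p \<cdot> h = u \<and> q \<cdot> h = v" if "u \<in> hom D A A" "v \<in> hom D A B" for u v
    using pr fh(4) that unfolding is_product_def by blast
  note idA = Idt_in_hom[OF cat fh(4)]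
  obtain f' where f': "f' \<in> hom D A P" "p \<cdot> f' = Idt D A" "q \<cdot> f' = f"
    using pair[OF idA f] by blast
  obtain g' where g': "g' \<in> hom D A P" "p \<cdot> g' = Idt D A" "q \<cdot> g' = g"
    using pair[OF idA g] by blast
  have "ev M p (ev M f' x) = x" "ev M q (ev M f' x) = ev M f x"
    "ev M p (ev M g' x) = x" "ev M q (ev M g' x) = ev M f x"
    using Mev_Cmp[OF M f'(1) p x] Mev_Cmp[OF M f'(1) q x] Mev_Cmp[OF M g'(1) p x] Mev_Cmp[OF M g'(1) q x]
      e f' g' Mev_Idt[OF M fh(4) x] by simp_all
  then have "ev M f' x = ev M g' x"
    using prM[OF M x Mev_in[OF M f x]] Mev_in[OF M f'(1) x] Mev_in[OF M g'(1) x] by blast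
  then obtain E u v z where E: "u \<in> hom D E A" "v \<in> hom D E A" "f' \<cdot> u = g' \<cdot> v" "z \<in> fobj M E"
    "ev M u z = x" "ev M v z = x"
    by (rule ex_pullback_point[OF f'(1) g'(1) M x x]) (rule that, assumption+)
  have "u = v"
    using Cmp_assoc[OF cat E(1) f'(1) p] Cmp_assoc[OF cat E(2) g'(1) p] E(3) f'(2) g'(2)
      Cmp_Idt(2)[OF cat E(1)] Cmp_Idt(2)[OF cat E(2)] by simp
  moreover have "f \<cdot> u = g \<cdot> v"
    using Cmp_assoc[OF cat E(1) f'(1) q] Cmp_assoc[OF cat E(2) g'(1) q] E(3) f'(3) g'(3) by simp
  ultimately show ?thesis using that[OF E(1) _ E(4,5)] by simp
qed

text \<open>A model preserves images and finite unions, so a covering family is jointly surjective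
  on elements. The converse is what saturation provides.\<close>

lemma coverage_points:
  assumes T: "T \<in> coherent_coverage D A" and M: "M \<in> Mod" and x: "x \<in> fobj M A"
  obtains f z where "f \<in> T" "f \<in> hom D (Dom D f) A" "z \<in> fobj M (Dom D f)" "ev M f z = x"
proof -
  obtain im where im: "\<And>f. f \<in> T \<Longrightarrow> is_image D f (im f)" and un: "is_union D A (im ` T) (Idt D A)"
    using T by (auto simp: coherent_coverage_def images_join_to_top_def)
  have A: "A \<in> Obj D" using un homD(5)[OF cat subobj_hom] by (auto simp: is_union_def)
  have "finite (im ` T)" using T by (simp add: coherent_coverage_def)
  note u = model_union[OF M this un]
  have "x \<in> ev M (Idt D A) ` fobj M (Dom D (Idt D A))"
    using Mev_Idt[OF M A x] x homD(2)[OF cat Idt_in_hom[OF cat A]] by (metis image_eqI)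
  then obtain f where f: "f \<in> T" "x \<in> ev M (im f) ` fobj M (Dom D (im f))" unfolding u by blast
  then obtain z where "z \<in> fobj M (Dom D f)" "ev M f z = x"
    unfolding model_image[OF M im[OF f(1)]] by blast
  moreover have "f \<in> hom D (Dom D f) A" using f(1) T by (auto simp: coherent_coverage_def hom_def)
  ultimately show ?thesis using that f(1) by blast
qed

end

lemma hom_Sets_in: "f \<in> hom (Sets \<kappa>) S T \<Longrightarrow> x \<in> S \<Longrightarrow> app f x \<in> T"
  unfolding Sets_def by (rule hom_set_catD)

lemma app_Cmp_Sets: "f \<in> hom (Sets \<kappa>) S T \<Longrightarrow> x \<in> S \<Longrightarrow> app (Cmp (Sets \<kappa>) g f) x = app g (app f x)"
  unfolding Sets_def by (rule app_Cmp_set_cat)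

lemma Sets_arrow_eqI:
  "f \<in> hom (Sets \<kappa>) S T \<Longrightarrow> g \<in> hom (Sets \<kappa>) S T \<Longrightarrow> (\<And>x. x \<in> S \<Longrightarrow> app f x = app g x) \<Longrightarrow> f = g"
  unfolding Sets_def by (rule arrow_eqI)

lemma Cmp_in_hom_Sets:
  "f \<in> hom (Sets \<kappa>) S T \<Longrightarrow> g \<in> hom (Sets \<kappa>) T U \<Longrightarrow> Cmp (Sets \<kappa>) g f \<in> hom (Sets \<kappa>) S U"
  unfolding Sets_def by (rule Cmp_in_hom_set_cat)

lemma Arrow_in_hom_Sets:
  "S \<in> Obj (Sets \<kappa>) \<Longrightarrow> T \<in> Obj (Sets \<kappa>) \<Longrightarrow> (\<And>x. x \<in> S \<Longrightarrow> h x \<in> T) \<Longrightarrow>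
    Arrow S (restrict h S) T \<in> hom (Sets \<kappa>) S T"
  unfolding Sets_def by (rule Arrow_in_hom_set_cat) auto

lemma functor_cat_simps [simp]:
  "Obj (functor_cat C E) = {F. is_functor C E F}" "Dom (functor_cat C E) = src"
  "Cod (functor_cat C E) = trg"
  "Arr (functor_cat C E) = {\<alpha>. nat_trans C E (src \<alpha>) (app \<alpha>) (trg \<alpha>)}"
  by (simp_all add: functor_cat_def)

lemma app_Cmp_functor_cat:
  "A \<in> Obj C \<Longrightarrow> app (Cmp (functor_cat C E) g f) A = Cmp E (app g A) (app f A)"
  by (simp add: functor_cat_def)

lemma app_Idt_functor_cat:
  "A \<in> Obj C \<Longrightarrow> app (Idt (functor_cat C E) F) A = Idt E (fobj F A)"
  by (simp add: functor_cat_def)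

lemma functor_cat_arrow_eqI:
  assumes "nat_trans C E (src f) (app f) (trg f)" "nat_trans C E (src g) (app g) (trg g)"
    "src f = src g" "trg f = trg g" "\<And>A. A \<in> Obj C \<Longrightarrow> app f A = app g A"
  shows "f = g"
proof (rule arrow.expand, intro conjI)
  show "app f = app g"
    by (rule extensionalityI[of _ "Obj C"]) (use assms in \<open>auto simp: nat_trans_def\<close>)
qed (use assms in auto)

text \<open>One value is corrected at a time by a transposition. A permutation is wanted, not just
  an injection on the given values, because it has to act on the labels of all models at
  once.\<close>

lemma finite_partial_injection_extends:
  assumes "finite I" "\<And>i. i \<in> I \<Longrightarrow> a i \<in> S" "\<And>i. i \<in> I \<Longrightarrow> b i \<in> S"
    and "\<And>i j. i \<in> I \<Longrightarrow> j \<in> I \<Longrightarrow> a i = a j \<longleftrightarrow> b i = b j"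
  shows "\<exists>\<sigma>. \<sigma> permutes S \<and> (\<forall>i\<in>I. \<sigma> (a i) = b i)"
  using assms
proof (induction I rule: finite_induct)
  case empty
  then show ?case using permutes_id by blast
next
  case (insert i I)
  then obtain \<sigma> where \<sigma>: "\<sigma> permutes S" "\<forall>j\<in>I. \<sigma> (a j) = b j" by auto
  \<comment> \<open>If \<open>a i\<close> is new, then neither \<open>\<sigma> (a i)\<close> nor
    \<open>b i\<close> is a value already settled. If it is an old \<open>a j\<close>, then
    \<open>\<sigma> (a i)\<close> is \<open>b i\<close> and the transposition is trivial.\<close>
  let ?\<tau> = "Transposition.transpose (\<sigma> (a i)) (b i) \<circ> \<sigma>"
  have "\<sigma> (a i) \<in> S" using \<sigma>(1) insert.prems(1) by (simp add: permutes_in_image)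
  then have "?\<tau> permutes S"
    using insert.prems(2) by (intro permutes_compose[OF \<sigma>(1)] permutes_swap_id) auto
  moreover have "?\<tau> (a j) = b j" if j: "j \<in> I" for j
  proof (cases "a i = a j")
    case True
    then have "b i = b j" using insert.prems(3)[of i j] j by simp
    then show ?thesis using True by simp
  next
    case False
    then have "b i \<noteq> b j" using insert.prems(3)[of i j] j by simp
    moreover have "\<sigma> (a i) \<noteq> \<sigma> (a j)" using False permutes_inj[OF \<sigma>(1)] by (auto dest: injD)
    ultimately show ?thesis using \<sigma>(2) j by (simp add: transpose_def)
  qed
  moreover have "?\<tau> (a i) = b i" by simp
  ultimately have "?\<tau> permutes S \<and> (\<forall>j\<in>insert i I. ?\<tau> (a j) = b j)" by blast
  then show ?case by (rule exI[of _ ?\<tau>])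
qed

context coherent_models
begin

subsection \<open>Isomorphisms of models\<close>

abbreviation gcmp (infixl "\<diamondop>" 70) where "g \<diamondop> f \<equiv> Cmp FC g f"
abbreviation gid where "gid M \<equiv> Idt FC M"
definition ginv where "ginv \<phi> = inverse_of Grpd \<phi>"

lemma Grpd_simps [simp]:
  "ob_top Grpd = X" "ar_top Grpd = GG" "source Grpd = src" "target Grpd = trg"
  "unit_at Grpd = Idt FC" "mult Grpd = Cmp FC"
  by (simp_all add: model_groupoid_def)

lemmas topX = topspace_model_topology[OF \<kappa> coh]
lemmas topG = topspace_model_iso_topology[OF \<kappa> coh]
lemmas tgrpd = topological_groupoid_model_groupoid[OF \<kappa> coh]

lemma Iso_src: "\<phi> \<in> Iso \<Longrightarrow> src \<phi> \<in> Mod" and Iso_trg: "\<phi> \<in> Iso \<Longrightarrow> trg \<phi> \<in> Mod"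
  by (simp_all add: model_isos_def)

lemma grpd_cat: "category (groupoid_cat Grpd)"
  using tgrpd by (simp only: topological_groupoid_def)

lemma Iso_hom: "\<phi> \<in> hom (groupoid_cat Grpd) M N \<longleftrightarrow> \<phi> \<in> Iso \<and> src \<phi> = M \<and> trg \<phi> = N"
  by (simp add: hom_def groupoid_cat_def topG)

lemma gcmp_Iso:
  assumes "f \<in> Iso" "g \<in> Iso" "trg f = src g"
  shows "g \<diamondop> f \<in> Iso" "src (g \<diamondop> f) = src f" "trg (g \<diamondop> f) = trg g"
proof -
  have "Cmp (groupoid_cat Grpd) g f \<in> hom (groupoid_cat Grpd) (src f) (trg g)"
    by (rule Cmp_in_hom[OF grpd_cat, of f "src f" "src g" g "trg g"]) (simp_all add: Iso_hom assms)
  moreover have "Cmp (groupoid_cat Grpd) g f = g \<diamondop> f" by (simp add: groupoid_cat_def)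
  ultimately show "g \<diamondop> f \<in> Iso" "src (g \<diamondop> f) = src f" "trg (g \<diamondop> f) = trg g"
    unfolding Iso_hom by simp_all
qed

lemma gid_Iso:
  assumes "M \<in> Mod"
  shows "gid M \<in> Iso" "src (gid M) = M" "trg (gid M) = M"
proof -
  have "Idt (groupoid_cat Grpd) M \<in> hom (groupoid_cat Grpd) M M"
    by (rule Idt_in_hom[OF grpd_cat]) (simp add: groupoid_cat_def topX assms)
  moreover have "Idt (groupoid_cat Grpd) M = gid M" by (simp add: groupoid_cat_def)
  ultimately show "gid M \<in> Iso" "src (gid M) = M" "trg (gid M) = M"
    unfolding Iso_hom by simp_all
qed

lemma ginv_Iso:
  assumes "\<phi> \<in> Iso"
  shows "ginv \<phi> \<in> Iso" "src (ginv \<phi>) = trg \<phi>" "trg (ginv \<phi>) = src \<phi>"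
    "ginv \<phi> \<diamondop> \<phi> = gid (src \<phi>)" "\<phi> \<diamondop> ginv \<phi> = gid (trg \<phi>)"
proof -
  have "\<forall>f\<in>topspace (ar_top Grpd). inverse_of Grpd f \<in> hom (groupoid_cat Grpd) (target Grpd f) (source Grpd f) \<and>
      mult Grpd (inverse_of Grpd f) f = unit_at Grpd (source Grpd f) \<and>
      mult Grpd f (inverse_of Grpd f) = unit_at Grpd (target Grpd f)"
    using tgrpd unfolding topological_groupoid_def by (elim conjE)
  then have "ginv \<phi> \<in> hom (groupoid_cat Grpd) (trg \<phi>) (src \<phi>) \<and>
      ginv \<phi> \<diamondop> \<phi> = gid (src \<phi>) \<and> \<phi> \<diamondop> ginv \<phi> = gid (trg \<phi>)"
    using assms unfolding ginv_def by (simp add: topG)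
  then show "ginv \<phi> \<in> Iso" "src (ginv \<phi>) = trg \<phi>" "trg (ginv \<phi>) = src \<phi>"
    "ginv \<phi> \<diamondop> \<phi> = gid (src \<phi>)" "\<phi> \<diamondop> ginv \<phi> = gid (trg \<phi>)"
    unfolding Iso_hom by auto
qed

lemma Iso_nat: "\<phi> \<in> Iso \<Longrightarrow> nat_trans D (Sets \<kappa>) (src \<phi>) (app \<phi>) (trg \<phi>)"
  by (simp add: model_isos_def isos_def)

lemma Iso_comp_hom: "\<phi> \<in> Iso \<Longrightarrow> A \<in> Obj D \<Longrightarrow> app \<phi> A \<in> hom (Sets \<kappa>) (fobj (src \<phi>) A) (fobj (trg \<phi>) A)"
  using Iso_nat by (simp add: nat_trans_def)

lemma cmpt_in: "\<phi> \<in> Iso \<Longrightarrow> A \<in> Obj D \<Longrightarrow> x \<in> fobj (src \<phi>) A \<Longrightarrow> cmpt \<phi> A x \<in> fobj (trg \<phi>) A"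
  using hom_Sets_in[OF Iso_comp_hom] .

lemma cmpt_gcmp:
  assumes "f \<in> Iso" "A \<in> Obj D" "x \<in> fobj (src f) A"
  shows "cmpt (g \<diamondop> f) A x = cmpt g A (cmpt f A x)"
  using app_Cmp_Sets[OF Iso_comp_hom[OF assms(1,2)] assms(3)] assms(2) by (simp add: app_Cmp_functor_cat)

lemma cmpt_gid: "A \<in> Obj D \<Longrightarrow> x \<in> fobj M A \<Longrightarrow> cmpt (gid M) A x = x"
  by (simp add: app_Idt_functor_cat Sets_def Idt_set_cat)

lemma cmpt_ginv:
  assumes "\<phi> \<in> Iso" "A \<in> Obj D"
  shows "x \<in> fobj (src \<phi>) A \<Longrightarrow> cmpt (ginv \<phi>) A (cmpt \<phi> A x) = x"
    "y \<in> fobj (trg \<phi>) A \<Longrightarrow> cmpt \<phi> A (cmpt (ginv \<phi>) A y) = y"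
  using cmpt_gcmp[OF assms, of x "ginv \<phi>"] cmpt_gcmp[OF ginv_Iso(1)[OF assms(1)] assms(2), of y \<phi>]
    cmpt_gid[OF assms(2)] ginv_Iso[OF assms(1)] by simp_all

lemma cmpt_natural:
  assumes \<phi>: "\<phi> \<in> Iso" and f: "f \<in> hom D A B" and x: "x \<in> fobj (src \<phi>) A"
  shows "cmpt \<phi> B (ev (src \<phi>) f x) = ev (trg \<phi>) f (cmpt \<phi> A x)"
proof -
  note h = homD[OF cat f]
  have "Cmp (Sets \<kappa>) (farr (trg \<phi>) f) (app \<phi> A) = Cmp (Sets \<kappa>) (app \<phi> B) (farr (src \<phi>) f)"
    using Iso_nat[OF \<phi>] h unfolding nat_trans_def by blast
  moreover have "app (Cmp (Sets \<kappa>) (farr (trg \<phi>) f) (app \<phi> A)) x = ev (trg \<phi>) f (cmpt \<phi> A x)"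
    by (rule app_Cmp_Sets[OF Iso_comp_hom[OF \<phi> h(4)] x])
  moreover have "app (Cmp (Sets \<kappa>) (app \<phi> B) (farr (src \<phi>) f)) x = cmpt \<phi> B (ev (src \<phi>) f x)"
    by (rule app_Cmp_Sets[OF is_functorD(2)[OF Mod_functor[OF Iso_src[OF \<phi>]] f] x])
  ultimately show ?thesis by simp
qed

subsection \<open>Renaming the elements of a model\<close>

text \<open>
  The topologies only see the labels of elements. Transporting a model along permutations of the
  labels gives a continuous self-map of the space of models and a continuous choice of isomorphisms.
\<close>

definition renaming :: "('o \<Rightarrow> 'k hset \<Rightarrow> 'k hset) \<Rightarrow> bool" where
  "renaming \<sigma> \<longleftrightarrow> (\<forall>A. \<sigma> A permutes H)"

definition ren :: "('o \<Rightarrow> 'k hset \<Rightarrow> 'k hset) \<Rightarrow> ('k, 'o, 'a) model \<Rightarrow> ('k, 'o, 'a) model" where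
  "ren \<sigma> M = \<lparr>fobj = (\<lambda>A\<in>Obj D. \<sigma> A ` fobj M A),
    farr = (\<lambda>f\<in>Arr D. Arrow (\<sigma> (Dom D f) ` fobj M (Dom D f))
      (\<lambda>y\<in>\<sigma> (Dom D f) ` fobj M (Dom D f). \<sigma> (Cod D f) (ev M f (inv (\<sigma> (Dom D f)) y)))
      (\<sigma> (Cod D f) ` fobj M (Cod D f)))\<rparr>"

definition ren_iso :: "('o \<Rightarrow> 'k hset \<Rightarrow> 'k hset) \<Rightarrow> ('k, 'o, 'a) model \<Rightarrow> ('k, 'o, 'a) model_map" where
  "ren_iso \<sigma> M = Arrow M
    (\<lambda>A\<in>Obj D. Arrow (fobj M A) (restrict (\<sigma> A) (fobj M A)) (\<sigma> A ` fobj M A)) (ren \<sigma> M)"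

lemma fobj_ren: "A \<in> Obj D \<Longrightarrow> fobj (ren \<sigma> M) A = \<sigma> A ` fobj M A"
  by (simp add: ren_def)

lemma renaming_inj: "renaming \<sigma> \<Longrightarrow> inj (\<sigma> A)"
  using permutes_inj by (auto simp: renaming_def)

lemma renaming_inv: "renaming \<sigma> \<Longrightarrow> renaming (\<lambda>A. inv (\<sigma> A))"
  using permutes_inv by (auto simp: renaming_def)

lemma renaming_simps [simp]:
  assumes "renaming \<sigma>"
  shows "inv (\<sigma> A) (\<sigma> A x) = x" "\<sigma> A (inv (\<sigma> A) x) = x" "\<sigma> A x = \<sigma> A y \<longleftrightarrow> x = y"
    "\<sigma> A x \<in> H \<longleftrightarrow> x \<in> H"
  using permutes_inverses[of "\<sigma> A" H] renaming_inj[OF assms, of A] permutes_in_image[of "\<sigma> A" H] assms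
  by (auto simp: renaming_def dest: injD)

lemma ev_ren:
  assumes "renaming \<sigma>" "f \<in> hom D A B" "x \<in> fobj M A"
  shows "ev (ren \<sigma> M) f (\<sigma> A x) = \<sigma> B (ev M f x)"
  using assms homD[OF cat assms(2)] by (simp add: ren_def)

lemma is_functor_ren:
  assumes \<sigma>: "renaming \<sigma>" and M: "is_functor D (Sets \<kappa>) M"
  shows "is_functor D (Sets \<kappa>) (ren \<sigma> M)"
proof (rule is_functorI[OF cat])
  note FM = is_functorD[OF M]
  have O: "fobj (ren \<sigma> M) A \<in> Obj (Sets \<kappa>)" if A: "A \<in> Obj D" for A
  proof -
    have "fobj M A \<subseteq> H" "|fobj M A| <o \<kappa>" using FM(1)[OF A] unfolding Obj_Sets_iff[OF \<kappa>] by auto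
    then show ?thesis
      unfolding fobj_ren[OF A] Obj_Sets_iff[OF \<kappa>]
      using \<sigma> ordLeq_ordLess_trans[OF card_of_image] by auto
  qed
  show "fobj (ren \<sigma> M) A \<in> Obj (Sets \<kappa>)" if "A \<in> Obj D" for A by (rule O[OF that])
  show fh: "farr (ren \<sigma> M) f \<in> hom (Sets \<kappa>) (fobj (ren \<sigma> M) A) (fobj (ren \<sigma> M) B)"
    if f: "f \<in> hom D A B" for f A B
  proof -
    note h = homD[OF cat f]
    have e: "farr (ren \<sigma> M) f = Arrow (fobj (ren \<sigma> M) A)
        (restrict (\<lambda>y. \<sigma> B (ev M f (inv (\<sigma> A) y))) (fobj (ren \<sigma> M) A)) (fobj (ren \<sigma> M) B)"
      using h by (simp add: ren_def)
    show ?thesis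
      unfolding e
      by (rule Arrow_in_hom_Sets[OF O O]) (use h \<sigma> ev_in[OF M f] in \<open>auto simp: fobj_ren\<close>)
  qed
  show "farr (ren \<sigma> M) (Idt D A) = Idt (Sets \<kappa>) (fobj (ren \<sigma> M) A)" if A: "A \<in> Obj D" for A
  proof (rule Sets_arrow_eqI[OF fh[OF Idt_in_hom[OF cat A]]])
    show "Idt (Sets \<kappa>) (fobj (ren \<sigma> M) A) \<in> hom (Sets \<kappa>) (fobj (ren \<sigma> M) A) (fobj (ren \<sigma> M) A)"
      using O[OF A] Idt_in_hom[OF category_set_cat] by (simp add: Sets_def)
    fix y assume "y \<in> fobj (ren \<sigma> M) A"
    then show "ev (ren \<sigma> M) (Idt D A) y = app (Idt (Sets \<kappa>) (fobj (ren \<sigma> M) A)) y"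
      using ev_ren[OF \<sigma> Idt_in_hom[OF cat A]] ev_Idt[OF M A] A
      by (auto simp: fobj_ren Sets_def Idt_set_cat)
  qed
  show "farr (ren \<sigma> M) (g \<cdot> f) = Cmp (Sets \<kappa>) (farr (ren \<sigma> M) g) (farr (ren \<sigma> M) f)"
    if f: "f \<in> hom D A B" and g: "g \<in> hom D B E" for f g A B E
  proof (rule Sets_arrow_eqI[OF fh[OF Cmp_in_hom[OF cat f g]] Cmp_in_hom_Sets[OF fh[OF f] fh[OF g]]])
    fix y assume y: "y \<in> fobj (ren \<sigma> M) A"
    then obtain x where x: "x \<in> fobj M A" "y = \<sigma> A x" using homD[OF cat f] by (auto simp: fobj_ren)
    show "ev (ren \<sigma> M) (g \<cdot> f) y = app (Cmp (Sets \<kappa>) (farr (ren \<sigma> M) g) (farr (ren \<sigma> M) f)) y"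
      unfolding app_Cmp_Sets[OF fh[OF f] y]
      using x ev_ren[OF \<sigma> f] ev_ren[OF \<sigma> g] ev_ren[OF \<sigma> Cmp_in_hom[OF cat f g]] ev_in[OF M f]
        ev_Cmp[OF M f g] by simp
  qed
qed (simp_all add: ren_def)

lemma ren_image:
  assumes \<sigma>: "renaming \<sigma>" and f: "f \<in> hom D A B"
  shows "ev (ren \<sigma> M) f ` fobj (ren \<sigma> M) A = \<sigma> B ` (ev M f ` fobj M A)"
proof -
  have "A \<in> Obj D" using homD[OF cat f] by simp
  then have "ev (ren \<sigma> M) f ` fobj (ren \<sigma> M) A = (\<lambda>x. ev (ren \<sigma> M) f (\<sigma> A x)) ` fobj M A"
    by (simp add: fobj_ren image_image)
  also have "\<dots> = (\<lambda>x. \<sigma> B (ev M f x)) ` fobj M A"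
    by (rule image_cong[OF refl ev_ren[OF assms]])
  finally show ?thesis by (simp add: image_image)
qed

lemma ren_inj:
  assumes \<sigma>: "renaming \<sigma>" and f: "f \<in> hom D A B" and i: "inj_on (ev M f) (fobj M A)"
  shows "inj_on (ev (ren \<sigma> M) f) (fobj (ren \<sigma> M) A)"
proof -
  have "A \<in> Obj D" using homD[OF cat f] by simp
  then show ?thesis
    using i by (auto simp: inj_on_def fobj_ren ev_ren[OF \<sigma> f] \<sigma>)
qed

text \<open>\<open>\<sigma>\<close> maps each \<open>fobj M A\<close> bijectively onto its renamed
  copy and commutes with the arrows, so the elementwise conditions carry over. A compatible family
  in the renamed model is pulled back to \<open>M\<close>, amalgamated there and renamed
  again.\<close>

lemma ren_Mod:
  assumes \<sigma>: "renaming \<sigma>" and M: "M \<in> Mod"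
  shows "ren \<sigma> M \<in> Mod"
proof -
  have p: "preserves_limits M" "preserves_images M" "preserves_unions M"
    using M by (auto simp: models_iff)
  have un: "m \<in> hom D (Dom D m) A" if "m \<in> S" "is_union D A S u" for m A S u
    using that subobj_hom by (auto simp: is_union_def)
  have un': "u \<in> hom D (Dom D u) A" if "is_union D A S u" for A S u
    using that subobj_hom by (auto simp: is_union_def)
  have im: "m \<in> hom D (Dom D m) (Cod D f)" "f \<in> hom D (Dom D f) (Cod D f)" if "is_image D f m" for m f
    using that by (auto simp: is_image_def subobj_def mono_arr_def hom_def)
  have "preserves_images (ren \<sigma> M)"
    unfolding preserves_images_def
  proof (intro allI impI)
    fix f m assume i: "is_image D f m"
    show "inj_on (ev (ren \<sigma> M) m) (fobj (ren \<sigma> M) (Dom D m)) \<and>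
        ev (ren \<sigma> M) m ` fobj (ren \<sigma> M) (Dom D m) = ev (ren \<sigma> M) f ` fobj (ren \<sigma> M) (Dom D f)"
      using ren_inj[OF \<sigma> im(1)[OF i], of M] p(2) i
      unfolding ren_image[OF \<sigma> im(1)[OF i]] ren_image[OF \<sigma> im(2)[OF i]] preserves_images_def by simp
  qed
  moreover have "preserves_unions (ren \<sigma> M)"
    unfolding preserves_unions_def
  proof (intro allI impI)
    fix A S u assume a: "finite S \<and> is_union D A S u"
    have i: "ev (ren \<sigma> M) m ` fobj (ren \<sigma> M) (Dom D m) = \<sigma> A ` (ev M m ` fobj M (Dom D m))" if "m \<in> S" for m
      by (rule ren_image[OF \<sigma> un[OF that conjunct2[OF a]]])
    note pu = p(3)[unfolded preserves_unions_def, rule_format, OF a]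
    have "inj_on (ev (ren \<sigma> M) m) (fobj (ren \<sigma> M) (Dom D m))" if "m \<in> S" for m
      using ren_inj[OF \<sigma> un[OF that conjunct2[OF a]], of M] pu that by blast
    moreover have "inj_on (ev (ren \<sigma> M) u) (fobj (ren \<sigma> M) (Dom D u))"
      using ren_inj[OF \<sigma> un'[OF conjunct2[OF a]], of M] pu by blast
    moreover have "ev (ren \<sigma> M) u ` fobj (ren \<sigma> M) (Dom D u) =
        (\<Union>m\<in>S. ev (ren \<sigma> M) m ` fobj (ren \<sigma> M) (Dom D m))"
      using pu i unfolding ren_image[OF \<sigma> un'[OF conjunct2[OF a]]] by (simp add: image_UN)
    ultimately show "(\<forall>m\<in>S. inj_on (ev (ren \<sigma> M) m) (fobj (ren \<sigma> M) (Dom D m))) \<and>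
      inj_on (ev (ren \<sigma> M) u) (fobj (ren \<sigma> M) (Dom D u)) \<and>
      ev (ren \<sigma> M) u ` fobj (ren \<sigma> M) (Dom D u) =
        (\<Union>m\<in>S. ev (ren \<sigma> M) m ` fobj (ren \<sigma> M) (Dom D m))" by blast
  qed
  moreover have "preserves_limits (ren \<sigma> M)"
    unfolding preserves_limits_def
  proof (intro allI impI, elim conjE)
    fix J K L \<pi> x
    assume fd: "finite_diagram J D K" and lc: "limit_cone D J K L \<pi>"
      and x: "\<forall>i\<in>Obj J. x i \<in> fobj (ren \<sigma> M) (fobj K i)"
      and xc: "\<forall>u\<in>Arr J. ev (ren \<sigma> M) (farr K u) (x (Dom J u)) = x (Cod J u)"
    have J: "category J" and K: "is_functor J D K" using fd by (auto simp: finite_diagram_def)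
    have L: "L \<in> Obj D" and \<pi>: "\<And>i. i \<in> Obj J \<Longrightarrow> \<pi> i \<in> hom D L (fobj K i)"
      using lc by (auto simp: limit_cone_def cone_def)
    have KO: "fobj K i \<in> Obj D" if "i \<in> Obj J" for i using is_functorD(1)[OF K that] .
    define y where "y i = inv (\<sigma> (fobj K i)) (x i)" for i
    have y: "y i \<in> fobj M (fobj K i)" "x i = \<sigma> (fobj K i) (y i)" if i: "i \<in> Obj J" for i
    proof -
      have "x i \<in> \<sigma> (fobj K i) ` fobj M (fobj K i)"
        using x[rule_format, OF i] unfolding fobj_ren[OF KO[OF i]] .
      then obtain w where "w \<in> fobj M (fobj K i)" "x i = \<sigma> (fobj K i) w" by (elim imageE)
      then show "y i \<in> fobj M (fobj K i)" "x i = \<sigma> (fobj K i) (y i)" using \<sigma> by (auto simp: y_def)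
    qed
    have "\<exists>!z. z \<in> fobj M L \<and> (\<forall>i\<in>Obj J. ev M (\<pi> i) z = y i)"
    proof (rule model_limit[OF M fd lc])
      fix u assume u: "u \<in> Arr J"
      then have o: "Dom J u \<in> Obj J" "Cod J u \<in> Obj J" using J by (auto simp: category_def)
      show "ev M (farr K u) (y (Dom J u)) = y (Cod J u)"
        using xc[rule_format, OF u] y[OF o(1)] y[OF o(2)] ev_ren[OF \<sigma> is_functorD(2)[OF K Arr_hom[OF u]] y(1)[OF o(1)]]
        by (simp add: \<sigma>)
    qed (use y in auto)
    then obtain z where z: "z \<in> fobj M L" "\<forall>i\<in>Obj J. ev M (\<pi> i) z = y i"
      and z': "\<And>w. w \<in> fobj M L \<Longrightarrow> \<forall>i\<in>Obj J. ev M (\<pi> i) w = y i \<Longrightarrow> w = z" by (elim ex1E) blast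
    show "\<exists>!z. z \<in> fobj (ren \<sigma> M) L \<and> (\<forall>i\<in>Obj J. ev (ren \<sigma> M) (\<pi> i) z = x i)"
    proof (rule ex1I[of _ "\<sigma> L z"])
      show "\<sigma> L z \<in> fobj (ren \<sigma> M) L \<and> (\<forall>i\<in>Obj J. ev (ren \<sigma> M) (\<pi> i) (\<sigma> L z) = x i)"
        using z y ev_ren[OF \<sigma> \<pi> z(1)] L by (simp add: fobj_ren)
      fix w assume w: "w \<in> fobj (ren \<sigma> M) L \<and> (\<forall>i\<in>Obj J. ev (ren \<sigma> M) (\<pi> i) w = x i)"
      then obtain v where v: "v \<in> fobj M L" "w = \<sigma> L v" using L by (auto simp: fobj_ren)
      have "\<forall>i\<in>Obj J. ev M (\<pi> i) v = y i"
        using w y ev_ren[OF \<sigma> \<pi> v(1)] v(2) by (simp add: \<sigma>)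
      then show "w = \<sigma> L z" using z'[OF v(1)] v(2) by simp
    qed
  qed
  ultimately show ?thesis
    using is_functor_ren[OF \<sigma> Mod_functor[OF M]] by (simp add: models_iff)
qed

text \<open>Equality on the nose, which holds since functors are extensional. It gives the
  isomorphism of the inverse renaming the target \<open>M\<close> itself.\<close>

lemma ren_inv:
  assumes \<sigma>: "renaming \<sigma>" and M: "M \<in> Mod"
  shows "ren (\<lambda>A. inv (\<sigma> A)) (ren \<sigma> M) = M"
proof -
  note \<sigma>' = renaming_inv[OF \<sigma>] and M' = ren_Mod[OF \<sigma> M]
  note F = is_functorD[OF Mod_functor[OF M]] and F' = is_functorD[OF Mod_functor[OF ren_Mod[OF \<sigma>' M']]]
  have o: "fobj (ren (\<lambda>A. inv (\<sigma> A)) (ren \<sigma> M)) A = fobj M A" if "A \<in> Obj D" for A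
    using that \<sigma> by (simp add: fobj_ren image_image)
  have "fobj (ren (\<lambda>A. inv (\<sigma> A)) (ren \<sigma> M)) = fobj M"
    by (rule extensionalityI[OF F'(5) F(5)]) (rule o)
  moreover have "farr (ren (\<lambda>A. inv (\<sigma> A)) (ren \<sigma> M)) = farr M"
  proof (rule extensionalityI[OF F'(6) F(6)])
    fix f assume "f \<in> Arr D"
    note f = Arr_hom[OF this] and h = homD[OF cat Arr_hom[OF this]]
    note fh = F'(2)[OF f, unfolded o[OF h(4)] o[OF h(5)]]
    show "farr (ren (\<lambda>A. inv (\<sigma> A)) (ren \<sigma> M)) f = farr M f"
    proof (rule Sets_arrow_eqI[OF fh F(2)[OF f]])
      fix x assume x: "x \<in> fobj M (Dom D f)"
      then have "\<sigma> (Dom D f) x \<in> fobj (ren \<sigma> M) (Dom D f)" using h by (simp add: fobj_ren)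
      from ev_ren[OF \<sigma>' f this] show "ev (ren (\<lambda>A. inv (\<sigma> A)) (ren \<sigma> M)) f x = ev M f x"
        using ev_ren[OF \<sigma> f x] by (simp add: \<sigma>)
    qed
  qed
  ultimately show ?thesis by (intro functr.equality) auto
qed

lemma nat_trans_ren:
  assumes \<sigma>: "renaming \<sigma>" and M: "M \<in> Mod"
  shows "nat_trans D (Sets \<kappa>) M (app (ren_iso \<sigma> M)) (ren \<sigma> M)"
  unfolding nat_trans_def
proof (intro conjI ballI)
  note F = Mod_functor[OF M] and F' = Mod_functor[OF ren_Mod[OF \<sigma> M]]
  show "is_functor D (Sets \<kappa>) M" "is_functor D (Sets \<kappa>) (ren \<sigma> M)" by fact+
  show "app (ren_iso \<sigma> M) \<in> extensional (Obj D)" by (simp add: ren_iso_def)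
  have h: "app (ren_iso \<sigma> M) A \<in> hom (Sets \<kappa>) (fobj M A) (fobj (ren \<sigma> M) A)" if "A \<in> Obj D" for A
  proof -
    have "Arrow (fobj M A) (restrict (\<sigma> A) (fobj M A)) (fobj (ren \<sigma> M) A) \<in> hom (Sets \<kappa>) (fobj M A) (fobj (ren \<sigma> M) A)"
      by (rule Arrow_in_hom_Sets[OF is_functorD(1)[OF F that] is_functorD(1)[OF F' that]])
        (simp add: fobj_ren[OF that])
    then show ?thesis using that by (simp add: ren_iso_def fobj_ren)
  qed
  then show "app (ren_iso \<sigma> M) A \<in> hom (Sets \<kappa>) (fobj M A) (fobj (ren \<sigma> M) A)" if "A \<in> Obj D" for A
    using that .
  fix f assume "f \<in> Arr D"
  note f = Arr_hom[OF this] and h' = homD[OF cat Arr_hom[OF this]]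
  note fM = is_functorD(2)[OF F f] and fM' = is_functorD(2)[OF F' f]
  show "Cmp (Sets \<kappa>) (farr (ren \<sigma> M) f) (app (ren_iso \<sigma> M) (Dom D f)) =
      Cmp (Sets \<kappa>) (app (ren_iso \<sigma> M) (Cod D f)) (farr M f)"
  proof (rule Sets_arrow_eqI[OF Cmp_in_hom_Sets[OF h[OF h'(4)] fM'] Cmp_in_hom_Sets[OF fM h[OF h'(5)]]])
    fix x assume x: "x \<in> fobj M (Dom D f)"
    show "app (Cmp (Sets \<kappa>) (farr (ren \<sigma> M) f) (app (ren_iso \<sigma> M) (Dom D f))) x =
        app (Cmp (Sets \<kappa>) (app (ren_iso \<sigma> M) (Cod D f)) (farr M f)) x"
      unfolding app_Cmp_Sets[OF h[OF h'(4)] x] app_Cmp_Sets[OF fM x]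
      using x h' ev_ren[OF \<sigma> f x] ev_in[OF F f x] by (simp add: ren_iso_def)
  qed
qed

text \<open>By the last clause the inverses of renaming isomorphisms come from a renaming too, so
  they also depend continuously on the model.\<close>

lemma ren_iso_Iso:
  assumes \<sigma>: "renaming \<sigma>" and M: "M \<in> Mod"
  shows "ren_iso \<sigma> M \<in> Iso" "src (ren_iso \<sigma> M) = M" "trg (ren_iso \<sigma> M) = ren \<sigma> M"
    "A \<in> Obj D \<Longrightarrow> x \<in> fobj M A \<Longrightarrow> cmpt (ren_iso \<sigma> M) A x = \<sigma> A x"
    "ginv (ren_iso \<sigma> M) = ren_iso (\<lambda>A. inv (\<sigma> A)) (ren \<sigma> M)"
proof -
  note \<sigma>' = renaming_inv[OF \<sigma>] and M' = ren_Mod[OF \<sigma> M]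
  show st: "src (ren_iso \<sigma> M) = M" "trg (ren_iso \<sigma> M) = ren \<sigma> M" by (simp_all add: ren_iso_def)
  show ap: "A \<in> Obj D \<Longrightarrow> x \<in> fobj M A \<Longrightarrow> cmpt (ren_iso \<sigma> M) A x = \<sigma> A x" for A x
    by (simp add: ren_iso_def)
  let ?\<phi> = "ren_iso \<sigma> M" and ?\<psi> = "ren_iso (\<lambda>A. inv (\<sigma> A)) (ren \<sigma> M)"
  note r = ren_inv[OF \<sigma> M]
  have st': "src ?\<psi> = ren \<sigma> M" "trg ?\<psi> = M" by (simp_all add: ren_iso_def r)
  have F: "category FC"
    by (intro category_functor_cat cat) (simp add: Sets_def category_set_cat)
  have \<phi>: "?\<phi> \<in> hom FC M (ren \<sigma> M)" and \<psi>: "?\<psi> \<in> hom FC (ren \<sigma> M) M"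
    using nat_trans_ren[OF \<sigma> M] nat_trans_ren[OF \<sigma>' M'] st st' by (simp_all add: hom_def r)
  have oM: "M \<in> Obj FC" "ren \<sigma> M \<in> Obj FC" using Mod_functor[OF M] Mod_functor[OF M'] by simp_all
  have hM: "app ?\<phi> A \<in> hom (Sets \<kappa>) (fobj M A) (fobj (ren \<sigma> M) A)"
    "app ?\<psi> A \<in> hom (Sets \<kappa>) (fobj (ren \<sigma> M) A) (fobj M A)" if "A \<in> Obj D" for A
    using nat_trans_ren[OF \<sigma> M] nat_trans_ren[OF \<sigma>' M'] that by (simp_all add: nat_trans_def r)
  have ap': "cmpt ?\<psi> A y = inv (\<sigma> A) y" if "A \<in> Obj D" "y \<in> fobj (ren \<sigma> M) A" for A y
    using that by (simp add: ren_iso_def)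
  have idh: "Idt (Sets \<kappa>) (fobj N A) \<in> hom (Sets \<kappa>) (fobj N A) (fobj N A)" if "N \<in> Mod" "A \<in> Obj D" for N A
    using Idt_in_hom[OF category_set_cat] is_functorD(1)[OF Mod_functor[OF that(1)] that(2)]
    by (simp add: Sets_def)
  have 1: "?\<psi> \<diamondop> ?\<phi> = gid M"
  proof (rule functor_cat_arrow_eqI[of D "Sets \<kappa>"])
    show "nat_trans D (Sets \<kappa>) (src (?\<psi> \<diamondop> ?\<phi>)) (app (?\<psi> \<diamondop> ?\<phi>)) (trg (?\<psi> \<diamondop> ?\<phi>))"
      "src (?\<psi> \<diamondop> ?\<phi>) = src (gid M)" "trg (?\<psi> \<diamondop> ?\<phi>) = trg (gid M)"
      "nat_trans D (Sets \<kappa>) (src (gid M)) (app (gid M)) (trg (gid M))"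
      using Cmp_in_hom[OF F \<phi> \<psi>] Idt_in_hom[OF F oM(1)] by (auto simp: hom_def)
    fix A assume A: "A \<in> Obj D"
    show "app (?\<psi> \<diamondop> ?\<phi>) A = app (gid M) A"
      unfolding app_Cmp_functor_cat[OF A] app_Idt_functor_cat[OF A]
    proof (rule Sets_arrow_eqI[OF Cmp_in_hom_Sets[OF hM(1)[OF A] hM(2)[OF A]] idh[OF M A]])
      fix x assume x: "x \<in> fobj M A"
      show "app (Cmp (Sets \<kappa>) (app ?\<psi> A) (app ?\<phi> A)) x = app (Idt (Sets \<kappa>) (fobj M A)) x"
        unfolding app_Cmp_Sets[OF hM(1)[OF A] x] ap[OF A x]
        using ap'[OF A, of "\<sigma> A x"] x A by (simp add: fobj_ren \<sigma> Sets_def Idt_set_cat)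
    qed
  qed
  have 2: "?\<phi> \<diamondop> ?\<psi> = gid (ren \<sigma> M)"
  proof (rule functor_cat_arrow_eqI[of D "Sets \<kappa>"])
    show "nat_trans D (Sets \<kappa>) (src (?\<phi> \<diamondop> ?\<psi>)) (app (?\<phi> \<diamondop> ?\<psi>)) (trg (?\<phi> \<diamondop> ?\<psi>))"
      "src (?\<phi> \<diamondop> ?\<psi>) = src (gid (ren \<sigma> M))" "trg (?\<phi> \<diamondop> ?\<psi>) = trg (gid (ren \<sigma> M))"
      "nat_trans D (Sets \<kappa>) (src (gid (ren \<sigma> M))) (app (gid (ren \<sigma> M))) (trg (gid (ren \<sigma> M)))"
      using Cmp_in_hom[OF F \<psi> \<phi>] Idt_in_hom[OF F oM(2)] by (auto simp: hom_def)
    fix A assume A: "A \<in> Obj D"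
    show "app (?\<phi> \<diamondop> ?\<psi>) A = app (gid (ren \<sigma> M)) A"
      unfolding app_Cmp_functor_cat[OF A] app_Idt_functor_cat[OF A]
    proof (rule Sets_arrow_eqI[OF Cmp_in_hom_Sets[OF hM(2)[OF A] hM(1)[OF A]] idh[OF M' A]])
      fix y assume y: "y \<in> fobj (ren \<sigma> M) A"
      have "inv (\<sigma> A) y \<in> fobj M A" using y A by (auto simp: fobj_ren \<sigma>)
      then show "app (Cmp (Sets \<kappa>) (app ?\<phi> A) (app ?\<psi> A)) y = app (Idt (Sets \<kappa>) (fobj (ren \<sigma> M) A)) y"
        unfolding app_Cmp_Sets[OF hM(2)[OF A] y] ap'[OF A y]
        using ap[OF A, of "inv (\<sigma> A) y"] y by (simp add: \<sigma> Sets_def Idt_set_cat)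
    qed
  qed
  show \<phi>I: "?\<phi> \<in> Iso"
    unfolding model_isos_def isos_def
    using \<phi> \<psi> 1 2 st st' M M' by (auto simp: hom_def intro!: exI[of _ ?\<psi>])
  have "?\<psi> = ginv ?\<phi>"
  proof -
    note i = ginv_Iso[OF \<phi>I]
    have ih: "ginv ?\<phi> \<in> hom FC (ren \<sigma> M) M"
      using Iso_nat[OF i(1)] i st by (simp add: hom_def)
    have "?\<psi> = ?\<psi> \<diamondop> (?\<phi> \<diamondop> ginv ?\<phi>)" using Cmp_Idt(1)[OF F \<psi>] i st by simp
    also have "\<dots> = (?\<psi> \<diamondop> ?\<phi>) \<diamondop> ginv ?\<phi>" by (rule Cmp_assoc[OF F ih \<phi> \<psi>])
    also have "\<dots> = ginv ?\<phi>" unfolding 1 by (rule Cmp_Idt(2)[OF F ih])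
    finally show ?thesis .
  qed
  then show "ginv ?\<phi> = ?\<psi>" by simp
qed

end

lemma ex1_eq: "\<exists>!x. P x \<Longrightarrow> P a \<Longrightarrow> P b \<Longrightarrow> a = b"
  by blast

context coherent_models
begin

subsection \<open>Neighbourhoods\<close>

definition out_of :: "'o \<Rightarrow> 'a set" where
  "out_of C = {f \<in> Arr D. Dom D f = C}"

text \<open>Basic neighbourhoods of \<open>M\<close>. The witness hidden by the existential in a
  subbasic open set is named here by its label \<open>z\<close>. One element is enough, since
  several elements combine into an element of a product.\<close>

definition nbd where
  "nbd M C z F = {N \<in> Mod. z \<in> fobj N C \<and> (\<forall>f\<in>F. ev N f z = ev M f z)}"

text \<open>Basic neighbourhoods of the identity of \<open>M\<close>. By naturality such an
  isomorphism fixes, besides \<open>z\<close>, the labels of the images of \<open>z\<close> under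
  \<open>F\<close>.\<close>

definition gnbd where
  "gnbd M C z F = {\<phi> \<in> Iso. src \<phi> \<in> nbd M C z F \<and> trg \<phi> \<in> nbd M C z F \<and> cmpt \<phi> C z = z}"

lemma out_of_hom: "f \<in> out_of C \<Longrightarrow> f \<in> hom D C (Cod D f)"
  by (simp add: out_of_def hom_def)

lemma hom_out_of: "f \<in> hom D C B \<Longrightarrow> f \<in> out_of C"
  by (simp add: out_of_def hom_def)

lemma openin_values:
  assumes C: "C \<in> Obj D" and F: "finite F" "F \<subseteq> out_of C"
  shows "openin X {N \<in> Mod. z \<in> fobj N C \<and> (\<forall>f\<in>F. ev N f z = c f)}" (is "openin X ?S")
\<comment> \<open>The subbasis admits labels from \<open>H\<close> only. Elements of models carry no
  other labels, so outside \<open>H\<close> the set is empty.\<close>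
proof (cases "z \<in> H \<and> c ` F \<subseteq> H")
  case False
  have "?S = {}"
  proof -
    have "z \<in> H \<and> c ` F \<subseteq> H" if N: "N \<in> ?S" for N
    proof -
      have "c f \<in> H" if f: "f \<in> F" for f
      proof -
        have fh: "f \<in> hom D C (Cod D f)" using f F out_of_hom by blast
        have "ev N f z \<in> H" using fobj_H[OF _ homD(5)[OF cat fh] Mev_in[OF _ fh]] N by blast
        then show ?thesis using N f by simp
      qed
      then show ?thesis using N fobj_H C by blast
    qed
    then show ?thesis using False by blast
  qed
  then show ?thesis by (simp only: openin_empty)
next
  case True
  obtain fs where fs: "set fs = F" using finite_list[OF F(1)] by blast
  \<comment> \<open>The identity in front forces the witness to be \<open>z\<close>.\<close>
  let ?fs = "Idt D C # fs" and ?as = "z # map c fs"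
  note id = Idt_in_hom[OF cat C]
  have "openin X {N \<in> Mod. \<exists>x\<in>fobj N C. \<forall>i<length ?fs. ev N (?fs ! i) x = ?as ! i}"
    unfolding model_topology_def
    by (intro topology_generated_by_Basis CollectI exI[of _ C] exI[of _ ?fs] exI[of _ ?as])
      (use True C F fs homD[OF cat id] in \<open>auto simp: out_of_def\<close>)
  also have "{N \<in> Mod. \<exists>x\<in>fobj N C. \<forall>i<length ?fs. ev N (?fs ! i) x = ?as ! i} = ?S"
  proof -
    have "(\<forall>i<length ?fs. ev N (?fs ! i) x = ?as ! i) \<longleftrightarrow> x = z \<and> (\<forall>f\<in>F. ev N f z = c f)"
      if "N \<in> Mod" "x \<in> fobj N C" for N x
    proof -
      have "(\<forall>f\<in>F. ev N f x = c f) \<longleftrightarrow> (\<forall>i<length fs. ev N (fs ! i) x = c (fs ! i))"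
        unfolding fs[symmetric] by (rule all_set_conv_all_nth)
      then show ?thesis
        using Mev_Idt[OF that(1) C that(2)] by (auto simp: All_less_Suc2)
    qed
    then show ?thesis by auto
  qed
  finally show ?thesis .
qed

lemma openin_nbd:
  "C \<in> Obj D \<Longrightarrow> finite F \<Longrightarrow> F \<subseteq> out_of C \<Longrightarrow> openin X (nbd M C z F)"
  unfolding nbd_def by (rule openin_values)

lemma openin_mem: "C \<in> Obj D \<Longrightarrow> openin X {N \<in> Mod. z \<in> fobj N C}"
  using openin_values[of C "{}" z] by simp

lemma nbd_refl: "M \<in> Mod \<Longrightarrow> z \<in> fobj M C \<Longrightarrow> M \<in> nbd M C z F"
  by (simp add: nbd_def)

lemma gnbd_mono_nbd: "F \<subseteq> F' \<Longrightarrow> nbd M C z F' \<subseteq> nbd M C z F" "F \<subseteq> F' \<Longrightarrow> gnbd M C z F' \<subseteq> gnbd M C z F"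
  by (auto simp: nbd_def gnbd_def)

text \<open>Both elements are projections of one element \<open>w\<close> of a product. The
  projections belong to \<open>G\<close> because in another model nothing else ties the label
  \<open>w\<close> to the labels \<open>z\<close> and \<open>z'\<close>.\<close>

lemma nbd_refine:
  assumes M: "M \<in> Mod" and C: "C \<in> Obj D" "z \<in> fobj M C" "finite F" "F \<subseteq> out_of C"
    and C': "C' \<in> Obj D" "z' \<in> fobj M C'" "finite F'" "F' \<subseteq> out_of C'"
  obtains P p q w G where "p \<in> hom D P C" "q \<in> hom D P C'" "w \<in> fobj M P" "ev M p w = z" "ev M q w = z'"
    "finite G" "G \<subseteq> out_of P" "p \<in> G" "q \<in> G" "nbd M P w G \<subseteq> nbd M C z F \<inter> nbd M C' z' F'"
    "gnbd M P w G \<subseteq> gnbd M C z F \<inter> gnbd M C' z' F'"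
proof -
  obtain P p q w where p: "p \<in> hom D P C" and q: "q \<in> hom D P C'" and w: "w \<in> fobj M P"
    and pw: "ev M p w = z" and qw: "ev M q w = z'"
    by (rule ex_product_point[OF C(1) C'(1) M C(2) C'(2)]) (rule that, assumption+)
  define G where "G = {p, q} \<union> (\<lambda>f. f \<cdot> p) ` F \<union> (\<lambda>f. f \<cdot> q) ` F'"
  have "f \<cdot> p \<in> out_of P" if "f \<in> F" for f
    using Cmp_in_hom[OF cat p out_of_hom] hom_out_of that C by blast
  moreover have "f \<cdot> q \<in> out_of P" if "f \<in> F'" for f
    using Cmp_in_hom[OF cat q out_of_hom] hom_out_of that C' by blast
  ultimately have G: "finite G" "G \<subseteq> out_of P" "p \<in> G" "q \<in> G"
    using C C' hom_out_of[OF p] hom_out_of[OF q] by (auto simp: G_def)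
  have key: "N \<in> nbd M B y F0" if N: "N \<in> nbd M P w G" and k: "k \<in> hom D P B" "ev M k w = y" "k \<in> G"
      "(\<lambda>f. f \<cdot> k) ` F0 \<subseteq> G" "F0 \<subseteq> out_of B" for N k B y F0
  proof -
    have NM: "N \<in> Mod" and wN: "w \<in> fobj N P" using N by (auto simp: nbd_def)
    have ky: "ev N k w = y" using N k by (auto simp: nbd_def)
    have "ev N f y = ev M f y" if f: "f \<in> F0" for f
    proof -
      have fh: "f \<in> hom D B (Cod D f)" using f k(5) out_of_hom by blast
      have "f \<cdot> k \<in> G" using f k(4) by blast
      then have "ev N (f \<cdot> k) w = ev M (f \<cdot> k) w" using N by (auto simp: nbd_def)
      then show ?thesis using Mev_Cmp[OF NM k(1) fh wN] Mev_Cmp[OF M k(1) fh w] ky k(2) by simp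
    qed
    then show ?thesis using Mev_in[OF NM k(1) wN] NM ky by (simp add: nbd_def)
  qed
  have sub: "nbd M P w G \<subseteq> nbd M C z F" "nbd M P w G \<subseteq> nbd M C' z' F'"
    using key[OF _ p pw] key[OF _ q qw] G C C' by (auto simp: G_def)
  have gkey: "cmpt \<phi> B y = y" if \<phi>: "\<phi> \<in> gnbd M P w G" and k: "k \<in> hom D P B" "ev M k w = y" "k \<in> G" for \<phi> k B y
  proof -
    have \<phi>I: "\<phi> \<in> Iso" and s: "src \<phi> \<in> nbd M P w G" "trg \<phi> \<in> nbd M P w G" and fx: "cmpt \<phi> P w = w"
      using \<phi> by (auto simp: gnbd_def)
    have "ev (src \<phi>) k w = y" "ev (trg \<phi>) k w = y" "w \<in> fobj (src \<phi>) P"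
      using s k by (auto simp: nbd_def)
    then show ?thesis using cmpt_natural[OF \<phi>I k(1)] fx by metis
  qed
  have "gnbd M P w G \<subseteq> gnbd M C z F \<inter> gnbd M C' z' F'"
  proof
    fix \<phi> assume \<phi>: "\<phi> \<in> gnbd M P w G"
    then show "\<phi> \<in> gnbd M C z F \<inter> gnbd M C' z' F'"
      using gkey[OF \<phi> p pw G(3)] gkey[OF \<phi> q qw G(4)] sub unfolding gnbd_def by blast
  qed
  then show ?thesis using that[OF p q w pw qw G] sub by blast
qed

text \<open>In a subbasic set the witness of the existential supplies \<open>z\<close>; finite
  intersections are taken care of by \<open>nbd_refine\<close>.\<close>

lemma nbd_base:
  assumes U: "openin X U" and M: "M \<in> U"
  obtains C z F where "C \<in> Obj D" "z \<in> fobj M C" "finite F" "F \<subseteq> out_of C" "nbd M C z F \<subseteq> U"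
proof -
  have MM: "M \<in> Mod" using openin_subset[OF U] M topX by blast
  have "\<exists>C z F. C \<in> Obj D \<and> z \<in> fobj M C \<and> finite F \<and> F \<subseteq> out_of C \<and> nbd M C z F \<subseteq> U"
    using U[unfolded model_topology_def openin_topology_generated_by_iff] M
  proof (induction rule: generate_topology_on.induct)
    case (Int a b)
    obtain C z F where
      1: "C \<in> Obj D" "z \<in> fobj M C" "finite F" "F \<subseteq> out_of C" "nbd M C z F \<subseteq> a"
      using Int.IH(1)[OF IntD1[OF Int.prems]] by (elim exE conjE) (rule that, assumption+)
    obtain C' z' F' where
      2: "C' \<in> Obj D" "z' \<in> fobj M C'" "finite F'" "F' \<subseteq> out_of C'" "nbd M C' z' F' \<subseteq> b"
      using Int.IH(2)[OF IntD2[OF Int.prems]] by (elim exE conjE) (rule that, assumption+)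
    obtain P p q w G where "p \<in> hom D P C" "w \<in> fobj M P" "finite G" "G \<subseteq> out_of P"
      "nbd M P w G \<subseteq> nbd M C z F \<inter> nbd M C' z' F'"
      by (rule nbd_refine[OF MM 1(1-4) 2(1-4)]) (rule that, assumption+)
    then show ?case using 1(5) 2(5) homD[OF cat \<open>p \<in> hom D P C\<close>] by blast
  next
    case (UN K)
    then obtain k where k: "k \<in> K" "M \<in> k" by blast
    from UN.IH[OF this] show ?case using k(1) by blast
  next
    case (Basis s)
    then obtain A fs as where s: "s = {N \<in> Mod. \<exists>x\<in>fobj N A. \<forall>i<length fs. ev N (fs ! i) x = as ! i}"
      and A: "A \<in> Obj D" "set fs \<subseteq> {f \<in> Arr D. Dom D f = A}" by blast
    obtain x where x: "x \<in> fobj M A" "\<forall>i<length fs. ev M (fs ! i) x = as ! i" using Basis(2) s by blast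
    have "nbd M A x (set fs) \<subseteq> s"
    proof
      fix N assume N: "N \<in> nbd M A x (set fs)"
      have "ev N (fs ! i) x = as ! i" if "i < length fs" for i
        using N x(2) nth_mem[OF that] that by (simp add: nbd_def)
      moreover have "N \<in> Mod" "x \<in> fobj N A" using N by (auto simp: nbd_def)
      ultimately show "N \<in> s" unfolding s by blast
    qed
    then show ?case using A x by (intro exI[of _ A] exI[of _ x] exI[of _ "set fs"]) (auto simp: out_of_def)
  qed simp
  then show ?thesis using that by blast
qed

text \<open>Neighbourhoods of identities are what the local invariance of a section asks for. Source
  and target conditions turn into neighbourhoods of \<open>M\<close>, and a value condition at the
  identity can only say that a label is fixed.\<close>

lemma gnbd_base:
  assumes V: "openin GG V" and M: "M \<in> Mod" "gid M \<in> V"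
  obtains C z F where "C \<in> Obj D" "z \<in> fobj M C" "finite F" "F \<subseteq> out_of C" "gnbd M C z F \<subseteq> V"
proof -
  have "\<exists>C z F. C \<in> Obj D \<and> z \<in> fobj M C \<and> finite F \<and> F \<subseteq> out_of C \<and> gnbd M C z F \<subseteq> V"
    using V[unfolded model_iso_topology_def openin_topology_generated_by_iff] M(2)
  proof (induction rule: generate_topology_on.induct)
    case (Int a b)
    obtain C z F where
      1: "C \<in> Obj D" "z \<in> fobj M C" "finite F" "F \<subseteq> out_of C" "gnbd M C z F \<subseteq> a"
      using Int.IH(1)[OF IntD1[OF Int.prems]] by (elim exE conjE) (rule that, assumption+)
    obtain C' z' F' where
      2: "C' \<in> Obj D" "z' \<in> fobj M C'" "finite F'" "F' \<subseteq> out_of C'" "gnbd M C' z' F' \<subseteq> b"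
      using Int.IH(2)[OF IntD2[OF Int.prems]] by (elim exE conjE) (rule that, assumption+)
    obtain P p q w G where "p \<in> hom D P C" "w \<in> fobj M P" "finite G" "G \<subseteq> out_of P"
      "gnbd M P w G \<subseteq> gnbd M C z F \<inter> gnbd M C' z' F'"
      by (rule nbd_refine[OF M(1) 1(1-4) 2(1-4)]) (rule that, assumption+)
    then show ?case using 1(5) 2(5) homD[OF cat \<open>p \<in> hom D P C\<close>] by blast
  next
    case (UN K)
    then obtain k where k: "k \<in> K" "gid M \<in> k" by blast
    from UN.IH[OF this] show ?case using k(1) by blast
  next
    case (Basis s)
    have "\<exists>C z F. C \<in> Obj D \<and> z \<in> fobj M C \<and> finite F \<and> F \<subseteq> out_of C \<and> gnbd M C z F \<subseteq> s"
      if U: "openin X U" "M \<in> U" and s: "{\<phi> \<in> Iso. src \<phi> \<in> U \<and> trg \<phi> \<in> U} \<subseteq> s" for U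
    proof -
      obtain C z F where "C \<in> Obj D" "z \<in> fobj M C" "finite F" "F \<subseteq> out_of C" "nbd M C z F \<subseteq> U"
        by (rule nbd_base[OF U]) (rule that, assumption+)
      moreover from this have "gnbd M C z F \<subseteq> s" using s unfolding gnbd_def by blast
      ultimately show ?thesis by blast
    qed
    note * = this
    from Basis(1) consider U where "openin X U" "s = {\<phi> \<in> Iso. src \<phi> \<in> U}"
      | U where "openin X U" "s = {\<phi> \<in> Iso. trg \<phi> \<in> U}"
      | A a b where "A \<in> Obj D" "s = {\<phi> \<in> Iso. a \<in> fobj (src \<phi>) A \<and> cmpt \<phi> A a = b}" by blast
    then show ?case
    proof cases
      case 1 then show ?thesis using *[of U] Basis(2) gid_Iso[OF M(1)] by auto
    next
      case 2 then show ?thesis using *[of U] Basis(2) gid_Iso[OF M(1)] by auto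
    next
      case 3
      then have "a \<in> fobj M A" "b = a" using Basis(2) gid_Iso[OF M(1)] cmpt_gid[OF 3(1)] by auto
      then show ?thesis
        using 3 by (intro exI[of _ A] exI[of _ a] exI[of _ "{}"]) (auto simp: gnbd_def nbd_def)
    qed
  qed simp
  then show ?thesis using that by blast
qed

text \<open>A condition on the labels of the renamed model is a condition of the same kind on the
  original one, with each label moved back by the permutation at its object.\<close>

lemma continuous_map_ren:
  assumes \<sigma>: "renaming \<sigma>"
  shows "continuous_map X X (ren \<sigma>)"
  \<comment> \<open>Rewrites only the second occurrence of \<open>X\<close>, the one whose subbasis
    is pulled back.\<close>
  unfolding model_topology_def[of \<kappa> D, THEN arg_cong, of "\<lambda>T. continuous_map X T (ren \<sigma>)"]
proof (rule continuous_on_generated_topo)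
  show "ren \<sigma> ` topspace X \<subseteq> \<Union> {{M \<in> Mod. \<exists>x\<in>fobj M A. \<forall>i<length fs. ev M (fs ! i) x = as ! i} | A fs as.
      A \<in> Obj D \<and> set fs \<subseteq> {f \<in> Arr D. Dom D f = A} \<and> set as \<subseteq> H \<and> length as = length fs}"
    unfolding topology_generated_by_topspace[symmetric] model_topology_def[symmetric] topX
    using ren_Mod[OF \<sigma>] by blast
  fix U assume "U \<in> {{M \<in> Mod. \<exists>x\<in>fobj M A. \<forall>i<length fs. ev M (fs ! i) x = as ! i} | A fs as.
      A \<in> Obj D \<and> set fs \<subseteq> {f \<in> Arr D. Dom D f = A} \<and> set as \<subseteq> H \<and> length as = length fs}"
  then obtain A fs as where U: "U = {M \<in> Mod. \<exists>x\<in>fobj M A. \<forall>i<length fs. ev M (fs ! i) x = as ! i}"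
    and A: "A \<in> Obj D" "set fs \<subseteq> {f \<in> Arr D. Dom D f = A}" "set as \<subseteq> H" "length as = length fs" by blast
  define bs where "bs = map (\<lambda>i. inv (\<sigma> (Cod D (fs ! i))) (as ! i)) [0..<length fs]"
  have fh: "fs ! i \<in> hom D A (Cod D (fs ! i))" if "i < length fs" for i
    using A(2) that nth_mem by (fastforce simp: hom_def)
  have "as ! i \<in> H" if "i < length fs" for i using A(3,4) that by (metis nth_mem subsetD)
  then have bs: "set bs \<subseteq> H" "length bs = length fs"
    using renaming_simps(4)[OF renaming_inv[OF \<sigma>]] by (auto simp: bs_def)
  have "openin X {M \<in> Mod. \<exists>x\<in>fobj M A. \<forall>i<length fs. ev M (fs ! i) x = bs ! i}"
    unfolding model_topology_def
    by (rule topology_generated_by_Basis) (use A bs in blast)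
  also have "{M \<in> Mod. \<exists>x\<in>fobj M A. \<forall>i<length fs. ev M (fs ! i) x = bs ! i} = ren \<sigma> -` U \<inter> topspace X"
  proof -
    have "ev (ren \<sigma> N) (fs ! i) (\<sigma> A x) = as ! i \<longleftrightarrow> ev N (fs ! i) x = bs ! i"
      if "i < length fs" "x \<in> fobj N A" for i x N
    proof -
      have "\<sigma> B u = a \<longleftrightarrow> u = inv (\<sigma> B) a" for B u a
        using renaming_simps(1,2)[OF \<sigma>] by metis
      then show ?thesis
        using ev_ren[OF \<sigma> fh[OF that(1)] that(2)] that(1) by (simp add: bs_def)
    qed
    then show ?thesis
      using ren_Mod[OF \<sigma>] A(1) by (auto simp: U topX fobj_ren)
  qed
  finally show "openin X (ren \<sigma> -` U \<inter> topspace X)" .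
qed

lemma continuous_map_ren_iso:
  assumes \<sigma>: "renaming \<sigma>"
  shows "continuous_map X GG (ren_iso \<sigma>)"
  unfolding model_iso_topology_def
proof (rule continuous_on_generated_topo)
  note r = ren_iso_Iso[OF \<sigma>]
  show "ren_iso \<sigma> ` topspace X \<subseteq> \<Union> ({{\<phi> \<in> Iso. src \<phi> \<in> U} | U. openin X U} \<union>
     {{\<phi> \<in> Iso. trg \<phi> \<in> U} | U. openin X U} \<union>
     {{\<phi> \<in> Iso. a \<in> fobj (src \<phi>) A \<and> cmpt \<phi> A a = b} | A a b. A \<in> Obj D \<and> a \<in> H \<and> b \<in> H})"
    unfolding topology_generated_by_topspace[symmetric] model_iso_topology_def[symmetric] topG topX
    using r(1) by blast
  fix V assume "V \<in> {{\<phi> \<in> Iso. src \<phi> \<in> U} | U. openin X U} \<union>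
     {{\<phi> \<in> Iso. trg \<phi> \<in> U} | U. openin X U} \<union>
     {{\<phi> \<in> Iso. a \<in> fobj (src \<phi>) A \<and> cmpt \<phi> A a = b} | A a b. A \<in> Obj D \<and> a \<in> H \<and> b \<in> H}"
  then consider U where "openin X U" "V = {\<phi> \<in> Iso. src \<phi> \<in> U}"
    | U where "openin X U" "V = {\<phi> \<in> Iso. trg \<phi> \<in> U}"
    | A a b where "A \<in> Obj D" "V = {\<phi> \<in> Iso. a \<in> fobj (src \<phi>) A \<and> cmpt \<phi> A a = b}" by blast
  then show "openin X (ren_iso \<sigma> -` V \<inter> topspace X)"
  proof cases
    case (1 U)
    have "U \<subseteq> Mod" using openin_subset[OF 1(1)] topX by simp
    then have "ren_iso \<sigma> -` V \<inter> topspace X = U" using r(1,2) by (auto simp: 1(2) topX)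
    then show ?thesis using 1(1) by simp
  next
    case (2 U)
    have "ren_iso \<sigma> -` V \<inter> topspace X = {N \<in> topspace X. ren \<sigma> N \<in> U}" using r(1,3) by (auto simp: 2(2) topX)
    then show ?thesis using openin_continuous_map_preimage[OF continuous_map_ren[OF \<sigma>] 2(1)] by simp
  next
    case (3 A a b)
    \<comment> \<open>The isomorphism sends the label \<open>a\<close> to
      \<open>\<sigma> A a\<close> in every model that has it, so the condition on the value is the
      same for all of them.\<close>
    have "ren_iso \<sigma> -` V \<inter> topspace X = (if \<sigma> A a = b then {N \<in> Mod. a \<in> fobj N A} else {})"
      using r(1,2,4) 3(1) by (auto simp: 3(2) topX)
    then show ?thesis using openin_mem[OF 3(1)] by simp
  qed
qed

text \<open>
  The arrow \<open>g\<close> restricts \<open>C\<close> to the elements on which the members of \<open>F\<close> take equal values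
  exactly where they do at \<open>z\<close>. In particular inequalities have to be expressed, and this is the
  only use of the complemented diagonals.
\<close>

definition pattern where
  "pattern M C z F C' g \<longleftrightarrow> (\<forall>N\<in>Mod. \<forall>w\<in>fobj N C'. \<forall>f\<in>F. \<forall>f'\<in>F. Cod D f = Cod D f' \<longrightarrow>
    (ev N f (ev N g w) = ev N f' (ev N g w) \<longleftrightarrow> ev M f z = ev M f' z))"

text \<open>The permutation at an object \<open>B\<close> only has to treat the arrows of
  \<open>F\<close> into \<open>B\<close>, and for these the pattern makes the wanted assignment of
  labels a partial injection. Objects are treated separately: the same label at two objects stands
  for unrelated elements.\<close>

lemma pattern_renaming:
  assumes p: "pattern M C z F C' g" and F: "finite F" "F \<subseteq> out_of C" and g: "g \<in> hom D C' C"
    and M: "M \<in> Mod" "z \<in> fobj M C" and N: "N \<in> Mod" "w \<in> fobj N C'"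
  obtains \<sigma> where "renaming \<sigma>" "\<And>f. f \<in> F \<Longrightarrow> \<sigma> (Cod D f) (ev N f (ev N g w)) = ev M f z"
proof -
  have ex: "\<exists>\<tau>. \<tau> permutes H \<and> (\<forall>f\<in>{f \<in> F. Cod D f = B}. \<tau> (ev N f (ev N g w)) = ev M f z)" for B
  proof (rule finite_partial_injection_extends)
    show "finite {f \<in> F. Cod D f = B}" using F by simp
    fix f assume f: "f \<in> {f \<in> F. Cod D f = B}"
    have fh: "f \<in> hom D C (Cod D f)" using f F out_of_hom by blast
    note O = homD(5)[OF cat fh]
    show "ev N f (ev N g w) \<in> H" by (rule fobj_H[OF N(1) O Mev_in[OF N(1) fh Mev_in[OF N(1) g N(2)]]])
    show "ev M f z \<in> H" by (rule fobj_H[OF M(1) O Mev_in[OF M(1) fh M(2)]])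
    fix f' assume f': "f' \<in> {f \<in> F. Cod D f = B}"
    show "ev N f (ev N g w) = ev N f' (ev N g w) \<longleftrightarrow> ev M f z = ev M f' z"
      using p[unfolded pattern_def, rule_format, OF N, of f f'] f f' by simp
  qed
  define \<sigma> where "\<sigma> B = (SOME \<tau>. \<tau> permutes H \<and> (\<forall>f\<in>{f \<in> F. Cod D f = B}. \<tau> (ev N f (ev N g w)) = ev M f z))" for B
  have \<sigma>: "\<sigma> B permutes H \<and> (\<forall>f\<in>{f \<in> F. Cod D f = B}. \<sigma> B (ev N f (ev N g w)) = ev M f z)" for B
    unfolding \<sigma>_def by (rule someI_ex[OF ex])
  show ?thesis
    by (rule that[of \<sigma>]) (use \<sigma> in \<open>auto simp: renaming_def\<close>)
qed

text \<open>As the identity belongs to \<open>F\<close>, the element \<open>y\<close> itself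
  receives the label \<open>z\<close>, and not only its images.\<close>

lemma ren_in_nbd:
  assumes \<sigma>: "renaming \<sigma>" and N: "N \<in> Mod" "y \<in> fobj N C" and C: "C \<in> Obj D"
    and F: "F \<subseteq> out_of C" "Idt D C \<in> F" "\<And>f. f \<in> F \<Longrightarrow> \<sigma> (Cod D f) (ev N f y) = ev M f z"
    and M: "M \<in> Mod" "z \<in> fobj M C"
  shows "\<sigma> C y = z" "ren \<sigma> N \<in> nbd M C z F"
proof -
  show z: "\<sigma> C y = z"
    using F(3)[OF F(2)] Mev_Idt[OF N(1) C N(2)] Mev_Idt[OF M(1) C M(2)] homD(3)[OF cat Idt_in_hom[OF cat C]] by simp
  have "ev (ren \<sigma> N) f z = ev M f z" if "f \<in> F" for f
    using ev_ren[OF \<sigma> out_of_hom N(2)] F z that by auto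
  moreover have "z \<in> fobj (ren \<sigma> N) C" using z N(2) by (auto simp: fobj_ren[OF C])
  ultimately show "ren \<sigma> N \<in> nbd M C z F"
    using ren_Mod[OF \<sigma> N(1)] by (simp add: nbd_def)
qed

end

section \<open>Definable equality patterns and definability of stable open sets\<close>

locale decidable_models = coherent_models \<kappa> D for \<kappa> :: "'k rel" and D :: "('o, 'a) cat" +
  assumes decidable: "decidable_coherent_category D"
begin

text \<open>Seen in a model, the diagonal and its complement are equality and its negation: the
  union is preserved, so one of them applies, and a least subobject has no elements, so not both
  do.\<close>

lemma ex_diagonal_complement:
  assumes B: "B \<in> Obj D"
  obtains P p q d n where "is_product D B B P p q" "d \<in> hom D (Dom D d) P" "n \<in> hom D (Dom D n) P"
    "\<And>N y. N \<in> Mod \<Longrightarrow> y \<in> fobj N P \<Longrightarrow> y \<in> ev N d ` fobj N (Dom D d) \<longleftrightarrow> ev N p y = ev N q y"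
    "\<And>N y. N \<in> Mod \<Longrightarrow> y \<in> fobj N P \<Longrightarrow> y \<in> ev N n ` fobj N (Dom D n) \<longleftrightarrow> ev N p y \<noteq> ev N q y"
proof -
  obtain P p q where pr: "is_product D B B P p q" and p: "p \<in> hom D P B" and q: "q \<in> hom D P B"
    and prM: "\<And>M x y. M \<in> Mod \<Longrightarrow> x \<in> fobj M B \<Longrightarrow> y \<in> fobj M B \<Longrightarrow>
      \<exists>!z. z \<in> fobj M P \<and> ev M p z = x \<and> ev M q z = y"
    by (rule ex_product[OF B B]) (rule that, assumption+)
  note idB = Idt_in_hom[OF cat B]
  obtain d where d: "d \<in> hom D B P" "p \<cdot> d = Idt D B" "q \<cdot> d = Idt D B"
    using pr B idB unfolding is_product_def by blast
  have "complemented D P d"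
    using decidable pr d unfolding decidable_coherent_category_def by blast
  then obtain n where un: "is_union D P {d, n} (Idt D P)"
    and dis: "\<And>w. subobj D P w \<Longrightarrow> factors D w d \<Longrightarrow> factors D w n \<Longrightarrow> is_union D P {} w"
    unfolding complemented_def by blast
  have n: "n \<in> hom D (Dom D n) P" and sd: "subobj D P d" "subobj D P n"
    using un subobj_hom by (auto simp: is_union_def)
  have P: "P \<in> Obj D" using homD[OF cat p] by simp
  have Dd: "Dom D d = B" using homD[OF cat d(1)] by simp
  have cover: "y \<in> ev N d ` fobj N (Dom D d) \<or> y \<in> ev N n ` fobj N (Dom D n)"
    if N: "N \<in> Mod" and y: "y \<in> fobj N P" for N y
  proof -
    have "y \<in> ev N (Idt D P) ` fobj N (Dom D (Idt D P))"
      using Mev_Idt[OF N P y] y homD(2)[OF cat Idt_in_hom[OF cat P]] by (metis image_eqI)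
    then show ?thesis using model_union[OF N _ un] by auto
  qed
  have disj: False if N: "N \<in> Mod" and a: "a \<in> fobj N B" and b: "b \<in> fobj N (Dom D n)"
    and e: "ev N d a = ev N n b" for N a b
  proof -
    \<comment> \<open>A common element of \<open>d\<close> and \<open>n\<close> lives on their
      pullback. Its map to \<open>P\<close> need not be known to be monic, so its image is taken;
      this lies below both, is an empty union, and still would contain the image of
      \<open>z\<close>.\<close>
    obtain Q u v z where uv: "u \<in> hom D Q B" "v \<in> hom D Q (Dom D n)" "d \<cdot> u = n \<cdot> v" "z \<in> fobj N Q"
      by (rule ex_pullback_point[OF d(1) n N a b e]) (rule that, assumption+)
    have w0: "d \<cdot> u \<in> hom D Q P" by (rule Cmp_in_hom[OF cat uv(1) d(1)])
    note w0' = homD[OF cat w0]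
    have "\<forall>f\<in>Arr D. \<exists>m. is_image D f m"
      using coh unfolding coherent_category_def by (elim conjE)
    then obtain m where m: "is_image D (d \<cdot> u) m" using w0' by blast
    have min: "subobj D P k \<Longrightarrow> factors D (d \<cdot> u) k \<Longrightarrow> factors D m k" and sm: "subobj D P m" for k
      using m[unfolded is_image_def w0'(3)] by simp_all
    have "factors D (d \<cdot> u) d" using uv(1) w0' Dd by (auto simp: factors_def)
    moreover have "factors D (d \<cdot> u) n" using uv(2,3) w0' by (auto simp: factors_def)
    ultimately have "is_union D P {} m" using dis[OF sm] min sd by blast
    then have "ev N m ` fobj N (Dom D m) = {}" using model_union[OF N, of "{}" P m] by simp
    then show False using model_image[OF N m] uv(4) w0' by simp
  qed
  have dp: "y \<in> ev N d ` fobj N (Dom D d) \<longleftrightarrow> ev N p y = ev N q y" if N: "N \<in> Mod" and y: "y \<in> fobj N P" for N y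
  proof -
    have pd: "ev N p (ev N d x) = x" "ev N q (ev N d x) = x" if "x \<in> fobj N B" for x
      using Mev_Cmp[OF N d(1) p that] Mev_Cmp[OF N d(1) q that] d Mev_Idt[OF N B that] by simp_all
    show ?thesis
    proof
      assume "y \<in> ev N d ` fobj N (Dom D d)"
      then show "ev N p y = ev N q y" using pd unfolding Dd by auto
    next
      assume e: "ev N p y = ev N q y"
      have x: "ev N p y \<in> fobj N B" by (rule Mev_in[OF N p y])
      have "y = ev N d (ev N p y)"
        by (rule ex1_eq[OF prM[OF N x x]]) (use y e pd[OF x] Mev_in[OF N d(1) x] in simp_all)
      then show "y \<in> ev N d ` fobj N (Dom D d)" using x Dd by blast
    qed
  qed
  have "y \<in> ev N n ` fobj N (Dom D n) \<longleftrightarrow> ev N p y \<noteq> ev N q y" if N: "N \<in> Mod" and y: "y \<in> fobj N P" for N y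
  proof -
    have "\<not> (y \<in> ev N d ` fobj N (Dom D d) \<and> y \<in> ev N n ` fobj N (Dom D n))"
    proof
      assume "y \<in> ev N d ` fobj N (Dom D d) \<and> y \<in> ev N n ` fobj N (Dom D n)"
      then obtain a b where "a \<in> fobj N B" "b \<in> fobj N (Dom D n)" "y = ev N d a" "y = ev N n b"
        unfolding Dd by (elim conjE imageE)
      then show False using disj[OF N, of a b] by simp
    qed
    then show ?thesis using cover[OF N y] dp[OF N y] by argo
  qed
  moreover have "d \<in> hom D (Dom D d) P" using d(1) Dd by simp
  ultimately show ?thesis using that[OF pr _ n dp] by simp
qed

text \<open>The pairing of \<open>f\<close> and \<open>f'\<close> is an arrow into the product.
  Along it the diagonal or its complement is pulled back, whichever holds at
  \<open>z\<close>.\<close>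

lemma ex_pattern_pair:
  assumes f: "f \<in> hom D C B" and f': "f' \<in> hom D C B" and M: "M \<in> Mod" and z: "z \<in> fobj M C"
  obtains C' g z' where "g \<in> hom D C' C" "z' \<in> fobj M C'" "ev M g z' = z"
    "\<And>N w. N \<in> Mod \<Longrightarrow> w \<in> fobj N C' \<Longrightarrow>
      ev N f (ev N g w) = ev N f' (ev N g w) \<longleftrightarrow> ev M f z = ev M f' z"
proof -
  note fh = homD[OF cat f]
  obtain P p q d n where pr: "is_product D B B P p q" and d: "d \<in> hom D (Dom D d) P" and n: "n \<in> hom D (Dom D n) P"
    and di: "\<And>N y. N \<in> Mod \<Longrightarrow> y \<in> fobj N P \<Longrightarrow> y \<in> ev N d ` fobj N (Dom D d) \<longleftrightarrow> ev N p y = ev N q y"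
    and ni: "\<And>N y. N \<in> Mod \<Longrightarrow> y \<in> fobj N P \<Longrightarrow> y \<in> ev N n ` fobj N (Dom D n) \<longleftrightarrow> ev N p y \<noteq> ev N q y"
    by (rule ex_diagonal_complement[OF fh(5)]) (rule that, assumption+)
  have p: "p \<in> hom D P B" and q: "q \<in> hom D P B" using pr by (auto simp: is_product_def)
  obtain k where k: "k \<in> hom D C P" "p \<cdot> k = f" "q \<cdot> k = f'"
    using pr fh(4) f f' unfolding is_product_def by blast
  have kp: "ev N p (ev N k y) = ev N f y" "ev N q (ev N k y) = ev N f' y" if "N \<in> Mod" "y \<in> fobj N C" for N y
    using Mev_Cmp[OF that(1) k(1) p that(2)] Mev_Cmp[OF that(1) k(1) q that(2)] k by simp_all
  define m where "m = (if ev M f z = ev M f' z then d else n)"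
  have m: "m \<in> hom D (Dom D m) P" using d n by (simp add: m_def)
  have mi: "y \<in> ev N m ` fobj N (Dom D m) \<longleftrightarrow> (ev N p y = ev N q y \<longleftrightarrow> ev M f z = ev M f' z)"
    if "N \<in> Mod" "y \<in> fobj N P" for N y
    using di[OF that] ni[OF that] by (simp add: m_def)
  have kz: "ev M k z \<in> fobj M P" by (rule Mev_in[OF M k(1) z])
  obtain a where a: "a \<in> fobj M (Dom D m)" "ev M k z = ev M m a"
    using mi[OF M kz] kp[OF M z] by auto
  obtain C' g v z' where C': "g \<in> hom D C' C" "v \<in> hom D C' (Dom D m)" "k \<cdot> g = m \<cdot> v" "z' \<in> fobj M C'" "ev M g z' = z"
    by (rule ex_pullback_point[OF k(1) m M z a]) (rule that, assumption+)
  show ?thesis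
  proof (rule that[OF C'(1,4,5)])
    fix N w assume N: "N \<in> Mod" and w: "w \<in> fobj N C'"
    have y: "ev N g w \<in> fobj N C" by (rule Mev_in[OF N C'(1) w])
    have "ev N k (ev N g w) = ev N m (ev N v w)"
      using Mev_Cmp[OF N C'(1) k(1) w] Mev_Cmp[OF N C'(2) m w] C'(3) by simp
    moreover have "ev N v w \<in> fobj N (Dom D m)" by (rule Mev_in[OF N C'(2) w])
    ultimately show "ev N f (ev N g w) = ev N f' (ev N g w) \<longleftrightarrow> ev M f z = ev M f' z"
      using mi[OF N Mev_in[OF N k(1) y]] kp[OF N y] by simp
  qed
qed

text \<open>One pair of arrows after the other is decided by a further restriction; what was decided
  before survives precomposition.\<close>

lemma ex_pattern:
  assumes F: "finite F" "F \<subseteq> out_of C" and M: "M \<in> Mod" and C: "C \<in> Obj D" and z: "z \<in> fobj M C"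
  obtains C' g z' where "g \<in> hom D C' C" "z' \<in> fobj M C'" "ev M g z' = z" "pattern M C z F C' g"
proof -
  let ?S = "{(f, f'). f \<in> F \<and> f' \<in> F \<and> Cod D f = Cod D f'}"
  have "finite ?S" by (rule finite_subset[of _ "F \<times> F"]) (use F in auto)
  have "\<exists>C' g z'. g \<in> hom D C' C \<and> z' \<in> fobj M C' \<and> ev M g z' = z \<and>
      (\<forall>N\<in>Mod. \<forall>w\<in>fobj N C'. \<forall>(f, f')\<in>S.
        ev N f (ev N g w) = ev N f' (ev N g w) \<longleftrightarrow> ev M f z = ev M f' z)" if "S \<subseteq> ?S" for S
    using finite_subset[OF that \<open>finite ?S\<close>] that
  proof (induction S rule: finite_induct)
    case empty
    show ?case
      using Idt_in_hom[OF cat C] Mev_Idt[OF M C z] z by (intro exI[of _ C] exI[of _ "Idt D C"] exI[of _ z]) auto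
  next
    case (insert s S)
    obtain f f' where s: "s = (f, f')" "f \<in> F" "f' \<in> F" "Cod D f = Cod D f'" using insert.prems by auto
    obtain C' g z' where g: "g \<in> hom D C' C" and z': "z' \<in> fobj M C'" "ev M g z' = z"
      and S: "\<forall>N\<in>Mod. \<forall>w\<in>fobj N C'. \<forall>(f, f')\<in>S.
        ev N f (ev N g w) = ev N f' (ev N g w) \<longleftrightarrow> ev M f z = ev M f' z"
      using insert.IH[OF subset_trans[OF subset_insertI insert.prems]]
      by (elim exE conjE) (rule that, assumption+)
    have f: "f \<in> hom D C (Cod D f)" "f' \<in> hom D C (Cod D f)" using s F out_of_hom[of f] out_of_hom[of f'] by auto
    note fg = Cmp_in_hom[OF cat g f(1)] Cmp_in_hom[OF cat g f(2)]
    obtain C'' k z'' where k: "k \<in> hom D C'' C'" "z'' \<in> fobj M C''" "ev M k z'' = z'"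
      and K: "\<And>N w. N \<in> Mod \<Longrightarrow> w \<in> fobj N C'' \<Longrightarrow>
        ev N (f \<cdot> g) (ev N k w) = ev N (f' \<cdot> g) (ev N k w) \<longleftrightarrow> ev M (f \<cdot> g) z' = ev M (f' \<cdot> g) z'"
      by (rule ex_pattern_pair[OF fg M z'(1)]) (rule that, assumption+)
    have ff: "ev M (f \<cdot> g) z' = ev M f z" "ev M (f' \<cdot> g) z' = ev M f' z"
      using Mev_Cmp[OF M g f(1) z'(1)] Mev_Cmp[OF M g f(2) z'(1)] z' by simp_all
    have 1: "ev N f (ev N (g \<cdot> k) w) = ev N f' (ev N (g \<cdot> k) w) \<longleftrightarrow> ev M f z = ev M f' z"
      and 2: "\<forall>(f, f')\<in>S. ev N f (ev N (g \<cdot> k) w) = ev N f' (ev N (g \<cdot> k) w) \<longleftrightarrow> ev M f z = ev M f' z"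
      if N: "N \<in> Mod" and w: "w \<in> fobj N C''" for N w
    proof -
      have kw: "ev N k w \<in> fobj N C'" by (rule Mev_in[OF N k(1) w])
      have gk: "ev N (g \<cdot> k) w = ev N g (ev N k w)" by (rule Mev_Cmp[OF N k(1) g w])
      show "ev N f (ev N (g \<cdot> k) w) = ev N f' (ev N (g \<cdot> k) w) \<longleftrightarrow> ev M f z = ev M f' z"
        using K[OF N w] Mev_Cmp[OF N g f(1) kw] Mev_Cmp[OF N g f(2) kw] ff gk by simp
      show "\<forall>(f, f')\<in>S. ev N f (ev N (g \<cdot> k) w) = ev N f' (ev N (g \<cdot> k) w) \<longleftrightarrow> ev M f z = ev M f' z"
        unfolding gk using S N kw by blast
    qed
    have "ev M (g \<cdot> k) z'' = z" using Mev_Cmp[OF M k(1) g k(2)] k(3) z'(2) by simp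
    then show ?case
      using Cmp_in_hom[OF cat k(1) g] k(2) 1 2 s(1)
      by (intro exI[of _ C''] exI[of _ "g \<cdot> k"] exI[of _ z'']) auto
  qed
  from this[OF subset_refl] obtain C' g z' where *: "g \<in> hom D C' C" "z' \<in> fobj M C'" "ev M g z' = z"
    "\<forall>N\<in>Mod. \<forall>w\<in>fobj N C'. \<forall>(f, f')\<in>?S.
        ev N f (ev N g w) = ev N f' (ev N g w) \<longleftrightarrow> ev M f z = ev M f' z"
    by (elim exE conjE) (rule that, assumption+)
  have "pattern M C z F C' g" unfolding pattern_def using *(4) by blast
  then show ?thesis using that *(1-3) by blast
qed

text \<open>Openness gives the property only for the labels prescribed by a neighbourhood of
  \<open>M\<close>. An element of any model with the same equality pattern can be renamed to these
  labels, has the property there, and stability carries it back along the inverse isomorphism. So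
  the property holds on all of the object that defines the pattern.\<close>

lemma stable_open_definable:
  assumes A: "A \<in> Obj D" and op: "\<And>a. openin X {N \<in> Mod. a \<in> fobj N A \<and> S N a}"
    and st: "\<And>\<phi> x. \<phi> \<in> Iso \<Longrightarrow> x \<in> fobj (src \<phi>) A \<Longrightarrow> S (src \<phi>) x \<Longrightarrow> S (trg \<phi>) (cmpt \<phi> A x)"
    and M: "M \<in> Mod" and x: "x \<in> fobj M A" "S M x"
  obtains C g z where "g \<in> hom D C A" "z \<in> fobj M C" "ev M g z = x"
    "\<And>N w. N \<in> Mod \<Longrightarrow> w \<in> fobj N C \<Longrightarrow> S N (ev N g w)"
proof -
  have "M \<in> {N \<in> Mod. x \<in> fobj N A \<and> S N x}" using M x by simp
  then obtain C0 z0 F0 where 0: "C0 \<in> Obj D" "z0 \<in> fobj M C0" "finite F0" "F0 \<subseteq> out_of C0"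
    and U: "nbd M C0 z0 F0 \<subseteq> {N \<in> Mod. x \<in> fobj N A \<and> S N x}"
    by (rule nbd_base[OF op]) (rule that, assumption+)
  \<comment> \<open>The neighbourhood is refined by the element \<open>x\<close>, so that the
    renaming will also send the element under consideration to the label \<open>x\<close>, at which
    \<open>U\<close> speaks about \<open>S\<close>.\<close>
  obtain P p q w G where pq: "p \<in> hom D P C0" "q \<in> hom D P A" and w: "w \<in> fobj M P" and qw: "ev M q w = x"
    and G: "finite G" "G \<subseteq> out_of P" "q \<in> G" and sub: "nbd M P w G \<subseteq> nbd M C0 z0 F0 \<inter> nbd M A x {}"
    by (rule nbd_refine[OF M 0 A x(1), of "{}"]) (simp, simp, rule that, assumption+)
  have P: "P \<in> Obj D" using homD[OF cat pq(1)] by simp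
  define F where "F = insert (Idt D P) G"
  have F: "finite F" "F \<subseteq> out_of P" "Idt D P \<in> F" "q \<in> F"
    using G hom_out_of[OF Idt_in_hom[OF cat P]] by (auto simp: F_def)
  obtain C g z where g: "g \<in> hom D C P" and z: "z \<in> fobj M C" "ev M g z = w" and pt: "pattern M P w F C g"
    by (rule ex_pattern[OF F(1,2) M P w]) (rule that, assumption+)
  show ?thesis
  proof (rule that[OF Cmp_in_hom[OF cat g pq(2)] z(1)])
    show "ev M (q \<cdot> g) z = x" using Mev_Cmp[OF M g pq(2) z(1)] z qw by simp
    fix N v assume N: "N \<in> Mod" and v: "v \<in> fobj N C"
    obtain \<sigma> where \<sigma>: "renaming \<sigma>" and \<sigma>F: "\<And>f. f \<in> F \<Longrightarrow> \<sigma> (Cod D f) (ev N f (ev N g v)) = ev M f w"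
      by (rule pattern_renaming[OF pt F(1,2) g M w N v]) (rule that, assumption+)
    have y: "ev N g v \<in> fobj N P" by (rule Mev_in[OF N g v])
    have "ren \<sigma> N \<in> nbd M P w F" by (rule ren_in_nbd(2)[OF \<sigma> N y P F(2,3) \<sigma>F M w])
    then have S: "S (ren \<sigma> N) x" using sub U gnbd_mono_nbd(1)[of G F M P w] unfolding F_def by blast
    note r = ren_iso_Iso[OF \<sigma> N]
    have qy: "ev N q (ev N g v) \<in> fobj N A" by (rule Mev_in[OF N pq(2) y])
    have "cmpt (ren_iso \<sigma> N) A (ev N q (ev N g v)) = x"
      using r(4)[OF A qy] \<sigma>F[OF F(4)] homD[OF cat pq(2)] qw by simp
    then have "cmpt (ginv (ren_iso \<sigma> N)) A x = ev N q (ev N g v)"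
      using cmpt_ginv(1)[OF r(1) A, of "ev N q (ev N g v)"] qy r(2) by simp
    moreover have "x \<in> fobj (ren \<sigma> N) A"
      using cmpt_in[OF r(1) A, of "ev N q (ev N g v)"] qy r(2,3) \<open>cmpt (ren_iso \<sigma> N) A _ = x\<close> by simp
    ultimately have "S N (ev N q (ev N g v))"
      using st[OF ginv_Iso(1)[OF r(1)], of x] ginv_Iso(2,3)[OF r(1)] r(2,3) S by simp
    then show "S N (ev N (q \<cdot> g) v)" using Mev_Cmp[OF N g pq(2) v] by simp
  qed
qed

end

section \<open>Local homeomorphisms\<close>

lemma local_homeo_open_map:
  assumes f: "local_homeo S T f" and U: "openin S U"
  shows "openin T (f ` U)"
proof (subst openin_subopen, intro ballI)
  fix y assume "y \<in> f ` U"
  then obtain x where x: "x \<in> U" "y = f x" by blast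
  then have "x \<in> topspace S" using openin_subset[OF U] by blast
  then obtain V where V: "openin S V" "x \<in> V" "openin T (f ` V)"
    "homeomorphic_map (subtopology S V) (subtopology T (f ` V)) f"
    using f unfolding local_homeo_def by blast
  have "openin (subtopology S V) (V \<inter> U)" using U by (rule openin_subtopology_Int2)
  then have "openin (subtopology T (f ` V)) (f ` (V \<inter> U))"
    using homeomorphic_imp_open_map[OF V(4)] by (simp add: open_map_def)
  then have "openin T (f ` (V \<inter> U))" using V(3) by (rule openin_trans_full)
  then show "\<exists>T'. openin T T' \<and> y \<in> T' \<and> T' \<subseteq> f ` U" using x V(2) by (intro exI[of _ "f ` (V \<inter> U)"]) auto
qed

lemma local_homeo_injective:
  assumes f: "local_homeo S T f" and x: "x \<in> topspace S"
  obtains U where "openin S U" "x \<in> U" "inj_on f U"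
proof -
  obtain V where V: "openin S V" "x \<in> V" "homeomorphic_map (subtopology S V) (subtopology T (f ` V)) f"
    using f x unfolding local_homeo_def by blast
  have "inj_on f (topspace (subtopology S V))" using V(3) homeomorphic_eq_everything_map by blast
  then have "inj_on f V" using openin_subset[OF V(1)] by (simp add: Int_absorb1 topspace_subtopology)
  then show ?thesis using that V by blast
qed

text \<open>On an open set where it is injective, a continuous open map is a homeomorphism onto its
  image.\<close>

lemma local_homeoI:
  assumes c: "continuous_map S T f" and op: "\<And>U. openin S U \<Longrightarrow> openin T (f ` U)"
    and inj: "\<And>x. x \<in> topspace S \<Longrightarrow> \<exists>U. openin S U \<and> x \<in> U \<and> inj_on f U"
  shows "local_homeo S T f"
  unfolding local_homeo_def
proof (intro conjI ballI c)
  fix x assume "x \<in> topspace S"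
  then obtain U where U: "openin S U" "x \<in> U" "inj_on f U" using inj by blast
  have tS: "topspace (subtopology S U) = U" using openin_subset[OF U(1)] by (simp add: Int_absorb1 topspace_subtopology)
  have tT: "topspace (subtopology T (f ` U)) = f ` U"
    using openin_subset[OF op[OF U(1)]] by (simp add: Int_absorb1 topspace_subtopology)
  have "continuous_map (subtopology S U) (subtopology T (f ` U)) f"
    by (intro continuous_map_into_subtopology continuous_map_from_subtopology c) (simp add: tS)
  moreover have "open_map (subtopology S U) (subtopology T (f ` U)) f"
    unfolding open_map_def
  proof (intro allI impI)
    fix V assume "openin (subtopology S U) V"
    then have V: "openin S V" "V \<subseteq> U" using openin_open_subtopology[OF U(1)] by auto
    show "openin (subtopology T (f ` U)) (f ` V)"
      using op[OF V(1)] V(2) openin_open_subtopology[OF op[OF U(1)]] by auto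
  qed
  ultimately have "homeomorphic_map (subtopology S U) (subtopology T (f ` U)) f"
    by (intro bijective_open_imp_homeomorphic_map) (simp_all only: tS tT U(3))
  then show "\<exists>U. openin S U \<and> x \<in> U \<and> openin T (f ` U) \<and> homeomorphic_map (subtopology S U) (subtopology T (f ` U)) f"
    using U op by blast
qed

section \<open>Equivariant sheaves over the groupoid of models\<close>

locale model_sheaf = decidable_models \<kappa> D for \<kappa> :: "'k rel" and D :: "('o, 'a) cat" +
  fixes E :: "(('k, 'o, 'a) model, ('k, 'o, 'a) model_map, 'u) action"
  assumes E: "equivariant_sheaf Grpd E"
begin

abbreviation "TE \<equiv> topspace (total E)"

lemma proj_lh: "local_homeo (total E) X (proj E)"
  using E by (simp add: equivariant_sheaf_def)

lemma proj_cont: "continuous_map (total E) X (proj E)"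
  using proj_lh by (simp add: local_homeo_def)

lemma proj_Mod: "e \<in> TE \<Longrightarrow> proj E e \<in> Mod"
  using continuous_map_image_subset_topspace[OF proj_cont] topX by blast

lemmas proj_open = local_homeo_open_map[OF proj_lh]

lemma act_dom_iff: "(\<phi>, e) \<in> act_dom Grpd E \<longleftrightarrow> \<phi> \<in> Iso \<and> e \<in> TE \<and> src \<phi> = proj E e"
  by (simp add: act_dom_def topG)

lemma act_cont: "continuous_map (subtopology (prod_topology GG (total E)) (act_dom Grpd E)) (total E) (act E)"
  using E by (simp add: equivariant_sheaf_def)

lemma topspace_act_dom: "topspace (subtopology (prod_topology GG (total E)) (act_dom Grpd E)) = act_dom Grpd E"
  by (auto simp: topspace_subtopology act_dom_def topG)

lemma act_in:
  assumes "\<phi> \<in> Iso" "e \<in> TE" "src \<phi> = proj E e"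
  shows "act E (\<phi>, e) \<in> TE" "proj E (act E (\<phi>, e)) = trg \<phi>"
proof -
  have d: "(\<phi>, e) \<in> act_dom Grpd E" using assms by (simp add: act_dom_iff)
  then show "act E (\<phi>, e) \<in> TE"
    using continuous_map_image_subset_topspace[OF act_cont] topspace_act_dom by blast
  show "proj E (act E (\<phi>, e)) = trg \<phi>" using E d unfolding equivariant_sheaf_def by fastforce
qed

lemma act_gid: "e \<in> TE \<Longrightarrow> act E (gid (proj E e), e) = e"
  using E unfolding equivariant_sheaf_def by simp

lemma act_gcmp:
  assumes "\<phi> \<in> Iso" "e \<in> TE" "src \<phi> = proj E e" "\<psi> \<in> Iso" "src \<psi> = trg \<phi>"
  shows "act E (\<psi> \<diamondop> \<phi>, e) = act E (\<psi>, act E (\<phi>, e))"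
proof -
  have d: "(\<phi>, e) \<in> act_dom Grpd E" using assms by (simp add: act_dom_iff)
  have "\<forall>(f, x)\<in>act_dom Grpd E. \<forall>g\<in>topspace (ar_top Grpd). source Grpd g = target Grpd f \<longrightarrow>
      act E (g, act E (f, x)) = act E (mult Grpd g f, x)"
    using E unfolding equivariant_sheaf_def by (elim conjE)
  from bspec[OF this d] show ?thesis using assms by (simp add: topG)
qed

lemma act_ginv:
  assumes "\<phi> \<in> Iso" "e \<in> TE"
  shows "src \<phi> = proj E e \<Longrightarrow> act E (ginv \<phi>, act E (\<phi>, e)) = e"
    "trg \<phi> = proj E e \<Longrightarrow> act E (\<phi>, act E (ginv \<phi>, e)) = e"
  using act_gcmp[of \<phi> e "ginv \<phi>"] act_gcmp[of "ginv \<phi>" e \<phi>] ginv_Iso[OF assms(1)] assms act_gid[OF assms(2)]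
  by simp_all

text \<open>
  As a space, the sheaf of elements of \<open>A\<close> is the disjoint union, over all labels \<open>a\<close>, of the open
  sets \<open>{N. a \<in> fobj N A}\<close>; so continuity is tested label by label.
\<close>

definition EL where
  "EL A = {(N, x). N \<in> Mod \<and> x \<in> fobj N A}"

definition HomE where
  "HomE A = {h \<in> extensional (EL A).
    (\<forall>N\<in>Mod. \<forall>x\<in>fobj N A. h (N, x) \<in> TE \<and> proj E (h (N, x)) = N) \<and>
    (\<forall>\<phi>\<in>Iso. \<forall>x\<in>fobj (src \<phi>) A. h (trg \<phi>, cmpt \<phi> A x) = act E (\<phi>, h (src \<phi>, x))) \<and>
    (\<forall>W a. openin (total E) W \<longrightarrow> openin X {N \<in> Mod. a \<in> fobj N A \<and> h (N, a) \<in> W})}"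

lemma HomE_in: "h \<in> HomE A \<Longrightarrow> N \<in> Mod \<Longrightarrow> x \<in> fobj N A \<Longrightarrow> h (N, x) \<in> TE"
  and HomE_proj: "h \<in> HomE A \<Longrightarrow> N \<in> Mod \<Longrightarrow> x \<in> fobj N A \<Longrightarrow> proj E (h (N, x)) = N"
  and HomE_equiv: "h \<in> HomE A \<Longrightarrow> \<phi> \<in> Iso \<Longrightarrow> x \<in> fobj (src \<phi>) A \<Longrightarrow>
    h (trg \<phi>, cmpt \<phi> A x) = act E (\<phi>, h (src \<phi>, x))"
  and HomE_open: "h \<in> HomE A \<Longrightarrow> openin (total E) W \<Longrightarrow> openin X {N \<in> Mod. a \<in> fobj N A \<and> h (N, a) \<in> W}"
  and HomE_ext: "h \<in> HomE A \<Longrightarrow> h \<in> extensional (EL A)"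
  by (simp_all add: HomE_def)

lemma HomE_eqI:
  assumes "h \<in> HomE A" "k \<in> HomE A" "\<And>N x. N \<in> Mod \<Longrightarrow> x \<in> fobj N A \<Longrightarrow> h (N, x) = k (N, x)"
  shows "h = k"
  by (rule extensionalityI[OF HomE_ext[OF assms(1)] HomE_ext[OF assms(2)]]) (use assms(3) in \<open>auto simp: EL_def\<close>)

definition pre :: "'a \<Rightarrow> (('k, 'o, 'a) model \<times> 'k hset \<Rightarrow> 'u) \<Rightarrow> ('k, 'o, 'a) model \<times> 'k hset \<Rightarrow> 'u" where
  "pre f h = (\<lambda>(N, x)\<in>EL (Dom D f). h (N, ev N f x))"

lemma pre_apply: "f \<in> hom D C A \<Longrightarrow> N \<in> Mod \<Longrightarrow> x \<in> fobj N C \<Longrightarrow> pre f h (N, x) = h (N, ev N f x)"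
  using homD(2)[OF cat] by (simp add: pre_def EL_def)

lemma pre_HomE:
  assumes f: "f \<in> hom D C A" and h: "h \<in> HomE A"
  shows "pre f h \<in> HomE C"
  unfolding HomE_def
proof (intro CollectI conjI ballI allI impI)
  note p = pre_apply[OF f] and fh = homD[OF cat f]
  show "pre f h \<in> extensional (EL C)" using fh by (simp add: pre_def)
  fix N x assume N: "N \<in> Mod" "x \<in> fobj N C"
  show "pre f h (N, x) \<in> TE" "proj E (pre f h (N, x)) = N"
    unfolding p[OF N]
    using HomE_in[OF h N(1) Mev_in[OF N(1) f N(2)]] HomE_proj[OF h N(1) Mev_in[OF N(1) f N(2)]] by blast+
next
  note p = pre_apply[OF f] and fh = homD[OF cat f]
  fix \<phi> x assume \<phi>: "\<phi> \<in> Iso" and x: "x \<in> fobj (src \<phi>) C"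
  show "pre f h (trg \<phi>, cmpt \<phi> C x) = act E (\<phi>, pre f h (src \<phi>, x))"
    unfolding p[OF Iso_src[OF \<phi>] x] p[OF Iso_trg[OF \<phi>] cmpt_in[OF \<phi> fh(4) x]]
    using HomE_equiv[OF h \<phi> Mev_in[OF Iso_src[OF \<phi>] f x]] cmpt_natural[OF \<phi> f x] by simp
next
  note p = pre_apply[OF f] and fh = homD[OF cat f]
  fix W a assume W: "openin (total E) W"
  \<comment> \<open>The image of the element labelled \<open>a\<close> may have a different label
    \<open>b\<close> in each model. Every fixed choice of \<open>b\<close> is an open condition, and
    the union over \<open>b\<close> loses nothing.\<close>
  have "openin X ({N \<in> Mod. a \<in> fobj N C \<and> (\<forall>g\<in>{f}. ev N g a = b)} \<inter> {N \<in> Mod. b \<in> fobj N A \<and> h (N, b) \<in> W})" for b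
    using hom_out_of[OF f] by (intro openin_Int HomE_open[OF h W] openin_values fh(4)) auto
  then have "openin X (\<Union>b. {N \<in> Mod. a \<in> fobj N C \<and> (\<forall>g\<in>{f}. ev N g a = b)} \<inter> {N \<in> Mod. b \<in> fobj N A \<and> h (N, b) \<in> W})"
    by (intro openin_Union) blast
  also have "(\<Union>b. {N \<in> Mod. a \<in> fobj N C \<and> (\<forall>g\<in>{f}. ev N g a = b)} \<inter> {N \<in> Mod. b \<in> fobj N A \<and> h (N, b) \<in> W}) =
      {N \<in> Mod. a \<in> fobj N C \<and> pre f h (N, a) \<in> W}"
    using p Mev_in[OF _ f] by auto
  finally show "openin X {N \<in> Mod. a \<in> fobj N C \<and> pre f h (N, a) \<in> W}" .
qed

lemma pre_Cmp:
  assumes f: "f \<in> hom D B A" and g: "g \<in> hom D C B" and h: "h \<in> HomE A"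
  shows "pre (f \<cdot> g) h = pre g (pre f h)"
proof (rule HomE_eqI[OF pre_HomE[OF Cmp_in_hom[OF cat g f] h] pre_HomE[OF g pre_HomE[OF f h]]])
  fix N x assume N: "N \<in> Mod" "x \<in> fobj N C"
  show "pre (f \<cdot> g) h (N, x) = pre g (pre f h) (N, x)"
    unfolding pre_apply[OF Cmp_in_hom[OF cat g f] N] pre_apply[OF g N] pre_apply[OF f N(1) Mev_in[OF N(1) g N(2)]]
      Mev_Cmp[OF N(1) g f N(2)] by (rule refl)
qed

lemma pre_Idt:
  assumes A: "A \<in> Obj D" and h: "h \<in> HomE A"
  shows "pre (Idt D A) h = h"
  by (rule HomE_eqI[OF pre_HomE[OF Idt_in_hom[OF cat A] h] h])
    (simp add: pre_apply[OF Idt_in_hom[OF cat A]] Mev_Idt[OF _ A])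

lemma ex_section_nbd:
  assumes "e \<in> TE"
  obtains Q where "openin (total E) Q" "e \<in> Q" "inj_on (proj E) Q"
  by (rule local_homeo_injective[OF proj_lh assms])

text \<open>The projection of \<open>E\<close> is locally injective, so maps that agree at a point
  agree near it. The set where they agree is therefore open, and it is stable because both maps are
  equivariant; hence it contains a definable neighbourhood of the point.\<close>

lemma HomE_equalizer:
  assumes A: "A \<in> Obj D" and h: "h \<in> HomE A" and k: "k \<in> HomE A" and M: "M \<in> Mod" and x: "x \<in> fobj M A"
    and e: "h (M, x) = k (M, x)"
  obtains C g z where "g \<in> hom D C A" "z \<in> fobj M C" "ev M g z = x" "pre g h = pre g k"
proof -
  let ?S = "\<lambda>N y. h (N, y) = k (N, y)"
  have op: "openin X {N \<in> Mod. a \<in> fobj N A \<and> ?S N a}" (is "openin X ?U") for a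
  proof (subst openin_subopen, intro ballI)
    fix N assume N: "N \<in> ?U"
    then have "h (N, a) \<in> TE" using HomE_in[OF h] by blast
    then obtain Q where Q: "openin (total E) Q" "h (N, a) \<in> Q" "inj_on (proj E) Q"
      by (rule ex_section_nbd)
    let ?T = "{N \<in> Mod. a \<in> fobj N A \<and> h (N, a) \<in> Q} \<inter> {N \<in> Mod. a \<in> fobj N A \<and> k (N, a) \<in> Q}"
    have "openin X ?T" by (intro openin_Int HomE_open[OF h Q(1)] HomE_open[OF k Q(1)])
    moreover have "N \<in> ?T" using N Q(2) by auto
    moreover have "?T \<subseteq> ?U"
    proof
      fix N' assume N': "N' \<in> ?T"
      then have "h (N', a) = k (N', a)"
        by (intro inj_onD[OF Q(3)]) (use HomE_proj[OF h] HomE_proj[OF k] in auto)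
      then show "N' \<in> ?U" using N' by blast
    qed
    ultimately show "\<exists>T. openin X T \<and> N \<in> T \<and> T \<subseteq> ?U" by blast
  qed
  obtain C g z where g: "g \<in> hom D C A" "z \<in> fobj M C" "ev M g z = x"
    and S: "\<And>N w. N \<in> Mod \<Longrightarrow> w \<in> fobj N C \<Longrightarrow> ?S N (ev N g w)"
  proof (rule stable_open_definable[OF A op _ M x e])
    fix \<phi> x assume "\<phi> \<in> Iso" "x \<in> fobj (src \<phi>) A" "h (src \<phi>, x) = k (src \<phi>, x)"
    then show "h (trg \<phi>, cmpt \<phi> A x) = k (trg \<phi>, cmpt \<phi> A x)"
      using HomE_equiv[OF h] HomE_equiv[OF k] by simp
  qed (rule that, assumption+)
  have "pre g h = pre g k"
    by (rule HomE_eqI[OF pre_HomE[OF g(1) h] pre_HomE[OF g(1) k]]) (simp add: pre_apply[OF g(1)] S)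
  then show ?thesis using that g by blast
qed

text \<open>Sections of a local homeomorphism are open: in a sheet \<open>Q\<close> around a value,
  a point whose model also has its value of \<open>h\<close> in \<open>Q\<close> must be that
  value.\<close>

lemma HomE_open_image:
  assumes h: "h \<in> HomE A" and W: "openin X W" "W \<subseteq> {N. a \<in> fobj N A}"
  shows "openin (total E) ((\<lambda>N. h (N, a)) ` W)"
proof (subst openin_subopen, intro ballI)
  fix e assume "e \<in> (\<lambda>N. h (N, a)) ` W"
  then obtain N0 where N0: "N0 \<in> W" "e = h (N0, a)" by blast
  have WM: "W \<subseteq> Mod" using openin_subset[OF W(1)] topX by simp
  have N0': "N0 \<in> Mod" "a \<in> fobj N0 A" using N0 WM W(2) by blast+
  have "e \<in> TE" using N0(2) HomE_in[OF h N0'] by simp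
  then obtain Q where Q: "openin (total E) Q" "e \<in> Q" "inj_on (proj E) Q"
    by (rule ex_section_nbd)
  let ?V = "W \<inter> {N \<in> Mod. a \<in> fobj N A \<and> h (N, a) \<in> Q}"
  let ?T = "Q \<inter> {e \<in> TE. proj E e \<in> ?V}"
  have V: "openin X ?V" by (intro openin_Int W(1) HomE_open[OF h Q(1)])
  have "openin (total E) ?T"
    by (rule openin_Int[OF Q(1) openin_continuous_map_preimage[OF proj_cont V]])
  moreover have "e \<in> ?T" using N0 N0' Q(2) HomE_proj[OF h N0'] \<open>e \<in> TE\<close> by simp
  moreover have "?T \<subseteq> (\<lambda>N. h (N, a)) ` W"
  proof
    fix r assume r: "r \<in> ?T"
    let ?N = "proj E r"
    have N: "?N \<in> W" "?N \<in> Mod" "a \<in> fobj ?N A" "h (?N, a) \<in> Q" using r by auto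
    have "r = h (?N, a)"
      by (rule inj_onD[OF Q(3)]) (use r N HomE_proj[OF h N(2,3)] in auto)
    then show "r \<in> (\<lambda>N. h (N, a)) ` W" using N(1) by blast
  qed
  ultimately show "\<exists>T. openin (total E) T \<and> e \<in> T \<and> T \<subseteq> (\<lambda>N. h (N, a)) ` W" by blast
qed

lemma openin_TE: "openin (total E) W \<Longrightarrow> W \<subseteq> TE"
  by (rule openin_subset)

text \<open>Continuity of the action at a unit, with the open set of the product replaced by a box
  \<open>V \<times> Q1\<close> and its relative nature by side conditions.\<close>

lemma act_nbd:
  assumes r: "r \<in> TE" and Q0: "openin (total E) Q0" "r \<in> Q0"
  obtains V Q1 where "openin GG V" "gid (proj E r) \<in> V" "openin (total E) Q1" "r \<in> Q1"
    "\<And>\<phi> e. \<phi> \<in> V \<Longrightarrow> e \<in> Q1 \<Longrightarrow> \<phi> \<in> Iso \<Longrightarrow> src \<phi> = proj E e \<Longrightarrow> act E (\<phi>, e) \<in> Q0"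
proof -
  let ?P = "prod_topology GG (total E)"
  have "openin (subtopology ?P (act_dom Grpd E)) {x \<in> topspace (subtopology ?P (act_dom Grpd E)). act E x \<in> Q0}"
    by (rule openin_continuous_map_preimage[OF act_cont Q0(1)])
  then obtain T where T: "openin ?P T" "{x \<in> act_dom Grpd E. act E x \<in> Q0} = T \<inter> act_dom Grpd E"
    unfolding topspace_act_dom openin_subtopology by blast
  have g: "(gid (proj E r), r) \<in> act_dom Grpd E"
    using r gid_Iso[OF proj_Mod[OF r]] by (simp add: act_dom_iff)
  then have "(gid (proj E r), r) \<in> {x \<in> act_dom Grpd E. act E x \<in> Q0}"
    using act_gid[OF r] Q0(2) by simp
  then have gT: "(gid (proj E r), r) \<in> T" unfolding T(2) by (rule IntD1)
  obtain V Q1 where V: "openin GG V" "gid (proj E r) \<in> V" "openin (total E) Q1" "r \<in> Q1" "V \<times> Q1 \<subseteq> T"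
    using T(1)[unfolded openin_prod_topology_alt, rule_format, OF gT] by (elim exE conjE) (rule that, assumption+)
  show ?thesis
  proof (rule that[OF V(1-4)])
    fix \<phi> e assume "\<phi> \<in> V" "e \<in> Q1" "\<phi> \<in> Iso" "src \<phi> = proj E e"
    then have "(\<phi>, e) \<in> T \<inter> act_dom Grpd E" using V(5) openin_TE[OF V(3)] by (auto simp: act_dom_iff)
    then show "act E (\<phi>, e) \<in> Q0" unfolding T(2)[symmetric] by simp
  qed
qed

end

context model_sheaf
begin

text \<open>The section is the inverse of the projection on a sheet \<open>Q0\<close>. An
  isomorphism near the identity keeps points inside \<open>Q0\<close>, where a point is determined
  by its model; so it has to carry the value of the section to the value of the section.\<close>

lemma ex_section:
  assumes r: "r \<in> TE"
  obtains U s C z F where "openin X U" "continuous_map (subtopology X U) (total E) s"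
    "\<And>N. N \<in> U \<Longrightarrow> s N \<in> TE \<and> proj E (s N) = N" "s (proj E r) = r"
    "C \<in> Obj D" "z \<in> fobj (proj E r) C" "finite F" "F \<subseteq> out_of C" "nbd (proj E r) C z F \<subseteq> U"
    "\<And>\<phi>. \<phi> \<in> gnbd (proj E r) C z F \<Longrightarrow> act E (\<phi>, s (src \<phi>)) = s (trg \<phi>)"
proof -
  let ?M = "proj E r"
  note M = proj_Mod[OF r]
  obtain Q0 where Q0: "openin (total E) Q0" "r \<in> Q0" "inj_on (proj E) Q0"
    by (rule ex_section_nbd[OF r])
  define s where "s = inv_into Q0 (proj E)"
  have s: "s N \<in> Q0" "proj E (s N) = N" if "N \<in> proj E ` Q0" for N
    using inv_into_into[OF that] f_inv_into_f[OF that] by (simp_all add: s_def)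
  have s_eq: "s (proj E e) = e" if "e \<in> Q0" for e
    using inv_into_f_f[OF Q0(3) that] by (simp add: s_def)
  note sub = openin_TE[OF Q0(1)]
  note oQ = proj_open[OF Q0(1)]
  have ts: "topspace (subtopology X (proj E ` Q0)) = proj E ` Q0"
    using openin_subset[OF oQ] by (simp only: topspace_subtopology Int_absorb1)
  have cs: "continuous_map (subtopology X (proj E ` Q0)) (total E) s"
    unfolding continuous_map_def ts
  proof (intro conjI allI impI)
    show "s \<in> proj E ` Q0 \<rightarrow> topspace (total E)" using s(1) sub by blast
    fix W assume W: "openin (total E) W"
    have "{N \<in> proj E ` Q0. s N \<in> W} = proj E ` (Q0 \<inter> W)"
    proof
      show "{N \<in> proj E ` Q0. s N \<in> W} \<subseteq> proj E ` (Q0 \<inter> W)"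
      proof
        fix N assume N: "N \<in> {N \<in> proj E ` Q0. s N \<in> W}"
        then have "s N \<in> Q0 \<inter> W" using s(1) by simp
        moreover have "N = proj E (s N)" using N s(2) by simp
        ultimately show "N \<in> proj E ` (Q0 \<inter> W)" by (rule rev_image_eqI)
      qed
      show "proj E ` (Q0 \<inter> W) \<subseteq> {N \<in> proj E ` Q0. s N \<in> W}" using s_eq by auto
    qed
    then show "openin (subtopology X (proj E ` Q0)) {N \<in> proj E ` Q0. s N \<in> W}"
      using proj_open[OF openin_Int[OF Q0(1) W]] openin_open_subtopology[OF oQ] by auto
  qed
  obtain V Q1 where V: "openin GG V" "gid ?M \<in> V" "openin (total E) Q1" "r \<in> Q1"
    and act: "\<And>\<phi> e. \<phi> \<in> V \<Longrightarrow> e \<in> Q1 \<Longrightarrow> \<phi> \<in> Iso \<Longrightarrow> src \<phi> = proj E e \<Longrightarrow> act E (\<phi>, e) \<in> Q0"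
    by (rule act_nbd[OF r Q0(1,2)]) (rule that, assumption+)
  \<comment> \<open>Over these models the point of \<open>Q0\<close> that the section picks lies in
    \<open>Q1\<close> as well, so \<open>act\<close> applies to it.\<close>
  let ?U = "proj E ` (Q0 \<inter> Q1)"
  have oU: "openin X ?U" by (rule proj_open[OF openin_Int[OF Q0(1) V(3)]])
  have MU: "?M \<in> ?U" using Q0(2) V(4) by blast
  obtain C1 z1 F1 where 1: "C1 \<in> Obj D" "z1 \<in> fobj ?M C1" "finite F1" "F1 \<subseteq> out_of C1" and n1: "nbd ?M C1 z1 F1 \<subseteq> ?U"
    by (rule nbd_base[OF oU MU]) (rule that, assumption+)
  obtain C2 z2 F2 where 2: "C2 \<in> Obj D" "z2 \<in> fobj ?M C2" "finite F2" "F2 \<subseteq> out_of C2" and n2: "gnbd ?M C2 z2 F2 \<subseteq> V"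
    by (rule gnbd_base[OF V(1) M V(2)]) (rule that, assumption+)
  obtain C p z F where p: "p \<in> hom D C C1" and C: "z \<in> fobj ?M C" "finite F" "F \<subseteq> out_of C"
    and n: "nbd ?M C z F \<subseteq> nbd ?M C1 z1 F1 \<inter> nbd ?M C2 z2 F2" and gn: "gnbd ?M C z F \<subseteq> gnbd ?M C1 z1 F1 \<inter> gnbd ?M C2 z2 F2"
    by (rule nbd_refine[OF M 1 2]) (rule that, assumption+)
  have nU: "nbd ?M C z F \<subseteq> ?U" using n n1 by blast
  show ?thesis
  proof (rule that[OF oQ cs])
    show "s N \<in> TE \<and> proj E (s N) = N" if "N \<in> proj E ` Q0" for N
      using s[OF that] sub by blast
    show "s ?M = r" by (rule s_eq[OF Q0(2)])
    show "C \<in> Obj D" using homD[OF cat p] by simp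
    show "nbd ?M C z F \<subseteq> proj E ` Q0" using nU by blast
    fix \<phi> assume \<phi>: "\<phi> \<in> gnbd ?M C z F"
    then have \<phi>I: "\<phi> \<in> Iso" and sU: "src \<phi> \<in> ?U" and tU: "trg \<phi> \<in> ?U" and \<phi>V: "\<phi> \<in> V"
      using nU gn n2 by (auto simp: gnbd_def)
    obtain e where e: "e \<in> Q0" "e \<in> Q1" "src \<phi> = proj E e" using sU by blast
    have "act E (\<phi>, e) \<in> Q0" by (rule act[OF \<phi>V e(2) \<phi>I e(3)])
    moreover have "proj E (act E (\<phi>, e)) = trg \<phi>"
      using act_in(2)[OF \<phi>I _ e(3)] e(1) sub by blast
    ultimately have "s (trg \<phi>) = act E (\<phi>, e)" using s_eq[of "act E (\<phi>, e)"] by simp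
    then show "act E (\<phi>, s (src \<phi>)) = s (trg \<phi>)" using s_eq[OF e(1)] e(3) by simp
  qed (rule C)+
qed

text \<open>
  A local section through \<open>r\<close> is fixed by all isomorphisms near the identity, hence by all those
  fixing finitely many labels \<open>ev M f z\<close>. Given \<open>w\<close> with the same equality pattern in another model \<open>N\<close>,
  an isomorphism moves the corresponding elements of \<open>N\<close> to these labels; pulling the section back
  along it defines the map at \<open>w\<close>, independently of the isomorphism.
\<close>

lemma HomE_generate:
  assumes r: "r \<in> TE"
  obtains A h x where "A \<in> Obj D" "h \<in> HomE A" "x \<in> fobj (proj E r) A" "h (proj E r, x) = r"
proof -
  define M where "M = proj E r"
  have M: "M \<in> Mod" using proj_Mod[OF r] by (simp add: M_def)
  obtain U s C z F0 where U: "openin X U" and cs: "continuous_map (subtopology X U) (total E) s"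
    and s: "\<And>N. N \<in> U \<Longrightarrow> s N \<in> TE \<and> proj E (s N) = N" and sM: "s M = r"
    and C: "C \<in> Obj D" and z: "z \<in> fobj M C" and F0: "finite F0" "F0 \<subseteq> out_of C" and nU0: "nbd M C z F0 \<subseteq> U"
    and inv0: "\<And>\<phi>. \<phi> \<in> gnbd M C z F0 \<Longrightarrow> act E (\<phi>, s (src \<phi>)) = s (trg \<phi>)"
    by (rule ex_section[OF r, folded M_def]) (rule that, assumption+)
  \<comment> \<open>With the identity in \<open>F\<close>, renamings according to the pattern reach
    the label \<open>z\<close> itself.\<close>
  define F where "F = insert (Idt D C) F0"
  have F: "finite F" "F \<subseteq> out_of C" "Idt D C \<in> F"
    using F0 hom_out_of[OF Idt_in_hom[OF cat C]] by (auto simp: F_def)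
  have nU: "nbd M C z F \<subseteq> U" using gnbd_mono_nbd(1)[of F0 F] nU0 unfolding F_def by blast
  have inv: "act E (\<phi>, s (src \<phi>)) = s (trg \<phi>)" if "\<phi> \<in> gnbd M C z F" for \<phi>
    using inv0 gnbd_mono_nbd(2)[of F0 F] that unfolding F_def by blast
  obtain C' g z' where g: "g \<in> hom D C' C" and z': "z' \<in> fobj M C'" "ev M g z' = z" and pt: "pattern M C z F C' g"
    by (rule ex_pattern[OF F(1,2) M C z]) (rule that, assumption+)
  have C': "C' \<in> Obj D" using homD[OF cat g] by simp
  \<comment> \<open>A good isomorphism brings the element below \<open>w\<close> to the label
    \<open>z\<close> in a model where the section \<open>s\<close> is defined and invariant.\<close>
  define good where "good \<phi> N w \<longleftrightarrow> \<phi> \<in> Iso \<and> src \<phi> = N \<and> trg \<phi> \<in> nbd M C z F \<and> cmpt \<phi> C (ev N g w) = z" for \<phi> N w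
  have ex_good: "\<exists>\<phi>. good \<phi> N w" if N: "N \<in> Mod" and w: "w \<in> fobj N C'" for N w
  proof -
    obtain \<sigma> where \<sigma>: "renaming \<sigma>" and \<sigma>F: "\<And>f. f \<in> F \<Longrightarrow> \<sigma> (Cod D f) (ev N f (ev N g w)) = ev M f z"
      by (rule pattern_renaming[OF pt F(1,2) g M z N w]) (rule that, assumption+)
    note y = Mev_in[OF N g w]
    note rn = ren_in_nbd[OF \<sigma> N y C F(2,3) \<sigma>F M z] and r = ren_iso_Iso[OF \<sigma> N]
    have "good (ren_iso \<sigma> N) N w" using rn r(1-3) r(4)[OF C y] by (simp add: good_def)
    then show ?thesis ..
  qed
  have goodD: "\<phi> \<in> Iso" "src \<phi> = N" "trg \<phi> \<in> nbd M C z F" "cmpt \<phi> C (ev N g w) = z"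
    "s (trg \<phi>) \<in> TE" "proj E (s (trg \<phi>)) = trg \<phi>" if "good \<phi> N w" for \<phi> N w
    using that s nU unfolding good_def by auto
  define h0 where "h0 N w = (let \<phi> = SOME \<phi>. good \<phi> N w in act E (ginv \<phi>, s (trg \<phi>)))" for N w
  have indep: "act E (ginv \<phi>, s (trg \<phi>)) = act E (ginv \<psi>, s (trg \<psi>))"
    if \<phi>: "good \<phi> N w" and \<psi>: "good \<psi> N w" and w: "w \<in> fobj N C'" for \<phi> \<psi> N w
  proof -
    note p = goodD[OF \<phi>] and q = goodD[OF \<psi>] and ip = ginv_Iso[OF goodD(1)[OF \<phi>]] and iq = ginv_Iso[OF goodD(1)[OF \<psi>]]
    \<comment> \<open>The comparison of two good isomorphisms fixes the label \<open>z\<close> and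
      has both ends in the neighbourhood. It thus lies in \<open>gnbd\<close>, and \<open>s\<close>
      is invariant under it.\<close>
    let ?\<chi> = "\<psi> \<diamondop> ginv \<phi>"
    have NM: "N \<in> Mod" using Iso_src[OF p(1)] p(2) by simp
    have c: "?\<chi> \<in> Iso" "src ?\<chi> = trg \<phi>" "trg ?\<chi> = trg \<psi>"
      using gcmp_Iso[OF ip(1) q(1)] ip p(2) q(2) by simp_all
    have zt: "z \<in> fobj (trg \<phi>) C" using p(3) by (simp add: nbd_def)
    have "cmpt ?\<chi> C z = cmpt \<psi> C (cmpt (ginv \<phi>) C z)"
      by (rule cmpt_gcmp[OF ip(1) C]) (simp add: ip zt)
    also have "cmpt (ginv \<phi>) C z = ev N g w"
      using cmpt_ginv(1)[OF p(1) C, of "ev N g w"] Mev_in[OF NM g w] p(2,4) by simp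
    also have "cmpt \<psi> C (ev N g w) = z" by (rule q(4))
    finally have "?\<chi> \<in> gnbd M C z F" using c p(3) q(3) by (simp add: gnbd_def)
    then have "act E (?\<chi>, s (trg \<phi>)) = s (trg \<psi>)" using inv c by metis
    moreover have "act E (?\<chi>, s (trg \<phi>)) = act E (\<psi>, act E (ginv \<phi>, s (trg \<phi>)))"
      by (rule act_gcmp[OF ip(1) p(5)]) (use p q ip in simp_all)
    ultimately have 1: "act E (\<psi>, act E (ginv \<phi>, s (trg \<phi>))) = s (trg \<psi>)" by simp
    have a: "act E (ginv \<phi>, s (trg \<phi>)) \<in> TE" "proj E (act E (ginv \<phi>, s (trg \<phi>))) = N"
      using act_in[OF ip(1) p(5)] p ip by simp_all
    have "act E (ginv \<psi>, act E (\<psi>, act E (ginv \<phi>, s (trg \<phi>)))) = act E (ginv \<phi>, s (trg \<phi>))"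
      by (rule act_ginv(1)[OF q(1) a(1)]) (simp add: q(2) a(2))
    then show ?thesis using 1 by simp
  qed
  have h0_good: "h0 N w = act E (ginv \<phi>, s (trg \<phi>))" if "good \<phi> N w" "w \<in> fobj N C'" for N w \<phi>
    unfolding h0_def Let_def by (rule indep[OF someI that(1,2)]) (rule that(1))
  have h0_in: "h0 N w \<in> TE" "proj E (h0 N w) = N" if N: "N \<in> Mod" and w: "w \<in> fobj N C'" for N w
  proof -
    obtain \<phi> where \<phi>: "good \<phi> N w" using ex_good[OF N w] by blast
    note p = goodD[OF \<phi>] and ip = ginv_Iso[OF goodD(1)[OF \<phi>]]
    show "h0 N w \<in> TE" "proj E (h0 N w) = N"
      unfolding h0_good[OF \<phi> w] using act_in[OF ip(1) p(5)] p ip by simp_all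
  qed
  have act_h0: "act E (\<phi>, h0 N w) = s (trg \<phi>)" if "good \<phi> N w" "w \<in> fobj N C'" for \<phi> N w
    unfolding h0_good[OF that] by (rule act_ginv(2)[OF goodD(1,5)[OF that(1)]]) (simp add: goodD(6)[OF that(1)])
  define h where "h = (\<lambda>(N, w)\<in>EL C'. h0 N w)"
  have hh: "h (N, w) = h0 N w" if "N \<in> Mod" "w \<in> fobj N C'" for N w
    using that by (simp add: h_def EL_def)
  have "h \<in> HomE C'"
    unfolding HomE_def
  proof (intro CollectI conjI ballI allI impI)
    show "h \<in> extensional (EL C')" by (simp add: h_def)
    show "h (N, x) \<in> TE" "proj E (h (N, x)) = N" if "N \<in> Mod" "x \<in> fobj N C'" for N x
      unfolding hh[OF that] by (rule h0_in[OF that])+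
  next
    fix \<psi> w assume \<psi>: "\<psi> \<in> Iso" and w: "w \<in> fobj (src \<psi>) C'"
    let ?N = "src \<psi>" and ?N' = "trg \<psi>" and ?w' = "cmpt \<psi> C' w"
    note N = Iso_src[OF \<psi>] and N' = Iso_trg[OF \<psi>] and w' = cmpt_in[OF \<psi> C' w]
    \<comment> \<open>Composed with \<open>\<psi>\<close>, a good isomorphism at the image of
      \<open>w\<close> becomes a good one at \<open>w\<close>; so the same value of \<open>s\<close>
      is pulled back at both places.\<close>
    obtain \<phi> where \<phi>: "good \<phi> ?N' ?w'" using ex_good[OF N' w'] by blast
    note p = goodD[OF \<phi>]
    note c = gcmp_Iso[OF \<psi> p(1) p(2)[symmetric]]
    have y: "ev ?N g w \<in> fobj ?N C" by (rule Mev_in[OF N g w])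
    have "cmpt (\<phi> \<diamondop> \<psi>) C (ev ?N g w) = cmpt \<phi> C (cmpt \<psi> C (ev ?N g w))" by (rule cmpt_gcmp[OF \<psi> C y])
    also have "\<dots> = z" unfolding cmpt_natural[OF \<psi> g w] by (rule p(4))
    finally have gc: "good (\<phi> \<diamondop> \<psi>) ?N w" using c p(3) by (simp add: good_def)
    have "act E (\<phi>, act E (\<psi>, h0 ?N w)) = act E (\<phi> \<diamondop> \<psi>, h0 ?N w)"
      by (rule act_gcmp[symmetric]) (use h0_in[OF N w] \<psi> p in simp_all)
    also have "\<dots> = s (trg \<phi>)" using act_h0[OF gc w] c(3) by simp
    finally have 1: "act E (\<phi>, act E (\<psi>, h0 ?N w)) = s (trg \<phi>)" .
    have a: "act E (\<psi>, h0 ?N w) \<in> TE" "proj E (act E (\<psi>, h0 ?N w)) = ?N'"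
      using act_in[OF \<psi>] h0_in[OF N w] by simp_all
    have "h0 ?N' ?w' = act E (ginv \<phi>, s (trg \<phi>))" by (rule h0_good[OF \<phi> w'])
    also have "\<dots> = act E (\<psi>, h0 ?N w)"
      unfolding 1[symmetric] by (rule act_ginv(1)[OF p(1) a(1)]) (simp add: p(2) a(2))
    finally show "h (trg \<psi>, cmpt \<psi> C' w) = act E (\<psi>, h (src \<psi>, w))"
      by (simp add: hh[OF N w] hh[OF N' w'])
  next
    fix W a assume W: "openin (total E) W"
    show "openin X {N \<in> Mod. a \<in> fobj N C' \<and> h (N, a) \<in> W}" (is "openin X ?T")
    proof (subst openin_subopen, intro ballI)
      fix N0 assume N0: "N0 \<in> ?T"
      then have N0M: "N0 \<in> Mod" and a: "a \<in> fobj N0 C'" by blast+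
      \<comment> \<open>A renaming chosen once at \<open>N0\<close> stays good for every model in
        \<open>?W0\<close>, where \<open>a\<close> has the same labels under the arrows of the
        pattern. With \<open>\<sigma>\<close> fixed, the value at \<open>a\<close> is a composite of
        continuous maps, although good isomorphisms were chosen arbitrarily.\<close>
      obtain \<sigma> where \<sigma>: "renaming \<sigma>" and \<sigma>F: "\<And>f. f \<in> F \<Longrightarrow> \<sigma> (Cod D f) (ev N0 f (ev N0 g a)) = ev M f z"
        by (rule pattern_renaming[OF pt F(1,2) g M z N0M a]) (rule that, assumption+)
      let ?W0 = "{N \<in> Mod. a \<in> fobj N C' \<and> (\<forall>k\<in>(\<lambda>f. f \<cdot> g) ` F. ev N k a = ev N0 k a)}"
      have fg: "f \<cdot> g \<in> hom D C' (Cod D f)" if "f \<in> F" for f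
        using Cmp_in_hom[OF cat g out_of_hom] that F(2) by blast
      have oW0: "openin X ?W0"
        by (rule openin_values[OF C']) (use F(1) hom_out_of[OF fg] in auto)
      have N0W: "N0 \<in> ?W0" using N0M a by simp
      have tW0: "topspace (subtopology X ?W0) = ?W0"
        using openin_subset[OF oW0] by (simp only: topspace_subtopology Int_absorb1)
      have g': "ren \<sigma> N \<in> nbd M C z F" "good (ren_iso \<sigma> N) N a" if N: "N \<in> ?W0" for N
      proof -
        have NM: "N \<in> Mod" and aN: "a \<in> fobj N C'" using N by blast+
        have "\<sigma> (Cod D f) (ev N f (ev N g a)) = ev M f z" if f: "f \<in> F" for f
        proof -
          have fh: "f \<in> hom D C (Cod D f)" using f F(2) out_of_hom by blast
          have "ev N (f \<cdot> g) a = ev N0 (f \<cdot> g) a" using N f by blast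
          then show ?thesis using Mev_Cmp[OF NM g fh aN] Mev_Cmp[OF N0M g fh a] \<sigma>F[OF f] by simp
        qed
        note rn = ren_in_nbd[OF \<sigma> NM Mev_in[OF NM g aN] C F(2,3) this M z] and r = ren_iso_Iso[OF \<sigma> NM]
        show "ren \<sigma> N \<in> nbd M C z F" by (rule rn(2))
        show "good (ren_iso \<sigma> N) N a" using rn r(1-3) r(4)[OF C Mev_in[OF NM g aN]] by (simp add: good_def)
      qed
      define \<tau> where "\<tau> = (\<lambda>A. inv (\<sigma> A))"
      have \<tau>: "renaming \<tau>" unfolding \<tau>_def by (rule renaming_inv[OF \<sigma>])
      let ?k = "\<lambda>N. act E (ren_iso \<tau> (ren \<sigma> N), s (ren \<sigma> N))"
      have hk: "h (N, a) = ?k N" if N: "N \<in> ?W0" for N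
      proof -
        have NM: "N \<in> Mod" and aN: "a \<in> fobj N C'" using N by blast+
        show ?thesis
          using h0_good[OF g'(2)[OF N] aN] ren_iso_Iso(3,5)[OF \<sigma> NM] hh[OF NM aN] by (simp add: \<tau>_def)
      qed
      have rU: "ren \<sigma> N \<in> U" if "N \<in> ?W0" for N using g'(1)[OF that] nU by blast
      have c1: "continuous_map (subtopology X ?W0) X (ren \<sigma>)"
        by (rule continuous_map_from_subtopology[OF continuous_map_ren[OF \<sigma>]])
      have c2: "continuous_map (subtopology X ?W0) (subtopology X U) (ren \<sigma>)"
        by (rule continuous_map_into_subtopology[OF c1]) (use rU in \<open>unfold tW0, blast\<close>)
      have c3: "continuous_map (subtopology X ?W0) (total E) (\<lambda>N. s (ren \<sigma> N))"
        using continuous_map_compose[OF c2 cs] by (simp add: o_def)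
      have c4: "continuous_map (subtopology X ?W0) GG (\<lambda>N. ren_iso \<tau> (ren \<sigma> N))"
        using continuous_map_compose[OF c1 continuous_map_ren_iso[OF \<tau>]] by (simp add: o_def)
      have c5: "continuous_map (subtopology X ?W0) (prod_topology GG (total E)) (\<lambda>N. (ren_iso \<tau> (ren \<sigma> N), s (ren \<sigma> N)))"
        using c3 c4 by (simp add: continuous_map_paired)
      have c6: "continuous_map (subtopology X ?W0) (subtopology (prod_topology GG (total E)) (act_dom Grpd E))
          (\<lambda>N. (ren_iso \<tau> (ren \<sigma> N), s (ren \<sigma> N)))"
      proof (rule continuous_map_into_subtopology[OF c5], unfold tW0, rule Pi_I)
        fix N assume N: "N \<in> ?W0"
        have "ren \<sigma> N \<in> Mod" using ren_Mod[OF \<sigma>] N by blast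
        from ren_iso_Iso(1,2)[OF \<tau> this] show "(ren_iso \<tau> (ren \<sigma> N), s (ren \<sigma> N)) \<in> act_dom Grpd E"
          using s[OF rU[OF N]] by (simp add: act_dom_iff)
      qed
      have c7: "continuous_map (subtopology X ?W0) (total E) ?k"
        using continuous_map_compose[OF c6 act_cont] by (simp add: o_def)
      have "openin (subtopology X ?W0) {N \<in> topspace (subtopology X ?W0). ?k N \<in> W}"
        by (rule openin_continuous_map_preimage[OF c7 W])
      then have o: "openin X {N \<in> ?W0. ?k N \<in> W}"
        unfolding tW0 openin_open_subtopology[OF oW0] by (rule conjunct1)
      have "N0 \<in> {N \<in> ?W0. ?k N \<in> W}" using N0 N0W hk[OF N0W] by simp
      moreover have "{N \<in> ?W0. ?k N \<in> W} \<subseteq> ?T"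
      proof
        fix N assume N: "N \<in> {N \<in> ?W0. ?k N \<in> W}"
        then have NW: "N \<in> ?W0" by blast
        show "N \<in> ?T" using N hk[OF NW] by simp
      qed
      ultimately show "\<exists>T. openin X T \<and> N0 \<in> T \<and> T \<subseteq> ?T" using o by blast
    qed
  qed
  moreover have "h (M, z') = r"
  proof -
    note i = gid_Iso[OF M]
    \<comment> \<open>At the original element nothing has to be moved, and the value is that of the
      section through \<open>r\<close>.\<close>
    have gg: "good (gid M) M z'"
      unfolding good_def using i cmpt_gid[OF C Mev_in[OF M g z'(1)]] z'(2) nbd_refl[OF M z] by simp
    have "act E (gid M, h0 M z') = s M" using act_h0[OF gg z'(1)] i by simp
    then show ?thesis
      using act_gid[OF h0_in(1)[OF M z'(1)]] h0_in(2)[OF M z'(1)] sM hh[OF M z'(1)] by simp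
  qed
  ultimately show ?thesis using that[OF C', of h z'] z'(1) unfolding M_def by blast
qed

text \<open>Gluing is pointwise: each element of \<open>A\<close> lifts along some member of the
  cover, and two lifts come from one element of a pullback, where the matching condition identifies
  the values.\<close>

lemma HomE_glue:
  assumes A: "A \<in> Obj D" and T: "T \<in> coherent_coverage D A"
    and k: "\<And>f. f \<in> T \<Longrightarrow> k f \<in> HomE (Dom D f)"
    and match: "\<And>f g u v. f \<in> T \<Longrightarrow> g \<in> T \<Longrightarrow> u \<in> hom D (Dom D u) (Dom D f) \<Longrightarrow> v \<in> hom D (Dom D u) (Dom D g) \<Longrightarrow>
      f \<cdot> u = g \<cdot> v \<Longrightarrow> pre u (k f) = pre v (k g)"
  shows "\<exists>h\<in>HomE A. \<forall>f\<in>T. pre f h = k f"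
proof -
  have Th: "f \<in> hom D (Dom D f) A" if "f \<in> T" for f
    using that T by (auto simp: coherent_coverage_def hom_def)
  have wd: "k f (N, y) = k g (N, w)"
    if f: "f \<in> T" and g: "g \<in> T" and N: "N \<in> Mod" and y: "y \<in> fobj N (Dom D f)" and w: "w \<in> fobj N (Dom D g)"
      and e: "ev N f y = ev N g w" for f g N y w
  proof -
    obtain P u v z where u: "u \<in> hom D P (Dom D f)" and v: "v \<in> hom D P (Dom D g)" and uv: "f \<cdot> u = g \<cdot> v"
      and z: "z \<in> fobj N P" "ev N u z = y" "ev N v z = w"
      by (rule ex_pullback_point[OF Th[OF f] Th[OF g] N y w e]) (rule that, assumption+)
    have "pre u (k f) = pre v (k g)"
      using match[OF f g _ _ uv] u v homD(2)[OF cat u] by simp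
    then have "pre u (k f) (N, z) = pre v (k g) (N, z)" by simp
    then show ?thesis unfolding pre_apply[OF u N z(1)] pre_apply[OF v N z(1)] z(2,3) .
  qed
  define h0 where "h0 N x = (SOME e. \<exists>f\<in>T. \<exists>y\<in>fobj N (Dom D f). ev N f y = x \<and> e = k f (N, y))" for N x
  have h0: "h0 N (ev N f y) = k f (N, y)" if f: "f \<in> T" and N: "N \<in> Mod" and y: "y \<in> fobj N (Dom D f)" for f N y
  proof -
    have "\<exists>g\<in>T. \<exists>w\<in>fobj N (Dom D g). ev N g w = ev N f y \<and> h0 N (ev N f y) = k g (N, w)"
      unfolding h0_def by (rule someI[of _ "k f (N, y)"]) (use f y in blast)
    then obtain g w where g: "g \<in> T" "w \<in> fobj N (Dom D g)" "ev N g w = ev N f y" "h0 N (ev N f y) = k g (N, w)"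
      by blast
    show ?thesis unfolding g(4) by (rule wd[OF g(1) f N g(2) y g(3)])
  qed
  define h where "h = (\<lambda>(N, x)\<in>EL A. h0 N x)"
  have h: "h (N, ev N f y) = k f (N, y)" if "f \<in> T" "N \<in> Mod" "y \<in> fobj N (Dom D f)" for f N y
    using h0[OF that] Mev_in[OF that(2) Th[OF that(1)] that(3)] that(2) by (simp add: h_def EL_def)
  have pts: "\<exists>f y. f \<in> T \<and> y \<in> fobj N (Dom D f) \<and> x = ev N f y" if N: "N \<in> Mod" and x: "x \<in> fobj N A" for N x
    by (rule coverage_points[OF T N x]) blast
  have hA: "h \<in> HomE A"
    unfolding HomE_def
  proof (intro CollectI conjI ballI allI impI)
    show "h \<in> extensional (EL A)" by (simp add: h_def)
    fix N x assume N: "N \<in> Mod" and x: "x \<in> fobj N A"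
    obtain f y where f: "f \<in> T" "y \<in> fobj N (Dom D f)" "x = ev N f y" using pts[OF N x] by blast
    show "h (N, x) \<in> TE" "proj E (h (N, x)) = N"
      unfolding f(3) h[OF f(1) N f(2)] by (rule HomE_in[OF k[OF f(1)] N f(2)], rule HomE_proj[OF k[OF f(1)] N f(2)])
  next
    fix \<phi> x assume \<phi>: "\<phi> \<in> Iso" and x: "x \<in> fobj (src \<phi>) A"
    obtain f y where f: "f \<in> T" "y \<in> fobj (src \<phi>) (Dom D f)" "x = ev (src \<phi>) f y" using pts[OF Iso_src[OF \<phi>] x] by blast
    note fo = homD(4)[OF cat Th[OF f(1)]]
    show "h (trg \<phi>, cmpt \<phi> A x) = act E (\<phi>, h (src \<phi>, x))"
      unfolding f(3) cmpt_natural[OF \<phi> Th[OF f(1)] f(2)] h[OF f(1) Iso_src[OF \<phi>] f(2)]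
        h[OF f(1) Iso_trg[OF \<phi>] cmpt_in[OF \<phi> fo f(2)]]
      by (rule HomE_equiv[OF k[OF f(1)] \<phi> f(2)])
  next
    fix W a assume W: "openin (total E) W"
    \<comment> \<open>The models in which \<open>a\<close> is the image under \<open>f\<close> of
      the element labelled \<open>b\<close>, and the value of \<open>k f\<close> there lies in
      \<open>W\<close>.\<close>
    let ?S = "\<lambda>f b. {N \<in> Mod. b \<in> fobj N (Dom D f) \<and> (\<forall>g\<in>{f}. ev N g b = a)} \<inter> {N \<in> Mod. b \<in> fobj N (Dom D f) \<and> k f (N, b) \<in> W}"
    have oS: "openin X (?S f b)" if f: "f \<in> T" for f b
      using hom_out_of[OF Th[OF f]] homD(4)[OF cat Th[OF f]]
      by (intro openin_Int HomE_open[OF k[OF f] W] openin_values) auto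
    have "openin X (\<Union>f\<in>T. \<Union>b. ?S f b)"
      by (intro openin_Union ballI; elim imageE; simp only:; intro openin_Union ballI; elim imageE; simp only:; rule oS)
    also have "(\<Union>f\<in>T. \<Union>b. ?S f b) = {N \<in> Mod. a \<in> fobj N A \<and> h (N, a) \<in> W}"
    proof
      show "(\<Union>f\<in>T. \<Union>b. ?S f b) \<subseteq> {N \<in> Mod. a \<in> fobj N A \<and> h (N, a) \<in> W}"
      proof
        fix N assume "N \<in> (\<Union>f\<in>T. \<Union>b. ?S f b)"
        then obtain f b where f: "f \<in> T" "N \<in> Mod" "b \<in> fobj N (Dom D f)" "ev N f b = a" "k f (N, b) \<in> W" by auto
        then show "N \<in> {N \<in> Mod. a \<in> fobj N A \<and> h (N, a) \<in> W}"
          using h[OF f(1,2,3)] Mev_in[OF f(2) Th[OF f(1)] f(3)] by simp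
      qed
      show "{N \<in> Mod. a \<in> fobj N A \<and> h (N, a) \<in> W} \<subseteq> (\<Union>f\<in>T. \<Union>b. ?S f b)"
      proof
        fix N assume N: "N \<in> {N \<in> Mod. a \<in> fobj N A \<and> h (N, a) \<in> W}"
        then obtain f y where f: "f \<in> T" "y \<in> fobj N (Dom D f)" "a = ev N f y" using pts by blast
        have "N \<in> ?S f y" using f N h[OF f(1) _ f(2)] by simp
        then show "N \<in> (\<Union>f\<in>T. \<Union>b. ?S f b)" using f(1) by blast
      qed
    qed
    finally show "openin X {N \<in> Mod. a \<in> fobj N A \<and> h (N, a) \<in> W}" .
  qed
  moreover have "pre f h = k f" if f: "f \<in> T" for f
    by (rule HomE_eqI[OF pre_HomE[OF Th[OF f] hA] k[OF f]]) (simp add: pre_apply[OF Th[OF f]] h[OF f])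
  ultimately show ?thesis by blast
qed

lemma HomE_separated:
  assumes T: "T \<in> coherent_coverage D A" and h: "h \<in> HomE A" "k \<in> HomE A"
    and e: "\<And>f. f \<in> T \<Longrightarrow> pre f h = pre f k"
  shows "h = k"
proof (rule HomE_eqI[OF h])
  fix N x assume N: "N \<in> Mod" and x: "x \<in> fobj N A"
  obtain f y where f: "f \<in> T" "f \<in> hom D (Dom D f) A" "y \<in> fobj N (Dom D f)" "ev N f y = x"
    by (rule coverage_points[OF T N x])
  have "pre f h (N, y) = pre f k (N, y)" using e[OF f(1)] by simp
  then show "h (N, x) = k (N, x)" unfolding pre_apply[OF f(2) N f(3)] f(4) .
qed

end

section \<open>Equivalences of categories\<close>

lemma hom_op_cat: "f \<in> hom (op_cat C) A B \<longleftrightarrow> f \<in> hom C B A"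
  by (auto simp: hom_def op_cat_def)

lemma op_cat_simps [simp]:
  "Obj (op_cat C) = Obj C" "Arr (op_cat C) = Arr C" "Dom (op_cat C) = Cod C" "Cod (op_cat C) = Dom C"
  "Idt (op_cat C) = Idt C" "Cmp (op_cat C) g f = Cmp C f g"
  by (simp_all add: op_cat_def)

lemma category_op_cat: "category C \<Longrightarrow> category (op_cat C)"
  unfolding category_def by (auto simp: hom_op_cat)

lemma full_subcat_simps [simp]:
  "Obj (full_subcat C P) = Obj C \<inter> P" "Arr (full_subcat C P) = {f \<in> Arr C. Dom C f \<in> P \<and> Cod C f \<in> P}"
  "Dom (full_subcat C P) = Dom C" "Cod (full_subcat C P) = Cod C" "Idt (full_subcat C P) = Idt C"
  "Cmp (full_subcat C P) = Cmp C"
  by (simp_all add: full_subcat_def)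

lemma category_full_subcat:
  assumes "category C"
  shows "category (full_subcat C P)"
proof -
  have h: "hom (full_subcat C P) A B = (if A \<in> P \<and> B \<in> P then hom C A B else {})" for A B
    by (auto simp: hom_def)
  show ?thesis using assms unfolding category_def h by (auto simp: hom_def)
qed

text \<open>Inverses of natural components are natural, so only one square is asked for.\<close>

lemma naturally_isomorphicI:
  assumes C: "category C" and E: "category E" and F: "is_functor C E F" and G: "is_functor C E G"
    and \<tau>: "\<And>A. A \<in> Obj C \<Longrightarrow> \<tau> A \<in> hom E (fobj F A) (fobj G A)"
    and \<tau>': "\<And>A. A \<in> Obj C \<Longrightarrow> \<tau>' A \<in> hom E (fobj G A) (fobj F A)"
    and inv: "\<And>A. A \<in> Obj C \<Longrightarrow> Cmp E (\<tau>' A) (\<tau> A) = Idt E (fobj F A)"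
      "\<And>A. A \<in> Obj C \<Longrightarrow> Cmp E (\<tau> A) (\<tau>' A) = Idt E (fobj G A)"
    and nat: "\<And>f A B. f \<in> hom C A B \<Longrightarrow> Cmp E (farr G f) (\<tau> A) = Cmp E (\<tau> B) (farr F f)"
  shows "naturally_isomorphic C E F G"
proof -
  let ?\<alpha> = "Arrow F (restrict \<tau> (Obj C)) G" and ?\<beta> = "Arrow G (restrict \<tau>' (Obj C)) F"
  have "nat_trans C E F (restrict \<tau> (Obj C)) G"
    unfolding nat_trans_def
  proof (intro conjI ballI F G)
    fix f assume f: "f \<in> Arr C"
    show "Cmp E (farr G f) (restrict \<tau> (Obj C) (Dom C f)) = Cmp E (restrict \<tau> (Obj C) (Cod C f)) (farr F f)"
      using nat[OF Arr_hom[OF f]] homD[OF C Arr_hom[OF f]] by simp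
  qed (use \<tau> in auto)
  moreover have "nat_trans C E G (restrict \<tau>' (Obj C)) F"
    unfolding nat_trans_def
  proof (intro conjI ballI F G)
    fix f assume "f \<in> Arr C"
    note f = Arr_hom[OF this]
    note o = homD(4,5)[OF C f]
    note Ff = is_functorD(2)[OF F f] and Gf = is_functorD(2)[OF G f]
    let ?A = "Dom C f" and ?B = "Cod C f"
    have "Cmp E (farr F f) (\<tau>' ?A) = Cmp E (Cmp E (\<tau>' ?B) (\<tau> ?B)) (Cmp E (farr F f) (\<tau>' ?A))"
      unfolding inv(1)[OF o(2)] by (rule Cmp_Idt(2)[OF E Cmp_in_hom[OF E \<tau>'[OF o(1)] Ff], symmetric])
    also have "\<dots> = Cmp E (\<tau>' ?B) (Cmp E (\<tau> ?B) (Cmp E (farr F f) (\<tau>' ?A)))"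
      by (rule Cmp_assoc[OF E Cmp_in_hom[OF E \<tau>'[OF o(1)] Ff] \<tau>[OF o(2)] \<tau>'[OF o(2)], symmetric])
    also have "Cmp E (\<tau> ?B) (Cmp E (farr F f) (\<tau>' ?A)) = Cmp E (Cmp E (farr G f) (\<tau> ?A)) (\<tau>' ?A)"
      unfolding nat[OF f] by (rule Cmp_assoc[OF E \<tau>'[OF o(1)] Ff \<tau>[OF o(2)]])
    also have "\<dots> = Cmp E (farr G f) (Cmp E (\<tau> ?A) (\<tau>' ?A))"
      by (rule Cmp_assoc[OF E \<tau>'[OF o(1)] \<tau>[OF o(1)] Gf, symmetric])
    also have "\<dots> = farr G f" unfolding inv(2)[OF o(1)] by (rule Cmp_Idt(1)[OF E Gf])
    finally show "Cmp E (farr F f) (restrict \<tau>' (Obj C) ?A) = Cmp E (restrict \<tau>' (Obj C) ?B) (farr G f)"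
      using o by simp
  qed (use \<tau>' in auto)
  moreover have "Cmp (functor_cat C E) ?\<beta> ?\<alpha> = Idt (functor_cat C E) F"
    "Cmp (functor_cat C E) ?\<alpha> ?\<beta> = Idt (functor_cat C E) G"
    using inv by (auto simp: functor_cat_def intro!: restrict_ext)
  ultimately have "?\<alpha> \<in> isos (functor_cat C E)"
    by (auto simp: isos_def hom_def intro!: exI[of _ ?\<beta>])
  then show ?thesis unfolding naturally_isomorphic_def by (intro bexI[of _ ?\<alpha>]) auto
qed

lemma is_functor_id: "category C \<Longrightarrow> is_functor C C (id_functor C)"
  by (rule is_functorI) (auto simp: id_functor_def dest: homD Cmp_in_hom Idt_in_hom)

text \<open>Preimages of objects and of arrows are chosen; faithfulness allows every equation in
  \<open>C\<close> to be checked after applying \<open>\<Phi>\<close>. The conclusion names the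
  target \<open>E\<close> of \<open>\<Phi>\<close> first because \<open>\<Phi>\<close> will run from
  the equivariant sheaves to the site.\<close>

lemma equivalent_cats_if_fully_faithful_essentially_surjective:
  assumes C: "category C" and E: "category E" and \<Phi>: "is_functor C E \<Phi>"
    and full: "\<And>A B g. A \<in> Obj C \<Longrightarrow> B \<in> Obj C \<Longrightarrow> g \<in> hom E (fobj \<Phi> A) (fobj \<Phi> B) \<Longrightarrow>
      \<exists>f\<in>hom C A B. farr \<Phi> f = g"
    and faithful: "\<And>A B f g. f \<in> hom C A B \<Longrightarrow> g \<in> hom C A B \<Longrightarrow> farr \<Phi> f = farr \<Phi> g \<Longrightarrow> f = g"
    and eso: "\<And>Y. Y \<in> Obj E \<Longrightarrow> \<exists>A\<in>Obj C. \<exists>i\<in>hom E (fobj \<Phi> A) Y. \<exists>j\<in>hom E Y (fobj \<Phi> A).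
      Cmp E j i = Idt E (fobj \<Phi> A) \<and> Cmp E i j = Idt E Y"
  shows "equivalent_cats E C"
proof -
  note P = is_functorD[OF \<Phi>]
  have "\<forall>Y. \<exists>A i j. Y \<in> Obj E \<longrightarrow> A \<in> Obj C \<and> i \<in> hom E (fobj \<Phi> A) Y \<and> j \<in> hom E Y (fobj \<Phi> A) \<and>
      Cmp E j i = Idt E (fobj \<Phi> A) \<and> Cmp E i j = Idt E Y"
    using eso by blast
  then obtain ob i j where *: "\<forall>Y. Y \<in> Obj E \<longrightarrow> ob Y \<in> Obj C \<and> i Y \<in> hom E (fobj \<Phi> (ob Y)) Y \<and>
      j Y \<in> hom E Y (fobj \<Phi> (ob Y)) \<and> Cmp E (j Y) (i Y) = Idt E (fobj \<Phi> (ob Y)) \<and> Cmp E (i Y) (j Y) = Idt E Y"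
    unfolding choice_iff by (elim exE) (rule that, assumption+)
  have ob: "ob Y \<in> Obj C" and i: "i Y \<in> hom E (fobj \<Phi> (ob Y)) Y" and j: "j Y \<in> hom E Y (fobj \<Phi> (ob Y))"
    and ji: "Cmp E (j Y) (i Y) = Idt E (fobj \<Phi> (ob Y))" and ij: "Cmp E (i Y) (j Y) = Idt E Y"
    if "Y \<in> Obj E" for Y using *[rule_format, OF that] by simp_all
  define lift where "lift A B g = (SOME f. f \<in> hom C A B \<and> farr \<Phi> f = g)" for A B g
  have lift: "lift A B g \<in> hom C A B" "farr \<Phi> (lift A B g) = g"
    if "A \<in> Obj C" "B \<in> Obj C" "g \<in> hom E (fobj \<Phi> A) (fobj \<Phi> B)" for A B g
    using someI_ex[of "\<lambda>f. f \<in> hom C A B \<and> farr \<Phi> f = g"] full[OF that] unfolding lift_def by blast+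
  \<comment> \<open>The arrow \<open>g\<close> carried along the chosen isomorphisms to one between
    values of \<open>\<Phi>\<close>, where it can be lifted.\<close>
  define conj where "conj g = Cmp E (j (Cod E g)) (Cmp E g (i (Dom E g)))" for g
  have conj: "conj g \<in> hom E (fobj \<Phi> (ob Y)) (fobj \<Phi> (ob Z))" "Cmp E (i Z) (conj g) = Cmp E g (i Y)"
    if g: "g \<in> hom E Y Z" for g Y Z
  proof -
    note h = homD[OF E g]
    note gi = Cmp_in_hom[OF E i[OF h(4)] g]
    show "conj g \<in> hom E (fobj \<Phi> (ob Y)) (fobj \<Phi> (ob Z))"
      using Cmp_in_hom[OF E gi j[OF h(5)]] h by (simp add: conj_def)
    show "Cmp E (i Z) (conj g) = Cmp E g (i Y)"
      using Cmp_assoc[OF E gi j[OF h(5)] i[OF h(5)]] ij[OF h(5)] Cmp_Idt(2)[OF E gi] h by (simp add: conj_def)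
  qed
  have i_cancel: "u = v" if "Y \<in> Obj E" "u \<in> hom E X (fobj \<Phi> (ob Y))" "v \<in> hom E X (fobj \<Phi> (ob Y))"
    "Cmp E (i Y) u = Cmp E (i Y) v" for u v X Y
  proof -
    have "Cmp E (j Y) (Cmp E (i Y) w) = w" if w: "w \<in> hom E X (fobj \<Phi> (ob Y))" for w
      unfolding Cmp_assoc[OF E w i[OF \<open>Y \<in> Obj E\<close>] j[OF \<open>Y \<in> Obj E\<close>]] ji[OF \<open>Y \<in> Obj E\<close>]
      by (rule Cmp_Idt(2)[OF E w])
    from this[OF that(2)] this[OF that(3)] show ?thesis unfolding that(4) by (rule trans[OF sym])
  qed
  let ?\<Psi> = "\<lparr>fobj = restrict ob (Obj E), farr = (\<lambda>g\<in>Arr E. lift (ob (Dom E g)) (ob (Cod E g)) (conj g))\<rparr>"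
  have Pa: "farr ?\<Psi> g = lift (ob Y) (ob Z) (conj g)" "farr ?\<Psi> g \<in> hom C (ob Y) (ob Z)" "farr \<Phi> (farr ?\<Psi> g) = conj g"
    if g: "g \<in> hom E Y Z" for g Y Z
    using homD[OF E g] lift[OF ob ob conj(1)[OF g]] by simp_all
  have \<Psi>: "is_functor E C ?\<Psi>"
  proof (rule is_functorI[OF E])
    show "fobj ?\<Psi> Y \<in> Obj C" if "Y \<in> Obj E" for Y using ob[OF that] that by simp
    show "farr ?\<Psi> g \<in> hom C (fobj ?\<Psi> Y) (fobj ?\<Psi> Z)" if "g \<in> hom E Y Z" for g Y Z
      using Pa(2)[OF that] homD[OF E that] by simp
    show "farr ?\<Psi> (Idt E Y) = Idt C (fobj ?\<Psi> Y)" if Y: "Y \<in> Obj E" for Y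
    proof (rule faithful)
      note id = Idt_in_hom[OF E Y]
      show "farr ?\<Psi> (Idt E Y) \<in> hom C (ob Y) (ob Y)" by (rule Pa(2)[OF id])
      show "Idt C (fobj ?\<Psi> Y) \<in> hom C (ob Y) (ob Y)" using Idt_in_hom[OF C ob[OF Y]] Y by simp
      have "conj (Idt E Y) = Idt E (fobj \<Phi> (ob Y))"
        unfolding conj_def using homD[OF E id] Cmp_Idt(2)[OF E i[OF Y]] ji[OF Y] by simp
      then show "farr \<Phi> (farr ?\<Psi> (Idt E Y)) = farr \<Phi> (Idt C (fobj ?\<Psi> Y))"
        unfolding Pa(3)[OF id] using P(3)[OF ob[OF Y]] Y by simp
    qed
    show "farr ?\<Psi> (Cmp E h g) = Cmp C (farr ?\<Psi> h) (farr ?\<Psi> g)"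
      if g: "g \<in> hom E Y Z" and h: "h \<in> hom E Z W" for g h Y Z W
    proof (rule faithful[OF Pa(2)[OF Cmp_in_hom[OF E g h]] Cmp_in_hom[OF C Pa(2)[OF g] Pa(2)[OF h]]])
      note hg = Cmp_in_hom[OF E g h]
      have "conj (Cmp E h g) = Cmp E (conj h) (conj g)"
      proof (rule i_cancel[OF homD(5)[OF E h] conj(1)[OF hg] Cmp_in_hom[OF E conj(1)[OF g] conj(1)[OF h]]])
        have "Cmp E (i W) (Cmp E (conj h) (conj g)) = Cmp E (Cmp E (i W) (conj h)) (conj g)"
          by (rule Cmp_assoc[OF E conj(1)[OF g] conj(1)[OF h] i[OF homD(5)[OF E h]]])
        also have "\<dots> = Cmp E h (Cmp E (i Z) (conj g))"
          unfolding conj(2)[OF h] by (rule Cmp_assoc[OF E conj(1)[OF g] i[OF homD(4)[OF E h]] h, symmetric])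
        also have "\<dots> = Cmp E (Cmp E h g) (i Y)"
          unfolding conj(2)[OF g] by (rule Cmp_assoc[OF E i[OF homD(4)[OF E g]] g h])
        also have "\<dots> = Cmp E (i W) (conj (Cmp E h g))" by (rule conj(2)[OF hg, symmetric])
        finally show "Cmp E (i W) (conj (Cmp E h g)) = Cmp E (i W) (Cmp E (conj h) (conj g))" by (rule sym)
      qed
      then show "farr \<Phi> (farr ?\<Psi> (Cmp E h g)) = farr \<Phi> (Cmp C (farr ?\<Psi> h) (farr ?\<Psi> g))"
        unfolding P(4)[OF Pa(2)[OF g] Pa(2)[OF h]] Pa(3)[OF g] Pa(3)[OF h] Pa(3)[OF hg] .
    qed
  qed simp_all
  have "naturally_isomorphic E E (comp_functor E \<Phi> ?\<Psi>) (id_functor E)"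
  proof (rule naturally_isomorphicI[OF E E is_functor_comp[OF E \<Psi> \<Phi>] is_functor_id[OF E], of i j])
    fix Y assume Y: "Y \<in> Obj E"
    show "i Y \<in> hom E (fobj (comp_functor E \<Phi> ?\<Psi>) Y) (fobj (id_functor E) Y)"
      "j Y \<in> hom E (fobj (id_functor E) Y) (fobj (comp_functor E \<Phi> ?\<Psi>) Y)"
      "Cmp E (j Y) (i Y) = Idt E (fobj (comp_functor E \<Phi> ?\<Psi>) Y)" "Cmp E (i Y) (j Y) = Idt E (fobj (id_functor E) Y)"
      using i[OF Y] j[OF Y] ij[OF Y] ji[OF Y] Y by (simp_all add: id_functor_def)
  next
    fix g Y Z assume g: "g \<in> hom E Y Z"
    show "Cmp E (farr (id_functor E) g) (i Y) = Cmp E (i Z) (farr (comp_functor E \<Phi> ?\<Psi>) g)"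
      using conj(2)[OF g] Pa(3)[OF g] homD(1)[OF E g] by (simp add: id_functor_def)
  qed
  moreover have "naturally_isomorphic C C (comp_functor C ?\<Psi> \<Phi>) (id_functor C)"
  proof -
    let ?e = "\<lambda>A. lift (ob (fobj \<Phi> A)) A (i (fobj \<Phi> A))" and ?e' = "\<lambda>A. lift A (ob (fobj \<Phi> A)) (j (fobj \<Phi> A))"
    have e: "?e A \<in> hom C (ob (fobj \<Phi> A)) A" "farr \<Phi> (?e A) = i (fobj \<Phi> A)"
      and e': "?e' A \<in> hom C A (ob (fobj \<Phi> A))" "farr \<Phi> (?e' A) = j (fobj \<Phi> A)" if A: "A \<in> Obj C" for A
      using lift[OF ob[OF P(1)[OF A]] A i[OF P(1)[OF A]]] lift[OF A ob[OF P(1)[OF A]] j[OF P(1)[OF A]]] by simp_all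
    show ?thesis
    proof (rule naturally_isomorphicI[OF C C is_functor_comp[OF C \<Phi> \<Psi>] is_functor_id[OF C], of ?e ?e'])
      fix A assume A: "A \<in> Obj C"
      note PA = P(1)[OF A] and e = e[OF A] and e' = e'[OF A]
      have o: "fobj (comp_functor C ?\<Psi> \<Phi>) A = ob (fobj \<Phi> A)" "fobj (id_functor C) A = A"
        using A PA by (simp_all add: id_functor_def)
      show "?e A \<in> hom C (fobj (comp_functor C ?\<Psi> \<Phi>) A) (fobj (id_functor C) A)"
        "?e' A \<in> hom C (fobj (id_functor C) A) (fobj (comp_functor C ?\<Psi> \<Phi>) A)"
        unfolding o by (rule e(1), rule e'(1))
      show "Cmp C (?e' A) (?e A) = Idt C (fobj (comp_functor C ?\<Psi> \<Phi>) A)"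
        unfolding o by (rule faithful[OF Cmp_in_hom[OF C e(1) e'(1)] Idt_in_hom[OF C ob[OF PA]]])
          (simp only: P(4)[OF e(1) e'(1)] e(2) e'(2) ji[OF PA] P(3)[OF ob[OF PA]])
      show "Cmp C (?e A) (?e' A) = Idt C (fobj (id_functor C) A)"
        unfolding o by (rule faithful[OF Cmp_in_hom[OF C e'(1) e(1)] Idt_in_hom[OF C A]])
          (simp only: P(4)[OF e'(1) e(1)] e(2) e'(2) ij[OF PA] P(3)[OF A])
    next
      fix f A B assume f: "f \<in> hom C A B"
      note h = homD[OF C f]
      note Pf = P(2)[OF f]
      have a: "farr (comp_functor C ?\<Psi> \<Phi>) f = farr ?\<Psi> (farr \<Phi> f)" "farr (id_functor C) f = f"
        using h by (simp_all add: id_functor_def)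
      show "Cmp C (farr (id_functor C) f) (?e A) = Cmp C (?e B) (farr (comp_functor C ?\<Psi> \<Phi>) f)"
        unfolding a
      proof (rule faithful[OF Cmp_in_hom[OF C e(1)[OF h(4)] f] Cmp_in_hom[OF C Pa(2)[OF Pf] e(1)[OF h(5)]]])
        show "farr \<Phi> (Cmp C f (?e A)) = farr \<Phi> (Cmp C (?e B) (farr ?\<Psi> (farr \<Phi> f)))"
          unfolding P(4)[OF e(1)[OF h(4)] f] P(4)[OF Pa(2)[OF Pf] e(1)[OF h(5)]] e(2)[OF h(4)] e(2)[OF h(5)] Pa(3)[OF Pf]
          by (rule conj(2)[OF Pf, symmetric])
      qed
    qed
  qed
  ultimately show ?thesis
    unfolding equivalent_cats_def using C E \<Phi> \<Psi> by blast
qed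

section \<open>Presheaves of large sets coded in a small universe\<close>

text \<open>Some injection of \<open>S\<close> into \<open>'u\<close>, as long as one exists; this
  holds for sets smaller than a cardinal on \<open>'u\<close>. It lets sets of functions serve as
  values of sheaves in \<open>small_sets\<close>.\<close>

definition code :: "'x set \<Rightarrow> 'x \<Rightarrow> 'u" where
  "code S = (SOME e. inj_on e S)"

definition decode :: "'x set \<Rightarrow> 'u \<Rightarrow> 'x" where
  "decode S = inv_into S (code S)"

lemma inj_on_code:
  fixes \<mu> :: "'u rel" and S :: "'x set"
  assumes \<mu>: "Card_order \<mu>" and S: "|S| <o \<mu>"
  shows "inj_on (code S :: 'x \<Rightarrow> 'u) S"
proof -
  have "|S| \<le>o |Field \<mu>|"
    by (rule ordLeq_ordIso_trans[OF ordLess_imp_ordLeq[OF S] ordIso_symmetric[OF card_of_Field_ordIso[OF \<mu>]]])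
  then have "\<exists>e :: 'x \<Rightarrow> 'u. inj_on e S" unfolding card_of_ordLeq[symmetric] by blast
  then show ?thesis unfolding code_def by (rule someI_ex)
qed

lemma code_small:
  assumes "|S| <o \<mu>"
  shows "code S ` S \<in> small_sets \<mu>"
  using ordLeq_ordLess_trans[OF card_of_image assms] by (simp add: small_sets_def)

definition coded_presheaf :: "('o, 'a) cat \<Rightarrow> ('o \<Rightarrow> 'x set) \<Rightarrow> ('a \<Rightarrow> 'x \<Rightarrow> 'x)
    \<Rightarrow> ('o, 'a, 'u set, ('u set, 'u \<Rightarrow> 'u) arrow) functr" where
  "coded_presheaf D S r = \<lparr>fobj = (\<lambda>A\<in>Obj D. code (S A) ` S A),
    farr = (\<lambda>f\<in>Arr D. Arrow (code (S (Cod D f)) ` S (Cod D f))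
      (\<lambda>v\<in>code (S (Cod D f)) ` S (Cod D f). code (S (Dom D f)) (r f (decode (S (Cod D f)) v)))
      (code (S (Dom D f)) ` S (Dom D f)))\<rparr>"

locale big_presheaf =
  fixes D :: "('o, 'a) cat" and \<mu> :: "'u rel" and S :: "'o \<Rightarrow> 'x set" and r :: "'a \<Rightarrow> 'x \<Rightarrow> 'x"
  assumes D: "category D" and \<mu>: "Card_order \<mu>" and small: "\<And>A. A \<in> Obj D \<Longrightarrow> |S A| <o \<mu>"
    and r_in: "\<And>f A B x. f \<in> hom D A B \<Longrightarrow> x \<in> S B \<Longrightarrow> r f x \<in> S A"
    and r_Idt: "\<And>A x. A \<in> Obj D \<Longrightarrow> x \<in> S A \<Longrightarrow> r (Idt D A) x = x"
    and r_Cmp: "\<And>f g A B C x. g \<in> hom D A B \<Longrightarrow> f \<in> hom D B C \<Longrightarrow> x \<in> S C \<Longrightarrow> r (Cmp D f g) x = r g (r f x)"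
begin

abbreviation P :: "('o, 'a, 'u set, ('u set, 'u \<Rightarrow> 'u) arrow) functr" where
  "P \<equiv> coded_presheaf D S r"

abbreviation c :: "'o \<Rightarrow> 'x \<Rightarrow> 'u" where "c A \<equiv> code (S A)"

lemma decode_code [simp]: "A \<in> Obj D \<Longrightarrow> x \<in> S A \<Longrightarrow> decode (S A) (c A x) = x"
  unfolding decode_def by (rule inv_into_f_f[OF inj_on_code[OF \<mu> small]])

lemma fobj_P: "A \<in> Obj D \<Longrightarrow> fobj P A = c A ` S A"
  by (simp add: coded_presheaf_def)

lemma decode_in: "A \<in> Obj D \<Longrightarrow> v \<in> fobj P A \<Longrightarrow> decode (S A) v \<in> S A"
  and code_decode: "A \<in> Obj D \<Longrightarrow> v \<in> fobj P A \<Longrightarrow> c A (decode (S A) v) = v"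
  by (auto simp: fobj_P)

lemma code_eq_iff: "A \<in> Obj D \<Longrightarrow> x \<in> S A \<Longrightarrow> y \<in> S A \<Longrightarrow> c A x = c A y \<longleftrightarrow> x = y"
  by (metis decode_code)

lemma ev_P: "f \<in> hom D A B \<Longrightarrow> x \<in> S B \<Longrightarrow> ev P f (c B x) = c A (r f x)"
  using homD[OF D, of f A B] by (simp add: coded_presheaf_def)

lemma farr_P: "f \<in> hom D A B \<Longrightarrow> farr P f \<in> hom (set_cat (small_sets \<mu>)) (fobj P B) (fobj P A)"
proof -
  assume f: "f \<in> hom D A B"
  note h = homD[OF D f]
  have "farr P f = Arrow (fobj P B) (restrict (\<lambda>v. c A (r f (decode (S B) v))) (fobj P B)) (fobj P A)"
    using h by (simp add: coded_presheaf_def)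
  then show ?thesis
    using h f r_in decode_in code_small[OF small] by (auto intro!: Arrow_in_hom_set_cat simp: fobj_P)
qed

lemma is_functor_P: "is_functor (op_cat D) (set_cat (small_sets \<mu>)) P"
proof (rule is_functorI[OF category_op_cat[OF D]])
  show "fobj P A \<in> Obj (set_cat (small_sets \<mu>))" if "A \<in> Obj (op_cat D)" for A
    using that code_small[OF small] by (simp add: fobj_P)
  show fh: "farr P f \<in> hom (set_cat (small_sets \<mu>)) (fobj P A) (fobj P B)" if "f \<in> hom (op_cat D) A B" for f A B
    using farr_P that by (simp add: hom_op_cat)
  show "farr P (Idt (op_cat D) A) = Idt (set_cat (small_sets \<mu>)) (fobj P A)" if "A \<in> Obj (op_cat D)" for A
  proof -
    have A: "A \<in> Obj D" using that by simp
    show ?thesis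
    proof (rule arrow_eqI[OF fh])
      show "Idt (op_cat D) A \<in> hom (op_cat D) A A" using Idt_in_hom[OF D A] by (simp add: hom_op_cat)
      show "Idt (set_cat (small_sets \<mu>)) (fobj P A) \<in> hom (set_cat (small_sets \<mu>)) (fobj P A) (fobj P A)"
        by (rule Idt_in_hom[OF category_set_cat]) (simp add: fobj_P A code_small[OF small])
      fix v assume "v \<in> fobj P A"
      then show "ev P (Idt (op_cat D) A) v = app (Idt (set_cat (small_sets \<mu>)) (fobj P A)) v"
        using ev_P[OF Idt_in_hom[OF D A]] r_Idt[OF A] A by (auto simp: fobj_P Idt_set_cat)
    qed
  qed
  show "farr P (Cmp (op_cat D) g f) = Cmp (set_cat (small_sets \<mu>)) (farr P g) (farr P f)"
    if f: "f \<in> hom (op_cat D) A B" and g: "g \<in> hom (op_cat D) B C" for f g A B C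
  proof (rule arrow_eqI[OF fh[OF Cmp_in_hom[OF category_op_cat[OF D] f g]] Cmp_in_hom_set_cat[OF fh[OF f] fh[OF g]]])
    have f': "f \<in> hom D B A" and g': "g \<in> hom D C B" using f g by (simp_all add: hom_op_cat)
    fix v assume v: "v \<in> fobj P A"
    then obtain x where x: "x \<in> S A" "v = c A x" using homD(5)[OF D f'] by (auto simp: fobj_P)
    show "ev P (Cmp (op_cat D) g f) v = app (Cmp (set_cat (small_sets \<mu>)) (farr P g) (farr P f)) v"
      unfolding app_Cmp_set_cat[OF fh[OF f] v]
      using ev_P[OF Cmp_in_hom[OF D g' f'] x(1)] ev_P[OF f' x(1)] ev_P[OF g' r_in[OF f' x(1)]] r_Cmp[OF g' f' x(1)] x(2)
      by simp
  qed
qed (simp_all add: coded_presheaf_def)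

end

section \<open>Equivariant sheaves as sheaves on the site\<close>

lemma act_dom_in:
  assumes "equivariant_sheaf G E" "(g, x) \<in> act_dom G E"
  shows "act E (g, x) \<in> topspace (total E)"
proof -
  have "continuous_map (subtopology (prod_topology (ar_top G) (total E)) (act_dom G E)) (total E) (act E)"
    using assms(1) by (simp add: equivariant_sheaf_def)
  from continuous_map_image_subset_topspace[OF this] show ?thesis
    using assms(2) by (auto simp: topspace_subtopology act_dom_def)
qed

lemma equivariant_mapD:
  assumes "equivariant_map G E h E'"
  shows "h \<in> extensional (topspace (total E))" "continuous_map (total E) (total E') h"
    "x \<in> topspace (total E) \<Longrightarrow> h x \<in> topspace (total E')"
    "x \<in> topspace (total E) \<Longrightarrow> proj E' (h x) = proj E x"
    "(g, x) \<in> act_dom G E \<Longrightarrow> h (act E (g, x)) = act E' (g, h x)"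
    "(g, x) \<in> act_dom G E \<Longrightarrow> (g, h x) \<in> act_dom G E'"
proof -
  show c: "continuous_map (total E) (total E') h" using assms by (simp add: equivariant_map_def)
  show i: "x \<in> topspace (total E) \<Longrightarrow> h x \<in> topspace (total E')" for x
    using continuous_map_image_subset_topspace[OF c] by blast
  show p: "x \<in> topspace (total E) \<Longrightarrow> proj E' (h x) = proj E x" for x
    using assms by (simp add: equivariant_map_def)
  show "h \<in> extensional (topspace (total E))" using assms by (simp add: equivariant_map_def)
  show "(g, x) \<in> act_dom G E \<Longrightarrow> h (act E (g, x)) = act E' (g, h x)"
    using assms unfolding equivariant_map_def by blast
  show "(g, x) \<in> act_dom G E \<Longrightarrow> (g, h x) \<in> act_dom G E'"
    using i p by (auto simp: act_dom_def)
qed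

lemma equivariant_map_id:
  assumes "equivariant_sheaf G E"
  shows "equivariant_map G E (\<lambda>x\<in>topspace (total E). x) E"
proof -
  have "continuous_map (total E) (total E) (\<lambda>x\<in>topspace (total E). x)"
    by (rule continuous_map_eq[OF continuous_map_id]) simp
  moreover have "x \<in> topspace (total E)" if "(g, x) \<in> act_dom G E" for g x
    using that by (simp add: act_dom_def)
  ultimately show ?thesis
    using act_dom_in[OF assms] by (auto simp: equivariant_map_def)
qed

lemma equivariant_map_compose:
  assumes E: "equivariant_sheaf G E" and h: "equivariant_map G E h E'" and k: "equivariant_map G E' k E''"
  shows "equivariant_map G E (compose (topspace (total E)) k h) E''"
proof -
  note H = equivariant_mapD[OF h] and K = equivariant_mapD[OF k]
  have "continuous_map (total E) (total E'') (compose (topspace (total E)) k h)"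
    by (rule continuous_map_eq[OF continuous_map_compose[OF H(2) K(2)]]) (simp add: compose_def)
  moreover have "x \<in> topspace (total E)" if "(g, x) \<in> act_dom G E" for g x
    using that by (simp add: act_dom_def)
  ultimately show ?thesis
    using act_dom_in[OF E] H(3,4,5,6) K(4,5) unfolding equivariant_map_def
    by (auto simp: compose_def)
qed

lemma esc_simps [simp]:
  "Dom (equivariant_sheaf_cat \<U> G) = src" "Cod (equivariant_sheaf_cat \<U> G) = trg"
  "Obj (equivariant_sheaf_cat \<U> G) = {E. equivariant_sheaf G E \<and> topspace (total E) \<in> \<U>}"
  by (simp_all add: equivariant_sheaf_cat_def)

lemma hom_esc_iff:
  "f \<in> hom (equivariant_sheaf_cat \<U> G) E E' \<longleftrightarrow> src f = E \<and> trg f = E' \<and>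
    equivariant_sheaf G E \<and> topspace (total E) \<in> \<U> \<and> equivariant_sheaf G E' \<and> topspace (total E') \<in> \<U> \<and>
    equivariant_map G E (app f) E'"
  by (auto simp: hom_def equivariant_sheaf_cat_def)

lemma Arr_esc_iff:
  "f \<in> Arr (equivariant_sheaf_cat \<U> G) \<longleftrightarrow> f \<in> hom (equivariant_sheaf_cat \<U> G) (src f) (trg f)"
  by (simp add: hom_def)

lemma category_equivariant_sheaf_cat: "category (equivariant_sheaf_cat \<U> G)" (is "category ?C")
proof -
  have id: "Idt ?C E = Arrow E (\<lambda>x\<in>topspace (total E). x) E" for E
    by (simp add: equivariant_sheaf_cat_def)
  have cmp: "Cmp ?C g f = Arrow (src f) (compose (topspace (total (src f))) (app g) (app f)) (trg g)" for g f
    by (simp add: equivariant_sheaf_cat_def)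
  have in_top: "app f x \<in> topspace (total (trg f))" if "f \<in> Arr ?C" "x \<in> topspace (total (src f))" for f x
    using that equivariant_mapD(3)[of G "src f" "app f" "trg f"] by (auto simp: Arr_esc_iff hom_esc_iff)
  have ext: "app f \<in> extensional (topspace (total (src f)))" if "f \<in> Arr ?C" for f
    using that equivariant_mapD(1)[of G "src f" "app f" "trg f"] by (auto simp: Arr_esc_iff hom_esc_iff)
  show ?thesis
    unfolding category_def
  proof (intro conjI ballI impI)
    fix f assume f: "f \<in> Arr ?C"
    then show "Dom ?C f \<in> Obj ?C" "Cod ?C f \<in> Obj ?C" by (auto simp: Arr_esc_iff hom_esc_iff)
    show "Cmp ?C f (Idt ?C (Dom ?C f)) = f"
      unfolding id cmp
      by (rule arrow.expand) (auto simp: compose_def intro!: extensionalityI[OF _ ext[OF f]])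
    show "Cmp ?C (Idt ?C (Cod ?C f)) f = f"
      unfolding id cmp
      by (rule arrow.expand) (auto simp: compose_def in_top[OF f] intro!: extensionalityI[OF _ ext[OF f]])
  next
    fix E assume "E \<in> Obj ?C"
    then show "Idt ?C E \<in> hom ?C E E" unfolding id hom_esc_iff by (simp add: equivariant_map_id)
  next
    fix f g assume "f \<in> Arr ?C" "g \<in> Arr ?C" "Cod ?C f = Dom ?C g"
    then show "Cmp ?C g f \<in> hom ?C (Dom ?C f) (Cod ?C g)"
      unfolding cmp hom_esc_iff Arr_esc_iff by (simp add: equivariant_map_compose[of G _ _ "src g"])
  next
    fix f g h assume "f \<in> Arr ?C" "g \<in> Arr ?C" "h \<in> Arr ?C" "Cod ?C f = Dom ?C g \<and> Cod ?C g = Dom ?C h"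
    then show "Cmp ?C h (Cmp ?C g f) = Cmp ?C (Cmp ?C h g) f"
      unfolding cmp using in_top[of f] by (auto simp: compose_def intro!: restrict_ext)
  qed
qed

section \<open>Maps of equivariant sheaves against transformations of the sets
  \<open>HomE\<close>\<close>

locale model_sheaf_pair = decidable_models \<kappa> D + S1: model_sheaf \<kappa> D E + S2: model_sheaf \<kappa> D E'
  for \<kappa> :: "'k rel" and D :: "('o, 'a) cat"
    and E E' :: "(('k, 'o, 'a) model, ('k, 'o, 'a) model_map, 'u) action"
begin

definition post :: "'o \<Rightarrow> ('u \<Rightarrow> 'u) \<Rightarrow> (('k, 'o, 'a) model \<times> 'k hset \<Rightarrow> 'u)
    \<Rightarrow> ('k, 'o, 'a) model \<times> 'k hset \<Rightarrow> 'u" where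
  "post A h x = (\<lambda>(N, y)\<in>S1.EL A. h (x (N, y)))"

lemma post_apply: "N \<in> Mod \<Longrightarrow> y \<in> fobj N A \<Longrightarrow> post A h x (N, y) = h (x (N, y))"
  by (simp add: post_def S1.EL_def)

lemma post_HomE:
  assumes A: "A \<in> Obj D" and h: "equivariant_map Grpd E h E'" and x: "x \<in> S1.HomE A"
  shows "post A h x \<in> S2.HomE A"
  unfolding S2.HomE_def
proof (intro CollectI conjI ballI allI impI)
  note hD = equivariant_mapD[OF h]
  show "post A h x \<in> extensional (S2.EL A)" by (simp add: post_def)
  fix N y assume N: "N \<in> Mod" "y \<in> fobj N A"
  show "post A h x (N, y) \<in> S2.TE" "proj E' (post A h x (N, y)) = N"
    unfolding post_apply[OF N] using hD(3,4)[OF S1.HomE_in[OF x N]] S1.HomE_proj[OF x N] by simp_all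
next
  note hD = equivariant_mapD[OF h]
  fix \<phi> y assume \<phi>: "\<phi> \<in> Iso" and y: "y \<in> fobj (src \<phi>) A"
  have c: "cmpt \<phi> A y \<in> fobj (trg \<phi>) A" by (rule cmpt_in[OF \<phi> A y])
  have "(\<phi>, x (src \<phi>, y)) \<in> act_dom Grpd E"
    using \<phi> S1.HomE_in[OF x Iso_src[OF \<phi>] y] S1.HomE_proj[OF x Iso_src[OF \<phi>] y] by (simp add: S1.act_dom_iff)
  then show "post A h x (trg \<phi>, cmpt \<phi> A y) = act E' (\<phi>, post A h x (src \<phi>, y))"
    unfolding post_apply[OF Iso_src[OF \<phi>] y] post_apply[OF Iso_trg[OF \<phi>] c] S1.HomE_equiv[OF x \<phi> y]
    by (rule hD(5))
next
  note hD = equivariant_mapD[OF h]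
  fix W a assume W: "openin (total E') W"
  have "openin X {N \<in> Mod. a \<in> fobj N A \<and> x (N, a) \<in> {e \<in> S1.TE. h e \<in> W}}"
    by (rule S1.HomE_open[OF x openin_continuous_map_preimage[OF hD(2) W]])
  also have "{N \<in> Mod. a \<in> fobj N A \<and> x (N, a) \<in> {e \<in> S1.TE. h e \<in> W}} =
      {N \<in> Mod. a \<in> fobj N A \<and> post A h x (N, a) \<in> W}"
    using S1.HomE_in[OF x] post_apply by auto
  finally show "openin X {N \<in> Mod. a \<in> fobj N A \<and> post A h x (N, a) \<in> W}" .
qed

lemma post_pre:
  assumes f: "f \<in> hom D C A" and x: "x \<in> S1.HomE A" and h: "equivariant_map Grpd E h E'"
  shows "post C h (S1.pre f x) = S2.pre f (post A h x)"
proof (rule S2.HomE_eqI[OF post_HomE[OF homD(4)[OF cat f] h S1.pre_HomE[OF f x]] S2.pre_HomE[OF f post_HomE[OF homD(5)[OF cat f] h x]]])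
  fix N y assume N: "N \<in> Mod" "y \<in> fobj N C"
  show "post C h (S1.pre f x) (N, y) = S2.pre f (post A h x) (N, y)"
    unfolding post_apply[OF N] S1.pre_apply[OF f N] post_apply[OF N(1) Mev_in[OF N(1) f N(2)]] by (rule refl)
qed

text \<open>Every point of the total space is a value of some map out of an \<open>EL A\<close>, so
  composites with those maps determine everything.\<close>

lemma equivariant_map_eqI:
  assumes h: "equivariant_map Grpd E h E'" and k: "equivariant_map Grpd E k E'"
    and e: "\<And>A x. A \<in> Obj D \<Longrightarrow> x \<in> S1.HomE A \<Longrightarrow> post A h x = post A k x"
  shows "h = k"
proof (rule extensionalityI[OF equivariant_mapD(1)[OF h] equivariant_mapD(1)[OF k]])
  fix r assume r: "r \<in> S1.TE"
  obtain A x y where A: "A \<in> Obj D" "x \<in> S1.HomE A" "y \<in> fobj (proj E r) A" "x (proj E r, y) = r"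
    by (rule S1.HomE_generate[OF r])
  have "post A h x (proj E r, y) = post A k x (proj E r, y)" using e[OF A(1,2)] by simp
  then show "h r = k r" unfolding post_apply[OF S1.proj_Mod[OF r] A(3)] A(4) .
qed

text \<open>A point is some \<open>x (M, a)\<close>, and \<open>h\<close> must send it to
  \<open>\<tau> A x (M, a)\<close>. Two presentations of a point pull back to two maps on a product
  that agree at an element. They become equal after restriction to a definable part, and there the
  naturality of \<open>\<tau>\<close> compares the values.\<close>

lemma ex_equivariant_map:
  assumes \<tau>: "\<And>A x. A \<in> Obj D \<Longrightarrow> x \<in> S1.HomE A \<Longrightarrow> \<tau> A x \<in> S2.HomE A"
    and nat: "\<And>f C A x. f \<in> hom D C A \<Longrightarrow> x \<in> S1.HomE A \<Longrightarrow> \<tau> C (S1.pre f x) = S2.pre f (\<tau> A x)"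
  shows "\<exists>h. equivariant_map Grpd E h E' \<and> (\<forall>A\<in>Obj D. \<forall>x\<in>S1.HomE A. post A h x = \<tau> A x)"
proof -
  have wd: "\<tau> A x (M, a) = \<tau> B x' (M, b)"
    if A: "A \<in> Obj D" and B: "B \<in> Obj D" and x: "x \<in> S1.HomE A" and x': "x' \<in> S1.HomE B" and M: "M \<in> Mod"
      and a: "a \<in> fobj M A" and b: "b \<in> fobj M B" and e: "x (M, a) = x' (M, b)" for A B x x' M a b
  proof -
    obtain P p q z where p: "p \<in> hom D P A" and q: "q \<in> hom D P B" and z: "z \<in> fobj M P" "ev M p z = a" "ev M q z = b"
      by (rule ex_product_point[OF A B M a b]) (rule that, assumption+)
    have P: "P \<in> Obj D" using homD[OF cat p] by simp
    note px = S1.pre_HomE[OF p x] and qx = S1.pre_HomE[OF q x']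
    have "S1.pre p x (M, z) = S1.pre q x' (M, z)"
      unfolding S1.pre_apply[OF p M z(1)] S1.pre_apply[OF q M z(1)] z(2,3) by (rule e)
    then obtain C g w where g: "g \<in> hom D C P" "w \<in> fobj M C" "ev M g w = z"
      and ge: "S1.pre g (S1.pre p x) = S1.pre g (S1.pre q x')"
      by (rule S1.HomE_equalizer[OF P px qx M z(1)]) (rule that, assumption+)
    have 1: "\<tau> B0 y (M, ev M k z) = \<tau> C (S1.pre g (S1.pre k y)) (M, w)"
      if k: "k \<in> hom D P B0" and y: "y \<in> S1.HomE B0" for k B0 y
    proof -
      have "\<tau> C (S1.pre g (S1.pre k y)) = S2.pre g (S2.pre k (\<tau> B0 y))"
        unfolding nat[OF g(1) S1.pre_HomE[OF k y]] nat[OF k y] by (rule refl)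
      then show ?thesis
        by (simp only: S2.pre_apply[OF g(1) M g(2)] g(3) S2.pre_apply[OF k M z(1)])
    qed
    show ?thesis using 1[OF p x] 1[OF q x'] z(2,3) ge by simp
  qed
  define h0 where "h0 e = (SOME e'. \<exists>A\<in>Obj D. \<exists>x\<in>S1.HomE A. \<exists>a\<in>fobj (proj E e) A.
    x (proj E e, a) = e \<and> e' = \<tau> A x (proj E e, a))" for e
  have h0: "h0 (x (M, a)) = \<tau> A x (M, a)" if A: "A \<in> Obj D" and x: "x \<in> S1.HomE A" and M: "M \<in> Mod" and a: "a \<in> fobj M A" for A x M a
  proof -
    have pr: "proj E (x (M, a)) = M" by (rule S1.HomE_proj[OF x M a])
    have "\<exists>B\<in>Obj D. \<exists>x'\<in>S1.HomE B. \<exists>b\<in>fobj M B. x' (M, b) = x (M, a) \<and> h0 (x (M, a)) = \<tau> B x' (M, b)"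
      unfolding h0_def pr by (rule someI[of _ "\<tau> A x (M, a)"]) (use A x a in blast)
    then obtain B x' b where B: "B \<in> Obj D" "x' \<in> S1.HomE B" "b \<in> fobj M B" "x' (M, b) = x (M, a)"
      and e: "h0 (x (M, a)) = \<tau> B x' (M, b)" by blast
    show ?thesis unfolding e by (rule wd[OF B(1) A B(2) x M B(3) a B(4)])
  qed
  define h where "h = restrict h0 S1.TE"
  have h: "h (x (M, a)) = \<tau> A x (M, a)" if "A \<in> Obj D" "x \<in> S1.HomE A" "M \<in> Mod" "a \<in> fobj M A" for A x M a
    using h0[OF that] S1.HomE_in[OF that(2-4)] by (simp add: h_def)
  have gen: "\<exists>A x a. A \<in> Obj D \<and> x \<in> S1.HomE A \<and> proj E r \<in> Mod \<and> a \<in> fobj (proj E r) A \<and> r = x (proj E r, a)"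
    if r: "r \<in> S1.TE" for r
  proof -
    obtain A x y where "A \<in> Obj D" "x \<in> S1.HomE A" "y \<in> fobj (proj E r) A" "x (proj E r, y) = r"
      by (rule S1.HomE_generate[OF r])
    then show ?thesis using S1.proj_Mod[OF r] by metis
  qed
  have "equivariant_map Grpd E h E'"
    unfolding equivariant_map_def
  proof (intro conjI ballI)
    show "h \<in> extensional S1.TE" by (simp add: h_def)
    have hin: "h r \<in> S2.TE \<and> proj E' (h r) = proj E r" if r: "r \<in> S1.TE" for r
    proof -
      obtain A x a where A: "A \<in> Obj D" "x \<in> S1.HomE A" "proj E r \<in> Mod" "a \<in> fobj (proj E r) A" "r = x (proj E r, a)"
        using gen[OF r] by (elim exE conjE) (rule that, assumption+)
      have "h r = \<tau> A x (proj E r, a)" using h[OF A(1-4)] A(5) by simp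
      then show ?thesis
        using S2.HomE_in[OF \<tau>[OF A(1,2)] A(3,4)] S2.HomE_proj[OF \<tau>[OF A(1,2)] A(3,4)] by simp
    qed
    then show "proj E' (h r) = proj E r" if "r \<in> S1.TE" for r using that by blast
    show "continuous_map (total E) (total E') h"
      unfolding continuous_map_def
    proof (intro conjI allI impI)
      show "h \<in> S1.TE \<rightarrow> S2.TE" using hin by blast
      fix W assume W: "openin (total E') W"
      show "openin (total E) {r \<in> S1.TE. h r \<in> W}"
      proof (subst openin_subopen, intro ballI)
        fix r assume r: "r \<in> {r \<in> S1.TE. h r \<in> W}"
        then have "r \<in> S1.TE" by blast
        from gen[OF this] obtain A x a where A: "A \<in> Obj D" "x \<in> S1.HomE A" "proj E r \<in> Mod" "a \<in> fobj (proj E r) A" "r = x (proj E r, a)"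
          by (elim exE conjE) (rule that, assumption+)
        let ?V = "{N \<in> Mod. a \<in> fobj N A \<and> \<tau> A x (N, a) \<in> W}"
        \<comment> \<open>Neighbourhoods of \<open>r\<close> come as open images of sections; on
          such an image \<open>h\<close> is given by the single map
          \<open>\<tau> A x\<close>.\<close>
        have oV: "openin (total E) ((\<lambda>N. x (N, a)) ` ?V)"
          by (rule S1.HomE_open_image[OF A(2) S2.HomE_open[OF \<tau>[OF A(1,2)] W]]) blast
        have "h r = \<tau> A x (proj E r, a)" using h[OF A(1-4)] A(5) by simp
        then have "proj E r \<in> ?V" using r A(3,4) by simp
        then have "r \<in> (\<lambda>N. x (N, a)) ` ?V" using A(5) by (rule rev_image_eqI)
        moreover have "(\<lambda>N. x (N, a)) ` ?V \<subseteq> {r \<in> S1.TE. h r \<in> W}"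
          using S1.HomE_in[OF A(2)] h[OF A(1,2)] by auto
        ultimately show "\<exists>T. openin (total E) T \<and> r \<in> T \<and> T \<subseteq> {r \<in> S1.TE. h r \<in> W}" using oV by blast
      qed
    qed
    fix \<phi>r assume d: "\<phi>r \<in> act_dom Grpd E"
    obtain \<phi> r where \<phi>r: "\<phi>r = (\<phi>, r)" by (cases \<phi>r)
    then have \<phi>: "\<phi> \<in> Iso" and r: "r \<in> S1.TE" and s: "src \<phi> = proj E r" using d by (auto simp: S1.act_dom_iff)
    obtain A x a where A: "A \<in> Obj D" "x \<in> S1.HomE A" "proj E r \<in> Mod" "a \<in> fobj (proj E r) A" "r = x (proj E r, a)"
      using gen[OF r] by (elim exE conjE) (rule that, assumption+)
    have a: "a \<in> fobj (src \<phi>) A" and rs: "r = x (src \<phi>, a)" using A(4,5) s by simp_all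
    have "act E (\<phi>, r) = x (trg \<phi>, cmpt \<phi> A a)" unfolding rs by (rule S1.HomE_equiv[OF A(2) \<phi> a, symmetric])
    then have "h (act E (\<phi>, r)) = \<tau> A x (trg \<phi>, cmpt \<phi> A a)"
      using h[OF A(1,2) Iso_trg[OF \<phi>] cmpt_in[OF \<phi> A(1) a]] by simp
    also have "\<dots> = act E' (\<phi>, h r)"
      unfolding S2.HomE_equiv[OF \<tau>[OF A(1,2)] \<phi> a] using h[OF A(1,2) Iso_src[OF \<phi>] a] rs by simp
    finally show "case \<phi>r of (g, x) \<Rightarrow> h (act E (g, x)) = act E' (g, h x)" using \<phi>r by simp
  qed
  moreover from this have "post A h x = \<tau> A x" if "A \<in> Obj D" "x \<in> S1.HomE A" for A x
    by (intro S2.HomE_eqI[OF post_HomE[OF that(1) _ that(2)] \<tau>[OF that]]) (simp_all add: post_apply h[OF that])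
  ultimately show ?thesis by blast
qed

end

section \<open>The equivariant sheaf of a sheaf on the site\<close>

text \<open>The stalks have to be points of \<open>'u\<close>. The injection \<open>cd\<close> of
  the data that describe a germ is a parameter here; it comes from a cardinality bound once
  \<open>\<mu>\<close> is present.\<close>

locale site_sheaf = decidable_models \<kappa> D for \<kappa> :: "'k rel" and D :: "('o, 'a) cat" +
  fixes P :: "('o, 'a, 'u set, ('u set, 'u \<Rightarrow> 'u) arrow) functr" and \<U> :: "'u set set"
    and cd :: "('k, 'o, 'a) model \<times> 'o \<times> 'k hset \<times> 'u \<Rightarrow> 'u"
  assumes P: "is_functor (op_cat D) (set_cat \<U>) P" and sheaf: "is_sheaf D (coherent_coverage D) P"
    and sat: "saturated_set_of_small_models \<kappa> D"
    and cd: "inj_on cd {(M, A, x, p). M \<in> Mod \<and> A \<in> Obj D \<and> x \<in> fobj M A \<and> p \<in> fobj P A}"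
begin

lemma P_in: "f \<in> hom D C A \<Longrightarrow> p \<in> fobj P A \<Longrightarrow> ev P f p \<in> fobj P C"
  using is_functorD(2)[OF P, of f A C] hom_set_catD by (fastforce simp: hom_op_cat)

lemma P_Cmp:
  assumes "g \<in> hom D C B" "f \<in> hom D B A" "p \<in> fobj P A"
  shows "ev P (f \<cdot> g) p = ev P g (ev P f p)"
proof -
  have f: "f \<in> hom (op_cat D) A B" and g: "g \<in> hom (op_cat D) B C" using assms by (simp_all add: hom_op_cat)
  show ?thesis
    using is_functorD(4)[OF P f g] app_Cmp_set_cat[OF is_functorD(2)[OF P f] assms(3), of "farr P g"] by simp
qed

lemma P_Idt: "A \<in> Obj D \<Longrightarrow> p \<in> fobj P A \<Longrightarrow> ev P (Idt D A) p = p"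
  using is_functorD(3)[OF P, of A] by (simp add: Idt_set_cat)

text \<open>
  The stalk at a model \<open>M\<close> is the colimit of \<open>P\<close> over the category of elements of \<open>M\<close>, and the
  topology is final for the maps \<open>(N, x) \<mapsto> cls N A x p\<close>.
\<close>

definition rel where
  "rel M A x p B y q \<longleftrightarrow> (\<exists>C f g z. f \<in> hom D C A \<and> g \<in> hom D C B \<and> z \<in> fobj M C \<and>
    ev M f z = x \<and> ev M g z = y \<and> ev P f p = ev P g q)"

lemma relI: "f \<in> hom D C A \<Longrightarrow> g \<in> hom D C B \<Longrightarrow> z \<in> fobj M C \<Longrightarrow>
    ev M f z = x \<Longrightarrow> ev M g z = y \<Longrightarrow> ev P f p = ev P g q \<Longrightarrow> rel M A x p B y q"
  unfolding rel_def by blast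

lemma relE:
  assumes "rel M A x p B y q"
  obtains C f g z where "f \<in> hom D C A" "g \<in> hom D C B" "z \<in> fobj M C"
    "ev M f z = x" "ev M g z = y" "ev P f p = ev P g q"
  using assms unfolding rel_def by (elim exE conjE) (rule that, assumption+)

lemma rel_refl: "M \<in> Mod \<Longrightarrow> A \<in> Obj D \<Longrightarrow> x \<in> fobj M A \<Longrightarrow> rel M A x p A x p"
  using Idt_in_hom[OF cat] Mev_Idt by (intro relI[of "Idt D A" A A "Idt D A" A x]) auto

lemma rel_sym: "rel M A x p B y q \<Longrightarrow> rel M B y q A x p"
  by (elim relE, rule relI) auto

text \<open>Two spans that meet at an element are joined by a pullback at that element. So
  \<open>rel\<close> is already an equivalence relation, with no chains of spans.\<close>

lemma rel_trans:
  assumes M: "M \<in> Mod" and p: "p \<in> fobj P A" "p' \<in> fobj P B" "p'' \<in> fobj P B'"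
    and 1: "rel M A x p B y p'" and 2: "rel M B y p' B' w p''"
  shows "rel M A x p B' w p''"
proof -
  obtain C f g z where f: "f \<in> hom D C A" "g \<in> hom D C B" and z: "z \<in> fobj M C" "ev M f z = x" "ev M g z = y"
    and e: "ev P f p = ev P g p'" by (rule relE[OF 1])
  obtain C' f' g' z' where f': "f' \<in> hom D C' B" "g' \<in> hom D C' B'" and z': "z' \<in> fobj M C'" "ev M f' z' = y" "ev M g' z' = w"
    and e': "ev P f' p' = ev P g' p''" by (rule relE[OF 2])
  have "ev M g z = ev M f' z'" using z z' by simp
  then obtain Q u v t where u: "u \<in> hom D Q C" and v: "v \<in> hom D Q C'" and uv: "g \<cdot> u = f' \<cdot> v"
    and t: "t \<in> fobj M Q" "ev M u t = z" "ev M v t = z'"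
    by (rule ex_pullback_point[OF f(2) f'(1) M z(1) z'(1)]) (rule that, assumption+)
  show ?thesis
  proof (rule relI[OF Cmp_in_hom[OF cat u f(1)] Cmp_in_hom[OF cat v f'(2)] t(1)])
    show "ev M (f \<cdot> u) t = x" "ev M (g' \<cdot> v) t = w"
      using Mev_Cmp[OF M u f(1) t(1)] Mev_Cmp[OF M v f'(2) t(1)] t z z' by simp_all
    have "ev P (f \<cdot> u) p = ev P (g \<cdot> u) p'"
      using P_Cmp[OF u f(1) p(1)] P_Cmp[OF u f(2) p(2)] e by simp
    also have "\<dots> = ev P (g' \<cdot> v) p''"
      unfolding uv using P_Cmp[OF v f'(1) p(2)] P_Cmp[OF v f'(2) p(3)] e' by simp
    finally show "ev P (f \<cdot> u) p = ev P (g' \<cdot> v) p''" .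
  qed
qed

section \<open>Germs, the space of stalks and the action on it\<close>

definition reps where
  "reps M A x p = {(B, y, q). B \<in> Obj D \<and> y \<in> fobj M B \<and> q \<in> fobj P B \<and> rel M B y q A x p}"

text \<open>A class must be a single element of \<open>'u\<close>, so the code of one chosen
  representative stands for it. Related data have the same set \<open>reps\<close>, hence the same
  choice; the model is kept to separate the stalks.\<close>

definition cls where
  "cls M A x p = cd (M, SOME t. t \<in> reps M A x p)"

definition elem where
  "elem M A x p \<longleftrightarrow> M \<in> Mod \<and> A \<in> Obj D \<and> x \<in> fobj M A \<and> p \<in> fobj P A"

lemma some_reps: "elem M A x p \<Longrightarrow> (SOME t. t \<in> reps M A x p) \<in> reps M A x p"
  by (rule someI[of _ "(A, x, p)"]) (auto simp: elem_def reps_def rel_refl)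

lemma cls_eq_iff:
  assumes 1: "elem M A x p" and 2: "elem N B y q"
  shows "cls M A x p = cls N B y q \<longleftrightarrow> M = N \<and> rel M A x p B y q"
proof
  assume e: "cls M A x p = cls N B y q"
  have "(M, SOME t. t \<in> reps M A x p) = (N, SOME t. t \<in> reps N B y q)"
    by (rule inj_onD[OF cd e[unfolded cls_def]])
      (use some_reps[OF 1] some_reps[OF 2] 1 2 in \<open>auto simp: reps_def elem_def\<close>)
  note * = this[unfolded prod.inject]
  have MN: "M = N" by (rule conjunct1[OF *])
  have "(SOME t. t \<in> reps M A x p) = (SOME t. t \<in> reps N B y q)" by (rule conjunct2[OF *])
  then have "(SOME t. t \<in> reps M A x p) \<in> reps M A x p \<inter> reps M B y q"
    using some_reps[OF 1] some_reps[OF 2] unfolding MN by simp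
  then obtain A' x' p' where p': "p' \<in> fobj P A'" "rel M A' x' p' A x p" "rel M A' x' p' B y q"
    by (auto simp: reps_def)
  have M: "M \<in> Mod" and p: "p \<in> fobj P A" and q: "q \<in> fobj P B" using 1 2 by (simp_all add: elem_def)
  then show "M = N \<and> rel M A x p B y q"
    using rel_trans[OF M p p'(1) q rel_sym[OF p'(2)] p'(3)] MN by simp
next
  assume r: "M = N \<and> rel M A x p B y q"
  note rr = conjunct2[OF r]
  have M: "M \<in> Mod" and p: "p \<in> fobj P A" and q: "q \<in> fobj P B"
    using 1 2 by (simp_all add: elem_def)
  have "rel M C w s A x p \<longleftrightarrow> rel M C w s B y q" if s: "s \<in> fobj P C" for C w s
    using rel_trans[OF M s p q _ rr] rel_trans[OF M s q p _ rel_sym[OF rr]] by (rule iffI)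
  then have "reps M A x p = reps M B y q" unfolding reps_def by (intro Collect_cong) auto
  then show "cls M A x p = cls N B y q" using r by (simp add: cls_def)
qed

definition stalks :: "'u set" where
  "stalks = {r. \<exists>M A x p. elem M A x p \<and> r = cls M A x p}"

lemma cls_stalks: "elem M A x p \<Longrightarrow> cls M A x p \<in> stalks"
  unfolding stalks_def by blast

lemma stalksE:
  assumes "r \<in> stalks"
  obtains M A x p where "elem M A x p" "r = cls M A x p"
  using assms unfolding stalks_def by blast

definition prj where
  "prj r = (SOME M. \<exists>A x p. elem M A x p \<and> r = cls M A x p)"

lemma prj_cls: "elem M A x p \<Longrightarrow> prj (cls M A x p) = M"
proof -
  assume e: "elem M A x p"
  have "\<exists>B y q. elem (prj (cls M A x p)) B y q \<and> cls M A x p = cls (prj (cls M A x p)) B y q"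
    unfolding prj_def by (rule someI[of _ M]) (use e in blast)
  then obtain B y q where B: "elem (prj (cls M A x p)) B y q"
    "cls M A x p = cls (prj (cls M A x p)) B y q" by blast
  show ?thesis using iffD1[OF cls_eq_iff[OF e B(1)] B(2)] by simp
qed

definition open_stalks where
  "open_stalks W \<longleftrightarrow> W \<subseteq> stalks \<and>
    (\<forall>A\<in>Obj D. \<forall>p\<in>fobj P A. \<forall>a. openin X {N \<in> Mod. a \<in> fobj N A \<and> cls N A a p \<in> W})"

lemma istopology_open_stalks: "istopology open_stalks"
  unfolding istopology_def
proof (intro conjI allI impI)
  fix S T assume "open_stalks S" "open_stalks T"
  moreover have "{N \<in> Mod. a \<in> fobj N A \<and> cls N A a p \<in> S \<inter> T} =
      {N \<in> Mod. a \<in> fobj N A \<and> cls N A a p \<in> S} \<inter> {N \<in> Mod. a \<in> fobj N A \<and> cls N A a p \<in> T}" for A a p by blast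
  ultimately show "open_stalks (S \<inter> T)" unfolding open_stalks_def by auto
next
  fix K assume K: "\<forall>S\<in>K. open_stalks S"
  have "openin X {N \<in> Mod. a \<in> fobj N A \<and> cls N A a p \<in> \<Union> K}" if "A \<in> Obj D" "p \<in> fobj P A" for A a p
  proof -
    have "openin X (\<Union>S\<in>K. {N \<in> Mod. a \<in> fobj N A \<and> cls N A a p \<in> S})"
      by (rule openin_Union) (use K that in \<open>auto simp: open_stalks_def\<close>)
    also have "(\<Union>S\<in>K. {N \<in> Mod. a \<in> fobj N A \<and> cls N A a p \<in> S}) = {N \<in> Mod. a \<in> fobj N A \<and> cls N A a p \<in> \<Union> K}" by blast
    finally show ?thesis .
  qed
  then show "open_stalks (\<Union> K)" using K unfolding open_stalks_def by blast
qed

definition stalk_top where "stalk_top = topology open_stalks"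

lemma openin_stalk_top: "openin stalk_top W \<longleftrightarrow> open_stalks W"
  unfolding stalk_top_def by (simp add: topology_inverse' istopology_open_stalks)

lemma topspace_stalk_top: "topspace stalk_top = stalks"
proof
  show "topspace stalk_top \<subseteq> stalks"
    using openin_topspace[of stalk_top] unfolding openin_stalk_top open_stalks_def by blast
  have "open_stalks stalks"
    unfolding open_stalks_def
  proof (intro conjI ballI allI subset_refl)
    fix A p a assume A: "A \<in> Obj D" "p \<in> fobj P A"
    have "{N \<in> Mod. a \<in> fobj N A \<and> cls N A a p \<in> stalks} = {N \<in> Mod. a \<in> fobj N A}"
      using A cls_stalks by (auto simp: elem_def)
    then show "openin X {N \<in> Mod. a \<in> fobj N A \<and> cls N A a p \<in> stalks}" using openin_mem[OF A(1)] by simp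
  qed
  then show "stalks \<subseteq> topspace stalk_top" unfolding openin_stalk_top[symmetric] by (rule openin_subset)
qed

text \<open>That two germs are equal is witnessed by one label \<open>z\<close>, two of its images
  and an equation in \<open>P\<close>. The first two are open conditions on the model and the last
  does not mention it, so germs equal in one model are equal nearby.\<close>

lemma open_section:
  assumes A: "A \<in> Obj D" "p \<in> fobj P A" and W: "openin X W" "W \<subseteq> {N. a \<in> fobj N A}"
  shows "openin stalk_top ((\<lambda>N. cls N A a p) ` W)"
  unfolding openin_stalk_top open_stalks_def
proof (intro conjI ballI allI)
  have WM: "W \<subseteq> Mod" using openin_subset[OF W(1)] topX by simp
  have el: "elem N A a p" if "N \<in> W" for N using that WM W(2) A by (auto simp: elem_def)
  show "(\<lambda>N. cls N A a p) ` W \<subseteq> stalks" using el cls_stalks by blast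
  fix B q b assume B: "B \<in> Obj D" "q \<in> fobj P B"
  let ?S = "{N \<in> Mod. b \<in> fobj N B \<and> cls N B b q \<in> (\<lambda>N. cls N A a p) ` W}"
  have S: "N \<in> ?S \<longleftrightarrow> N \<in> W \<and> b \<in> fobj N B \<and> rel N B b q A a p" for N
  proof
    assume N: "N \<in> ?S"
    then obtain N' where N': "N' \<in> W" "cls N B b q = cls N' A a p" by blast
    have "elem N B b q" using N B by (simp add: elem_def)
    then show "N \<in> W \<and> b \<in> fobj N B \<and> rel N B b q A a p"
      using cls_eq_iff[OF _ el[OF N'(1)]] N' N by blast
  next
    assume N: "N \<in> W \<and> b \<in> fobj N B \<and> rel N B b q A a p"
    then have "elem N B b q" using WM B by (auto simp: elem_def)
    then have "cls N B b q = cls N A a p" using cls_eq_iff[OF _ el] N by blast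
    then show "N \<in> ?S" using N WM by blast
  qed
  show "openin X ?S"
  proof (subst openin_subopen, intro ballI)
    fix N assume N: "N \<in> ?S"
    then have NM: "N \<in> Mod" by blast
    have "rel N B b q A a p" using N unfolding S by blast
    then obtain C f g z where f: "f \<in> hom D C B" "g \<in> hom D C A" and z: "z \<in> fobj N C" "ev N f z = b" "ev N g z = a"
      and e: "ev P f q = ev P g p" by (rule relE)
    let ?T = "W \<inter> nbd N C z {f, g}"
    have "openin X ?T"
      using homD(4)[OF cat f(1)] hom_out_of[OF f(1)] hom_out_of[OF f(2)]
      by (intro openin_Int W(1) openin_nbd) auto
    moreover have "N \<in> ?T" using N nbd_refl[OF NM z(1)] unfolding S by blast
    moreover have "?T \<subseteq> ?S"
    proof
      fix N' assume N': "N' \<in> ?T"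
      then have v: "N' \<in> Mod" "z \<in> fobj N' C" "ev N' f z = b" "ev N' g z = a" using z by (auto simp: nbd_def)
      then have "b \<in> fobj N' B" using Mev_in[OF v(1) f(1) v(2)] by simp
      moreover have "rel N' B b q A a p" by (rule relI[OF f v(2,3,4) e])
      ultimately show "N' \<in> ?S" using N' unfolding S by blast
    qed
    ultimately show "\<exists>T. openin X T \<and> N \<in> T \<and> T \<subseteq> ?S" by blast
  qed
qed

lemma elem_act:
  assumes \<phi>: "\<phi> \<in> Iso" and e: "elem (src \<phi>) A x p"
  shows "elem (trg \<phi>) A (cmpt \<phi> A x) p"
  using e cmpt_in[OF \<phi>] Iso_trg[OF \<phi>] by (simp add: elem_def)

lemma rel_act:
  assumes \<phi>: "\<phi> \<in> Iso" and r: "rel (src \<phi>) A x p B y q"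
  shows "rel (trg \<phi>) A (cmpt \<phi> A x) p B (cmpt \<phi> B y) q"
proof -
  obtain C f g z where f: "f \<in> hom D C A" "g \<in> hom D C B" and z: "z \<in> fobj (src \<phi>) C" "ev (src \<phi>) f z = x" "ev (src \<phi>) g z = y"
    and e: "ev P f p = ev P g q" by (rule relE[OF r])
  show ?thesis
    by (rule relI[OF f cmpt_in[OF \<phi> homD(4)[OF cat f(1)] z(1)] _ _ e])
      (use cmpt_natural[OF \<phi> f(1) z(1)] cmpt_natural[OF \<phi> f(2) z(1)] z in simp_all)
qed

text \<open>A representative of \<open>r\<close> is chosen and moved; by \<open>rel_act\<close> any
  other gives the same germ.\<close>

definition stalk_act where
  "stalk_act \<phi> r = (SOME r'. \<exists>A x p. elem (src \<phi>) A x p \<and> r = cls (src \<phi>) A x p \<and> r' = cls (trg \<phi>) A (cmpt \<phi> A x) p)"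

lemma stalk_act_cls:
  assumes \<phi>: "\<phi> \<in> Iso" and e: "elem (src \<phi>) A x p"
  shows "stalk_act \<phi> (cls (src \<phi>) A x p) = cls (trg \<phi>) A (cmpt \<phi> A x) p"
proof -
  have "\<exists>B y q. elem (src \<phi>) B y q \<and> cls (src \<phi>) A x p = cls (src \<phi>) B y q \<and>
      stalk_act \<phi> (cls (src \<phi>) A x p) = cls (trg \<phi>) B (cmpt \<phi> B y) q"
    unfolding stalk_act_def by (rule someI[of _ "cls (trg \<phi>) A (cmpt \<phi> A x) p"]) (use e in blast)
  then obtain B y q where B: "elem (src \<phi>) B y q" "cls (src \<phi>) A x p = cls (src \<phi>) B y q"
    and s: "stalk_act \<phi> (cls (src \<phi>) A x p) = cls (trg \<phi>) B (cmpt \<phi> B y) q" by blast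
  have "rel (src \<phi>) A x p B y q" using cls_eq_iff[OF e B(1)] B(2) by blast
  then have "cls (trg \<phi>) A (cmpt \<phi> A x) p = cls (trg \<phi>) B (cmpt \<phi> B y) q"
    using cls_eq_iff[OF elem_act[OF \<phi> e] elem_act[OF \<phi> B(1)]] rel_act[OF \<phi>] by blast
  then show ?thesis using s by simp
qed

definition stalk_sheaf :: "(('k, 'o, 'a) model, ('k, 'o, 'a) model_map, 'u) action" where
  "stalk_sheaf = \<lparr>total = stalk_top, proj = restrict prj stalks,
    act = restrict (\<lambda>(\<phi>, r). stalk_act \<phi> r) {(\<phi>, r). \<phi> \<in> Iso \<and> r \<in> stalks \<and> src \<phi> = prj r}\<rparr>"

lemma stalk_sheaf_simps [simp]:
  "total stalk_sheaf = stalk_top" "proj stalk_sheaf = restrict prj stalks" "topspace stalk_top = stalks"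
  by (simp_all add: stalk_sheaf_def topspace_stalk_top)

lemma act_dom_stalk: "act_dom Grpd stalk_sheaf = {(\<phi>, r). \<phi> \<in> Iso \<and> r \<in> stalks \<and> src \<phi> = prj r}"
  by (auto simp: act_dom_def topG)

lemma act_stalk_cls:
  assumes "\<phi> \<in> Iso" "elem (src \<phi>) A x p"
  shows "act stalk_sheaf (\<phi>, cls (src \<phi>) A x p) = cls (trg \<phi>) A (cmpt \<phi> A x) p"
  using stalk_act_cls[OF assms] assms cls_stalks[OF assms(2)] prj_cls[OF assms(2)] by (simp add: stalk_sheaf_def)

lemma act_domE:
  assumes "d \<in> act_dom Grpd stalk_sheaf"
  obtains \<phi> A x p where "d = (\<phi>, cls (src \<phi>) A x p)" "\<phi> \<in> Iso" "elem (src \<phi>) A x p"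
proof -
  obtain \<phi> r where d: "d = (\<phi>, r)" "\<phi> \<in> Iso" "r \<in> stalks" "src \<phi> = prj r"
    using assms unfolding act_dom_stalk by blast
  obtain M A x p where e: "elem M A x p" "r = cls M A x p" by (rule stalksE[OF d(3)])
  have "src \<phi> = M" using d(4) prj_cls[OF e(1)] e(2) by simp
  then show ?thesis using that d e by simp
qed

lemma prj_continuous: "continuous_map stalk_top X (restrict prj stalks)"
  unfolding continuous_map_def stalk_sheaf_simps topX
proof (intro conjI allI impI)
  have "prj r \<in> Mod" if "r \<in> stalks" for r
    using that prj_cls by (elim stalksE) (simp add: elem_def)
  then show "restrict prj stalks \<in> stalks \<rightarrow> Mod" by simp
  fix U assume U: "openin X U"
  show "openin stalk_top {r \<in> stalks. restrict prj stalks r \<in> U}"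
    unfolding openin_stalk_top open_stalks_def
  proof (intro conjI ballI allI)
    fix A p a assume A: "A \<in> Obj D" "p \<in> fobj P A"
    have "{N \<in> Mod. a \<in> fobj N A \<and> cls N A a p \<in> {r \<in> stalks. restrict prj stalks r \<in> U}} = {N \<in> Mod. a \<in> fobj N A} \<inter> U"
      using A cls_stalks prj_cls by (auto simp: elem_def)
    then show "openin X {N \<in> Mod. a \<in> fobj N A \<and> cls N A a p \<in> {r \<in> stalks. restrict prj stalks r \<in> U}}"
      using openin_Int[OF openin_mem[OF A(1)] U] by simp
  qed blast
qed

lemma local_homeo_prj: "local_homeo stalk_top X (restrict prj stalks)"
proof (rule local_homeoI[OF prj_continuous])
  fix W assume W: "openin stalk_top W"
  have Ws: "W \<subseteq> stalks" and o: "\<And>A p a. A \<in> Obj D \<Longrightarrow> p \<in> fobj P A \<Longrightarrow> openin X {N \<in> Mod. a \<in> fobj N A \<and> cls N A a p \<in> W}"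
    using W unfolding openin_stalk_top open_stalks_def by blast+
  show "openin X (restrict prj stalks ` W)"
  proof (subst openin_subopen, intro ballI)
    fix N assume "N \<in> restrict prj stalks ` W"
    then obtain r where r: "r \<in> W" "N = prj r" using Ws by auto
    obtain M A x p where e: "elem M A x p" "r = cls M A x p" using stalksE r(1) Ws by blast
    let ?T = "{N \<in> Mod. x \<in> fobj N A \<and> cls N A x p \<in> W}"
    have "openin X ?T" using o e(1) by (simp add: elem_def)
    moreover have "N \<in> ?T" using e r prj_cls[OF e(1)] by (simp add: elem_def)
    moreover have "?T \<subseteq> restrict prj stalks ` W"
    proof
      fix N' assume N': "N' \<in> ?T"
      then have "elem N' A x p" using e(1) by (simp add: elem_def)
      then have "N' = restrict prj stalks (cls N' A x p)" using prj_cls cls_stalks by simp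
      moreover have "cls N' A x p \<in> W" using N' by blast
      ultimately show "N' \<in> restrict prj stalks ` W" by (rule image_eqI)
    qed
    ultimately show "\<exists>T. openin X T \<and> N \<in> T \<and> T \<subseteq> restrict prj stalks ` W" by blast
  qed
next
  fix r assume "r \<in> topspace stalk_top"
  then have "r \<in> stalks" by simp
  then obtain M A x p where e: "elem M A x p" "r = cls M A x p" by (rule stalksE)
  let ?W = "{N \<in> Mod. x \<in> fobj N A}"
  \<comment> \<open>The sheet through \<open>r\<close>: the germs of the same section
    \<open>p\<close> at the same label \<open>x\<close> in all models that have it.\<close>
  let ?U = "(\<lambda>N. cls N A x p) ` ?W"
  have el: "elem N A x p" if "N \<in> ?W" for N using that e(1) by (simp add: elem_def)
  have "openin stalk_top ?U"
    using e(1) by (intro open_section openin_mem) (auto simp: elem_def)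
  moreover have "r \<in> ?U" using e by (auto simp: elem_def)
  moreover have "inj_on (restrict prj stalks) ?U"
    by (rule inj_onI) (use el prj_cls cls_stalks in auto)
  ultimately show "\<exists>U. openin stalk_top U \<and> r \<in> U \<and> inj_on (restrict prj stalks) U" by blast
qed

lemma openin_values_iso:
  "A \<in> Obj D \<Longrightarrow> a \<in> H \<Longrightarrow> b \<in> H \<Longrightarrow> openin GG {\<phi> \<in> Iso. a \<in> fobj (src \<phi>) A \<and> cmpt \<phi> A a = b}"
  unfolding model_iso_topology_def by (intro topology_generated_by_Basis) blast

lemma openin_trg: "openin X U \<Longrightarrow> openin GG {\<phi> \<in> Iso. trg \<phi> \<in> U}"
  unfolding model_iso_topology_def by (intro topology_generated_by_Basis) blast

lemma act_stalk_continuous: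
  "continuous_map (subtopology (prod_topology GG stalk_top) (act_dom Grpd stalk_sheaf)) stalk_top (act stalk_sheaf)"
    (is "continuous_map ?T _ _")
  unfolding continuous_map_def
proof (intro conjI allI impI)
  have tT: "topspace ?T = act_dom Grpd stalk_sheaf"
    by (auto simp: act_dom_stalk topG)
  show "act stalk_sheaf \<in> topspace ?T \<rightarrow> topspace stalk_top"
    unfolding tT
  proof (rule Pi_I)
    fix d assume "d \<in> act_dom Grpd stalk_sheaf"
    then obtain \<phi> A x p where d: "d = (\<phi>, cls (src \<phi>) A x p)" "\<phi> \<in> Iso" "elem (src \<phi>) A x p" by (rule act_domE)
    show "act stalk_sheaf d \<in> topspace stalk_top"
      unfolding d(1) act_stalk_cls[OF d(2,3)] using cls_stalks[OF elem_act[OF d(2,3)]] by simp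
  qed
  fix W assume W: "openin stalk_top W"
  have o: "\<And>A p a. A \<in> Obj D \<Longrightarrow> p \<in> fobj P A \<Longrightarrow> openin X {N \<in> Mod. a \<in> fobj N A \<and> cls N A a p \<in> W}"
    using W unfolding openin_stalk_top open_stalks_def by blast
  show "openin ?T {d \<in> topspace ?T. act stalk_sheaf d \<in> W}"
    unfolding tT
  proof (subst openin_subopen, intro ballI)
    fix d assume d0: "d \<in> {d \<in> act_dom Grpd stalk_sheaf. act stalk_sheaf d \<in> W}"
    then have "d \<in> act_dom Grpd stalk_sheaf" by blast
    then obtain \<phi> A a p where d: "d = (\<phi>, cls (src \<phi>) A a p)" "\<phi> \<in> Iso" "elem (src \<phi>) A a p" by (rule act_domE)
    define b where "b = cmpt \<phi> A a"
    have A: "A \<in> Obj D" "a \<in> fobj (src \<phi>) A" "p \<in> fobj P A" "src \<phi> \<in> Mod" using d(3) by (simp_all add: elem_def)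
    have b: "b \<in> fobj (trg \<phi>) A" unfolding b_def by (rule cmpt_in[OF d(2) A(1,2)])
    \<comment> \<open>Fixing the label \<open>b\<close> of the moved element makes the action send
      the sheet at \<open>a\<close> to the sheet at \<open>b\<close>; what remains is a condition on
      the target model.\<close>
    let ?N = "{N \<in> Mod. b \<in> fobj N A \<and> cls N A b p \<in> W}"
    let ?V = "{\<phi> \<in> Iso. a \<in> fobj (src \<phi>) A \<and> cmpt \<phi> A a = b} \<inter> {\<phi> \<in> Iso. trg \<phi> \<in> ?N}"
    let ?Q = "(\<lambda>N. cls N A a p) ` {N \<in> Mod. a \<in> fobj N A}"
    have oV: "openin GG ?V"
      by (intro openin_Int openin_values_iso openin_trg o A(1,3) fobj_H[OF A(4,1,2)] fobj_H[OF Iso_trg[OF d(2)] A(1) b])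
    have oQ: "openin stalk_top ?Q" by (intro open_section openin_mem A(1,3)) blast
    have "openin (prod_topology GG stalk_top) (?V \<times> ?Q)"
      using oV oQ by (simp only: openin_prod_Times_iff) simp
    then have "openin ?T ((?V \<times> ?Q) \<inter> act_dom Grpd stalk_sheaf)" by (rule openin_subtopology_Int)
    moreover have "d \<in> (?V \<times> ?Q) \<inter> act_dom Grpd stalk_sheaf"
    proof -
      have "cls (trg \<phi>) A b p \<in> W" using d0 unfolding d(1) b_def using act_stalk_cls[OF d(2,3)] by simp
      then have "\<phi> \<in> ?V" using d(2) A(2) b Iso_trg[OF d(2)] by (simp add: b_def)
      moreover have "cls (src \<phi>) A a p \<in> ?Q" using A by blast
      ultimately show ?thesis using d0 unfolding d(1) by blast
    qed
    moreover have "(?V \<times> ?Q) \<inter> act_dom Grpd stalk_sheaf \<subseteq> {d \<in> act_dom Grpd stalk_sheaf. act stalk_sheaf d \<in> W}"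
    proof
      fix c assume c: "c \<in> (?V \<times> ?Q) \<inter> act_dom Grpd stalk_sheaf"
      obtain \<psi> r where cr: "c = (\<psi>, r)" by (cases c)
      have \<psi>: "\<psi> \<in> Iso" "a \<in> fobj (src \<psi>) A" "cmpt \<psi> A a = b" "trg \<psi> \<in> ?N" and rQ: "r \<in> ?Q"
        and s: "src \<psi> = prj r" using c unfolding cr act_dom_stalk by blast+
      have el: "elem (src \<psi>) A a p" using \<psi>(1,2) A Iso_src[OF \<psi>(1)] by (simp add: elem_def)
      obtain N where N: "N \<in> Mod" "a \<in> fobj N A" "r = cls N A a p" using rQ by blast
      have "elem N A a p" using N A by (simp add: elem_def)
      then have "r = cls (src \<psi>) A a p" using s N(3) prj_cls by simp
      then have "act stalk_sheaf c = cls (trg \<psi>) A b p" unfolding cr using act_stalk_cls[OF \<psi>(1) el] \<psi>(3) by simp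
      then show "c \<in> {d \<in> act_dom Grpd stalk_sheaf. act stalk_sheaf d \<in> W}" using \<psi>(4) c by simp
    qed
    ultimately show "\<exists>S. openin ?T S \<and> d \<in> S \<and> S \<subseteq> {d \<in> act_dom Grpd stalk_sheaf. act stalk_sheaf d \<in> W}" by blast
  qed
qed

lemma equivariant_sheaf_stalk_sheaf: "equivariant_sheaf Grpd stalk_sheaf"
  unfolding equivariant_sheaf_def
proof (intro conjI ballI)
  show "proj stalk_sheaf \<in> extensional (topspace (total stalk_sheaf))" by simp
  show "act stalk_sheaf \<in> extensional (act_dom Grpd stalk_sheaf)"
    unfolding act_dom_stalk by (simp add: stalk_sheaf_def)
  show "local_homeo (total stalk_sheaf) (ob_top Grpd) (proj stalk_sheaf)" using local_homeo_prj by simp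
  show "continuous_map (subtopology (prod_topology (ar_top Grpd) (total stalk_sheaf)) (act_dom Grpd stalk_sheaf))
      (total stalk_sheaf) (act stalk_sheaf)" using act_stalk_continuous by simp
next
  fix d assume "d \<in> act_dom Grpd stalk_sheaf"
  then obtain \<phi> A x p where d: "d = (\<phi>, cls (src \<phi>) A x p)" "\<phi> \<in> Iso" "elem (src \<phi>) A x p" by (rule act_domE)
  note e' = elem_act[OF d(2,3)]
  show "case d of (g, x) \<Rightarrow> proj stalk_sheaf (act stalk_sheaf (g, x)) = target Grpd g"
    unfolding d(1) using act_stalk_cls[OF d(2,3)] prj_cls[OF e'] cls_stalks[OF e'] by simp
  have "act stalk_sheaf (\<psi>, act stalk_sheaf (\<phi>, cls (src \<phi>) A x p)) = act stalk_sheaf (\<psi> \<diamondop> \<phi>, cls (src \<phi>) A x p)"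
    if \<psi>: "\<psi> \<in> Iso" "src \<psi> = trg \<phi>" for \<psi>
  proof -
    note c = gcmp_Iso[OF d(2) \<psi>(1) \<psi>(2)[symmetric]]
    have "act stalk_sheaf (\<psi>, cls (src \<psi>) A (cmpt \<phi> A x) p) = cls (trg \<psi>) A (cmpt \<psi> A (cmpt \<phi> A x)) p"
      by (rule act_stalk_cls[OF \<psi>(1)]) (simp add: \<psi>(2) e')
    moreover have "act stalk_sheaf (\<psi> \<diamondop> \<phi>, cls (src (\<psi> \<diamondop> \<phi>)) A x p) = cls (trg (\<psi> \<diamondop> \<phi>)) A (cmpt (\<psi> \<diamondop> \<phi>) A x) p"
      by (rule act_stalk_cls[OF c(1)]) (simp add: c(2) d(3))
    moreover have "cmpt (\<psi> \<diamondop> \<phi>) A x = cmpt \<psi> A (cmpt \<phi> A x)"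
      by (rule cmpt_gcmp[OF d(2)]) (use d(3) in \<open>simp_all add: elem_def\<close>)
    ultimately show ?thesis using act_stalk_cls[OF d(2,3)] c(2,3) \<psi>(2) by simp
  qed
  then show "case d of (f, x) \<Rightarrow> \<forall>g\<in>topspace (ar_top Grpd). source Grpd g = target Grpd f \<longrightarrow>
      act stalk_sheaf (g, act stalk_sheaf (f, x)) = act stalk_sheaf (mult Grpd g f, x)"
    unfolding d(1) by (simp add: topG)
next
  fix r assume "r \<in> topspace (total stalk_sheaf)"
  then have r: "r \<in> stalks" by simp
  then obtain M A x p where e: "elem M A x p" "r = cls M A x p" by (rule stalksE)
  have M: "M \<in> Mod" and A: "A \<in> Obj D" "x \<in> fobj M A" using e(1) by (simp_all add: elem_def)
  note i = gid_Iso[OF M]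
  have "act stalk_sheaf (gid M, cls (src (gid M)) A x p) = cls (trg (gid M)) A (cmpt (gid M) A x) p"
    by (rule act_stalk_cls[OF i(1)]) (simp add: i e(1))
  then show "act stalk_sheaf (unit_at Grpd (proj stalk_sheaf r), r) = r"
    using r e i cmpt_gid[OF A] prj_cls[OF e(1)] by simp
qed

section \<open>Sections of the sheaf as maps into its stalks\<close>

sublocale RE: model_sheaf \<kappa> D stalk_sheaf
  by unfold_locales (rule equivariant_sheaf_stalk_sheaf)

text \<open>The comparison map from \<open>fobj P A\<close> to \<open>HomE A\<close> for the stalk
  sheaf; it will turn out to be a bijection natural in \<open>A\<close>.\<close>

definition germ where
  "germ A p = (\<lambda>(N, x)\<in>RE.EL A. cls N A x p)"

lemma germ_apply: "N \<in> Mod \<Longrightarrow> x \<in> fobj N A \<Longrightarrow> germ A p (N, x) = cls N A x p"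
  by (simp add: germ_def RE.EL_def)

lemma germ_HomE:
  assumes A: "A \<in> Obj D" "p \<in> fobj P A"
  shows "germ A p \<in> RE.HomE A"
  unfolding RE.HomE_def
proof (intro CollectI conjI ballI allI impI)
  show "germ A p \<in> extensional (RE.EL A)" by (simp add: germ_def)
  fix N x assume N: "N \<in> Mod" "x \<in> fobj N A"
  then have "elem N A x p" using A by (simp add: elem_def)
  then show "germ A p (N, x) \<in> RE.TE" "proj stalk_sheaf (germ A p (N, x)) = N"
    unfolding germ_apply[OF N] using cls_stalks prj_cls by simp_all
next
  fix \<phi> x assume \<phi>: "\<phi> \<in> Iso" and x: "x \<in> fobj (src \<phi>) A"
  then have e: "elem (src \<phi>) A x p" using A Iso_src[OF \<phi>] by (simp add: elem_def)
  show "germ A p (trg \<phi>, cmpt \<phi> A x) = act stalk_sheaf (\<phi>, germ A p (src \<phi>, x))"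
    unfolding germ_apply[OF Iso_trg[OF \<phi>] cmpt_in[OF \<phi> A(1) x]] germ_apply[OF Iso_src[OF \<phi>] x]
    by (rule act_stalk_cls[OF \<phi> e, symmetric])
next
  fix W a assume "openin (total stalk_sheaf) W"
  then have "openin X {N \<in> Mod. a \<in> fobj N A \<and> cls N A a p \<in> W}"
    using A by (simp add: openin_stalk_top open_stalks_def)
  also have "{N \<in> Mod. a \<in> fobj N A \<and> cls N A a p \<in> W} = {N \<in> Mod. a \<in> fobj N A \<and> germ A p (N, a) \<in> W}"
    using germ_apply by auto
  finally show "openin X {N \<in> Mod. a \<in> fobj N A \<and> germ A p (N, a) \<in> W}" .
qed

lemma pre_germ:
  assumes f: "f \<in> hom D C A" and p: "p \<in> fobj P A"
  shows "RE.pre f (germ A p) = germ C (ev P f p)"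
proof (rule RE.HomE_eqI[OF RE.pre_HomE[OF f germ_HomE] germ_HomE])
  note h = homD[OF cat f]
  show "A \<in> Obj D" "C \<in> Obj D" "p \<in> fobj P A" "ev P f p \<in> fobj P C" using h p P_in[OF f p] by simp_all
  fix N x assume N: "N \<in> Mod" "x \<in> fobj N C"
  note fx = Mev_in[OF N(1) f N(2)]
  have "rel N A (ev N f x) p C x (ev P f p)"
    by (rule relI[OF f Idt_in_hom[OF cat h(4)] N(2)]) (simp_all add: Mev_Idt[OF N(1) h(4) N(2)] P_Idt[OF h(4) P_in[OF f p]])
  then have "cls N A (ev N f x) p = cls N C x (ev P f p)"
    using cls_eq_iff[of N A "ev N f x" p N C x "ev P f p"] N fx h p P_in[OF f p] by (simp add: elem_def)
  then show "RE.pre f (germ A p) (N, x) = germ C (ev P f p) (N, x)"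
    by (simp only: RE.pre_apply[OF f N] germ_apply[OF N(1) fx] germ_apply[OF N])
qed

text \<open>Saturation enters here: a family that reaches every element of every model contains a
  finite family of the coverage. Statements about sections of \<open>P\<close> can thereby be proved
  near one element at a time.\<close>

lemma covering_family:
  assumes A: "A \<in> Obj D" and S: "S \<subseteq> {f \<in> Arr D. Cod D f = A}"
    and c: "\<And>M x. M \<in> Mod \<Longrightarrow> x \<in> fobj M A \<Longrightarrow> \<exists>f\<in>S. \<exists>z\<in>fobj M (Dom D f). ev M f z = x"
  obtains T where "T \<subseteq> S" "T \<in> coherent_coverage D A"
proof -
  have "(\<Union>f\<in>S. ev M f ` fobj M (Dom D f)) = fobj M A" if M: "M \<in> Mod" for M
  proof
    show "(\<Union>f\<in>S. ev M f ` fobj M (Dom D f)) \<subseteq> fobj M A"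
    proof (intro UN_least image_subsetI)
      fix f z assume f: "f \<in> S" "z \<in> fobj M (Dom D f)"
      have "f \<in> hom D (Dom D f) A" using f S by (auto simp: hom_def)
      then show "ev M f z \<in> fobj M A" using Mev_in[OF M _ f(2)] by blast
    qed
    show "fobj M A \<subseteq> (\<Union>f\<in>S. ev M f ` fobj M (Dom D f))" using c[OF M] by blast
  qed
  then have "\<forall>M\<in>Mod. (\<Union>f\<in>S. ev M f ` fobj M (Dom D f)) = fobj M A" by (rule ballI)
  from sat[unfolded saturated_set_of_small_models_def, THEN bspec, OF A, THEN spec, THEN mp, OF S, THEN mp, OF this]
  obtain T where "T \<subseteq> S" "finite T" "images_join_to_top D A T" by (elim exE conjE) (rule that, assumption+)
  then show ?thesis using that S by (auto simp: coherent_coverage_def)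
qed

lemma P_glue:
  assumes "A \<in> Obj D" "T \<in> coherent_coverage D A" "matching_family D P T x"
  shows "\<exists>!y. y \<in> fobj P A \<and> (\<forall>f\<in>T. ev P f y = x f)"
  by (rule sheaf[unfolded is_sheaf_def, THEN bspec, OF assms(1), THEN bspec, OF assms(2), THEN spec, THEN mp, OF assms(3)])

lemma coverage_hom: "T \<in> coherent_coverage D A \<Longrightarrow> f \<in> T \<Longrightarrow> f \<in> hom D (Dom D f) A"
  by (auto simp: coherent_coverage_def hom_def)

lemma P_separated:
  assumes A: "A \<in> Obj D" and T: "T \<in> coherent_coverage D A" and p: "p \<in> fobj P A" "q \<in> fobj P A"
    and e: "\<And>f. f \<in> T \<Longrightarrow> ev P f p = ev P f q"
  shows "p = q"
proof -
  note Th = coverage_hom[OF T]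
  have "matching_family D P T (\<lambda>f. ev P f p)"
    unfolding matching_family_def
  proof (intro conjI ballI impI)
    fix f assume f: "f \<in> T"
    show "ev P f p \<in> fobj P (Dom D f)" by (rule P_in[OF Th[OF f] p(1)])
    fix g u v assume g: "g \<in> T" "u \<in> Arr D" "v \<in> Arr D"
      "Dom D u = Dom D v \<and> Cod D u = Dom D f \<and> Cod D v = Dom D g \<and> f \<cdot> u = g \<cdot> v"
    have u: "u \<in> hom D (Dom D u) (Dom D f)" and v: "v \<in> hom D (Dom D u) (Dom D g)" using g by (simp_all add: hom_def)
    show "ev P u (ev P f p) = ev P v (ev P g p)"
      using P_Cmp[OF u Th[OF f] p(1)] P_Cmp[OF v Th[OF g(1)] p(1)] g(4) by simp
  qed
  from P_glue[OF A T this] show ?thesis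
    by (rule ex1_eq) (use p e in auto)
qed

text \<open>Equal germs at an element mean equal restrictions of \<open>p\<close> and
  \<open>q\<close> to some object above that element. These objects cover \<open>A\<close> at all
  points, hence finitely many do in the site, and \<open>P\<close> is separated.\<close>

lemma germ_inject:
  assumes A: "A \<in> Obj D" and p: "p \<in> fobj P A" "q \<in> fobj P A" and e: "germ A p = germ A q"
  shows "p = q"
proof -
  let ?S = "{f \<in> Arr D. Cod D f = A \<and> ev P f p = ev P f q}"
  have cov: "\<exists>f\<in>?S. \<exists>z\<in>fobj M (Dom D f). ev M f z = x" if M: "M \<in> Mod" and x: "x \<in> fobj M A" for M x
  proof -
    have "cls M A x p = cls M A x q"
      using germ_apply[OF M x, of p] germ_apply[OF M x, of q] e by simp
    then have "rel M A x p A x q"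
      using cls_eq_iff[of M A x p M A x q] M A x p by (simp add: elem_def)
    then obtain C f g z where f: "f \<in> hom D C A" "g \<in> hom D C A" and z: "z \<in> fobj M C" "ev M f z = x" "ev M g z = x"
      and fg: "ev P f p = ev P g q" by (rule relE)
    have "ev M f z = ev M g z" using z by simp
    \<comment> \<open>\<open>rel\<close> compares \<open>p\<close> along \<open>f\<close> with
      \<open>q\<close> along \<open>g\<close>. The two arrows agree at \<open>z\<close>, so an
      equalizer through \<open>z\<close> replaces them by one arrow.\<close>
    then obtain B k w where k: "k \<in> hom D B C" "f \<cdot> k = g \<cdot> k" "w \<in> fobj M B" "ev M k w = z"
      by (rule ex_equalizer_point[OF f M z(1)]) (rule that, assumption+)
    note fk = Cmp_in_hom[OF cat k(1) f(1)]
    have "ev P (f \<cdot> k) p = ev P (f \<cdot> k) q"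
      using P_Cmp[OF k(1) f(1) p(1)] P_Cmp[OF k(1) f(2) p(2)] k(2) fg by simp
    moreover have "ev M (f \<cdot> k) w = x" using Mev_Cmp[OF M k(1) f(1) k(3)] k(4) z by simp
    ultimately show ?thesis
      using homD[OF cat fk] k(3) by (intro bexI[of _ "f \<cdot> k"] bexI[of _ w]) auto
  qed
  have "?S \<subseteq> {f \<in> Arr D. Cod D f = A}" by blast
  then obtain T where T: "T \<subseteq> ?S" "T \<in> coherent_coverage D A"
    by (rule covering_family[OF A]) (rule cov, assumption, assumption, rule that, assumption+)
  show ?thesis by (rule P_separated[OF A T(2) p]) (use T(1) in blast)
qed

text \<open>At each element \<open>h\<close> takes the value of some germ, and by
  \<open>HomE_equalizer\<close> it coincides with that germ on a definable part. Saturation selects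
  a finite cover by such parts; the sections on them match because germs determine sections, and the
  sheaf condition glues them.\<close>

lemma germ_surj:
  assumes A: "A \<in> Obj D" and h: "h \<in> RE.HomE A"
  shows "\<exists>p\<in>fobj P A. germ A p = h"
proof -
  let ?S = "{f \<in> Arr D. Cod D f = A \<and> (\<exists>q\<in>fobj P (Dom D f). RE.pre f h = germ (Dom D f) q)}"
  have cov: "\<exists>f\<in>?S. \<exists>z\<in>fobj M (Dom D f). ev M f z = x" if M: "M \<in> Mod" and x: "x \<in> fobj M A" for M x
  proof -
    have "h (M, x) \<in> stalks" using RE.HomE_in[OF h M x] by simp
    then obtain N B y p where el: "elem N B y p" and hx: "h (M, x) = cls N B y p" by (rule stalksE)
    have "N = M" using RE.HomE_proj[OF h M x] prj_cls[OF el] cls_stalks[OF el] hx by simp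
    then have B: "B \<in> Obj D" and y: "y \<in> fobj M B" and p: "p \<in> fobj P B" and hx: "h (M, x) = germ B p (M, y)"
      using el hx germ_apply[OF M] by (simp_all add: elem_def)
    obtain Q f g z where f: "f \<in> hom D Q A" and g: "g \<in> hom D Q B" and z: "z \<in> fobj M Q" "ev M f z = x" "ev M g z = y"
      by (rule ex_product_point[OF A B M x y]) (rule that, assumption+)
    have Q: "Q \<in> Obj D" using homD[OF cat f] by simp
    note gp = germ_HomE[OF B p]
    have "RE.pre f h (M, z) = RE.pre g (germ B p) (M, z)"
      unfolding RE.pre_apply[OF f M z(1)] RE.pre_apply[OF g M z(1)] z(2,3) by (rule hx)
    then obtain C k w where k: "k \<in> hom D C Q" "w \<in> fobj M C" "ev M k w = z"
      and e: "RE.pre k (RE.pre f h) = RE.pre k (RE.pre g (germ B p))"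
      by (rule RE.HomE_equalizer[OF Q RE.pre_HomE[OF f h] RE.pre_HomE[OF g gp] M z(1)]) (rule that, assumption+)
    note fk = Cmp_in_hom[OF cat k(1) f] and gk = Cmp_in_hom[OF cat k(1) g]
    have "RE.pre (f \<cdot> k) h = germ C (ev P (g \<cdot> k) p)"
      unfolding RE.pre_Cmp[OF f k(1) h] e RE.pre_Cmp[OF g k(1) gp, symmetric] by (rule pre_germ[OF gk p])
    moreover have "ev M (f \<cdot> k) w = x" using Mev_Cmp[OF M k(1) f k(2)] k(3) z by simp
    ultimately show ?thesis
      using homD[OF cat fk] k(2) P_in[OF gk p] by (intro bexI[of _ "f \<cdot> k"] bexI[of _ w]) auto
  qed
  have "?S \<subseteq> {f \<in> Arr D. Cod D f = A}" by blast
  then obtain T where TS: "T \<subseteq> ?S" and T: "T \<in> coherent_coverage D A"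
    by (rule covering_family[OF A]) (rule cov, assumption, assumption, rule that, assumption+)
  note Th = coverage_hom[OF T]
  have "\<forall>f\<in>T. \<exists>q. q \<in> fobj P (Dom D f) \<and> RE.pre f h = germ (Dom D f) q" using TS by blast
  from bchoice[OF this] obtain q where q: "\<And>f. f \<in> T \<Longrightarrow> q f \<in> fobj P (Dom D f)"
    "\<And>f. f \<in> T \<Longrightarrow> RE.pre f h = germ (Dom D f) (q f)" by blast
  have "matching_family D P T q"
    unfolding matching_family_def
  proof (intro conjI ballI impI)
    fix f assume f: "f \<in> T"
    show "q f \<in> fobj P (Dom D f)" by (rule q(1)[OF f])
    fix g u v assume g: "g \<in> T" "u \<in> Arr D" "v \<in> Arr D"
      "Dom D u = Dom D v \<and> Cod D u = Dom D f \<and> Cod D v = Dom D g \<and> f \<cdot> u = g \<cdot> v"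
    have u: "u \<in> hom D (Dom D u) (Dom D f)" and v: "v \<in> hom D (Dom D u) (Dom D g)" using g by (simp_all add: hom_def)
    have "germ (Dom D u) (ev P u (q f)) = RE.pre (f \<cdot> u) h"
      unfolding RE.pre_Cmp[OF Th[OF f] u h] q(2)[OF f] by (rule pre_germ[OF u q(1)[OF f], symmetric])
    also have "\<dots> = RE.pre (g \<cdot> v) h" using g(4) by simp
    also have "\<dots> = germ (Dom D u) (ev P v (q g))"
      unfolding RE.pre_Cmp[OF Th[OF g(1)] v h] q(2)[OF g(1)] by (rule pre_germ[OF v q(1)[OF g(1)]])
    finally show "ev P u (q f) = ev P v (q g)"
      by (rule germ_inject[OF homD(4)[OF cat u] P_in[OF u q(1)[OF f]] P_in[OF v q(1)[OF g(1)]]])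
  qed
  from ex1_implies_ex[OF P_glue[OF A T this]] obtain p where p: "p \<in> fobj P A" "\<And>f. f \<in> T \<Longrightarrow> ev P f p = q f" by blast
  have "germ A p = h"
    by (rule RE.HomE_separated[OF T germ_HomE[OF A p(1)] h]) (simp add: pre_germ[OF Th p(1)] p(2) q(2))
  then show ?thesis using p(1) by blast
qed

end

section \<open>The equivalence\<close>

text \<open>If this set were finite it would be the set of elements of one of its own members,
  against foundation. The infinity is used to absorb products in cardinal bounds.\<close>

lemma infinite_hered_small:
  fixes \<kappa> :: "'k rel"
  assumes \<kappa>: "Cinfinite \<kappa>"
  shows "infinite (hered_small \<kappa>)"
proof
  assume "finite (hered_small \<kappa>)"
  then have "|hered_small \<kappa>| <o \<kappa>"
    using \<kappa> Cfinite_ordLess_Cinfinite[of "|hered_small \<kappa>|" \<kappa>]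
    by (auto simp: cfinite_def Field_card_of card_of_card_order_on)
  then obtain x where "x \<in> hered_small \<kappa>" "elts x = hered_small \<kappa>"
    using ex_hered_small[of \<kappa> "hered_small \<kappa>"] \<kappa> by blast
  then have "(x, x) \<in> {(x :: 'k hset, y). x \<in> elts y}" by simp
  moreover have "(x, x) \<notin> {(x :: 'k hset, y). x \<in> elts y}" by (rule wf_not_refl[OF wf_elts])
  ultimately show False by contradiction
qed

text \<open>A function on \<open>Y\<close> is reindexed along the surjection \<open>g\<close>, which
  is injective on extensional functions.\<close>

lemma card_of_extensional_le_Func:
  assumes g: "g ` I = Y" and ext: "\<And>h. h \<in> S \<Longrightarrow> h \<in> extensional Y"
    and T: "\<And>h y. h \<in> S \<Longrightarrow> y \<in> Y \<Longrightarrow> h y \<in> T"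
  shows "|S| \<le>o |Func I T|"
\<comment> \<open>Members of \<open>Func\<close> have the value \<open>undefined\<close> outside the
  index set.\<close>
proof (rule card_of_ordLeqI[where f = "\<lambda>h i. if i \<in> I then h (g i) else undefined"])
  show "inj_on (\<lambda>h i. if i \<in> I then h (g i) else undefined) S"
  proof (rule inj_onI)
    fix h k assume h: "h \<in> S" and k: "k \<in> S"
      and e: "(\<lambda>i. if i \<in> I then h (g i) else undefined) = (\<lambda>i. if i \<in> I then k (g i) else undefined)"
    show "h = k"
    proof (rule extensionalityI[OF ext[OF h] ext[OF k]])
      fix y assume "y \<in> Y"
      then obtain i where "i \<in> I" "y = g i" using g by blast
      then show "h y = k y" using fun_cong[OF e, of i] by simp
    qed
  qed
  fix h assume "h \<in> S"
  then show "(\<lambda>i. if i \<in> I then h (g i) else undefined) \<in> Func I T"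
    using T g by (auto simp: Func_def)
qed

section \<open>Both categories at the size \<open>\<mu>\<close>\<close>

locale duality = decidable_models \<kappa> D for \<kappa> :: "'k rel" and D :: "('o, 'a) cat" +
  fixes \<mu> :: "'u rel"
  assumes saturated: "saturated_set_of_small_models \<kappa> D"
    and powers: "closed_under_powers \<mu> (Arr D <+> hered_small \<kappa> <+> models \<kappa> D)"
begin

abbreviation "I \<equiv> Arr D <+> H <+> Mod"
abbreviation "esc \<equiv> equivariant_sheaf_cat (small_sets \<mu>) Grpd"
abbreviation "shc \<equiv> sheaf_cat (small_sets \<mu>) D (coherent_coverage D)"
abbreviation "SU \<equiv> set_cat (small_sets \<mu>)"
abbreviation "HE E A \<equiv> model_sheaf.HomE \<kappa> D E A"
abbreviation "prE \<equiv> model_sheaf.pre \<kappa> D"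
abbreviation "psE \<equiv> model_sheaf_pair.post \<kappa> D"
abbreviation PH :: "(('k, 'o, 'a) model, ('k, 'o, 'a) model_map, 'u) action
    \<Rightarrow> ('o, 'a, 'u set, ('u set, 'u \<Rightarrow> 'u) arrow) functr" where
  "PH E \<equiv> coded_presheaf D (HE E) prE"
abbreviation cE :: "(('k, 'o, 'a) model, ('k, 'o, 'a) model_map, 'u) action
    \<Rightarrow> 'o \<Rightarrow> (('k, 'o, 'a) model \<times> 'k hset \<Rightarrow> 'u) \<Rightarrow> 'u" where
  "cE E A \<equiv> code (HE E A)"

lemma \<mu>: "Cinfinite \<mu>" "regularCard \<mu>" "|I| <o \<mu>" "Card_order \<mu>"
  and Func_small: "|S| <o \<mu> \<Longrightarrow> |Func I S| <o \<mu>" for S :: "'u set"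
  using powers unfolding closed_under_powers_def by blast+

text \<open>\<open>H\<close> makes \<open>I\<close> infinite, so \<open>I \<times> I\<close> is no
  larger than \<open>I\<close>.\<close>

lemma card_Mod_H: "|Mod \<times> H| \<le>o |I|"
proof -
  have "infinite I" using infinite_hered_small[OF \<kappa>] by (simp add: finite_Plus_iff)
  have "|Mod \<times> H| \<le>o |I \<times> I|"
    by (rule card_of_ordLeqI[where f = "\<lambda>(N, x). (Inr (Inr N), Inr (Inl x))"]) (auto simp: inj_on_def)
  also have "|I \<times> I| =o |I|" by (rule card_of_Times_same_infinite[OF \<open>infinite I\<close>])
  finally (ordLeq_ordIso_trans) show ?thesis .
qed

text \<open>Objects embed into arrows through their identities.\<close>

lemma card_Obj: "|Obj D| <o \<mu>"
proof -
  have "|Obj D| \<le>o |I|"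
    by (rule card_of_ordLeqI[where f = "\<lambda>A. Inl (Idt D A)"])
      (auto intro!: inj_onI dest: homD[OF cat Idt_in_hom[OF cat]] arg_cong[of "Idt D _" _ "Dom D"]
        simp: homD(2)[OF cat Idt_in_hom[OF cat]])
  then show ?thesis using \<mu>(3) by (rule ordLeq_ordLess_trans)
qed

lemma model_sheafI: "equivariant_sheaf Grpd E \<Longrightarrow> model_sheaf \<kappa> D E"
  by (intro model_sheaf.intro decidable_models_axioms model_sheaf_axioms.intro)

text \<open>A member of \<open>HE E A\<close> is a function on pairs of a model and a label; there
  are at most as many such pairs as elements of \<open>I\<close>, and
  \<open>closed_under_powers\<close> bounds the functions from \<open>I\<close> to the total
  space.\<close>

lemma small_HomE:
  fixes E :: "(('k, 'o, 'a) model, ('k, 'o, 'a) model_map, 'u) action"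
  assumes E: "equivariant_sheaf Grpd E" and s: "topspace (total E) \<in> small_sets \<mu>" and A: "A \<in> Obj D"
  shows "|HE E A| <o \<mu>"
proof -
  interpret E: model_sheaf \<kappa> D E by (rule model_sheafI[OF E])
  have S: "|Func I E.TE| <o \<mu>" using s by (intro Func_small) (simp add: small_sets_def)
  show ?thesis
  \<comment> \<open>The surjection from \<open>I\<close> needs a nonempty target; out of an empty
    \<open>EL A\<close> there is at most one extensional function.\<close>
  proof (cases "E.EL A = {}")
    case True
    then have "E.HomE A \<subseteq> {\<lambda>_. undefined}" by (auto simp: E.HomE_def extensional_def)
    then have "finite (E.HomE A)" by (rule finite_subset) simp
    then show ?thesis
      using \<mu>(1) Cfinite_ordLess_Cinfinite[of "|E.HomE A|" \<mu>]
      by (auto simp: cfinite_def Field_card_of card_of_card_order_on)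
  next
    case False
    have "|E.EL A| \<le>o |Mod \<times> H|"
      by (rule card_of_mono1) (use fobj_H A in \<open>auto simp: E.EL_def\<close>)
    then have "|E.EL A| \<le>o |I|" using card_Mod_H by (rule ordLeq_transitive)
    then obtain g where g: "g ` I = E.EL A" using card_of_ordLeq2[OF False, of I] by blast
    have "|E.HomE A| \<le>o |Func I E.TE|"
    proof (rule card_of_extensional_le_Func[OF g])
      fix h y assume "h \<in> E.HomE A" "y \<in> E.EL A"
      then show "h y \<in> E.TE" using E.HomE_in[of h A] by (auto simp: E.EL_def)
    qed (rule E.HomE_ext)
    then show ?thesis using S by (rule ordLeq_ordLess_trans)
  qed
qed

lemma big_presheaf_HomE:
  assumes E: "equivariant_sheaf Grpd E" and s: "topspace (total E) \<in> small_sets \<mu>"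
  shows "big_presheaf D \<mu> (HE E) prE"
proof -
  interpret E: model_sheaf \<kappa> D E by (rule model_sheafI[OF E])
  show ?thesis
    by (unfold_locales) (use cat \<mu>(4) small_HomE[OF E s] E.pre_HomE E.pre_Idt E.pre_Cmp in blast)+
qed

section \<open>Arrows between sheaves on the site\<close>

lemma hom_shc_iff:
  "f \<in> hom shc P Q \<longleftrightarrow> src f = P \<and> trg f = Q \<and> nat_trans (op_cat D) SU P (app f) Q \<and>
    is_sheaf D (coherent_coverage D) P \<and> is_sheaf D (coherent_coverage D) Q"
  by (auto simp: hom_def sheaf_cat_def)

lemma Obj_shc_iff: "P \<in> Obj shc \<longleftrightarrow> is_functor (op_cat D) SU P \<and> is_sheaf D (coherent_coverage D) P"
  by (simp add: sheaf_cat_def)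

lemma category_shc: "category shc"
  unfolding sheaf_cat_def by (intro category_full_subcat category_functor_cat category_op_cat cat category_set_cat)

lemma shc_comp_hom: "f \<in> hom shc P Q \<Longrightarrow> A \<in> Obj D \<Longrightarrow> app f A \<in> hom SU (fobj P A) (fobj Q A)"
  by (simp add: hom_shc_iff nat_trans_def)

lemma shc_natural:
  assumes "\<alpha> \<in> hom shc P Q" "f \<in> hom D C A" "v \<in> fobj P A"
  shows "cmpt \<alpha> C (ev P f v) = ev Q f (cmpt \<alpha> A v)"
proof -
  note h = homD[OF cat assms(2)]
  have "Cmp SU (farr Q f) (app \<alpha> (Dom (op_cat D) f)) = Cmp SU (app \<alpha> (Cod (op_cat D) f)) (farr P f)"
    using assms(1) h unfolding hom_shc_iff nat_trans_def op_cat_simps by blast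
  then have "app (Cmp SU (farr Q f) (app \<alpha> A)) v = app (Cmp SU (app \<alpha> C) (farr P f)) v" using h by simp
  moreover have "is_functor (op_cat D) SU P" using assms(1) by (simp add: hom_shc_iff nat_trans_def)
  then have "farr P f \<in> hom SU (fobj P A) (fobj P C)"
    by (rule is_functorD(2)) (simp only: hom_op_cat assms(2))
  ultimately show ?thesis
    using app_Cmp_set_cat[OF shc_comp_hom[OF assms(1) h(5)] assms(3)] app_Cmp_set_cat assms(3) by metis
qed

lemma shc_arrow_eqI:
  assumes f: "f \<in> hom shc P Q" and g: "g \<in> hom shc P Q"
    and e: "\<And>A v. A \<in> Obj D \<Longrightarrow> v \<in> fobj P A \<Longrightarrow> cmpt f A v = cmpt g A v"
  shows "f = g"
proof (rule functor_cat_arrow_eqI[of "op_cat D" SU])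
  fix A assume "A \<in> Obj (op_cat D)"
  then have A: "A \<in> Obj D" by simp
  show "app f A = app g A"
    by (rule arrow_eqI[OF shc_comp_hom[OF f A] shc_comp_hom[OF g A] e[OF A]])
qed (use f g in \<open>auto simp: hom_shc_iff\<close>)

text \<open>Packs plain functions \<open>t A\<close> into an arrow, made extensional on both levels
  so that arrows with the same values are equal.\<close>

definition mkn where
  "mkn P t Q = Arrow P (\<lambda>A\<in>Obj D. Arrow (fobj P A) (restrict (t A) (fobj P A)) (fobj Q A)) Q"

lemma cmpt_mkn: "A \<in> Obj D \<Longrightarrow> v \<in> fobj P A \<Longrightarrow> cmpt (mkn P t Q) A v = t A v"
  by (simp add: mkn_def)

lemma mkn_hom:
  assumes P: "P \<in> Obj shc" and Q: "Q \<in> Obj shc"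
    and t: "\<And>A v. A \<in> Obj D \<Longrightarrow> v \<in> fobj P A \<Longrightarrow> t A v \<in> fobj Q A"
    and nat: "\<And>f C A v. f \<in> hom D C A \<Longrightarrow> v \<in> fobj P A \<Longrightarrow> t C (ev P f v) = ev Q f (t A v)"
  shows "mkn P t Q \<in> hom shc P Q"
proof -
  have FP: "is_functor (op_cat D) SU P" and FQ: "is_functor (op_cat D) SU Q"
    and sh: "is_sheaf D (coherent_coverage D) P" "is_sheaf D (coherent_coverage D) Q"
    using P Q by (simp_all add: Obj_shc_iff)
  have th: "app (mkn P t Q) A \<in> hom SU (fobj P A) (fobj Q A)" if A: "A \<in> Obj D" for A
    using is_functorD(1)[OF FP] is_functorD(1)[OF FQ] A t[OF A] by (simp add: mkn_def Arrow_in_hom_set_cat)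
  have "nat_trans (op_cat D) SU P (app (mkn P t Q)) Q"
    unfolding nat_trans_def
  proof (intro conjI ballI FP FQ)
    show "app (mkn P t Q) \<in> extensional (Obj (op_cat D))" by (simp add: mkn_def)
    show "app (mkn P t Q) A \<in> hom SU (fobj P A) (fobj Q A)" if "A \<in> Obj (op_cat D)" for A using th that by simp
    fix f assume "f \<in> Arr (op_cat D)"
    then have f: "f \<in> hom D (Dom D f) (Cod D f)" by (simp add: hom_def)
    note h = homD(4,5)[OF cat f]
    have Pf: "farr P f \<in> hom SU (fobj P (Cod D f)) (fobj P (Dom D f))"
      and Qf: "farr Q f \<in> hom SU (fobj Q (Cod D f)) (fobj Q (Dom D f))"
      using is_functorD(2)[OF FP] is_functorD(2)[OF FQ] f by (simp_all add: hom_op_cat)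
    show "Cmp SU (farr Q f) (app (mkn P t Q) (Dom (op_cat D) f)) = Cmp SU (app (mkn P t Q) (Cod (op_cat D) f)) (farr P f)"
      unfolding op_cat_simps
    proof (rule arrow_eqI[OF Cmp_in_hom_set_cat[OF th[OF h(2)] Qf] Cmp_in_hom_set_cat[OF Pf th[OF h(1)]]])
      fix v assume v: "v \<in> fobj P (Cod D f)"
      show "app (Cmp SU (farr Q f) (app (mkn P t Q) (Cod D f))) v = app (Cmp SU (app (mkn P t Q) (Dom D f)) (farr P f)) v"
        unfolding app_Cmp_set_cat[OF th[OF h(2)] v] app_Cmp_set_cat[OF Pf v] cmpt_mkn[OF h(2) v]
          cmpt_mkn[OF h(1) hom_set_catD[OF Pf v]]
        by (rule nat[OF f v, symmetric])
    qed
  qed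
  then show ?thesis using sh unfolding hom_shc_iff by (simp add: mkn_def)
qed

lemma cmpt_Cmp_shc:
  "f \<in> hom shc P Q \<Longrightarrow> A \<in> Obj D \<Longrightarrow> v \<in> fobj P A \<Longrightarrow> cmpt (Cmp shc g f) A v = cmpt g A (cmpt f A v)"
  using app_Cmp_set_cat[OF shc_comp_hom] by (simp add: sheaf_cat_def app_Cmp_functor_cat)

lemma cmpt_Idt_shc: "A \<in> Obj D \<Longrightarrow> v \<in> fobj P A \<Longrightarrow> cmpt (Idt shc P) A v = v"
  by (simp add: sheaf_cat_def app_Idt_functor_cat Idt_set_cat)

text \<open>The sheaf condition is \<open>HomE_glue\<close> for existence and
  \<open>HomE_separated\<close> for uniqueness, read through the codes.\<close>

lemma PH_Obj:
  assumes E: "equivariant_sheaf Grpd E" and s: "topspace (total E) \<in> small_sets \<mu>"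
  shows "PH E \<in> Obj shc"
proof -
  interpret E: model_sheaf \<kappa> D E by (rule model_sheafI[OF E])
  interpret B: big_presheaf D \<mu> "HE E" prE by (rule big_presheaf_HomE[OF E s])
  have "is_sheaf D (coherent_coverage D) (PH E)"
    unfolding is_sheaf_def
  proof (intro ballI allI impI)
    fix A T x assume A: "A \<in> Obj D" and T: "T \<in> coherent_coverage D A" and m: "matching_family D (PH E) T x"
    have Th: "f \<in> hom D (Dom D f) A" if "f \<in> T" for f
      using T that by (auto simp: coherent_coverage_def hom_def)
    have Td: "Dom D f \<in> Obj D" if "f \<in> T" for f using homD(4)[OF cat Th[OF that]] .
    have x: "x f \<in> fobj (PH E) (Dom D f)" if "f \<in> T" for f using m that by (simp add: matching_family_def)
    define k where "k f = decode (HE E (Dom D f)) (x f)" for f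
    have k: "k f \<in> HE E (Dom D f)" "cE E (Dom D f) (k f) = x f" if "f \<in> T" for f
      unfolding k_def using B.decode_in[OF Td[OF that] x[OF that]] B.code_decode[OF Td[OF that] x[OF that]] by simp_all
    have "\<exists>h\<in>HE E A. \<forall>f\<in>T. prE f h = k f"
    proof (rule E.HomE_glue[OF A T k(1)])
      fix f g u v assume f: "f \<in> T" and g: "g \<in> T" and u: "u \<in> hom D (Dom D u) (Dom D f)"
        and v: "v \<in> hom D (Dom D u) (Dom D g)" and e: "f \<cdot> u = g \<cdot> v"
      have "ev (PH E) u (x f) = ev (PH E) v (x g)"
        using m[unfolded matching_family_def, THEN conjunct2, THEN bspec, OF f, THEN bspec, OF g, THEN bspec,
          OF homD(1)[OF cat u], THEN bspec, OF homD(1)[OF cat v]] homD(2,3)[OF cat u] homD(2,3)[OF cat v] e by simp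
      then have "cE E (Dom D u) (prE u (k f)) = cE E (Dom D u) (prE v (k g))"
        using B.ev_P[OF u k(1)[OF f]] B.ev_P[OF v k(1)[OF g]] k(2)[OF f] k(2)[OF g] by simp
      then show "prE u (k f) = prE v (k g)"
        using B.code_eq_iff[OF homD(4)[OF cat u] E.pre_HomE[OF u k(1)[OF f]] E.pre_HomE[OF v k(1)[OF g]]] by simp
    qed assumption
    then obtain h where h: "h \<in> HE E A" "\<And>f. f \<in> T \<Longrightarrow> prE f h = k f" by blast
    show "\<exists>!y. y \<in> fobj (PH E) A \<and> (\<forall>f\<in>T. ev (PH E) f y = x f)"
    proof (rule ex1I[of _ "cE E A h"])
      show "cE E A h \<in> fobj (PH E) A \<and> (\<forall>f\<in>T. ev (PH E) f (cE E A h) = x f)"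
        using h k(2) B.ev_P[OF Th h(1)] by (simp add: B.fobj_P[OF A])
      fix y assume y: "y \<in> fobj (PH E) A \<and> (\<forall>f\<in>T. ev (PH E) f y = x f)"
      then obtain h' where h': "h' \<in> HE E A" "y = cE E A h'" unfolding B.fobj_P[OF A] by blast
      have "h' = h"
      proof (rule E.HomE_separated[OF T h'(1) h(1)])
        fix f assume f: "f \<in> T"
        have "cE E (Dom D f) (prE f h') = cE E (Dom D f) (k f)"
          using B.ev_P[OF Th[OF f] h'(1)] y f h'(2) k(2)[OF f] by simp
        then show "prE f h' = prE f h"
          using B.code_eq_iff[OF Td[OF f] E.pre_HomE[OF Th[OF f] h'(1)] k(1)[OF f]] h(2)[OF f] by simp
      qed
      then show "y = cE E A h" using h'(2) by simp
    qed
  qed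
  then show ?thesis using B.is_functor_P by (simp add: Obj_shc_iff)
qed

section \<open>The functor from equivariant sheaves to sheaves on the site\<close>

definition PHmap where
  "PHmap k = mkn (PH (src k)) (\<lambda>A v. cE (trg k) A (psE A (app k) (decode (HE (src k) A) v))) (PH (trg k))"

lemma PHmap:
  assumes k: "k \<in> hom esc E E'"
  shows "PHmap k \<in> hom shc (PH E) (PH E')"
    "A \<in> Obj D \<Longrightarrow> x \<in> HE E A \<Longrightarrow> cmpt (PHmap k) A (cE E A x) = cE E' A (psE A (app k) x)"
proof -
  have E: "equivariant_sheaf Grpd E" "topspace (total E) \<in> small_sets \<mu>"
    and E': "equivariant_sheaf Grpd E'" "topspace (total E') \<in> small_sets \<mu>"
    and st: "src k = E" "trg k = E'" and h: "equivariant_map Grpd E (app k) E'"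
    using k by (auto simp: hom_esc_iff)
  interpret model_sheaf_pair \<kappa> D E E'
    by (intro model_sheaf_pair.intro model_sheafI E(1) E'(1) decidable_models_axioms)
  interpret B: big_presheaf D \<mu> "HE E" prE by (rule big_presheaf_HomE[OF E])
  interpret B': big_presheaf D \<mu> "HE E'" prE by (rule big_presheaf_HomE[OF E'])
  let ?t = "\<lambda>A v. cE E' A (psE A (app k) (decode (HE E A) v))"
  show "PHmap k \<in> hom shc (PH E) (PH E')"
    unfolding PHmap_def st
  proof (rule mkn_hom[OF PH_Obj[OF E] PH_Obj[OF E']])
    fix A v assume A: "A \<in> Obj D" and v: "v \<in> fobj (PH E) A"
    show "?t A v \<in> fobj (PH E') A"
      using post_HomE[OF A h B.decode_in[OF A v]] by (simp add: B'.fobj_P[OF A])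
  next
    fix f C A v assume f: "f \<in> hom D C A" and v: "v \<in> fobj (PH E) A"
    note h' = homD(4,5)[OF cat f]
    obtain x where x: "x \<in> HE E A" "v = cE E A x" using v unfolding B.fobj_P[OF h'(2)] by blast
    show "?t C (ev (PH E) f v) = ev (PH E') f (?t A v)"
      unfolding x(2) B.ev_P[OF f x(1)] B.decode_code[OF h'(2) x(1)] B.decode_code[OF h'(1) S1.pre_HomE[OF f x(1)]]
        B'.ev_P[OF f post_HomE[OF h'(2) h x(1)]] post_pre[OF f x(1) h] by (rule refl)
  qed
  show "cmpt (PHmap k) A (cE E A x) = cE E' A (psE A (app k) x)" if A: "A \<in> Obj D" and x: "x \<in> HE E A"
  proof -
    have "cE E A x \<in> fobj (PH E) A" using x by (simp add: B.fobj_P[OF A])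
    then show ?thesis unfolding PHmap_def st by (simp add: cmpt_mkn[OF A] B.decode_code[OF A x])
  qed
qed

definition \<Phi> where
  "\<Phi> = \<lparr>fobj = (\<lambda>E\<in>Obj esc. PH E), farr = restrict PHmap (Arr esc)\<rparr>"

lemma esc_Cmp: "Cmp esc g f = Arrow (src f) (compose (topspace (total (src f))) (app g) (app f)) (trg g)"
  and esc_Idt: "Idt esc E = Arrow E (\<lambda>x\<in>topspace (total E). x) E"
  by (simp_all add: equivariant_sheaf_cat_def)

lemma \<Phi>_functor: "is_functor esc shc \<Phi>"
proof (rule is_functorI[OF category_equivariant_sheaf_cat])
  show "fobj \<Phi> E \<in> Obj shc" if "E \<in> Obj esc" for E
    using that PH_Obj by (simp add: \<Phi>_def)
  show Ph: "farr \<Phi> f \<in> hom shc (fobj \<Phi> E) (fobj \<Phi> E')" if "f \<in> hom esc E E'" for f E E'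
    using PHmap(1)[OF that] homD[OF category_equivariant_sheaf_cat that] by (simp add: \<Phi>_def)
  show "farr \<Phi> (Idt esc E) = Idt shc (fobj \<Phi> E)" if EO: "E \<in> Obj esc" for E
  proof (rule shc_arrow_eqI[of _ "PH E" "PH E"])
    have E: "equivariant_sheaf Grpd E" "topspace (total E) \<in> small_sets \<mu>" using EO by simp_all
    note id = Idt_in_hom[OF category_equivariant_sheaf_cat EO]
    interpret model_sheaf_pair \<kappa> D E E
      by (intro model_sheaf_pair.intro model_sheafI E(1) decidable_models_axioms)
    interpret B: big_presheaf D \<mu> "HE E" prE by (rule big_presheaf_HomE[OF E])
    have fP: "fobj \<Phi> E = PH E" "farr \<Phi> (Idt esc E) = PHmap (Idt esc E)"
      using EO homD(1)[OF category_equivariant_sheaf_cat id] by (simp_all add: \<Phi>_def)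
    show "farr \<Phi> (Idt esc E) \<in> hom shc (PH E) (PH E)" unfolding fP by (rule PHmap(1)[OF id])
    show "Idt shc (fobj \<Phi> E) \<in> hom shc (PH E) (PH E)"
      unfolding fP by (rule Idt_in_hom[OF category_shc PH_Obj[OF E]])
    fix A v assume A: "A \<in> Obj D" and v: "v \<in> fobj (PH E) A"
    obtain x where x: "x \<in> HE E A" "v = cE E A x" using v unfolding B.fobj_P[OF A] by blast
    have "psE A (app (Idt esc E)) x = x"
    proof (rule S1.HomE_eqI[OF post_HomE[OF A _ x(1)] x(1)])
      show "equivariant_map Grpd E (app (Idt esc E)) E" using id by (simp add: hom_esc_iff)
      fix N y assume N: "N \<in> Mod" "y \<in> fobj N A"
      show "psE A (app (Idt esc E)) x (N, y) = x (N, y)"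
        unfolding post_apply[OF N] esc_Idt using S1.HomE_in[OF x(1) N] by simp
    qed
    then show "cmpt (farr \<Phi> (Idt esc E)) A v = cmpt (Idt shc (fobj \<Phi> E)) A v"
      unfolding fP x(2) PHmap(2)[OF id A x(1)] using cmpt_Idt_shc[OF A v] x(2) by simp
  qed
  show "farr \<Phi> (Cmp esc g f) = Cmp shc (farr \<Phi> g) (farr \<Phi> f)"
    if f: "f \<in> hom esc E E'" and g: "g \<in> hom esc E' E''" for f g E E' E''
  proof (rule shc_arrow_eqI[of _ "PH E" "PH E''"])
    note gf = Cmp_in_hom[OF category_equivariant_sheaf_cat f g]
    have E: "equivariant_sheaf Grpd E" "topspace (total E) \<in> small_sets \<mu>"
      and E': "equivariant_sheaf Grpd E'" "topspace (total E') \<in> small_sets \<mu>"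
      and E'': "equivariant_sheaf Grpd E''" "topspace (total E'') \<in> small_sets \<mu>"
      and fm: "equivariant_map Grpd E (app f) E'" and gm: "equivariant_map Grpd E' (app g) E''" and sf: "src f = E"
      and gfm: "equivariant_map Grpd E (app (Cmp esc g f)) E''"
      using f g gf unfolding hom_esc_iff by simp_all
    interpret p1: model_sheaf_pair \<kappa> D E E'
      by (intro model_sheaf_pair.intro model_sheafI E(1) E'(1) decidable_models_axioms)
    interpret p2: model_sheaf_pair \<kappa> D E' E''
      by (intro model_sheaf_pair.intro model_sheafI E'(1) E''(1) decidable_models_axioms)
    interpret p3: model_sheaf_pair \<kappa> D E E''
      by (intro model_sheaf_pair.intro model_sheafI E(1) E''(1) decidable_models_axioms)
    interpret B: big_presheaf D \<mu> "HE E" prE by (rule big_presheaf_HomE[OF E])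
    have a: "farr \<Phi> f = PHmap f" "farr \<Phi> g = PHmap g" "farr \<Phi> (Cmp esc g f) = PHmap (Cmp esc g f)"
      using homD(1)[OF category_equivariant_sheaf_cat f] homD(1)[OF category_equivariant_sheaf_cat g]
        homD(1)[OF category_equivariant_sheaf_cat gf] by (simp_all add: \<Phi>_def)
    show "farr \<Phi> (Cmp esc g f) \<in> hom shc (PH E) (PH E'')" unfolding a by (rule PHmap(1)[OF gf])
    show "Cmp shc (farr \<Phi> g) (farr \<Phi> f) \<in> hom shc (PH E) (PH E'')"
      unfolding a by (rule Cmp_in_hom[OF category_shc PHmap(1)[OF f] PHmap(1)[OF g]])
    fix A v assume A: "A \<in> Obj D" and v: "v \<in> fobj (PH E) A"
    obtain x where x: "x \<in> HE E A" "v = cE E A x" using v unfolding B.fobj_P[OF A] by blast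
    note fx = p1.post_HomE[OF A fm x(1)]
    have "psE A (app (Cmp esc g f)) x = psE A (app g) (psE A (app f) x)"
    proof (rule p2.S2.HomE_eqI[OF p3.post_HomE[OF A gfm x(1)] p2.post_HomE[OF A gm fx]])
      fix N y assume N: "N \<in> Mod" "y \<in> fobj N A"
      show "psE A (app (Cmp esc g f)) x (N, y) = psE A (app g) (psE A (app f) x) (N, y)"
        \<comment> \<open>The function \<open>post\<close> does not depend on the two sheaves, so
          the rule of one pair serves for all three.\<close>
        unfolding p1.post_apply[OF N] esc_Cmp using p1.S1.HomE_in[OF x(1) N] sf by (simp add: compose_def)
    qed
    then show "cmpt (farr \<Phi> (Cmp esc g f)) A v = cmpt (Cmp shc (farr \<Phi> g) (farr \<Phi> f)) A v"
      unfolding a x(2) cmpt_Cmp_shc[OF PHmap(1)[OF f] A v[unfolded x(2)]] PHmap(2)[OF gf A x(1)] PHmap(2)[OF f A x(1)] PHmap(2)[OF g A fx]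
      by simp
  qed
qed (simp_all add: \<Phi>_def)

text \<open>Codes are injective, and equivariant maps are separated by their composites with the
  maps out of the \<open>EL A\<close>.\<close>

lemma \<Phi>_faithful:
  assumes f: "f \<in> hom esc E E'" and g: "g \<in> hom esc E E'" and e: "farr \<Phi> f = farr \<Phi> g"
  shows "f = g"
proof -
  have E: "equivariant_sheaf Grpd E" "topspace (total E) \<in> small_sets \<mu>"
    and E': "equivariant_sheaf Grpd E'" "topspace (total E') \<in> small_sets \<mu>"
    and fm: "equivariant_map Grpd E (app f) E'" and gm: "equivariant_map Grpd E (app g) E'"
    and st: "src f = E" "trg f = E'" "src g = E" "trg g = E'"
    using f g unfolding hom_esc_iff by simp_all
  interpret model_sheaf_pair \<kappa> D E E'
    by (intro model_sheaf_pair.intro model_sheafI E(1) E'(1) decidable_models_axioms)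
  interpret B': big_presheaf D \<mu> "HE E'" prE by (rule big_presheaf_HomE[OF E'])
  have a: "PHmap f = PHmap g"
    using e homD(1)[OF category_equivariant_sheaf_cat f] homD(1)[OF category_equivariant_sheaf_cat g] by (simp add: \<Phi>_def)
  have "app f = app g"
  proof (rule equivariant_map_eqI[OF fm gm])
    fix A x assume A: "A \<in> Obj D" and x: "x \<in> S1.HomE A"
    have "cE E' A (psE A (app f) x) = cE E' A (psE A (app g) x)"
      unfolding PHmap(2)[OF f A x, symmetric] PHmap(2)[OF g A x, symmetric] a by (rule refl)
    then show "psE A (app f) x = psE A (app g) x"
      using B'.code_eq_iff[OF A post_HomE[OF A fm x] post_HomE[OF A gm x]] by simp
  qed
  then show ?thesis using st by (intro arrow.expand) simp
qed

lemma \<Phi>_full: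
  assumes E: "E \<in> Obj esc" and E': "E' \<in> Obj esc" and \<alpha>: "\<alpha> \<in> hom shc (fobj \<Phi> E) (fobj \<Phi> E')"
  shows "\<exists>f\<in>hom esc E E'. farr \<Phi> f = \<alpha>"
proof -
  have Es: "equivariant_sheaf Grpd E" "topspace (total E) \<in> small_sets \<mu>"
    and Es': "equivariant_sheaf Grpd E'" "topspace (total E') \<in> small_sets \<mu>"
    using E E' by simp_all
  interpret model_sheaf_pair \<kappa> D E E'
    by (intro model_sheaf_pair.intro model_sheafI Es(1) Es'(1) decidable_models_axioms)
  interpret B: big_presheaf D \<mu> "HE E" prE by (rule big_presheaf_HomE[OF Es])
  interpret B': big_presheaf D \<mu> "HE E'" prE by (rule big_presheaf_HomE[OF Es'])
  have \<alpha>: "\<alpha> \<in> hom shc (PH E) (PH E')" using \<alpha> E E' by (simp add: \<Phi>_def)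
  \<comment> \<open>The components of \<open>\<alpha>\<close> act on codes; decoded, they form the
    transformation from which \<open>ex_equivariant_map\<close> builds the map.\<close>
  define \<tau> where "\<tau> A x = decode (HE E' A) (cmpt \<alpha> A (cE E A x))" for A x
  have cin: "cE E A x \<in> fobj (PH E) A" if "A \<in> Obj D" "x \<in> HE E A" for A x
    using that(2) by (simp add: B.fobj_P[OF that(1)])
  have ain: "cmpt \<alpha> A (cE E A x) \<in> fobj (PH E') A" if "A \<in> Obj D" "x \<in> HE E A" for A x
    by (rule hom_set_catD[OF shc_comp_hom[OF \<alpha> that(1)] cin[OF that]])
  have \<tau>: "\<tau> A x \<in> HE E' A" "cE E' A (\<tau> A x) = cmpt \<alpha> A (cE E A x)" if "A \<in> Obj D" "x \<in> HE E A" for A x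
    unfolding \<tau>_def using B'.decode_in[OF that(1) ain[OF that]] B'.code_decode[OF that(1) ain[OF that]] by simp_all
  have "\<tau> C (prE f x) = prE f (\<tau> A x)" if f: "f \<in> hom D C A" and x: "x \<in> HE E A" for f C A x
  proof -
    note h = homD(4,5)[OF cat f]
    note fx = S1.pre_HomE[OF f x]
    have "cE E' C (\<tau> C (prE f x)) = cmpt \<alpha> C (ev (PH E) f (cE E A x))"
      unfolding \<tau>(2)[OF h(1) fx] B.ev_P[OF f x] by (rule refl)
    also have "\<dots> = ev (PH E') f (cE E' A (\<tau> A x))"
      unfolding shc_natural[OF \<alpha> f cin[OF h(2) x]] \<tau>(2)[OF h(2) x] by (rule refl)
    also have "\<dots> = cE E' C (prE f (\<tau> A x))" by (rule B'.ev_P[OF f \<tau>(1)[OF h(2) x]])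
    finally show ?thesis
      using B'.code_eq_iff[OF h(1) \<tau>(1)[OF h(1) fx] S2.pre_HomE[OF f \<tau>(1)[OF h(2) x]]] by simp
  qed
  from ex_equivariant_map[of \<tau>, OF \<tau>(1) this] obtain h where h: "equivariant_map Grpd E h E'"
    and p: "\<And>A x. A \<in> Obj D \<Longrightarrow> x \<in> HE E A \<Longrightarrow> psE A h x = \<tau> A x" by blast
  let ?f = "Arrow E h E'"
  have f: "?f \<in> hom esc E E'" using h Es Es' by (simp add: hom_esc_iff)
  have "PHmap ?f = \<alpha>"
  proof (rule shc_arrow_eqI[OF PHmap(1)[OF f] \<alpha>])
    fix A v assume A: "A \<in> Obj D" and v: "v \<in> fobj (PH E) A"
    obtain x where x: "x \<in> HE E A" "v = cE E A x" using v unfolding B.fobj_P[OF A] by blast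
    show "cmpt (PHmap ?f) A v = cmpt \<alpha> A v"
      unfolding x(2) PHmap(2)[OF f A x(1)] using p[OF A x(1)] \<tau>(2)[OF A x(1)] by simp
  qed
  then have "farr \<Phi> ?f = \<alpha>" using homD(1)[OF category_equivariant_sheaf_cat f] by (simp add: \<Phi>_def)
  then show ?thesis using f by blast
qed

text \<open>A union of sets \<open>fobj P A\<close> indexed by models, labels and objects. Each
  index set and each member is smaller than \<open>\<mu>\<close>, so regularity of
  \<open>\<mu>\<close> applies. The bound yields the coding of germs and the size of the stalk
  space.\<close>

lemma card_stalk_data:
  assumes P: "is_functor (op_cat D) SU P"
  shows "|{(M, A, x, p). M \<in> Mod \<and> A \<in> Obj D \<and> x \<in> fobj M A \<and> p \<in> fobj P A}| <o \<mu>" (is "|?T| <o \<mu>")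
proof -
  note un = card_of_UNION_ordLess_infinite_Field_regularCard[OF \<mu>(2,1)]
  have "|fobj P A| <o \<mu>" if "A \<in> Obj D" for A
    using is_functorD(1)[OF P] that by (simp add: small_sets_def)
  then have 0: "|(\<lambda>p. (M, A, x, p)) ` fobj P A| <o \<mu>" if "A \<in> Obj D" for M x A
    using that by (intro ordLeq_ordLess_trans[OF card_of_image]) blast
  have 1: "|\<Union>A\<in>Obj D. (\<lambda>p. (fst i, A, snd i, p)) ` fobj P A| <o \<mu>" for i
    by (rule un[OF card_Obj]) (simp add: 0)
  have "|Mod \<times> H| <o \<mu>" by (rule ordLeq_ordLess_trans[OF card_Mod_H \<mu>(3)])
  then have "|\<Union>i\<in>Mod \<times> H. \<Union>A\<in>Obj D. (\<lambda>p. (fst i, A, snd i, p)) ` fobj P A| <o \<mu>"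
    by (rule un) (simp add: 1)
  moreover have "?T \<subseteq> (\<Union>i\<in>Mod \<times> H. \<Union>A\<in>Obj D. (\<lambda>p. (fst i, A, snd i, p)) ` fobj P A)"
    using fobj_H by force
  ultimately show ?thesis using ordLeq_ordLess_trans[OF card_of_mono1] by blast
qed

text \<open>The preimage is the stalk sheaf of \<open>P\<close>. Bijectivity and naturality of
  \<open>germ\<close> give an isomorphism of sheaves as soon as germs are replaced by their
  codes.\<close>

lemma \<Phi>_essentially_surjective:
  assumes P: "P \<in> Obj shc"
  shows "\<exists>E\<in>Obj esc. \<exists>i\<in>hom shc (fobj \<Phi> E) P. \<exists>j\<in>hom shc P (fobj \<Phi> E).
    Cmp shc j i = Idt shc (fobj \<Phi> E) \<and> Cmp shc i j = Idt shc P"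
proof -
  define T where "T = {(M, A, x, p). M \<in> Mod \<and> A \<in> Obj D \<and> x \<in> fobj M A \<and> p \<in> fobj P A}"
  have FP: "is_functor (op_cat D) SU P" and sh: "is_sheaf D (coherent_coverage D) P"
    using P by (simp_all add: Obj_shc_iff)
  note T = card_stalk_data[OF FP, folded T_def]
  interpret S: site_sheaf \<kappa> D P "small_sets \<mu>" "code T"
    by (unfold_locales, unfold T_def[symmetric]) (rule FP sh saturated inj_on_code[OF \<mu>(4) T])+
  let ?E = "S.stalk_sheaf"
  have "S.stalks \<subseteq> (\<lambda>(M, A, x, p). S.cls M A x p) ` T"
  proof
    fix r assume "r \<in> S.stalks"
    then obtain M A x p where e: "S.elem M A x p" "r = S.cls M A x p" by (rule S.stalksE)
    show "r \<in> (\<lambda>(M, A, x, p). S.cls M A x p) ` T"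
      by (rule image_eqI[of _ _ "(M, A, x, p)"]) (use e in \<open>simp_all add: S.elem_def T_def\<close>)
  qed
  then have "|S.stalks| <o \<mu>"
    using ordLeq_ordLess_trans[OF ordLeq_transitive[OF card_of_mono1 card_of_image] T] by blast
  then have E: "equivariant_sheaf Grpd ?E" "topspace (total ?E) \<in> small_sets \<mu>"
    using S.equivariant_sheaf_stalk_sheaf by (simp_all add: small_sets_def)
  then have EO: "?E \<in> Obj esc" by simp
  interpret B: big_presheaf D \<mu> "HE ?E" prE by (rule big_presheaf_HomE[OF E])
  have \<Phi>E: "fobj \<Phi> ?E = PH ?E" using EO by (simp add: \<Phi>_def)
  \<comment> \<open>The inverse of \<open>germ\<close> on codes: the section whose germs form the
    decoded map. It exists by \<open>germ_surj\<close> and is unique by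
    \<open>germ_inject\<close>.\<close>
  define section_of where "section_of A v = inv_into (fobj P A) (S.germ A) (decode (HE ?E A) v)" for A and v :: 'u
  let ?j = "\<lambda>A p. cE ?E A (S.germ A p)"
  have j_in: "?j A p \<in> fobj (PH ?E) A" if "A \<in> Obj D" "p \<in> fobj P A" for A p
    using S.germ_HomE[OF that] by (simp add: B.fobj_P[OF that(1)])
  have inj: "inj_on (S.germ A) (fobj P A)" if "A \<in> Obj D" for A
    by (rule inj_onI) (rule S.germ_inject[OF that])
  have section_of_j: "section_of A (?j A p) = p" if "A \<in> Obj D" "p \<in> fobj P A" for A p
    unfolding section_of_def B.decode_code[OF that(1) S.germ_HomE[OF that]] by (rule inv_into_f_f[OF inj[OF that(1)] that(2)])
  have ex: "\<exists>p\<in>fobj P A. v = ?j A p" if A: "A \<in> Obj D" and v: "v \<in> fobj (PH ?E) A" for A v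
  proof -
    obtain x where x: "x \<in> HE ?E A" "v = cE ?E A x" using v unfolding B.fobj_P[OF A] by blast
    show ?thesis using S.germ_surj[OF A x(1)] x(2) by blast
  qed
  have j_nat: "?j C (ev P f p) = ev (PH ?E) f (?j A p)" if f: "f \<in> hom D C A" and p: "p \<in> fobj P A" for f C A p
    using B.ev_P[OF f S.germ_HomE[OF homD(5)[OF cat f] p]] S.pre_germ[OF f p] by simp
  let ?J = "mkn P ?j (PH ?E)" and ?I = "mkn (PH ?E) section_of P"
  have J: "?J \<in> hom shc P (PH ?E)"
    by (rule mkn_hom[OF P PH_Obj[OF E] j_in j_nat])
  have I: "?I \<in> hom shc (PH ?E) P"
  proof (rule mkn_hom[OF PH_Obj[OF E] P])
    show "section_of A v \<in> fobj P A" if A: "A \<in> Obj D" and v: "v \<in> fobj (PH ?E) A" for A v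
    proof -
      obtain p where p: "p \<in> fobj P A" "v = ?j A p" using ex[OF A v] by blast
      show ?thesis unfolding p(2) section_of_j[OF A p(1)] by (rule p(1))
    qed
    show "section_of C (ev (PH ?E) f v) = ev P f (section_of A v)" if f: "f \<in> hom D C A" and v: "v \<in> fobj (PH ?E) A" for f C A v
    proof -
      note o = homD(4,5)[OF cat f]
      obtain p where p: "p \<in> fobj P A" "v = ?j A p" using ex[OF o(2) v] by blast
      show ?thesis
        unfolding p(2) section_of_j[OF o(2) p(1)] j_nat[OF f p(1), symmetric] by (rule section_of_j[OF o(1) S.P_in[OF f p(1)]])
    qed
  qed
  have "Cmp shc ?J ?I = Idt shc (PH ?E)"
  proof (rule shc_arrow_eqI[OF Cmp_in_hom[OF category_shc I J] Idt_in_hom[OF category_shc PH_Obj[OF E]]])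
    fix A v assume A: "A \<in> Obj D" and v: "v \<in> fobj (PH ?E) A"
    obtain p where p: "p \<in> fobj P A" "v = ?j A p" using ex[OF A v] by blast
    have "section_of A v = p" unfolding p(2) by (rule section_of_j[OF A p(1)])
    then show "cmpt (Cmp shc ?J ?I) A v = cmpt (Idt shc (PH ?E)) A v"
      unfolding cmpt_Cmp_shc[OF I A v] cmpt_Idt_shc[OF A v] cmpt_mkn[OF A v] using cmpt_mkn[OF A p(1)] p(2) by simp
  qed
  moreover have "Cmp shc ?I ?J = Idt shc P"
  proof (rule shc_arrow_eqI[OF Cmp_in_hom[OF category_shc J I] Idt_in_hom[OF category_shc P]])
    fix A p assume A: "A \<in> Obj D" and p: "p \<in> fobj P A"
    show "cmpt (Cmp shc ?I ?J) A p = cmpt (Idt shc P) A p"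
      unfolding cmpt_Cmp_shc[OF J A p] cmpt_Idt_shc[OF A p] cmpt_mkn[OF A p] cmpt_mkn[OF A j_in[OF A p]]
      by (rule section_of_j[OF A p])
  qed
  ultimately show ?thesis using EO I J unfolding \<Phi>E[symmetric] by blast
qed

lemma equivalence: "equivalent_cats shc esc"
  by (rule equivalent_cats_if_fully_faithful_essentially_surjective
      [OF category_equivariant_sheaf_cat category_shc \<Phi>_functor \<Phi>_full \<Phi>_faithful \<Phi>_essentially_surjective])

end

theorem mainTheorem2:
  fixes \<kappa> :: "'k rel" and \<mu> :: "'u rel" and D :: "('o, 'a) cat"
  assumes "Cinfinite \<kappa>" and "regularCard \<kappa>"
    and "decidable_coherent_category D"
    and "saturated_set_of_small_models \<kappa> D"
    and "closed_under_powers \<mu> (Arr D <+> hered_small \<kappa> <+> models \<kappa> D)"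
  shows "equivalent_cats
    (sheaf_cat (small_sets \<mu>) D (coherent_coverage D))
    (equivariant_sheaf_cat (small_sets \<mu>) (model_groupoid \<kappa> D))"
proof -
  interpret duality \<kappa> D \<mu>
    by unfold_locales (use assms in \<open>simp_all add: decidable_coherent_category_def\<close>)
  show ?thesis by (rule equivalence)
qed


end
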